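(* Let $f$ be a distribution on $\mathbb{R}^n$ such that $M_\gamma f$ is tempered. Then any function $u(x,\rho)$, for which $M_\gamma u(x,\rho)$ is tempered in $x$, is a solution of the extension problem $$\Big(-L+\partial_\rho^2+\frac{1-2s}{\rho}\partial_\rho-\frac14\rho^2\Big)u(x,\rho)=0,\qquad u(x,0)=f(x)$$ with initial condition $f$ if and only if $u(x,\rho)=S^1_\rho f(x)+S^2_\rho g(x)$ for some $g\in\bigcap_{t>0}H^2_{\gamma,t}(\mathbb{R}^n)$.
   Context: Here $0<s<1$ and $\rho>0$. $\gamma(x)=\pi^{-n/2}e^{-|x|^2}$, $L^2(\gamma)=L^2(\mathbb{R}^n,\gamma(x)dx)$, $M_\gamma f(x)=\gamma(x)^{1/2}f(x)$. $L=-\Delta+2x\cdot\nabla+n$, with spectral decomposition $L=\sum_{k\ge0}(2k+n)Q_k$ on $L^2(\gamma)$; $Q_k$ is the projection onto the span of Hermite polynomials of degree $k$: $Q_kf=\sum_{|\alpha|=k}(f,H_\alpha)_{L^2(\gamma)}H_\alpha$ with $H_\alpha$ ($\alpha\in\mathbb{N}^n$) the Hermite polynomials normalised to be an orthonormal basis of $L^2(\gamma)$; this makes sense for any distribution $f$ with $M_\gamma f$ tempered. The Whittaker functions are $$M_{\kappa,\mu}(x)=e^{-x/2}x^{1/2+\mu}\sum_{p=0}^\infty\frac{(\frac12+\mu-\kappa)_p}{(1+2\mu)_p\,p!}x^p,\qquad W_{\kappa,\mu}(x)=\frac{\Gamma(-2\mu)}{\Gamma(\frac12-\mu-\kappa)}M_{\kappa,\mu}(x)+\frac{\Gamma(2\mu)}{\Gamma(\frac12+\mu-\kappa)}M_{\kappa,-\mu}(x)$$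 ($(a)_p$ the Pochhammer symbol, $2\mu\notin\mathbb{Z}$). Define $$S^1_\rho f(x)=\frac{(\frac12\rho^2)^{\frac{s-1}{2}}}{\Gamma(s)}\sum_{k=0}^\infty\Gamma\left(\tfrac12(2k+n+s+1)\right)W_{-(k+n/2),s/2}(\rho^2/2)\,Q_kf(x),$$ $$S^2_\rho g(x)=\left(\tfrac12\rho^2\right)^{\frac{s-1}{2}}\sum_{k=0}^\infty M_{-(k+n/2),s/2}(\rho^2/2)\,Q_kg(x).$$ $H^2_{\gamma,t}(\mathbb{R}^n)=e^{-t\sqrt L}(L^2(\gamma))$ is the image of $L^2(\gamma)$ under $e^{-t\sqrt L}$. *)

theory Defs
  imports "HOL-Analysis.Analysis"
begin

section \<open>Test functions, Schwartz functions and distributions on \<open>\<real>\<^sup>n\<close>\<close>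

text \<open>The dimension is \<open>n = CARD('n)\<close>; all functions and distributions are complex valued.\<close>

definition pderiv_at :: "'n \<Rightarrow> (real^'n::finite \<Rightarrow> complex) \<Rightarrow> real^'n \<Rightarrow> complex" where
  "pderiv_at i \<phi> x = frechet_derivative \<phi> (at x) (axis i 1)"

text \<open>Iterated partial derivatives are indexed by lists of coordinates rather than by multi-indices;
  for smooth functions the order of the list is immaterial.\<close>

fun pderivs :: "'n list \<Rightarrow> (real^'n::finite \<Rightarrow> complex) \<Rightarrow> real^'n \<Rightarrow> complex" where
  "pderivs [] \<phi> = \<phi>"
| "pderivs (i # is) \<phi> = pderiv_at i (pderivs is \<phi>)"

definition smooth_fun :: "(real^'n::finite \<Rightarrow> complex) \<Rightarrow> bool" where
  "smooth_fun \<phi> \<longleftrightarrow> (\<forall>is x. pderivs is \<phi> differentiable (at x))"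

definition test_funs_in :: "(real^'n::finite) set \<Rightarrow> (real^'n \<Rightarrow> complex) set" where
  "test_funs_in K = {\<phi>. smooth_fun \<phi> \<and> (\<forall>x. x \<notin> K \<longrightarrow> \<phi> x = 0)}"

definition test_funs :: "(real^'n::finite \<Rightarrow> complex) set" where
  "test_funs = (\<Union>K\<in>Collect compact. test_funs_in K)"

definition test_seminorm :: "nat \<Rightarrow> (real^'n::finite \<Rightarrow> complex) \<Rightarrow> real" where
  "test_seminorm N \<phi> = (SUP (is, x) \<in> {is. length is \<le> N} \<times> UNIV. cmod (pderivs is \<phi> x))"

definition schwartz_funs :: "(real^'n::finite \<Rightarrow> complex) set" where
  "schwartz_funs = {\<phi>. smooth_fun \<phi> \<and>
     (\<forall>N is. bdd_above (range (\<lambda>x. (1 + norm x) ^ N * cmod (pderivs is \<phi> x))))}"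

definition schwartz_seminorm :: "nat \<Rightarrow> (real^'n::finite \<Rightarrow> complex) \<Rightarrow> real" where
  "schwartz_seminorm N \<phi> =
     (SUP (is, x) \<in> {is. length is \<le> N} \<times> UNIV. (1 + norm x) ^ N * cmod (pderivs is \<phi> x))"

type_synonym 'n functional = "(real^'n \<Rightarrow> complex) \<Rightarrow> complex"

definition linear_functional_on :: "(real^'n::finite \<Rightarrow> complex) set \<Rightarrow> 'n functional \<Rightarrow> bool" where
  "linear_functional_on V F \<longleftrightarrow>
     (\<forall>\<phi>\<in>V. \<forall>\<psi>\<in>V. F (\<lambda>x. \<phi> x + \<psi> x) = F \<phi> + F \<psi>) \<and>
     (\<forall>\<phi>\<in>V. \<forall>c. F (\<lambda>x. c * \<phi> x) = c * F \<phi>)"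

text \<open>Functionals are total in HOL. Only the values on \<open>test_funs\<close> (respectively
  \<open>schwartz_funs\<close>) carry meaning.\<close>

definition is_distribution :: "'n::finite functional \<Rightarrow> bool" where
  "is_distribution F \<longleftrightarrow> linear_functional_on test_funs F \<and>
     (\<forall>K. compact K \<longrightarrow>
        (\<exists>C N. \<forall>\<phi>\<in>test_funs_in K. cmod (F \<phi>) \<le> C * test_seminorm N \<phi>))"

definition schwartz_continuous :: "'n::finite functional \<Rightarrow> bool" where
  "schwartz_continuous T \<longleftrightarrow> linear_functional_on schwartz_funs T \<and>
     (\<exists>C N. \<forall>\<phi>\<in>schwartz_funs. cmod (T \<phi>) \<le> C * schwartz_seminorm N \<phi>)"

definition tempered_extension :: "'n::finite functional \<Rightarrow> 'n functional \<Rightarrow> bool" where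
  "tempered_extension F T \<longleftrightarrow> schwartz_continuous T \<and> (\<forall>\<phi>\<in>test_funs. T \<phi> = F \<phi>)"

definition tempered :: "'n::finite functional \<Rightarrow> bool" where
  "tempered F \<longleftrightarrow> is_distribution F \<and> (\<exists>T. tempered_extension F T)"

text \<open>By density of the test functions, the extension of a tempered distribution is unique on
  \<open>schwartz_funs\<close>, so the choice below is harmless there.\<close>

definition tempered_ext :: "'n::finite functional \<Rightarrow> 'n functional" where
  "tempered_ext F = (SOME T. tempered_extension F T)"

definition locally_integrable :: "(real^'n::finite \<Rightarrow> complex) \<Rightarrow> bool" where
  "locally_integrable h \<longleftrightarrow> (\<forall>K. compact K \<longrightarrow> h absolutely_integrable_on K)"

definition fun_dist :: "(real^'n::finite \<Rightarrow> complex) \<Rightarrow> 'n functional" where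
  "fun_dist h \<phi> = (LINT x|lebesgue. h x * \<phi> x)"

definition dist_pderiv :: "'n \<Rightarrow> 'n::finite functional \<Rightarrow> 'n functional" where
  "dist_pderiv i F \<phi> = - F (pderiv_at i \<phi>)"

definition dist_mult :: "(real^'n \<Rightarrow> real) \<Rightarrow> 'n::finite functional \<Rightarrow> 'n functional" where
  "dist_mult m F \<phi> = F (\<lambda>x. complex_of_real (m x) * \<phi> x)"


section \<open>Gaussian setting\<close>

definition gauss :: "real^'n::finite \<Rightarrow> real" where
  "gauss x = pi powr (- real CARD('n) / 2) * exp (- (norm x)\<^sup>2)"

definition gauss_measure :: "(real^'n::finite) measure" where
  "gauss_measure = density lebesgue (\<lambda>x. ennreal (gauss x))"

definition L2_gauss :: "(real^'n::finite \<Rightarrow> complex) set" where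
  "L2_gauss = {h \<in> borel_measurable gauss_measure. integrable gauss_measure (\<lambda>x. (cmod (h x))\<^sup>2)}"

definition M_gauss :: "'n::finite functional \<Rightarrow> 'n functional" where
  "M_gauss F = dist_mult (\<lambda>x. sqrt (gauss x)) F"

definition OU_op :: "'n::finite functional \<Rightarrow> 'n functional" where
  "OU_op F \<phi> = - (\<Sum>i\<in>UNIV. dist_pderiv i (dist_pderiv i F) \<phi>)
     + 2 * (\<Sum>i\<in>UNIV. dist_mult (\<lambda>x. x $ i) (dist_pderiv i F) \<phi>)
     + of_nat CARD('n) * F \<phi>"

text \<open>Hermite polynomials in the physicists' normalisation, orthogonal with respect to
  \<open>exp (- x\<^sup>2)\<close>, with squared norm \<open>2 ^ k * fact k * sqrt pi\<close>.\<close>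

fun hermite :: "nat \<Rightarrow> real \<Rightarrow> real" where
  "hermite 0 x = 1"
| "hermite (Suc 0) x = 2 * x"
| "hermite (Suc (Suc k)) x = 2 * x * hermite (Suc k) x - 2 * real (Suc k) * hermite k x"

definition Herm :: "('n::finite \<Rightarrow> nat) \<Rightarrow> real^'n \<Rightarrow> real" where
  "Herm \<alpha> x = (\<Prod>i\<in>UNIV. hermite (\<alpha> i) (x $ i) / sqrt (2 ^ \<alpha> i * fact (\<alpha> i)))"

definition multi_indices :: "nat \<Rightarrow> ('n::finite \<Rightarrow> nat) set" where
  "multi_indices k = {\<alpha>. (\<Sum>i\<in>UNIV. \<alpha> i) = k}"

definition Q_fun :: "nat \<Rightarrow> (real^'n::finite \<Rightarrow> complex) \<Rightarrow> real^'n \<Rightarrow> complex" where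
  "Q_fun k h x = (\<Sum>\<alpha>\<in>multi_indices k.
     (LINT y|gauss_measure. h y * complex_of_real (Herm \<alpha> y)) * complex_of_real (Herm \<alpha> x))"

text \<open>If \<open>M_gauss F\<close> is tempered, the coefficient \<open>(F, H\<^sub>\<alpha>)\<close> in \<open>L\<^sup>2(\<gamma>)\<close> means the pairing of
  \<open>M_gauss F\<close> with the Schwartz function \<open>\<gamma>\<^bsup>1/2\<^esup> H\<^sub>\<alpha>\<close>.\<close>

definition Q_dist :: "nat \<Rightarrow> 'n::finite functional \<Rightarrow> real^'n \<Rightarrow> complex" where
  "Q_dist k F x = (\<Sum>\<alpha>\<in>multi_indices k.
     tempered_ext (M_gauss F) (\<lambda>y. complex_of_real (sqrt (gauss y) * Herm \<alpha> y))
       * complex_of_real (Herm \<alpha> x))"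

text \<open>\<open>is_OU_function m h g\<close>: \<open>g = m(L) h = (\<Sum>k. m (2k+n) Q\<^sub>k h)\<close> with convergence in \<open>L\<^sup>2(\<gamma>)\<close>.
  It is a relation since elements of \<open>L\<^sup>2(\<gamma>)\<close> are determined up to null sets only.\<close>

definition is_OU_function ::
  "(real \<Rightarrow> real) \<Rightarrow> (real^'n::finite \<Rightarrow> complex) \<Rightarrow> (real^'n \<Rightarrow> complex) \<Rightarrow> bool" where
  "is_OU_function m h g \<longleftrightarrow>
     (\<lambda>N. LINT x|gauss_measure.
        (cmod (g x - (\<Sum>k<N. complex_of_real (m (2 * real k + real CARD('n))) * Q_fun k h x)))\<^sup>2)
     \<longlonglongrightarrow> 0"

definition H2_gauss :: "real \<Rightarrow> (real^'n::finite \<Rightarrow> complex) set" where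
  "H2_gauss t = {g \<in> L2_gauss. \<exists>h\<in>L2_gauss. is_OU_function (\<lambda>l. exp (- t * sqrt l)) h g}"


section \<open>Whittaker functions and the solution operators\<close>

definition whittaker_M :: "real \<Rightarrow> real \<Rightarrow> real \<Rightarrow> real" where
  "whittaker_M \<kappa> \<mu> x = exp (- x / 2) * x powr (1/2 + \<mu>) *
     (\<Sum>p. pochhammer (1/2 + \<mu> - \<kappa>) p / (pochhammer (1 + 2 * \<mu>) p * fact p) * x ^ p)"

definition whittaker_W :: "real \<Rightarrow> real \<Rightarrow> real \<Rightarrow> real" where
  "whittaker_W \<kappa> \<mu> x =
     Gamma (- 2 * \<mu>) / Gamma (1/2 - \<mu> - \<kappa>) * whittaker_M \<kappa> \<mu> x
     + Gamma (2 * \<mu>) / Gamma (1/2 + \<mu> - \<kappa>) * whittaker_M \<kappa> (- \<mu>) x"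

definition S1 :: "real \<Rightarrow> real \<Rightarrow> 'n::finite functional \<Rightarrow> real^'n \<Rightarrow> complex" where
  "S1 s \<rho> f x = complex_of_real ((\<rho>\<^sup>2 / 2) powr ((s - 1) / 2) / Gamma s) *
     (\<Sum>k. complex_of_real (Gamma ((2 * real k + real CARD('n) + s + 1) / 2)
               * whittaker_W (- (real k + real CARD('n) / 2)) (s / 2) (\<rho>\<^sup>2 / 2))
            * Q_dist k f x)"

definition S2 :: "real \<Rightarrow> real \<Rightarrow> (real^'n::finite \<Rightarrow> complex) \<Rightarrow> real^'n \<Rightarrow> complex" where
  "S2 s \<rho> g x = complex_of_real ((\<rho>\<^sup>2 / 2) powr ((s - 1) / 2)) *
     (\<Sum>k. complex_of_real (whittaker_M (- (real k + real CARD('n) / 2)) (s / 2) (\<rho>\<^sup>2 / 2))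
            * Q_fun k g x)"


section \<open>The extension problem\<close>

text \<open>\<open>M_gauss (U \<rho>)\<close> is regarded as a curve in the space of tempered distributions with its
  weak-* topology: \<open>V\<close> is its \<open>\<rho>\<close>-derivative on \<open>\<rho> > 0\<close>.\<close>

definition has_rho_derivative ::
  "(real \<Rightarrow> 'n::finite functional) \<Rightarrow> (real \<Rightarrow> 'n functional) \<Rightarrow> bool" where
  "has_rho_derivative U V \<longleftrightarrow>
     (\<forall>\<rho>>0. is_distribution (U \<rho>) \<and> tempered (M_gauss (U \<rho>)) \<and>
             is_distribution (V \<rho>) \<and> tempered (M_gauss (V \<rho>)) \<and>
        (\<forall>\<phi>\<in>schwartz_funs.
           ((\<lambda>r. tempered_ext (M_gauss (U r)) \<phi>)
              has_vector_derivative tempered_ext (M_gauss (V \<rho>)) \<phi>) (at \<rho>)))"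

text \<open>The equation holds in the sense of distributions in \<open>x\<close> for every \<open>\<rho> > 0\<close>. As \<open>f\<close> is
  a distribution, \<open>u(x,0) = f(x)\<close> means \<open>M_gauss (U \<rho>) \<rightarrow> M_gauss f\<close> weakly-* in the
  tempered distributions as \<open>\<rho> \<rightarrow> 0+\<close>.\<close>

definition solves_extension ::
  "real \<Rightarrow> 'n::finite functional \<Rightarrow> (real \<Rightarrow> 'n functional) \<Rightarrow> bool" where
  "solves_extension s f U \<longleftrightarrow>
     (\<exists>U1 U2. has_rho_derivative U U1 \<and> has_rho_derivative U1 U2 \<and>
        (\<forall>\<rho>>0. \<forall>\<phi>\<in>test_funs.
           - OU_op (U \<rho>) \<phi> + U2 \<rho> \<phi> + complex_of_real ((1 - 2 * s) / \<rho>) * U1 \<rho> \<phi>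
             - complex_of_real (\<rho>\<^sup>2 / 4) * U \<rho> \<phi> = 0)) \<and>
     (\<forall>\<phi>\<in>schwartz_funs.
        ((\<lambda>\<rho>. tempered_ext (M_gauss (U \<rho>)) \<phi>) \<longlongrightarrow> tempered_ext (M_gauss f) \<phi>) (at_right 0))"

end

theory Submission
  imports Defs "HOL-Probability.Distributions" "HOL-Probability.Sinc_Integral" "HOL-Real_Asymp.Real_Asymp"
begin

text \<open>
  Conjugation with \<open>sqrt \<gamma>\<close> turns \<open>L\<close> into the harmonic oscillator \<open>|x|\<^sup>2 - \<Delta>\<close> (\<open>OU_op_M_gauss\<close>), and the
  extension problem into an equation for a curve \<open>T \<rho>\<close> of tempered distributions. The Hermite functions
  \<open>sqrt \<gamma> H\<^sub>\<mu>\<close> are eigenfunctions of the oscillator with eigenvalue \<open>l = 2|\<mu>| + n\<close>, and a tempered distribution is the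
  weakly convergent sum of its Hermite coefficients, which grow at most polynomially in \<open>|\<mu>|\<close>
  (\<open>tempered_hermite_expansion\<close>). So the problem splits into one radial equation
  \<open>y'' + (1 - 2s)/\<rho> y' = (l + \<rho>\<^sup>2/4) y\<close> per multi-index. In the variable \<open>\<rho>\<^sup>2/2\<close> it is Whittaker's equation:
  \<open>grow\<close>, which vanishes at \<open>0\<close>, is the factor of \<open>Q\<^sub>k g\<close> in \<open>S\<^sup>2\<close>, and \<open>dec\<close>, which tends to \<open>1\<close> at \<open>0\<close>, is the
  factor of \<open>Q\<^sub>k f\<close> in \<open>S\<^sup>1\<close>. By Wronskians a solution with limit \<open>y0\<close> at \<open>0\<close> is \<open>y0 * dec + c * grow\<close>
  (\<open>radial_sol_decompose\<close>): the initial value leaves exactly the constants \<open>c\<^sub>\<mu>\<close> free, and the theorem is a statement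
  on the size of \<open>c\<^sub>\<mu>\<close>.

  That size is settled by bounds which are uniform in \<open>l\<close>. On the one hand \<open>|dec| \<le> 1\<close>, and away from \<open>\<rho> = 0\<close> it
  decays faster than any power of \<open>l\<close> (\<open>dec_decay\<close>); on the other hand \<open>grow\<close> lies between
  \<open>exp (\<rho> * sqrt l / 4)\<close> and \<open>exp (t * sqrt l)\<close> up to constants (\<open>grow_lower\<close>, \<open>grow_growth\<close>). If \<open>u\<close> is a solution, its
  coefficients are polynomially bounded at every \<open>\<rho>\<close>, and large \<open>\<rho>\<close> forces \<open>c\<^sub>\<mu> = O(exp (- t * sqrt l))\<close> for all \<open>t\<close>
  (\<open>super_fast_of_slow_modes\<close>). Such sequences are precisely the Hermite coefficients of the functions in
  \<open>exp (- t sqrt L) (L\<^sup>2(\<gamma>))\<close> for all \<open>t > 0\<close> (\<open>super_fast_gauss_coeff\<close>, \<open>super_fast_synth_H2\<close>). Conversely this decay beats the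
  growth of \<open>grow\<close>, so that the two series converge for \<open>\<rho> > 0\<close> to a rapidly decreasing function over \<open>sqrt \<gamma>\<close> and may be
  differentiated termwise in \<open>\<rho>\<close>, and dominated convergence of series gives the initial value.
\<close>


section \<open>Partial derivatives and smooth functions\<close>

lemma pderiv_at_eqI:
  "(f has_derivative f') (at x) ==> pderiv_at i f x = f' (axis i 1)"
  unfolding pderiv_at_def using frechet_derivative_at by metis

lemma pderiv_at_add:
  assumes "f differentiable (at x)" "g differentiable (at x)"
  shows "pderiv_at i (\<lambda>x. f x + g x) x = pderiv_at i f x + pderiv_at i g x"
  using pderiv_at_eqI[OF has_derivative_add[OF assms[unfolded frechet_derivative_works]]]
  by (simp add: pderiv_at_def)

lemma pderiv_at_mult:
  assumes "f differentiable (at x)" "g differentiable (at x)"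
  shows "pderiv_at i (\<lambda>x. f x * g x) x = pderiv_at i f x * g x + f x * pderiv_at i g x"
  using pderiv_at_eqI[OF has_derivative_mult[OF assms[unfolded frechet_derivative_works]], of i]
  by (simp add: pderiv_at_def)

lemma pderiv_at_const [simp]: "pderiv_at i (\<lambda>x. c) x = 0"
  by (rule pderiv_at_eqI) simp

lemma pderiv_at_cmult:
  assumes "f differentiable (at x)"
  shows "pderiv_at i (\<lambda>x. c * f x) x = c * pderiv_at i f x"
  using pderiv_at_mult[of "\<lambda>x. c" x f i] assms by simp

lemma pderivs_snoc: "pderivs (is @ [i]) \<phi> = pderivs is (pderiv_at i \<phi>)"
  by (induction "is") auto

lemma pderivs_append: "pderivs (is @ js) \<phi> = pderivs is (pderivs js \<phi>)"
  by (induction "is") auto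

text \<open>A set of differentiable functions that is closed under partial derivatives consists of smooth functions.
  Smoothness is an infinite condition, and this principle replaces inductions over derivative lists.\<close>

lemma smooth_fun_coinduct:
  assumes "\<phi> \<in> X" and "\<And>\<phi> x. \<phi> \<in> X ==> \<phi> differentiable (at x)"
    and "\<And>\<phi> i. \<phi> \<in> X ==> pderiv_at i \<phi> \<in> X"
  shows "smooth_fun \<phi>"
proof -
  have "pderivs is \<phi> \<in> X" for "is"
    by (induction "is") (use assms in auto)
  then show ?thesis
    unfolding smooth_fun_def using assms(2) by blast
qed

lemma smooth_fun_differentiable: "smooth_fun \<phi> ==> \<phi> differentiable (at x)"
  unfolding smooth_fun_def by (metis pderivs.simps(1))

lemma smooth_fun_continuous: "smooth_fun \<phi> ==> continuous_on A \<phi>"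
  by (meson continuous_at_imp_continuous_on differentiable_imp_continuous_within smooth_fun_differentiable)

lemma smooth_fun_pderivs: "smooth_fun \<phi> ==> smooth_fun (pderivs is \<phi>)"
  unfolding smooth_fun_def by (metis pderivs_append)

lemma smooth_fun_pderiv_at: "smooth_fun \<phi> ==> smooth_fun (pderiv_at i \<phi>)"
  using smooth_fun_pderivs[of \<phi> "[i]"] by simp

lemma smooth_fun_pderivs_differentiable: "smooth_fun \<phi> ==> pderivs is \<phi> differentiable (at x)"
  unfolding smooth_fun_def by blast

lemma pderivs_const [simp]: "pderivs is (\<lambda>x::real^'n::finite. c) = (\<lambda>x. if is = [] then c else 0)"
proof (induction "is")
  case (Cons i "is")
  have "pderiv_at i (\<lambda>x. if is = [] then c else 0) x = 0" for x :: "real^'n"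
    by (cases "is = []") simp_all
  then show ?case unfolding pderivs.simps Cons.IH by auto
qed simp

lemma smooth_fun_const [simp, intro]: "smooth_fun (\<lambda>x. c)"
  unfolding smooth_fun_def by auto

lemma pderivs_add:
  assumes "smooth_fun f" "smooth_fun g"
  shows "pderivs is (\<lambda>x. f x + g x) = (\<lambda>x. pderivs is f x + pderivs is g x)"
proof (induction "is")
  case (Cons i "is")
  show ?case
    unfolding pderivs.simps Cons.IH
    by (intro ext pderiv_at_add smooth_fun_pderivs_differentiable assms)
qed simp

lemma smooth_fun_add [intro]:
  "smooth_fun f ==> smooth_fun g ==> smooth_fun (\<lambda>x. f x + g x)"
  unfolding smooth_fun_def[of "\<lambda>x. f x + g x"]
  by (auto simp: pderivs_add intro!: differentiable_add smooth_fun_pderivs_differentiable)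

text \<open>All ways to distribute the derivatives of a list over two factors: the index set of the Leibniz rule.\<close>

fun leibniz_splits :: "'a list => ('a list \<times> 'a list) list" where
  "leibniz_splits [] = [([], [])]"
| "leibniz_splits (i # is) =
     map (apfst (Cons i)) (leibniz_splits is) @ map (apsnd (Cons i)) (leibniz_splits is)"

lemma differentiable_sum_list:
  assumes "\<And>p. p \<in> set ps ==> F p differentiable (at x)"
  shows "(\<lambda>x. \<Sum>p\<leftarrow>ps. F p x) differentiable (at x)"
  using assms by (induction ps) (auto intro!: differentiable_add)

lemma pderiv_at_sum_list:
  assumes "\<And>p. p \<in> set ps ==> F p differentiable (at x)"
  shows "pderiv_at i (\<lambda>x. \<Sum>p\<leftarrow>ps. F p x) x = (\<Sum>p\<leftarrow>ps. pderiv_at i (F p) x)"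
  using assms by (induction ps) (auto simp: pderiv_at_add differentiable_sum_list)

lemma pderivs_mult:
  assumes "smooth_fun f" "smooth_fun g"
  shows "pderivs is (\<lambda>x. f x * g x) =
    (\<lambda>x. \<Sum>p\<leftarrow>leibniz_splits is. pderivs (fst p) f x * pderivs (snd p) g x)"
proof (induction "is")
  case (Cons i "is")
  note d = smooth_fun_pderivs_differentiable[OF assms(1)] smooth_fun_pderivs_differentiable[OF assms(2)]
  show ?case
  proof
    fix x
    have "pderivs (i # is) (\<lambda>x. f x * g x) x
        = (\<Sum>p\<leftarrow>leibniz_splits is. pderiv_at i (\<lambda>x. pderivs (fst p) f x * pderivs (snd p) g x) x)"
      unfolding pderivs.simps Cons.IH
      by (rule pderiv_at_sum_list) (intro differentiable_mult d)
    also have "... = (\<Sum>p\<leftarrow>leibniz_splits (i # is). pderivs (fst p) f x * pderivs (snd p) g x)"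
      by (simp add: pderiv_at_mult d sum_list_addf comp_def)
    finally show "pderivs (i # is) (\<lambda>x. f x * g x) x = ..." .
  qed
qed simp

lemma smooth_fun_mult [intro]:
  assumes "smooth_fun f" "smooth_fun g"
  shows "smooth_fun (\<lambda>x. f x * g x)"
  unfolding smooth_fun_def pderivs_mult[OF assms]
  by (intro allI differentiable_sum_list differentiable_mult smooth_fun_pderivs_differentiable assms)

lemma pderivs_cmult:
  assumes "smooth_fun f"
  shows "pderivs is (\<lambda>x. c * f x) = (\<lambda>x. c * pderivs is f x)"
proof (induction "is")
  case (Cons i "is")
  show ?case
    unfolding pderivs.simps Cons.IH
    by (intro ext pderiv_at_cmult smooth_fun_pderivs_differentiable assms)
qed simp

lemma smooth_fun_sum [intro]:
  "(\<And>a. a \<in> A ==> smooth_fun (F a)) ==> smooth_fun (\<lambda>x. \<Sum>a\<in>A. F a x)"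
  by (induction A rule: infinite_finite_induct) (auto intro!: smooth_fun_add)

lemma smooth_fun_prod [intro]:
  "(\<And>a. a \<in> A ==> smooth_fun (F a)) ==> smooth_fun (\<lambda>x. \<Prod>a\<in>A. F a x)"
  by (induction A rule: infinite_finite_induct) (auto intro!: smooth_fun_mult)

lemma smooth_fun_power [intro]:
  "smooth_fun f ==> smooth_fun (\<lambda>x. f x ^ k)"
  by (induction k) (auto intro!: smooth_fun_mult)

lemma has_derivative_coord:
  "((\<lambda>x::real^'n::finite. of_real (x $ i)) has_derivative (\<lambda>h. of_real (h $ i))) (at x)"
  by (intro has_derivative_of_real bounded_linear.has_derivative[OF bounded_linear_vec_nth] has_derivative_ident)

lemma pderiv_at_coord: "pderiv_at j (\<lambda>x. of_real (x $ i)) = (\<lambda>x. if i = j then 1 else 0)"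
proof
  fix x :: "real^'a"
  show "pderiv_at j (\<lambda>x. of_real (x $ i)) x = (if i = j then 1 else 0)"
    by (subst pderiv_at_eqI[OF has_derivative_coord]) (auto simp: axis_def)
qed

lemma smooth_fun_coord [simp, intro]: "smooth_fun (\<lambda>x. of_real (x $ i))"
proof (rule smooth_fun_coinduct)
  let ?X = "{\<lambda>x::real^'a. of_real (x $ i)} \<union> range (\<lambda>c x. c)"
  show "(\<lambda>x. of_real (x $ i)) \<in> ?X" by simp
  show "\<phi> differentiable (at x)" if "\<phi> \<in> ?X" for \<phi> x
    using that has_derivative_coord[of i x] by (auto simp: differentiable_def intro: has_derivative_const)
  have c: "pderiv_at j (\<lambda>x::real^'a. c) = (\<lambda>x. 0)" for j c by (rule ext) simp
  show "pderiv_at j \<phi> \<in> ?X" if "\<phi> \<in> ?X" for \<phi> j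
    using that by (auto simp: pderiv_at_coord c)
qed

text \<open>Differentiability of finite order, needed because the derivative of a composition is a product of a smooth
  factor and a function of the same kind, so that coinduction alone does not close up.\<close>

definition smooth_upto :: "nat => (real^'n::finite => complex) => bool" where
  "smooth_upto m \<phi> \<longleftrightarrow> (\<forall>is x. length is <= m --> pderivs is \<phi> differentiable (at x))"

lemma smooth_upto_add:
  assumes "smooth_upto m f" "smooth_upto m g"
  shows "smooth_upto m (\<lambda>x. f x + g x)"
proof -
  have *: "pderivs is (\<lambda>x. f x + g x) = (\<lambda>x. pderivs is f x + pderivs is g x)" if "length is <= m" for "is"
    using that
  proof (induction "is")
    case (Cons i "is")
    then have IH: "pderivs is (\<lambda>x. f x + g x) = (\<lambda>x. pderivs is f x + pderivs is g x)" by simp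
    show ?case
      unfolding pderivs.simps IH
      by (intro ext pderiv_at_add) (use assms Cons.prems in \<open>auto simp: smooth_upto_def\<close>)
  qed simp
  show ?thesis
    unfolding smooth_upto_def using assms
    by (auto simp: * smooth_upto_def intro!: differentiable_add)
qed

lemma smooth_fun_coinduct_upto:
  assumes mem: "\<phi> \<in> X" and diff: "\<And>\<phi> x. \<phi> \<in> X ==> \<phi> differentiable (at x)"
    and step: "\<And>\<phi> i. \<phi> \<in> X ==> \<exists>p\<in>Collect smooth_fun. \<exists>\<psi>\<in>X. pderiv_at i \<phi> = (\<lambda>x. p x * \<psi> x)"
  shows "smooth_fun \<phi>"
proof -
  have "smooth_upto m (\<lambda>x. p x * \<phi> x)" if "smooth_fun p" "\<phi> \<in> X" for m p \<phi>
    using that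
  proof (induction m arbitrary: p \<phi>)
    case 0
    then show ?case by (auto simp: smooth_upto_def intro!: differentiable_mult[OF smooth_fun_differentiable diff])
  next
    case (Suc m)
    show ?case
      unfolding smooth_upto_def
    proof (intro allI impI)
      fix "is" :: "'a list" and x
      assume len: "length is <= Suc m"
      show "pderivs is (\<lambda>x. p x * \<phi> x) differentiable at x"
      proof (cases "is" rule: rev_cases)
        case Nil
        then show ?thesis using Suc.prems
          by (auto intro!: differentiable_mult[OF smooth_fun_differentiable diff])
      next
        case (snoc js i)
        obtain q \<psi> where q: "smooth_fun q" "\<psi> \<in> X" "pderiv_at i \<phi> = (\<lambda>x. q x * \<psi> x)"
          using step[OF Suc.prems(2), of i] by auto
        have eq: "pderiv_at i (\<lambda>x. p x * \<phi> x) = (\<lambda>x. pderiv_at i p x * \<phi> x + (p x * q x) * \<psi> x)"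
        proof
          fix x
          show "pderiv_at i (\<lambda>x. p x * \<phi> x) x = pderiv_at i p x * \<phi> x + (p x * q x) * \<psi> x"
            using pderiv_at_mult[of p x \<phi> i] Suc.prems q(3)
            by (simp add: smooth_fun_differentiable diff)
        qed
        have "smooth_upto m (\<lambda>x. pderiv_at i p x * \<phi> x + (p x * q x) * \<psi> x)"
          by (intro smooth_upto_add Suc.IH smooth_fun_pderiv_at smooth_fun_mult Suc.prems(1) Suc.prems(2) q)
        then show ?thesis
          unfolding snoc pderivs_snoc eq using len snoc by (auto simp: smooth_upto_def)
      qed
    qed
  qed
  from this[OF smooth_fun_const mem, of _ 1] show ?thesis
    unfolding smooth_upto_def smooth_fun_def by fastforce
qed

lemma smooth_fun_compose:
  fixes D :: "nat => real => real" and l :: "real^'n::finite => real"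
  assumes D: "\<And>m t. (D m has_real_derivative D (Suc m) t) (at t)"
    and l: "smooth_fun (\<lambda>x. of_real (l x))"
  shows "smooth_fun (\<lambda>x. of_real (D m (l x)))"
proof (rule smooth_fun_coinduct_upto)
  let ?X = "range (\<lambda>m x. of_real (D m (l x)))"
  show "(\<lambda>x. of_real (D m (l x))) \<in> ?X" by blast
  have dl: "(l has_derivative (\<lambda>h. Re (frechet_derivative (\<lambda>x. of_real (l x)) (at x) h))) (at x)" for x
    using bounded_linear.has_derivative[OF bounded_linear_Re
      smooth_fun_differentiable[OF l, of x, unfolded frechet_derivative_works]] by simp
  have il: "Im (pderiv_at i (\<lambda>x. of_real (l x)) x) = 0" for i x
    using pderiv_at_eqI[OF has_derivative_of_real[OF dl]] by simp
  have dc: "((\<lambda>x. of_real (D m (l x))) has_derivative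
      (\<lambda>h. of_real (D (Suc m) (l x) * Re (frechet_derivative (\<lambda>x. of_real (l x)) (at x) h)))) (at x)"
    for m x
    by (rule has_derivative_of_real)
      (use has_derivative_compose[OF dl D[unfolded has_field_derivative_def]] in \<open>simp add: o_def\<close>)
  show "\<phi> differentiable (at x)" if "\<phi> \<in> ?X" for \<phi> x
    using that dc unfolding differentiable_def by blast
  have "pderiv_at i (\<lambda>x. of_real (D m (l x)))
      = (\<lambda>x. pderiv_at i (\<lambda>x. of_real (l x)) x * of_real (D (Suc m) (l x)))" for i m
    by (rule ext, subst pderiv_at_eqI[OF dc]) (use il in \<open>simp add: complex_eq_iff pderiv_at_def\<close>)
  then show "\<exists>p\<in>Collect smooth_fun. \<exists>\<psi>\<in>?X. pderiv_at i \<phi> = (\<lambda>x. p x * \<psi> x)" if "\<phi> \<in> ?X" for \<phi> i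
    using that smooth_fun_pderiv_at[OF l] by auto
qed

lemma smooth_fun_norm_sq: "smooth_fun (\<lambda>x::real^'n::finite. of_real ((norm x)^2))"
proof -
  have "(\<lambda>x::real^'n. complex_of_real ((norm x)^2)) = (\<lambda>x. \<Sum>i\<in>UNIV. of_real (x $ i) ^ 2)"
    by (auto simp: norm_vec_def L2_set_def real_sqrt_pow2 sum_nonneg)
  then show ?thesis by (auto intro!: smooth_fun_sum smooth_fun_power)
qed

lemma smooth_fun_real_affine:
  assumes "smooth_fun (\<lambda>x. of_real (l x))"
  shows "smooth_fun (\<lambda>x. of_real (a + b * l x))"
  using smooth_fun_add[OF smooth_fun_const[of "of_real a"]
      smooth_fun_mult[OF smooth_fun_const[of "of_real b"] assms]] by simp

lemma smooth_fun_exp_norm_sq: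
  "smooth_fun (\<lambda>x::real^'n::finite. of_real (a * exp (c * (norm x)^2)))"
proof -
  have "((\<lambda>t. c ^ m * exp (c * t)) has_real_derivative c ^ Suc m * exp (c * t)) (at t)" for m t
    by (auto intro!: derivative_eq_intros)
  from smooth_fun_compose[of "\<lambda>m t. c ^ m * exp (c * t)", OF this smooth_fun_norm_sq, of 0]
  show ?thesis
    using smooth_fun_real_affine[of "\<lambda>x. exp (c * (norm x)^2)" 0 a] by simp
qed


section \<open>Smooth cutoff functions\<close>

fun bump_poly :: "nat => real poly" where
  "bump_poly 0 = 1"
| "bump_poly (Suc m) = monom 1 2 * (bump_poly m - pderiv (bump_poly m))"

text \<open>The derivatives of \<open>exp (- 1 / t)\<close> are polynomials in \<open>1 / t\<close> times the function itself; keeping the whole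
  sequence lets \<open>smooth_fun_compose\<close> apply.\<close>

definition bump_deriv :: "nat => real => real" where
  "bump_deriv m t = (if t > 0 then poly (bump_poly m) (1 / t) * exp (- (1 / t)) else 0)"

abbreviation bump :: "real => real" where "bump \<equiv> bump_deriv 0"

lemma bump_eq: "bump t = (if t > 0 then exp (- (1 / t)) else 0)"
  by (simp add: bump_deriv_def)

lemma poly_times_exp_tendsto_0: "((\<lambda>y. poly p y * exp (- y)) \<longlongrightarrow> 0) at_top" for p :: "real poly"
proof -
  have eq: "poly p y * exp (- y) = (\<Sum>i\<le>degree p. coeff p i * (y ^ i / exp y))" for y
    by (simp add: poly_altdef sum_distrib_left sum_distrib_right exp_minus field_simps)
  show ?thesis
    unfolding eq by (intro tendsto_null_sum tendsto_mult_right_zero tendsto_power_div_exp_0)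
qed

lemma bump_deriv_has_derivative:
  "(bump_deriv m has_real_derivative bump_deriv (Suc m) t) (at t)"
proof -
  consider "t > 0" | "t < 0" | "t = 0" by linarith
  then show ?thesis
  proof cases
    case 1
    have "((\<lambda>t. poly (bump_poly m) (1 / t) * exp (- (1 / t))) has_real_derivative bump_deriv (Suc m) t) (at t)"
      using 1
      by (auto intro!: derivative_eq_intros DERIV_chain2[OF poly_DERIV]
          simp: bump_deriv_def poly_monom field_simps power2_eq_square)
    then show ?thesis
      by (rule DERIV_cong_ev[THEN iffD1, rotated -1])
        (use 1 eventually_nhds_in_open[of "{0<..}" t] in \<open>auto simp: bump_deriv_def elim!: eventually_mono\<close>)
  next
    case 2
    have "((\<lambda>t. 0) has_real_derivative bump_deriv (Suc m) t) (at t)"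
      using 2 by (simp add: bump_deriv_def)
    then show ?thesis
      by (rule DERIV_cong_ev[THEN iffD1, rotated -1])
        (use 2 eventually_nhds_in_open[of "{..<0}" t] in \<open>auto simp: bump_deriv_def elim!: eventually_mono\<close>)
  next
    case 3
    have "((\<lambda>h. bump_deriv m h / h) \<longlongrightarrow> 0) (at 0)"
    proof (rule filterlim_split_at)
      have "eventually (\<lambda>h::real. bump_deriv m h / h = 0) (at_left 0)"
        using eventually_at_left_field[of "\<lambda>h. h < 0" 0] 
        by (auto simp: eventually_at_left_field bump_deriv_def intro: exI[of _ "-1"])
      then show "((\<lambda>h. bump_deriv m h / h) \<longlongrightarrow> 0) (at_left 0)"
        by (rule tendsto_eventually)
      have "((\<lambda>h::real. poly (pCons 0 (bump_poly m)) (inverse h) * exp (- inverse h)) \<longlongrightarrow> 0) (at_right 0)"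
        by (rule filterlim_compose[OF poly_times_exp_tendsto_0 filterlim_inverse_at_top_right])
      then show "((\<lambda>h. bump_deriv m h / h) \<longlongrightarrow> 0) (at_right 0)"
        by (rule Lim_transform_eventually)
          (auto simp: eventually_at_right_field bump_deriv_def field_simps intro!: exI[of _ 1])
    qed
    then show ?thesis
      using 3 by (simp add: DERIV_def bump_deriv_def)
  qed
qed

lemma bump_nonneg [simp]: "bump t >= 0" and bump_pos: "t > 0 ==> bump t > 0"
  and bump_zero: "t <= 0 ==> bump t = 0"
  by (auto simp: bump_eq)

lemma bump_mono: "a <= b ==> bump a <= bump b"
  by (auto simp: bump_eq frac_le)

lemma smooth_fun_bump: "smooth_fun (\<lambda>x. of_real (l x)) ==> smooth_fun (\<lambda>x. of_real (bump (l x)))"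
  by (rule smooth_fun_compose[of bump_deriv l 0, OF bump_deriv_has_derivative])

text \<open>A smooth transition from \<open>1\<close> on \<open>t \<le> 0\<close> to \<open>0\<close> on \<open>t \<ge> 1\<close>. The inner argument falls from \<open>1\<close> below \<open>0\<close>
  since \<open>4 * exp (- 1) > 1\<close>, and the factor \<open>exp 1\<close> normalises the plateau.\<close>

definition ramp :: "real => real" where
  "ramp t = exp 1 * bump (1 - 4 * bump t)"

lemma ramp_le_0: "t <= 0 ==> ramp t = 1"
  by (simp add: ramp_def bump_eq flip: exp_add)

lemma ramp_ge_1: "t >= 1 ==> ramp t = 0"
proof -
  assume "t >= 1"
  have "bump 1 <= bump t" by (rule bump_mono) fact
  moreover have "bump 1 >= 1 / 4"
  proof -
    have "exp (1::real) <= 3" by (rule exp_le)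
    then have "inverse (exp (1::real)) >= inverse 3" by (intro le_imp_inverse_le) auto
    then show ?thesis by (simp add: bump_eq exp_minus)
  qed
  ultimately show ?thesis by (simp add: ramp_def bump_zero)
qed

lemma ramp_bounds: "0 <= ramp t" "ramp t <= 1"
proof -
  show "0 <= ramp t" by (simp add: ramp_def)
  have "bump (1 - 4 * bump t) <= bump 1" by (rule bump_mono) simp
  then have "exp 1 * bump (1 - 4 * bump t) <= exp 1 * bump 1" by (intro mult_left_mono) auto
  then show "ramp t <= 1" by (simp add: ramp_def bump_eq flip: exp_add)
qed

lemma smooth_fun_ramp:
  assumes "smooth_fun (\<lambda>x. of_real (l x))"
  shows "smooth_fun (\<lambda>x. of_real (ramp (l x)))"
proof -
  have "smooth_fun (\<lambda>x. of_real (bump (1 + (-4) * bump (l x))))"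
    by (intro smooth_fun_bump smooth_fun_real_affine assms)
  from smooth_fun_real_affine[OF this, of 0 "exp 1"] show ?thesis by (simp add: ramp_def)
qed


section \<open>Bounded families of Schwartz functions\<close>

text \<open>Bounded subsets of the Schwartz space, and families of multipliers of uniformly polynomial growth. A one-element
  family is a single Schwartz function or multiplier, so closure properties are proved once.\<close>

definition schwartz_family :: "'j set => ('j => real^'n::finite => complex) => bool" where
  "schwartz_family J \<Phi> \<longleftrightarrow> (\<forall>j\<in>J. smooth_fun (\<Phi> j)) \<and>
     (\<forall>N is. \<exists>C. \<forall>j\<in>J. \<forall>x. (1 + norm x) ^ N * cmod (pderivs is (\<Phi> j) x) <= C)"

definition slow_family :: "'j set => ('j => real^'n::finite => complex) => bool" where
  "slow_family J \<Psi> \<longleftrightarrow> (\<forall>j\<in>J. smooth_fun (\<Psi> j)) \<and>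
     (\<forall>is. \<exists>C N. \<forall>j\<in>J. \<forall>x. cmod (pderivs is (\<Psi> j) x) <= C * (1 + norm x) ^ N)"

lemma schwartz_funs_iff_family: "\<phi> \<in> schwartz_funs \<longleftrightarrow> schwartz_family {()} (\<lambda>_. \<phi>)"
  unfolding schwartz_funs_def schwartz_family_def by (auto simp: bdd_above_def)

lemma norm_sum_list_le:
  fixes F :: "'p => 'b::real_normed_vector"
  shows "norm (\<Sum>p\<leftarrow>ps. F p) <= (\<Sum>p\<leftarrow>ps. norm (F p))"
  by (induction ps) (auto intro: order_trans[OF norm_triangle_ineq])

lemma schwartz_family_mult:
  assumes "schwartz_family J \<Phi>" "slow_family J \<Psi>"
  shows "schwartz_family J (\<lambda>j x. \<Phi> j x * \<Psi> j x)"
  unfolding schwartz_family_def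
proof (intro conjI ballI allI)
  show "smooth_fun (\<lambda>x. \<Phi> j x * \<Psi> j x)" if "j \<in> J" for j
    using that assms by (auto simp: schwartz_family_def slow_family_def)
  fix N :: nat and "is" :: "'b list"
  obtain C2 N2 where C2: "\<And>bs j x. j \<in> J ==> cmod (pderivs bs (\<Psi> j) x) <= C2 bs * (1 + norm x) ^ N2 bs"
    using assms(2) unfolding slow_family_def by metis
  obtain C1 where C1: "\<And>M as j x. j \<in> J ==> (1 + norm x) ^ M * cmod (pderivs as (\<Phi> j) x) <= C1 M as"
    using assms(1) unfolding schwartz_family_def by metis
  show "\<exists>C. \<forall>j\<in>J. \<forall>x. (1 + norm x) ^ N * cmod (pderivs is (\<lambda>x. \<Phi> j x * \<Psi> j x) x) <= C"
  proof (intro exI ballI allI)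
    fix j x assume j: "j \<in> J"
    have sm: "smooth_fun (\<Phi> j)" "smooth_fun (\<Psi> j)"
      using j assms by (auto simp: schwartz_family_def slow_family_def)
    have "(1 + norm x) ^ N * cmod (pderivs is (\<lambda>x. \<Phi> j x * \<Psi> j x) x)
        <= (1 + norm x) ^ N * (\<Sum>p\<leftarrow>leibniz_splits is. cmod (pderivs (fst p) (\<Phi> j) x * pderivs (snd p) (\<Psi> j) x))"
      unfolding pderivs_mult[OF sm] by (intro mult_left_mono norm_sum_list_le) simp
    also have "... = (\<Sum>p\<leftarrow>leibniz_splits is.
        (1 + norm x) ^ N * (cmod (pderivs (fst p) (\<Phi> j) x) * cmod (pderivs (snd p) (\<Psi> j) x)))"
      by (simp add: sum_list_const_mult norm_mult)
    also have "... <= (\<Sum>p\<leftarrow>leibniz_splits is. C1 (N + N2 (snd p)) (fst p) * \<bar>C2 (snd p)\<bar>)"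
    proof (rule sum_list_mono)
      fix p :: "'b list \<times> 'b list"
      let ?u = "cmod (pderivs (fst p) (\<Phi> j) x)"
      have "(1 + norm x) ^ N * (?u * cmod (pderivs (snd p) (\<Psi> j) x))
          <= (1 + norm x) ^ N * (?u * (\<bar>C2 (snd p)\<bar> * (1 + norm x) ^ N2 (snd p)))"
        by (intro mult_left_mono order_trans[OF C2[OF j]] mult_right_mono) auto
      also have "... = ((1 + norm x) ^ (N + N2 (snd p)) * ?u) * \<bar>C2 (snd p)\<bar>"
        by (simp add: power_add)
      also have "... <= C1 (N + N2 (snd p)) (fst p) * \<bar>C2 (snd p)\<bar>"
        by (intro mult_right_mono C1 j) auto
      finally show "(1 + norm x) ^ N * (?u * cmod (pderivs (snd p) (\<Psi> j) x)) <= ..." .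
    qed
    finally show "(1 + norm x) ^ N * cmod (pderivs is (\<lambda>x. \<Phi> j x * \<Psi> j x) x)
      <= (\<Sum>p\<leftarrow>leibniz_splits is. C1 (N + N2 (snd p)) (fst p) * \<bar>C2 (snd p)\<bar>)" .
  qed
qed

lemma schwartz_family_member: "schwartz_family J \<Phi> ==> j \<in> J ==> \<Phi> j \<in> schwartz_funs"
  unfolding schwartz_funs_iff_family schwartz_family_def by (simp, blast)

lemma schwartz_family_add:
  assumes \<Phi>: "schwartz_family J \<Phi>" and \<Psi>: "schwartz_family J \<Psi>"
  shows "schwartz_family J (\<lambda>j x. \<Phi> j x + \<Psi> j x)"
  unfolding schwartz_family_def
proof (intro conjI ballI allI)
  have sm: "smooth_fun (\<Phi> j)" "smooth_fun (\<Psi> j)" if "j \<in> J" for j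
    using that assms by (auto simp: schwartz_family_def)
  show "smooth_fun (\<lambda>x. \<Phi> j x + \<Psi> j x)" if "j \<in> J" for j using sm[OF that] by auto
  fix N :: nat and "is" :: "'b list"
  obtain C where C: "\<And>j x. j \<in> J ==> (1 + norm x) ^ N * cmod (pderivs is (\<Phi> j) x) <= C"
    using \<Phi> unfolding schwartz_family_def by blast
  obtain D where D: "\<And>j x. j \<in> J ==> (1 + norm x) ^ N * cmod (pderivs is (\<Psi> j) x) <= D"
    using \<Psi> unfolding schwartz_family_def by blast
  have "(1 + norm x) ^ N * cmod (pderivs is (\<lambda>x. \<Phi> j x + \<Psi> j x) x) <= C + D" if j: "j \<in> J" for j x
    unfolding pderivs_add[OF sm[OF j]]
    by (intro order_trans[OF mult_left_mono[OF norm_triangle_ineq]]) (auto simp: distrib_left intro!: add_mono C D j)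
  then show "\<exists>C. \<forall>j\<in>J. \<forall>x. (1 + norm x) ^ N * cmod (pderivs is (\<lambda>x. \<Phi> j x + \<Psi> j x) x) <= C" by blast
qed

lemma schwartz_family_pderiv_at: "schwartz_family J \<Phi> ==> schwartz_family J (\<lambda>j. pderiv_at i (\<Phi> j))"
  unfolding schwartz_family_def pderivs_snoc[symmetric] by (blast intro: smooth_fun_pderiv_at)

lemma schwartz_smooth: "\<phi> \<in> schwartz_funs ==> smooth_fun \<phi>"
  by (simp add: schwartz_funs_def)

lemma schwartz_bound:
  assumes "\<phi> \<in> schwartz_funs"
  obtains C where "C >= 0" "\<And>x. (1 + norm x) ^ N * cmod (pderivs is \<phi> x) <= C"
proof -
  from assms have "bdd_above (range (\<lambda>x. (1 + norm x) ^ N * cmod (pderivs is \<phi> x)))"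
    by (simp add: schwartz_funs_def)
  then obtain C where C: "\<And>x. (1 + norm x) ^ N * cmod (pderivs is \<phi> x) <= C"
    unfolding bdd_above_def by auto
  have "0 <= (1 + norm (0::real^'a)) ^ N * cmod (pderivs is \<phi> 0)" by simp
  then have "C >= 0" using C[of 0] by linarith
  then show ?thesis using C that by blast
qed

lemma schwartz_funsI:
  assumes "smooth_fun \<phi>" "\<And>N is. \<exists>C. \<forall>x. (1 + norm x) ^ N * cmod (pderivs is \<phi> x) <= C"
  shows "\<phi> \<in> schwartz_funs"
  unfolding schwartz_funs_def using assms by (auto simp: bdd_above_def)

lemma schwartz_add: "f \<in> schwartz_funs ==> g \<in> schwartz_funs ==> (\<lambda>x. f x + g x) \<in> schwartz_funs"
  unfolding schwartz_funs_iff_family by (rule schwartz_family_add)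

lemma slow_family_const [simp]: "slow_family J (\<lambda>j x. c)"
  unfolding slow_family_def
  by (auto intro!: exI[of _ "cmod c"] exI[of _ "0::nat"])

lemma schwartz_mult_slow:
  "f \<in> schwartz_funs ==> slow_family {()} (\<lambda>_. g) ==> (\<lambda>x. f x * g x) \<in> schwartz_funs"
  using schwartz_family_mult[of "{()}" "\<lambda>_. f" "\<lambda>_. g"] by (simp add: schwartz_funs_iff_family)

lemma schwartz_cmult: "f \<in> schwartz_funs ==> (\<lambda>x. c * f x) \<in> schwartz_funs"
  using schwartz_mult_slow[of f "\<lambda>_. c"] by (simp add: mult.commute)

lemma schwartz_zero [simp]: "(\<lambda>x. 0) \<in> schwartz_funs"
  by (rule schwartz_funsI) (auto intro!: exI[of _ 0])

lemma schwartz_uminus: "f \<in> schwartz_funs ==> (\<lambda>x. - f x) \<in> schwartz_funs"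
  using schwartz_cmult[of f "-1"] by simp

lemma schwartz_diff: "f \<in> schwartz_funs ==> g \<in> schwartz_funs ==> (\<lambda>x. f x - g x) \<in> schwartz_funs"
  using schwartz_add[OF _ schwartz_uminus] by simp

lemma schwartz_sum:
  "(\<And>a. a \<in> A ==> F a \<in> schwartz_funs) ==> (\<lambda>x. \<Sum>a\<in>A. F a x) \<in> schwartz_funs"
  by (induction A rule: infinite_finite_induct) (auto intro!: schwartz_add)

lemma schwartz_slow:
  assumes "f \<in> schwartz_funs" shows "slow_family {()} (\<lambda>_. f)"
  unfolding slow_family_def
proof (intro conjI allI ballI)
  fix "is" :: "'a list"
  obtain C where "\<And>x. (1 + norm x) ^ 0 * cmod (pderivs is f x) <= C" using assms schwartz_bound by metis
  then show "\<exists>C N. \<forall>j\<in>{()}. \<forall>x. cmod (pderivs is f x) <= C * (1 + norm x) ^ N"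
    by (auto intro!: exI[of _ C] exI[of _ "0::nat"])
qed (use assms schwartz_smooth in auto)

lemma schwartz_mult: "f \<in> schwartz_funs ==> g \<in> schwartz_funs ==> (\<lambda>x. f x * g x) \<in> schwartz_funs"
  by (intro schwartz_mult_slow schwartz_slow)

lemma schwartz_pderiv_at: "f \<in> schwartz_funs ==> pderiv_at i f \<in> schwartz_funs"
  unfolding schwartz_funs_iff_family by (rule schwartz_family_pderiv_at)

lemma slow_family_coord: "slow_family J (\<lambda>_ x. of_real (x $ i))"
  unfolding slow_family_def
proof (intro conjI allI ballI)
  fix "is" :: "'b list"
  show "\<exists>C N. \<forall>j\<in>J. \<forall>x. cmod (pderivs is (\<lambda>x. of_real (x $ i)) x) <= C * (1 + norm x) ^ N"
  proof (cases "is" rule: rev_cases)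
    case Nil
    show ?thesis
      unfolding Nil using component_le_norm_cart[of _ i]
      by (auto intro!: exI[of _ "1::real"] exI[of _ "1::nat"] simp: add_increasing)
  next
    case (snoc js j)
    show ?thesis unfolding snoc pderivs_snoc pderiv_at_coord
      by (auto intro!: exI[of _ "1::real"] exI[of _ "0::nat"])
  qed
qed simp

lemma schwartz_coord: "f \<in> schwartz_funs ==> (\<lambda>x. of_real (x $ i) * f x) \<in> schwartz_funs"
  using schwartz_mult_slow[OF _ slow_family_coord] by (simp add: mult.commute)

lemma pderivs_zero_on_open:
  assumes "open S" "\<And>x. x \<in> S ==> \<phi> x = 0" "x \<in> S"
  shows "pderivs is \<phi> x = 0"
  using assms(3)
proof (induction "is" arbitrary: x)
  case (Cons i "is")
  have "(pderivs is \<phi> has_derivative (\<lambda>h. 0)) (at x)"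
    by (rule has_derivative_transform_within_open[OF has_derivative_const[of 0] assms(1) Cons.prems])
      (use Cons.IH in auto)
  then show ?case by (simp add: pderiv_at_eqI)
qed (use assms in auto)

lemma test_funs_in_pderivs_zero:
  assumes "\<phi> \<in> test_funs_in K" "closed K" "x \<notin> K"
  shows "pderivs is \<phi> x = 0"
  by (rule pderivs_zero_on_open[of "- K"]) (use assms in \<open>auto simp: test_funs_in_def\<close>)

lemma test_funs_smooth: "\<phi> \<in> test_funs ==> smooth_fun \<phi>"
  by (auto simp: test_funs_def test_funs_in_def)

lemma test_funs_pderivs_bounded:
  assumes "\<phi> \<in> test_funs"
  shows "\<exists>C. \<forall>x. (1 + norm x) ^ N * cmod (pderivs is \<phi> x) <= C"
proof -
  obtain K where K: "compact K" "\<phi> \<in> test_funs_in K" using assms by (auto simp: test_funs_def)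
  have "continuous_on K (\<lambda>x. (1 + norm x) ^ N * cmod (pderivs is \<phi> x))"
    by (intro continuous_intros smooth_fun_continuous smooth_fun_pderivs test_funs_smooth assms)
  then have "bounded ((\<lambda>x. (1 + norm x) ^ N * cmod (pderivs is \<phi> x)) ` K)"
    using K(1) compact_continuous_image compact_imp_bounded by blast
  then obtain C where C: "\<And>x. x \<in> K ==> norm ((1 + norm x) ^ N * cmod (pderivs is \<phi> x)) <= C"
    unfolding bounded_iff by auto
  have "(1 + norm x) ^ N * cmod (pderivs is \<phi> x) <= max C 0" for x
  proof (cases "x \<in> K")
    case True
    then show ?thesis using C[OF True] by auto
  next
    case False
    then show ?thesis using test_funs_in_pderivs_zero[OF K(2) compact_imp_closed[OF K(1)] False] by simp
  qed
  then show ?thesis by blast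
qed

lemma test_funs_schwartz: "\<phi> \<in> test_funs ==> \<phi> \<in> schwartz_funs"
  by (intro schwartz_funsI test_funs_smooth test_funs_pderivs_bounded)

lemma test_funs_mult:
  "\<phi> \<in> test_funs ==> smooth_fun g ==> (\<lambda>x. g x * \<phi> x) \<in> test_funs"
  by (auto simp: test_funs_def test_funs_in_def)

lemma test_funs_add:
  assumes "f \<in> test_funs" "g \<in> test_funs" shows "(\<lambda>x. f x + g x) \<in> test_funs"
proof -
  obtain K L where "compact K" "f \<in> test_funs_in K" "compact L" "g \<in> test_funs_in L"
    using assms by (auto simp: test_funs_def)
  then have "compact (K \<union> L)" "(\<lambda>x. f x + g x) \<in> test_funs_in (K \<union> L)" by (auto simp: test_funs_in_def)
  then show ?thesis by (auto simp: test_funs_def)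
qed

lemma test_funs_zero [simp]: "(\<lambda>x. 0) \<in> test_funs"
  unfolding test_funs_def test_funs_in_def using compact_empty by auto

lemma test_funs_sum:
  "(\<And>a. a \<in> A ==> F a \<in> test_funs) ==> (\<lambda>x. \<Sum>a\<in>A. F a x) \<in> test_funs"
  by (induction A rule: infinite_finite_induct) (auto intro!: test_funs_add)

lemma test_funs_pderiv_at:
  assumes "f \<in> test_funs" shows "pderiv_at i f \<in> test_funs"
proof -
  obtain K where K: "compact K" "f \<in> test_funs_in K" using assms by (auto simp: test_funs_def)
  have "pderiv_at i f x = 0" if "x \<notin> K" for x
    using test_funs_in_pderivs_zero[OF K(2) compact_imp_closed[OF K(1)] that, of "[i]"] by simp
  then have "pderiv_at i f \<in> test_funs_in K"
    using smooth_fun_pderiv_at[OF test_funs_smooth[OF assms]] by (auto simp: test_funs_in_def)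
  then show ?thesis using K(1) by (auto simp: test_funs_def)
qed

section \<open>Density of test functions\<close>

lemma pderivs_scale:
  assumes "smooth_fun \<phi>"
  shows "pderivs is (\<lambda>x. \<phi> (r *\<^sub>R x)) = (\<lambda>x. of_real (r ^ length is) * pderivs is \<phi> (r *\<^sub>R x))"
proof (induction "is")
  case (Cons i "is")
  show ?case
  proof
    fix x
    let ?D = "frechet_derivative (pderivs is \<phi>) (at (r *\<^sub>R x))"
    have 1: "(pderivs is \<phi> has_derivative ?D) (at (r *\<^sub>R x))"
      using smooth_fun_pderivs_differentiable[OF assms] frechet_derivative_works by blast
    have d: "((\<lambda>x. of_real (r ^ length is) * pderivs is \<phi> (r *\<^sub>R x)) has_derivative
        (\<lambda>h. of_real (r ^ length is) * ?D (r *\<^sub>R h))) (at x)"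
      by (intro has_derivative_mult_right has_derivative_compose[where f="\<lambda>x. r *\<^sub>R x" and g="pderivs is \<phi>", OF _ 1]
          has_derivative_scaleR_right has_derivative_ident)
    moreover have "?D (r *\<^sub>R axis i 1) = r *\<^sub>R ?D (axis i 1)"
      using 1 has_derivative_linear linear_scale by blast
    ultimately have "pderivs (i # is) (\<lambda>x. \<phi> (r *\<^sub>R x)) x
        = of_real (r ^ length is) * (of_real r * ?D (axis i 1))"
      unfolding pderivs.simps Cons.IH using pderiv_at_eqI[OF d, of i] by (simp add: scaleR_conv_of_real[of _ "_::complex"])
    then show "pderivs (i # is) (\<lambda>x. \<phi> (r *\<^sub>R x)) x
        = of_real (r ^ length (i # is)) * pderivs (i # is) \<phi> (r *\<^sub>R x)"
      by (simp add: pderiv_at_def)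
  qed
qed simp

lemma smooth_fun_scale:
  assumes "smooth_fun \<phi>" shows "smooth_fun (\<lambda>x. \<phi> (r *\<^sub>R x))"
proof -
  have "(\<lambda>x. of_real (r ^ length is) * pderivs is \<phi> (r *\<^sub>R x)) differentiable at x" for "is" x
  proof (rule differentiable_mult)
    show "(\<lambda>x. pderivs is \<phi> (r *\<^sub>R x)) differentiable at x"
      by (rule differentiable_compose[OF smooth_fun_pderivs_differentiable[OF assms]]) simp
  qed simp
  then show ?thesis unfolding smooth_fun_def pderivs_scale[OF assms] by blast
qed

definition cutoff :: "real^'n::finite => complex" where
  "cutoff x = of_real (ramp ((norm x)^2 - 1))"

lemma cutoff_eq_1: "norm x <= 1 ==> cutoff x = 1"
  by (simp add: cutoff_def ramp_le_0 power_le_one)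

lemma cutoff_eq_0: "norm x >= 2 ==> cutoff x = 0"
  using power_mono[of 2 "norm x" 2] by (simp add: cutoff_def ramp_ge_1)

lemma smooth_fun_cutoff: "smooth_fun cutoff"
proof -
  have "smooth_fun (\<lambda>x. of_real ((norm x)^2 - 1))"
    using smooth_fun_real_affine[OF smooth_fun_norm_sq, of "-1" 1] by simp
  from smooth_fun_ramp[OF this] show ?thesis unfolding cutoff_def .
qed

lemma cutoff_test_fun: "cutoff \<in> test_funs"
proof -
  have "cutoff \<in> test_funs_in (cball (0::real^'a) 2)"
    using smooth_fun_cutoff by (auto simp: test_funs_in_def cutoff_eq_0)
  then show ?thesis using compact_cball unfolding test_funs_def by blast
qed

lemma slow_family_dilated_cutoff:
  "slow_family {1..} (\<lambda>R x. cutoff ((1 / R) *\<^sub>R x) + (-1 :: complex))"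
  unfolding slow_family_def
proof (intro conjI allI ballI)
  show "smooth_fun (\<lambda>x. cutoff ((1 / j) *\<^sub>R x) + (-1 :: complex))" for j
    by (rule smooth_fun_add[OF smooth_fun_scale[OF smooth_fun_cutoff] smooth_fun_const])
  fix "is" :: "'a list"
  obtain C where C: "\<And>x::real^'a. (1 + norm x) ^ 0 * cmod (pderivs is cutoff x) <= C"
    using test_funs_pderivs_bounded[OF cutoff_test_fun, of 0 "is"] by blast
  have "cmod (pderivs is (\<lambda>x. cutoff ((1 / R) *\<^sub>R x) + (-1)) x) <= (C + 1) * (1 + norm x) ^ 0"
    if "R >= 1" for R and x :: "real^'a"
  proof -
    have "pderivs is (\<lambda>x. cutoff ((1 / R) *\<^sub>R x) + (-1)) x = of_real ((1 / R) ^ length is)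
        * pderivs is cutoff ((1 / R) *\<^sub>R x) + (if is = [] then -1 else 0)"
      unfolding pderivs_add[OF smooth_fun_scale[OF smooth_fun_cutoff] smooth_fun_const]
        pderivs_scale[OF smooth_fun_cutoff] pderivs_const ..
    also have "cmod ... <= cmod (of_real ((1 / R) ^ length is) * pderivs is cutoff ((1 / R) *\<^sub>R x)) + 1"
      by (rule order_trans[OF norm_triangle_ineq]) simp
    also have "cmod (of_real ((1 / R) ^ length is) * pderivs is cutoff ((1 / R) *\<^sub>R x))
        = (1 / R) ^ length is * cmod (pderivs is cutoff ((1 / R) *\<^sub>R x))"
      unfolding norm_mult norm_of_real using that by simp
    also have "(1 / R) ^ length is * cmod (pderivs is cutoff ((1 / R) *\<^sub>R x)) + 1
        <= 1 * cmod (pderivs is cutoff ((1 / R) *\<^sub>R x)) + 1"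
      using that by (intro add_mono mult_right_mono power_le_one) auto
    also have "... <= C + 1" using C[of "(1 / R) *\<^sub>R x"] by simp
    finally show ?thesis by simp
  qed
  then show "\<exists>C N. \<forall>R\<in>{1..}. \<forall>x::real^'a. cmod (pderivs is (\<lambda>x. cutoff ((1 / R) *\<^sub>R x) + (-1)) x) <= C * (1 + norm x) ^ N"
    by (intro exI[of _ "C + 1"] exI[of _ "0::nat"]) auto
qed

lemma schwartz_seminorm_le:
  assumes "\<And>is x. length is <= N ==> (1 + norm x) ^ N * cmod (pderivs is \<phi> x) <= B"
  shows "schwartz_seminorm N \<phi> <= B"
  unfolding schwartz_seminorm_def
  by (rule cSUP_least) (use assms in \<open>auto intro: exI[of _ "[]"]\<close>)

lemma finite_short_lists: "finite {is::'n::finite list. length is <= N}"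
  using finite_lists_length_le[of "UNIV::'n set" N] by simp

lemma schwartz_seminorm_bdd:
  assumes "\<phi> \<in> schwartz_funs"
  shows "bdd_above ((\<lambda>(is, x). (1 + norm x) ^ N * cmod (pderivs is \<phi> x)) ` ({is. length is <= N} \<times> UNIV))"
proof -
  have "\<forall>is. \<exists>C. \<forall>x. (1 + norm x) ^ N * cmod (pderivs is \<phi> x) <= C"
    using schwartz_bound[OF assms] by metis
  then obtain B where B: "\<And>is x. (1 + norm x) ^ N * cmod (pderivs is \<phi> x) <= B is" by metis
  have "(1 + norm x) ^ N * cmod (pderivs is \<phi> x) <= (\<Sum>is\<in>{is. length is <= N}. \<bar>B is\<bar>)"
    if "length is <= N" for "is" x
  proof -
    have "(1 + norm x) ^ N * cmod (pderivs is \<phi> x) <= \<bar>B is\<bar>"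
      by (rule order_trans[OF B]) simp
    also have "... <= (\<Sum>is\<in>{is. length is <= N}. \<bar>B is\<bar>)"
      by (rule member_le_sum) (use that finite_short_lists in auto)
    finally show ?thesis .
  qed
  then show ?thesis by (intro bdd_aboveI) auto
qed

lemma schwartz_seminorm_upper:
  assumes "\<phi> \<in> schwartz_funs" "length is <= N"
  shows "(1 + norm x) ^ N * cmod (pderivs is \<phi> x) <= schwartz_seminorm N \<phi>"
  unfolding schwartz_seminorm_def
  by (rule cSUP_upper2[OF schwartz_seminorm_bdd[OF assms(1)], of "(is, x)"]) (use assms(2) in auto)

lemma schwartz_seminorm_nonneg: "\<phi> \<in> schwartz_funs ==> 0 <= schwartz_seminorm N \<phi>"
  by (rule order_trans[OF _ schwartz_seminorm_upper[of \<phi> "[]" N 0]]) auto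

text \<open>Boundedness on bounded families is weaker to verify than a seminorm estimate and is preserved by composition
  with any operator that maps bounded families to bounded families.\<close>

definition bounded_functional :: "'n::finite functional => bool" where
  "bounded_functional T \<longleftrightarrow> linear_functional_on schwartz_funs T \<and>
     (\<forall>\<Phi>. schwartz_family {1::real..} \<Phi> --> (\<exists>C. \<forall>R\<ge>1. cmod (T (\<Phi> R)) <= C))"

lemma schwartz_continuous_bounded_functional:
  fixes T :: "'n::finite functional"
  assumes T: "schwartz_continuous T" shows "bounded_functional T"
  unfolding bounded_functional_def
proof (intro conjI allI impI)
  fix \<Phi> :: "real => real^'n => complex" assume \<Phi>: "schwartz_family {1..} \<Phi>"
  obtain C N where CN: "\<And>\<psi>. \<psi> \<in> schwartz_funs ==> cmod (T \<psi>) <= C * schwartz_seminorm N \<psi>"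
    using T unfolding schwartz_continuous_def by blast
  have "\<forall>is. \<exists>B. \<forall>R\<in>{1..}. \<forall>x. (1 + norm x) ^ N * cmod (pderivs is (\<Phi> R) x) <= B"
    using \<Phi>[unfolded schwartz_family_def, THEN conjunct2, THEN spec, of N] .
  from choice[OF this] obtain B where B: "\<And>is R x. R >= 1 ==> (1 + norm x) ^ N * cmod (pderivs is (\<Phi> R) x) <= B is"
    by auto
  define B' where "B' = (\<Sum>is\<in>{is. length is <= N}. \<bar>B is\<bar>)"
  have "cmod (T (\<Phi> R)) <= \<bar>C\<bar> * B'" if R: "R >= 1" for R
  proof -
    have m: "\<Phi> R \<in> schwartz_funs" using schwartz_family_member[OF \<Phi>] R by simp
    have "schwartz_seminorm N (\<Phi> R) <= B'"
    proof (rule schwartz_seminorm_le)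
      fix "is" :: "'n list" and x assume len: "length is <= N"
      have "\<bar>B is\<bar> <= B'" unfolding B'_def by (rule member_le_sum) (use len finite_short_lists in auto)
      then show "(1 + norm x) ^ N * cmod (pderivs is (\<Phi> R) x) <= B'" using B[OF R, of x "is"] by linarith
    qed
    then show ?thesis by (intro order_trans[OF CN[OF m] mult_mono]) (auto intro: schwartz_seminorm_nonneg m)
  qed
  then show "\<exists>C. \<forall>R\<ge>1. cmod (T (\<Phi> R)) <= C" by blast
qed (use T in \<open>simp add: schwartz_continuous_def\<close>)

lemma bounded_functional_linear:
  assumes "bounded_functional T"
  shows "\<phi> \<in> schwartz_funs ==> \<psi> \<in> schwartz_funs ==> T (\<lambda>x. \<phi> x + \<psi> x) = T \<phi> + T \<psi>"
    and "\<phi> \<in> schwartz_funs ==> T (\<lambda>x. c * \<phi> x) = c * T \<phi>"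
proof -
  have "linear_functional_on schwartz_funs T" using assms by (simp add: bounded_functional_def)
  then show "\<phi> \<in> schwartz_funs ==> \<psi> \<in> schwartz_funs ==> T (\<lambda>x. \<phi> x + \<psi> x) = T \<phi> + T \<psi>"
    and "\<phi> \<in> schwartz_funs ==> T (\<lambda>x. c * \<phi> x) = c * T \<phi>"
    unfolding linear_functional_on_def by blast+
qed

lemma bounded_functional_diff:
  "bounded_functional T ==> \<phi> \<in> schwartz_funs ==> \<psi> \<in> schwartz_funs ==> T (\<lambda>x. \<phi> x - \<psi> x) = T \<phi> - T \<psi>"
  using bounded_functional_linear(1)[of T \<phi> "\<lambda>x. (-1) * \<psi> x"] bounded_functional_linear(2)[of T \<psi> "-1"]
  by (simp add: schwartz_uminus)

lemma bounded_functional_bound: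
  "bounded_functional T ==> schwartz_family {1::real..} \<Phi> ==> \<exists>C. \<forall>R\<ge>1. cmod (T (\<Phi> R)) <= C"
  by (simp add: bounded_functional_def)

text \<open>Density of the test functions: with a cutoff at radius \<open>R\<close> the error vanishes for \<open>|x| < R\<close>, and there one
  power of \<open>|x|\<close> pays for a factor \<open>R\<close>. So \<open>R\<close> times the error is a bounded family and the error is \<open>O(1/R)\<close>.\<close>

theorem bounded_functional_eqI:
  fixes T1 T2 :: "'n::finite functional"
  assumes T1: "bounded_functional T1" and T2: "bounded_functional T2"
    and eq: "\<And>\<phi>. \<phi> \<in> test_funs ==> T1 \<phi> = T2 \<phi>" and \<phi>: "\<phi> \<in> schwartz_funs"
  shows "T1 \<phi> = T2 \<phi>"
proof -
  define tr where "tr R x = cutoff ((1 / R) *\<^sub>R x) * \<phi> x" for R :: real and x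
  have tr: "tr R \<in> test_funs" if "R >= 1" for R
  proof -
    have "cutoff ((1 / R) *\<^sub>R x) = 0" if "x \<notin> cball 0 (2 * R)" for x :: "real^'n"
      using that \<open>R >= 1\<close> by (intro cutoff_eq_0) (auto simp: field_simps)
    then have "tr R \<in> test_funs_in (cball 0 (2 * R))"
      unfolding tr_def test_funs_in_def
      using smooth_fun_mult[OF smooth_fun_scale[OF smooth_fun_cutoff] schwartz_smooth[OF \<phi>]] by auto
    then show ?thesis using compact_cball unfolding test_funs_def by blast
  qed
  define \<Psi> where "\<Psi> R x = \<phi> x * (cutoff ((1 / R) *\<^sub>R x) + (-1))" for R x
  define \<Phi> where "\<Phi> R x = of_real R * \<Psi> R x" for R x
  have \<Psi>: "schwartz_family {1..} \<Psi>"
    unfolding \<Psi>_def[abs_def]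
    by (rule schwartz_family_mult[OF _ slow_family_dilated_cutoff])
      (use \<phi> in \<open>auto simp: schwartz_family_def schwartz_funs_iff_family\<close>)
  have sm: "smooth_fun (\<Psi> R)" if "R >= 1" for R using \<Psi> that by (simp add: schwartz_family_def)
  have \<Phi>: "schwartz_family {1..} \<Phi>"
    unfolding schwartz_family_def
  proof (intro conjI ballI allI)
    show "smooth_fun (\<Phi> R)" if "R \<in> {1..}" for R
      unfolding \<Phi>_def[abs_def] using sm that by (intro smooth_fun_mult) auto
    fix N and "is" :: "'n list"
    obtain C where C: "\<And>R x. R \<in> {1..} ==> (1 + norm x) ^ Suc N * cmod (pderivs is (\<Psi> R) x) <= C"
      using \<Psi>[unfolded schwartz_family_def, THEN conjunct2, rule_format, of "Suc N" "is"] by auto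
    have "(1 + norm x) ^ N * cmod (pderivs is (\<Phi> R) x) <= \<bar>C\<bar>" if R: "R \<in> {1..}" for R x
    proof (cases "norm x < R")
      case True
      have "pderivs is (\<Phi> R) x = 0"
      proof (rule pderivs_zero_on_open[of "ball 0 R"])
        show "\<Phi> R y = 0" if "y \<in> ball 0 R" for y
          using that R by (simp add: \<Phi>_def \<Psi>_def cutoff_eq_1)
      qed (use True in auto)
      then show ?thesis by simp
    next
      case False
      have "pderivs is (\<Phi> R) = (\<lambda>x. of_real R * pderivs is (\<Psi> R) x)"
        unfolding \<Phi>_def[abs_def] using R by (intro pderivs_cmult sm) simp
      then have "(1 + norm x) ^ N * cmod (pderivs is (\<Phi> R) x) = R * ((1 + norm x) ^ N * cmod (pderivs is (\<Psi> R) x))"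
        using R by (simp add: norm_mult)
      also have "... <= (1 + norm x) * ((1 + norm x) ^ N * cmod (pderivs is (\<Psi> R) x))"
        using False by (intro mult_right_mono) auto
      also have "... <= C" using C[OF R, of x] by (simp add: mult.assoc)
      finally show ?thesis by simp
    qed
    then show "\<exists>C. \<forall>R\<in>{1..}. \<forall>x. (1 + norm x) ^ N * cmod (pderivs is (\<Phi> R) x) <= C" by blast
  qed
  have lim: "((\<lambda>R. T (tr R)) \<longlongrightarrow> T \<phi>) at_top" if T: "bounded_functional T" for T
  proof -
    obtain C where C: "\<And>R. R >= 1 ==> cmod (T (\<Phi> R)) <= C" using bounded_functional_bound[OF T \<Phi>] by blast
    have "cmod (T (tr R) - T \<phi>) <= C / R" if R: "R >= 1" for R
    proof -
      have m: "\<Phi> R \<in> schwartz_funs" using schwartz_family_member[OF \<Phi>] R by simp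
      have "tr R = (\<lambda>x. \<phi> x + of_real (1 / R) * \<Phi> R x)"
        using R by (simp add: fun_eq_iff tr_def \<Phi>_def \<Psi>_def algebra_simps)
      then have "T (tr R) = T \<phi> + of_real (1 / R) * T (\<Phi> R)"
        using bounded_functional_linear(1)[OF T \<phi> schwartz_cmult[OF m, of "of_real (1 / R)"]]
          bounded_functional_linear(2)[OF T m, of "of_real (1 / R)"] by simp
      then show ?thesis using C[OF R] R by (simp add: norm_mult norm_divide divide_right_mono)
    qed
    then have "\<forall>\<^sub>F R in at_top. norm (T (tr R) - T \<phi>) <= C / R"
      by (intro eventually_mono[OF eventually_ge_at_top[of 1]])
    moreover have "((\<lambda>R. C / R) \<longlongrightarrow> 0) at_top"
      by (intro tendsto_divide_0[OF tendsto_const] filterlim_at_top_imp_at_infinity filterlim_ident)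
    ultimately have "((\<lambda>R. T (tr R) - T \<phi>) \<longlongrightarrow> 0) at_top"
      by (rule Lim_null_comparison)
    then show ?thesis by (rule Lim_null[THEN iffD2])
  qed
  have "\<forall>\<^sub>F R in at_top. T2 (tr R) = T1 (tr R)"
    by (rule eventually_mono[OF eventually_ge_at_top[of 1]]) (simp add: eq tr)
  with lim[OF T2] have "((\<lambda>R. T1 (tr R)) \<longlongrightarrow> T2 \<phi>) at_top" by (rule Lim_transform_eventually)
  from tendsto_unique[OF trivial_limit_at_top_linorder lim[OF T1] this] show ?thesis .
qed

lemma tempered_ext_extension: "tempered F ==> tempered_extension F (tempered_ext F)"
  unfolding tempered_def tempered_ext_def by (metis someI_ex)

lemma tempered_ext_continuous: "tempered F ==> schwartz_continuous (tempered_ext F)"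
  using tempered_ext_extension tempered_extension_def by blast

lemma tempered_ext_test: "tempered F ==> \<phi> \<in> test_funs ==> tempered_ext F \<phi> = F \<phi>"
  using tempered_ext_extension tempered_extension_def by blast

lemma tempered_ext_eqI:
  assumes T: "tempered_extension F T" and \<phi>: "\<phi> \<in> schwartz_funs"
  shows "tempered_ext F \<phi> = T \<phi>"
proof (rule bounded_functional_eqI[OF _ _ _ \<phi>])
  have e: "tempered_extension F (tempered_ext F)"
    unfolding tempered_ext_def by (rule someI[of "tempered_extension F", OF T])
  show "bounded_functional (tempered_ext F)" "bounded_functional T"
    using e T by (simp_all add: tempered_extension_def schwartz_continuous_bounded_functional)
  show "tempered_ext F \<psi> = T \<psi>" if "\<psi> \<in> test_funs" for \<psi>
    using e T that by (simp add: tempered_extension_def)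
qed


section \<open>Integration of rapidly decreasing functions\<close>

lemma nn_integral_prod_coord:
  fixes g :: "real => ennreal"
  assumes [measurable]: "g \<in> borel_measurable borel"
  shows "(\<integral>\<^sup>+x. (\<Prod>i\<in>UNIV. g (x $ i)) \<partial>(lebesgue :: (real^'n::finite) measure))
    = (\<integral>\<^sup>+t. g t \<partial>lborel) ^ CARD('n)"
proof -
  have inj: "inj_on (\<lambda>i::'n. axis i (1::real)) UNIV" by (auto simp: inj_on_def axis_eq_axis)
  have B: "(Basis :: (real^'n) set) = (\<lambda>i. axis i 1) ` UNIV" by (auto simp: Basis_vec_def)
  have "(\<integral>\<^sup>+x. (\<Prod>i\<in>UNIV. g (x $ i)) \<partial>(lebesgue :: (real^'n) measure))
      = (\<integral>\<^sup>+x. (\<Prod>b\<in>Basis. g (x \<bullet> b)) \<partial>(lborel :: (real^'n) measure))"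
    unfolding nn_integral_completion B prod.reindex[OF inj] by (simp add: inner_axis)
  also have "... = (\<Prod>b\<in>(Basis::(real^'n) set). \<integral>\<^sup>+t. g t \<partial>lborel)"
    by (rule nn_integral_lborel_prod) auto
  also have "... = (\<integral>\<^sup>+t. g t \<partial>lborel) ^ CARD('n)" by simp
  finally show ?thesis .
qed

lemma continuous_lebesgue_measurable:
  "continuous_on UNIV f ==> f \<in> borel_measurable (lebesgue :: 'a::euclidean_space measure)"
  by (rule measurable_completion) (simp add: borel_measurable_continuous_onI)

lemma integrable_decay:
  "integrable lebesgue (\<lambda>x::real^'n::finite. inverse ((1 + norm x) ^ (2 * CARD('n))))"
proof (rule integrableI_bounded)
  have c: "continuous_on UNIV (\<lambda>x::real^'n. inverse ((1 + norm x) ^ (2 * CARD('n))))"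
    by (intro continuous_intros) (simp add: add_nonneg_eq_0_iff)
  then show "(\<lambda>x::real^'n. inverse ((1 + norm x) ^ (2 * CARD('n)))) \<in> borel_measurable lebesgue"
    by (rule continuous_lebesgue_measurable)
  have le: "inverse ((1 + norm x) ^ (2 * CARD('n))) <= (\<Prod>i\<in>UNIV. inverse (1 + (x $ i)^2))" for x :: "real^'n"
  proof -
    have "1 + (x $ i)^2 <= (1 + norm x)^2" for i
      using power_mono[OF component_le_norm_cart[of x i], of 2] by (simp add: power2_sum add_increasing2)
    then have "(\<Prod>i\<in>(UNIV::'n set). 1 + (x $ i)^2) <= (\<Prod>i\<in>(UNIV::'n set). (1 + norm x)^2)"
      by (intro prod_mono) auto
    also have "... = (1 + norm x) ^ (2 * CARD('n))" by (simp add: power_mult)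
    finally have "inverse ((1 + norm x) ^ (2 * CARD('n))) <= inverse (\<Prod>i\<in>(UNIV::'n set). 1 + (x $ i)^2)"
      by (intro le_imp_inverse_le prod_pos) (auto simp: add_pos_nonneg)
    then show ?thesis using prod_inversef[of "\<lambda>i. 1 + (x $ i)^2" UNIV] by (simp add: o_def)
  qed
  have "(\<integral>\<^sup>+x. ennreal (norm (inverse ((1 + norm x) ^ (2 * CARD('n))))) \<partial>(lebesgue :: (real^'n) measure))
      <= (\<integral>\<^sup>+x. (\<Prod>i\<in>UNIV. ennreal (inverse (1 + (x $ i)^2))) \<partial>(lebesgue :: (real^'n) measure))"
    by (intro nn_integral_mono) (use le in \<open>auto simp: prod_ennreal intro!: ennreal_leI\<close>)
  also have "... = (\<integral>\<^sup>+t. ennreal (inverse (1 + t^2)) \<partial>lborel) ^ CARD('n)"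
    by (rule nn_integral_prod_coord) simp
  also have "... < \<infinity>"
  proof -
    have "integrable lborel (\<lambda>t::real. inverse (1 + t^2))"
      using integrable_inverse_1_plus_square by (simp add: set_integrable_def)
    then have "(\<integral>\<^sup>+t. ennreal (inverse (1 + t^2)) \<partial>lborel) < \<infinity>"
      by (auto simp: integrable_iff_bounded)
    then show ?thesis by (simp add: power_less_top_ennreal)
  qed
  finally show "(\<integral>\<^sup>+x. ennreal (norm (inverse ((1 + norm x) ^ (2 * CARD('n))))) \<partial>(lebesgue :: (real^'n) measure)) < \<infinity>" .
qed

lemma integral_gauss: "(LINT x|lebesgue. gauss (x::real^'n::finite)) = 1"
  and integrable_gauss: "integrable lebesgue (gauss :: real^'n => real)"
proof -
  have nd: "(\<integral>\<^sup>+t. ennreal (normal_density 0 (1 / sqrt 2) t) \<partial>lborel) = 1"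
    using prob_space.emeasure_space_1[OF prob_space_normal_density[of "1 / sqrt 2" 0]]
    by (simp add: emeasure_density)
  have eq: "ennreal (gauss x) = (\<Prod>i\<in>UNIV. ennreal (normal_density 0 (1 / sqrt 2) (x $ i)))" for x :: "real^'n"
  proof -
    have "(\<Prod>i\<in>(UNIV::'n set). normal_density 0 (1 / sqrt 2) (x $ i))
       = (\<Prod>i\<in>(UNIV::'n set). 1 / sqrt pi * exp (- (x $ i)\<^sup>2))"
      by (rule prod.cong) (auto simp: normal_density_def power_divide)
    also have "... = (1 / sqrt pi) ^ CARD('n) * exp (- (\<Sum>i\<in>UNIV. (x $ i)^2))"
      unfolding prod.distrib by (simp add: exp_sum sum_negf[symmetric])
    also have "(\<Sum>i\<in>UNIV. (x $ i)^2) = (norm x)^2"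
      by (simp add: norm_vec_def L2_set_def real_sqrt_pow2 sum_nonneg)
    also have "(1 / sqrt pi) ^ CARD('n) = pi powr (- real CARD('n) / 2)"
    proof -
      have "1 / sqrt pi = pi powr (- 1/2)" by (simp add: powr_minus powr_half_sqrt divide_simps)
      then show ?thesis by (simp add: powr_power)
    qed
    finally show ?thesis by (simp add: gauss_def prod_ennreal)
  qed
  have c: "continuous_on UNIV (gauss :: real^'n => real)"
    unfolding gauss_def by (intro continuous_intros)
  have 1: "(\<integral>\<^sup>+x. ennreal (gauss x) \<partial>(lebesgue :: (real^'n) measure)) = 1"
    unfolding eq by (subst nn_integral_prod_coord) (auto simp: nd)
  have pos: "0 <= gauss x" for x :: "real^'n" by (simp add: gauss_def)
  show "integrable lebesgue (gauss :: real^'n => real)"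
    by (rule integrableI_nonneg) (use 1 pos continuous_lebesgue_measurable[OF c] in auto)
  show "(LINT x|lebesgue. gauss (x::real^'n::finite)) = 1"
    by (subst integral_eq_nn_integral) (use 1 pos continuous_lebesgue_measurable[OF c] in auto)
qed

text \<open>The class of \<open>sqrt \<gamma> u\<close> for solutions \<open>u\<close>: continuity and rapid decay of a Hermite series are enough to
  integrate it against Schwartz functions.\<close>

definition rapid :: "(real^'n::finite => complex) => bool" where
  "rapid h \<longleftrightarrow> continuous_on UNIV h \<and> (\<forall>N. \<exists>C. \<forall>x. (1 + norm x) ^ N * cmod (h x) <= C)"

lemma rapid_continuous: "rapid h ==> continuous_on A h"
  unfolding rapid_def by (meson continuous_on_subset subset_UNIV)

lemma rapid_bound:
  assumes "rapid h" obtains C where "C >= 0" "\<And>x. (1 + norm x) ^ N * cmod (h x) <= C"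
proof -
  obtain C where C: "\<And>x. (1 + norm x) ^ N * cmod (h x) <= C" using assms unfolding rapid_def by blast
  have "0 <= (1 + norm (0::real^'a)) ^ N * cmod (h 0)" by simp
  then have "C >= 0" using C[of 0] by linarith
  then show ?thesis using C that by blast
qed

lemma schwartz_rapid: "\<phi> \<in> schwartz_funs ==> rapid \<phi>"
proof -
  assume \<phi>: "\<phi> \<in> schwartz_funs"
  have "\<exists>C. \<forall>x. (1 + norm x) ^ N * cmod (\<phi> x) <= C" for N
    using schwartz_bound[OF \<phi>, of N "[]"] unfolding pderivs.simps by blast
  then show ?thesis unfolding rapid_def using smooth_fun_continuous[OF schwartz_smooth[OF \<phi>]] by blast
qed

lemma integrable_of_decay:
  fixes h :: "real^'n::finite => complex"
  assumes "continuous_on UNIV h" "\<And>x. (1 + norm x) ^ (2 * CARD('n)) * cmod (h x) <= C"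
  shows "integrable lebesgue h"
proof (rule Bochner_Integration.integrable_bound)
  show "integrable lebesgue (\<lambda>x::real^'n. C * inverse ((1 + norm x) ^ (2 * CARD('n))))"
    using integrable_decay by (rule integrable_mult_right)
  show "h \<in> borel_measurable lebesgue" by (rule continuous_lebesgue_measurable) fact
  have "cmod (h x) <= C * inverse ((1 + norm x) ^ (2 * CARD('n)))" for x
  proof -
    have "0 < (1 + norm x) ^ (2 * CARD('n))" by (intro zero_less_power add_pos_nonneg) auto
    then show ?thesis using assms(2)[of x] by (simp add: field_simps)
  qed
  then show "AE x in lebesgue. cmod (h x) <= norm (C * inverse ((1 + norm x) ^ (2 * CARD('n))))"
    by (intro AE_I2) (simp only: real_norm_def, rule order_trans[OF _ abs_ge_self])
qed

lemma rapid_integrable: "rapid h ==> integrable lebesgue h"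
proof -
  assume h: "rapid h"
  obtain C where "\<And>x. (1 + norm x) ^ (2 * CARD('a)) * cmod (h x) <= C" using rapid_bound[OF h] by blast
  then show ?thesis by (rule integrable_of_decay[OF rapid_continuous[OF h]])
qed

lemma rapid_mult_bounded:
  assumes "rapid h" "continuous_on UNIV g" "\<And>x. cmod (g x) <= B * (1 + norm x) ^ M"
  shows "rapid (\<lambda>x. h x * g x)"
  unfolding rapid_def
proof (intro conjI allI)
  show "continuous_on UNIV (\<lambda>x. h x * g x)" by (intro continuous_intros assms rapid_continuous)
  fix N
  obtain C where C: "C >= 0" "\<And>x. (1 + norm x) ^ (N + M) * cmod (h x) <= C" using rapid_bound[OF assms(1)] by blast
  have B: "0 <= B" using order_trans[OF norm_ge_zero assms(3)[of 0]] by simp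
  have "(1 + norm x) ^ N * cmod (h x * g x) <= C * B" for x
  proof -
    have "(1 + norm x) ^ N * cmod (h x * g x) <= (1 + norm x) ^ N * (cmod (h x) * (B * (1 + norm x) ^ M))"
      unfolding norm_mult by (intro mult_left_mono assms) auto
    also have "... = (1 + norm x) ^ (N + M) * cmod (h x) * B" by (simp add: power_add)
    also have "... <= C * B" by (intro mult_right_mono C B)
    finally show ?thesis .
  qed
  then show "\<exists>C. \<forall>x. (1 + norm x) ^ N * cmod (h x * g x) <= C" by blast
qed

lemma rapid_mult: "rapid h ==> rapid g ==> rapid (\<lambda>x. h x * g x)"
proof -
  assume h: "rapid h" and g: "rapid g"
  obtain C where "\<And>x. (1 + norm x) ^ 0 * cmod (g x) <= C" using rapid_bound[OF g] by blast
  then show ?thesis by (intro rapid_mult_bounded[OF h rapid_continuous[OF g], of C 0]) simp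
qed

lemma lebesgue_integral_translate:
  fixes h :: "real^'n::finite => complex"
  assumes "continuous_on UNIV h"
  shows "(LINT x|lebesgue. h (x + c)) = (LINT x|lebesgue. h x)"
proof -
  have m: "h \<in> borel_measurable borel" using assms by (rule borel_measurable_continuous_onI)
  have m2: "(\<lambda>x. h (x + c)) \<in> borel_measurable borel"
    by (intro borel_measurable_continuous_onI continuous_on_compose2[OF assms] continuous_intros) auto
  have "(LINT x|lebesgue. h x) = (LINT x|distr lborel borel ((+) c). h x)"
    using m by (simp add: integral_completion lborel_distr_plus)
  also have "... = (LINT x|lborel. h (c + x))" using m by (intro integral_distr) auto
  also have "... = (LINT x|lebesgue. h (x + c))" using m2 by (simp add: integral_completion add.commute)
  finally show ?thesis ..
qed

lemma line_has_vector_derivative: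
  fixes \<phi> :: "real^'n::finite => complex"
  assumes "smooth_fun \<phi>"
  shows "((\<lambda>\<tau>. \<phi> (x + \<tau> *\<^sub>R axis i 1)) has_vector_derivative pderiv_at i \<phi> (x + \<tau> *\<^sub>R axis i 1)) (at \<tau>)"
proof -
  have 1: "(\<phi> has_derivative frechet_derivative \<phi> (at (x + \<tau> *\<^sub>R axis i 1))) (at (x + \<tau> *\<^sub>R axis i 1))"
    using smooth_fun_differentiable[OF assms(1)] frechet_derivative_works by blast
  have "((\<lambda>\<tau>. x + \<tau> *\<^sub>R axis i (1::real)) has_derivative (\<lambda>h. h *\<^sub>R axis i 1)) (at \<tau>)"
    by (auto intro!: derivative_eq_intros)
  from has_derivative_compose[OF this 1] show ?thesis
    using linear_scale[OF has_derivative_linear[OF 1]] by (simp add: pderiv_at_def has_vector_derivative_def)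
qed

lemma norm_directional_increment_le:
  fixes \<phi> :: "real^'n::finite => complex"
  assumes "smooth_fun \<phi>" "t > 0"
  shows "\<exists>\<tau>\<in>{0<..<t}. cmod (\<phi> (x + t *\<^sub>R axis i 1) - \<phi> x) <= t * cmod (pderiv_at i \<phi> (x + \<tau> *\<^sub>R axis i 1))"
proof -
  note d = line_has_vector_derivative[OF assms(1), unfolded has_vector_derivative_def]
  have "continuous_on {0..t} (\<lambda>\<tau>. \<phi> (x + \<tau> *\<^sub>R axis i 1))"
    using d by (meson continuous_at_imp_continuous_on has_derivative_continuous)
  from mvt_general[OF assms(2) this d] show ?thesis using assms(2) by auto
qed

text \<open>The difference quotients integrate to \<open>0\<close> by translation invariance, and by the mean value theorem they are
  dominated by the decay of the derivative, as a shift by at most \<open>1\<close> changes \<open>1 + |x|\<close> by a factor of at most \<open>2\<close>.\<close>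

lemma integral_pderiv_at_zero:
  fixes \<phi> :: "real^'n::finite => complex"
  assumes "\<phi> \<in> schwartz_funs"
  shows "(LINT x|lebesgue. pderiv_at i \<phi> x) = 0"
proof -
  let ?N = "2 * CARD('n)"
  let ?e = "axis i 1 :: real^'n"
  define q where "q m x = of_nat (Suc m) * (\<phi> (x + (1 / Suc m) *\<^sub>R ?e) - \<phi> x)" for m :: nat and x
  note sm = schwartz_smooth[OF assms]
  have cont1: "continuous_on UNIV \<phi>" by (rule smooth_fun_continuous[OF sm])
  have cont2: "continuous_on UNIV (\<lambda>x. \<phi> (x + c))" for c
    by (rule continuous_on_compose2[OF cont1]) (auto intro!: continuous_intros)
  obtain C where C: "C >= 0" "\<And>x. (1 + norm x) ^ ?N * cmod (pderiv_at i \<phi> x) <= C"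
    using schwartz_bound[OF assms, of ?N "[i]"] by auto
  have int: "integrable lebesgue \<phi>" using assms by (intro rapid_integrable schwartz_rapid)
  have q0: "(LINT x|lebesgue. q m x) = 0" for m
  proof -
    let ?c = "(1 / Suc m) *\<^sub>R ?e"
    have "integrable lebesgue (\<lambda>x. \<phi> (x + ?c))"
    proof -
      have m: "\<phi> \<in> borel_measurable borel" using cont1 by (rule borel_measurable_continuous_onI)
      have "integrable lborel \<phi>" using int m by (simp add: integrable_completion)
      then have "integrable (distr lborel borel ((+) ?c)) \<phi>" by (simp add: lborel_distr_plus)
      then have "integrable lborel (\<lambda>x. \<phi> (?c + x))" using m by (subst (asm) integrable_distr_eq) auto
      then show ?thesis
        using borel_measurable_continuous_onI[OF cont2] by (simp add: integrable_completion add.commute)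
    qed
    then show ?thesis unfolding q_def using int lebesgue_integral_translate[OF cont1] by simp
  qed
  have bound: "cmod (q m x) <= 2 ^ ?N * C * inverse ((1 + norm x) ^ ?N)" for m x
  proof -
    obtain \<tau> where \<tau>: "0 < \<tau>" "\<tau> < 1 / Suc m"
      "cmod (\<phi> (x + (1 / Suc m) *\<^sub>R ?e) - \<phi> x) <= 1 / Suc m * cmod (pderiv_at i \<phi> (x + \<tau> *\<^sub>R ?e))"
      using norm_directional_increment_le[OF sm, of "1 / Suc m" x i] by auto
    let ?y = "x + \<tau> *\<^sub>R ?e"
    have "\<tau> <= 1" using \<tau>(2) order_less_imp_le order_trans[of \<tau> "1 / Suc m" 1] by (simp add: field_simps)
    have "norm x <= norm ?y + norm (\<tau> *\<^sub>R ?e)" by (metis add_diff_cancel norm_triangle_ineq4)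
    then have "1 + norm x <= 2 * (1 + norm ?y)" using \<open>\<tau> <= 1\<close> \<tau>(1) norm_ge_zero[of ?y] by (simp del: norm_ge_zero)
    then have "(1 + norm x) ^ ?N <= 2 ^ ?N * (1 + norm ?y) ^ ?N"
      by (subst power_mult_distrib[symmetric], intro power_mono) auto
    then have "(1 + norm x) ^ ?N * cmod (pderiv_at i \<phi> ?y) <= 2 ^ ?N * ((1 + norm ?y) ^ ?N * cmod (pderiv_at i \<phi> ?y))"
      by (simp add: mult_right_mono mult.assoc[symmetric])
    also have "... <= 2 ^ ?N * C" by (intro mult_left_mono C) auto
    finally have 1: "(1 + norm x) ^ ?N * cmod (pderiv_at i \<phi> ?y) <= 2 ^ ?N * C" .
    have "cmod (q m x) <= cmod (pderiv_at i \<phi> ?y)"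
      using \<tau>(3) unfolding q_def norm_mult norm_of_nat by (simp add: field_simps)
    moreover have "0 < (1 + norm x) ^ ?N" by (intro zero_less_power add_pos_nonneg) auto
    ultimately have "(1 + norm x) ^ ?N * cmod (q m x) <= 2 ^ ?N * C" and "0 < (1 + norm x) ^ ?N"
      using 1 mult_left_mono[of "cmod (q m x)" "cmod (pderiv_at i \<phi> ?y)" "(1 + norm x) ^ ?N"] by linarith+
    then show ?thesis by (simp only: divide_inverse[symmetric] pos_le_divide_eq) (simp only: mult.commute)
  qed
  have lim: "(\<lambda>m. q m x) \<longlonglongrightarrow> pderiv_at i \<phi> x" for x
  proof -
    let ?g = "\<lambda>\<tau>. \<phi> (x + \<tau> *\<^sub>R ?e)"
    have "(?g has_vector_derivative pderiv_at i \<phi> x) (at 0)"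
      using line_has_vector_derivative[OF sm, of x i 0] by simp
    then have "((\<lambda>h. norm (?g h - ?g 0 - h *\<^sub>R pderiv_at i \<phi> x) / norm h) \<longlongrightarrow> 0) (at 0)"
      unfolding has_vector_derivative_def has_derivative_at by simp
    then have "((\<lambda>h. norm ((?g h - ?g 0) /\<^sub>R h - pderiv_at i \<phi> x)) \<longlongrightarrow> 0) (at 0)"
    proof (rule Lim_transform_eventually)
      have "norm (?g h - ?g 0 - h *\<^sub>R pderiv_at i \<phi> x) / norm h = norm ((?g h - ?g 0) /\<^sub>R h - pderiv_at i \<phi> x)"
        if "h \<noteq> 0" for h
      proof -
        have "(?g h - ?g 0) /\<^sub>R h - pderiv_at i \<phi> x = (?g h - ?g 0 - h *\<^sub>R pderiv_at i \<phi> x) /\<^sub>R h"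
          using that by (simp add: scaleR_diff_right)
        then show ?thesis by (simp add: divide_inverse mult.commute)
      qed
      then show "\<forall>\<^sub>F h in at 0. norm (?g h - ?g 0 - h *\<^sub>R pderiv_at i \<phi> x) / norm h
          = norm ((?g h - ?g 0) /\<^sub>R h - pderiv_at i \<phi> x)"
        by (auto simp: eventually_at_filter)
    qed
    then have "((\<lambda>h. (?g h - ?g 0) /\<^sub>R h) \<longlongrightarrow> pderiv_at i \<phi> x) (at 0)"
      by (rule Lim_null[THEN iffD2, OF tendsto_norm_zero_cancel])
    moreover have "filterlim (\<lambda>m. 1 / real (Suc m)) (at 0) sequentially"
      unfolding filterlim_at using LIMSEQ_inverse_real_of_nat by (auto simp: divide_inverse)
    ultimately have "(\<lambda>m. (?g (1 / real (Suc m)) - ?g 0) /\<^sub>R (1 / real (Suc m))) \<longlonglongrightarrow> pderiv_at i \<phi> x"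
      by (rule filterlim_compose)
    then show ?thesis by (simp add: q_def scaleR_conv_of_real del: of_nat_Suc)
  qed
  have "(\<lambda>m. LINT x|lebesgue. q m x) \<longlonglongrightarrow> (LINT x|lebesgue. pderiv_at i \<phi> x)"
  proof (rule integral_dominated_convergence)
    show "pderiv_at i \<phi> \<in> borel_measurable lebesgue"
      by (intro continuous_lebesgue_measurable smooth_fun_continuous smooth_fun_pderiv_at sm)
    show "q m \<in> borel_measurable lebesgue" for m
      unfolding q_def by (intro continuous_lebesgue_measurable continuous_intros cont1 cont2)
    show "integrable lebesgue (\<lambda>x::real^'n. 2 ^ ?N * C * inverse ((1 + norm x) ^ ?N))"
      using integrable_decay by (rule integrable_mult_right)
  qed (use lim bound in auto)
  then show ?thesis using q0 LIMSEQ_unique by (simp add: LIMSEQ_const_iff)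
qed

lemma integration_by_parts:
  assumes "\<phi> \<in> schwartz_funs" "\<psi> \<in> schwartz_funs"
  shows "(LINT x|lebesgue. pderiv_at i \<phi> x * \<psi> x) = - (LINT x|lebesgue. \<phi> x * pderiv_at i \<psi> x)"
proof -
  have 1: "integrable lebesgue (\<lambda>x. pderiv_at i \<phi> x * \<psi> x)"
    by (rule rapid_integrable[OF schwartz_rapid[OF schwartz_mult[OF schwartz_pderiv_at[OF assms(1)] assms(2)]]])
  have 2: "integrable lebesgue (\<lambda>x. \<phi> x * pderiv_at i \<psi> x)"
    by (rule rapid_integrable[OF schwartz_rapid[OF schwartz_mult[OF assms(1) schwartz_pderiv_at[OF assms(2)]]]])
  have "0 = (LINT x|lebesgue. pderiv_at i (\<lambda>x. \<phi> x * \<psi> x) x)"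
    by (rule integral_pderiv_at_zero[OF schwartz_mult[OF assms], symmetric])
  also have "... = (LINT x|lebesgue. pderiv_at i \<phi> x * \<psi> x + \<phi> x * pderiv_at i \<psi> x)"
    by (rule Bochner_Integration.integral_cong[OF refl], rule pderiv_at_mult)
      (rule smooth_fun_differentiable[OF schwartz_smooth[OF assms(1)]],
        rule smooth_fun_differentiable[OF schwartz_smooth[OF assms(2)]])
  also have "... = (LINT x|lebesgue. pderiv_at i \<phi> x * \<psi> x) + (LINT x|lebesgue. \<phi> x * pderiv_at i \<psi> x)"
    using 1 2 by (rule Bochner_Integration.integral_add)
  finally show ?thesis by (simp only: eq_neg_iff_add_eq_0)
qed

section \<open>Distributions given by functions\<close>

lemma schwartz_mult_integrable:
  assumes "rapid w" "\<phi> \<in> schwartz_funs"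
  shows "integrable lebesgue (\<lambda>x. w x * \<phi> x)"
  by (intro rapid_integrable rapid_mult assms(1) schwartz_rapid assms(2))

lemma schwartz_continuous_fun_dist:
  assumes "rapid w" shows "schwartz_continuous (fun_dist w)"
  unfolding schwartz_continuous_def linear_functional_on_def
proof (intro conjI ballI allI)
  note int = schwartz_mult_integrable[OF assms]
  show "fun_dist w (\<lambda>x. f x + g x) = fun_dist w f + fun_dist w g"
    if "f \<in> schwartz_funs" "g \<in> schwartz_funs" for f g
    unfolding fun_dist_def using int[OF that(1)] int[OF that(2)] by (simp add: distrib_left)
  show "fun_dist w (\<lambda>x. c * f x) = c * fun_dist w f" for f c
    unfolding fun_dist_def mult.left_commute[of _ c] by simp
  have "cmod (fun_dist w \<phi>) <= (LINT x|lebesgue. cmod (w x)) * schwartz_seminorm 0 \<phi>" if \<phi>: "\<phi> \<in> schwartz_funs" for \<phi>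
  proof -
    have "cmod (fun_dist w \<phi>) <= (LINT x|lebesgue. cmod (w x * \<phi> x))"
      unfolding fun_dist_def by (rule integral_norm_bound)
    also have "... <= (LINT x|lebesgue. cmod (w x) * schwartz_seminorm 0 \<phi>)"
    proof (rule integral_mono)
      show "integrable lebesgue (\<lambda>x. cmod (w x * \<phi> x))" using int[OF \<phi>] by (rule integrable_norm)
      show "integrable lebesgue (\<lambda>x. cmod (w x) * schwartz_seminorm 0 \<phi>)"
        by (intro integrable_mult_left integrable_norm rapid_integrable assms)
      show "cmod (w x * \<phi> x) <= cmod (w x) * schwartz_seminorm 0 \<phi>" for x
        unfolding norm_mult using schwartz_seminorm_upper[OF \<phi>, of "[]" 0 x]
        by (intro mult_left_mono) auto
    qed
    finally show ?thesis by simp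
  qed
  then show "\<exists>C N. \<forall>\<phi>\<in>schwartz_funs. cmod (fun_dist w \<phi>) <= C * schwartz_seminorm N \<phi>" by blast
qed

lemma locally_integrable_times_test:
  assumes w: "locally_integrable w" and K: "compact K" "\<phi> \<in> test_funs_in K"
  shows "integrable lebesgue (\<lambda>x. w x * \<phi> x)"
    and "cmod (fun_dist w \<phi>) <= (LINT x|lebesgue. norm (indicator K x *\<^sub>R w x)) * test_seminorm 0 \<phi>"
proof -
  have \<phi>: "\<phi> \<in> test_funs" using K by (auto simp: test_funs_def)
  have wK: "integrable lebesgue (\<lambda>x. indicator K x *\<^sub>R w x)"
    using w K(1) unfolding locally_integrable_def set_integrable_def by blast
  have eq: "w x * \<phi> x = (indicator K x *\<^sub>R w x) * \<phi> x" for x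
    using K(2) by (cases "x \<in> K") (auto simp: test_funs_in_def)
  obtain C where C: "\<And>x. (1 + norm x) ^ 0 * cmod (pderivs [] \<phi> x) <= C"
    using test_funs_pderivs_bounded[OF \<phi>] by blast
  have up: "cmod (\<phi> x) <= test_seminorm 0 \<phi>" for x
    unfolding test_seminorm_def
    by (rule cSUP_upper2[where x="([], x)"]) (use C in \<open>auto intro!: bdd_aboveI[of _ C]\<close>)
  have le: "norm (w x * \<phi> x) <= norm (indicator K x *\<^sub>R w x) * test_seminorm 0 \<phi>" for x
    unfolding eq[of x] norm_mult by (intro mult_left_mono up norm_ge_zero)
  have bint: "integrable lebesgue (\<lambda>x. norm (indicator K x *\<^sub>R w x) * test_seminorm 0 \<phi>)"
    by (intro integrable_mult_left integrable_norm wK)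
  show int: "integrable lebesgue (\<lambda>x. w x * \<phi> x)"
  proof (rule Bochner_Integration.integrable_bound[OF bint])
    have "\<phi> \<in> borel_measurable lebesgue"
      by (intro continuous_lebesgue_measurable smooth_fun_continuous test_funs_smooth \<phi>)
    then show "(\<lambda>x. w x * \<phi> x) \<in> borel_measurable lebesgue"
      unfolding eq by (intro borel_measurable_times borel_measurable_integrable[OF wK])
    show "AE x in lebesgue. norm (w x * \<phi> x) <= norm (norm (indicator K x *\<^sub>R w x) * test_seminorm 0 \<phi>)"
      by (intro AE_I2 order_trans[OF le]) simp
  qed
  have "cmod (fun_dist w \<phi>) <= (LINT x|lebesgue. norm (w x * \<phi> x))"
    unfolding fun_dist_def by (rule integral_norm_bound)
  also have "... <= (LINT x|lebesgue. norm (indicator K x *\<^sub>R w x) * test_seminorm 0 \<phi>)"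
    by (rule integral_mono[OF integrable_norm[OF int] bint le])
  finally show "cmod (fun_dist w \<phi>) <= (LINT x|lebesgue. norm (indicator K x *\<^sub>R w x)) * test_seminorm 0 \<phi>"
    by simp
qed

lemma locally_integrable_test_integrable:
  "locally_integrable w ==> \<phi> \<in> test_funs ==> integrable lebesgue (\<lambda>x. w x * \<phi> x)"
  using locally_integrable_times_test(1) by (auto simp: test_funs_def)

lemma linear_functional_fun_dist:
  assumes "locally_integrable w" shows "linear_functional_on test_funs (fun_dist w)"
  unfolding linear_functional_on_def
proof (intro conjI ballI allI)
  note int = locally_integrable_test_integrable[OF assms]
  show "fun_dist w (\<lambda>x. f x + g x) = fun_dist w f + fun_dist w g"
    if "f \<in> test_funs" "g \<in> test_funs" for f g
    unfolding fun_dist_def using int[OF that(1)] int[OF that(2)] by (simp add: distrib_left)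
  show "fun_dist w (\<lambda>x. c * f x) = c * fun_dist w f" for f c
    unfolding fun_dist_def mult.left_commute[of _ c] by simp
qed

lemma is_distribution_fun_dist:
  assumes "locally_integrable w" shows "is_distribution (fun_dist w)"
  unfolding is_distribution_def
  using linear_functional_fun_dist[OF assms] locally_integrable_times_test(2)[OF assms] by blast

lemma continuous_locally_integrable:
  assumes "continuous_on UNIV (w :: real^'n::finite => complex)" shows "locally_integrable w"
  unfolding locally_integrable_def set_integrable_def
proof (intro allI impI)
  fix K :: "(real^'n) set" assume K: "compact K"
  have c: "continuous_on K w" using assms continuous_on_subset by blast
  have "integrable lborel (\<lambda>x. indicator K x *\<^sub>R w x)" using borel_integrable_compact[OF K c] .
  then show "integrable lebesgue (\<lambda>x. indicator K x *\<^sub>R w x)"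
    by (subst integrable_completion) (auto dest: borel_measurable_integrable)
qed

text \<open>The indicator of a box is a pointwise limit of test functions between \<open>0\<close> and \<open>1\<close>: a ramp of a large multiple of
  a smooth function that is positive exactly inside the box.\<close>

lemma open_box_indicator_limit:
  fixes a b :: "real^'n::finite"
  defines "l \<equiv> \<lambda>x. \<Prod>i\<in>UNIV. bump (x $ i + - (a $ i)) * bump (b $ i + (-1) * x $ i)"
  shows "(\<lambda>m. of_real (1 + (-1) * ramp (real m * l x))) \<longlonglongrightarrow> indicator (box a b) x"
    and "x \<notin> box a b ==> of_real (1 + (-1) * ramp (t * l x)) = 0"
    and "smooth_fun (\<lambda>x. of_real (1 + (-1) * ramp (t * l x)))"
proof -
  have in_box: "x \<in> box a b \<longleftrightarrow> (\<forall>i. a $ i < x $ i \<and> x $ i < b $ i)" by (simp add: mem_box_cart)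
  have 0: "l x = 0" if out: "x \<notin> box a b" for x
  proof -
    obtain i where "x $ i <= a $ i \<or> b $ i <= x $ i"
      using out by (auto simp: mem_box_cart not_less)
    then have "bump (x $ i + - (a $ i)) * bump (b $ i + (-1) * x $ i) = 0" by (auto simp: bump_zero)
    then show ?thesis unfolding l_def by (intro prod_zero) auto
  qed
  have 1: "l x > 0" if "x \<in> box a b"
    using that unfolding l_def in_box by (auto intro!: prod_pos mult_pos_pos bump_pos)
  show "x \<notin> box a b ==> of_real (1 + (-1) * ramp (t * l x)) = 0"
    using 0 by (simp add: ramp_le_0)
  show "(\<lambda>m. of_real (1 + (-1) * ramp (real m * l x))) \<longlonglongrightarrow> indicator (box a b) x"
  proof (cases "x \<in> box a b")
    case False
    then show ?thesis using 0 by (simp add: ramp_le_0)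
  next
    case True
    have "\<forall>\<^sub>F m in sequentially. of_real (1 + (-1) * ramp (real m * l x)) = 1"
    proof -
      have "\<forall>\<^sub>F m in sequentially. real m >= 1 / l x"
        using eventually_ge_at_top[of "nat \<lceil>1 / l x\<rceil>"] by eventually_elim linarith
      then show ?thesis
        by eventually_elim (use 1[OF True] in \<open>simp add: divide_le_eq ramp_ge_1\<close>)
    qed
    then show ?thesis using True by (simp add: tendsto_eventually)
  qed
  have coord: "smooth_fun (\<lambda>x. of_real (x $ i + - (a $ i)))" for i
    using smooth_fun_real_affine[OF smooth_fun_coord[of i], of "- (a $ i)" 1] by (simp add: add.commute)
  have "smooth_fun (\<lambda>x. of_real (l x))"
    unfolding l_def of_real_prod of_real_mult
    by (rule smooth_fun_prod, rule smooth_fun_mult; rule smooth_fun_bump)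
      (rule coord smooth_fun_real_affine[OF smooth_fun_coord])+
  from smooth_fun_real_affine[OF this, of 0 t] have "smooth_fun (\<lambda>x. of_real (t * l x))" by simp
  from smooth_fun_real_affine[OF smooth_fun_ramp[OF this], of 1 "-1"]
  show "smooth_fun (\<lambda>x. of_real (1 + (-1) * ramp (t * l x)))" .
qed

lemma box_integral_zero:
  fixes w :: "real^'n::finite => complex"
  assumes w: "locally_integrable w" and z: "\<And>\<phi>. \<phi> \<in> test_funs ==> fun_dist w \<phi> = 0"
  shows "(LINT x|lebesgue. indicator (box a b) x *\<^sub>R w x) = 0"
proof -
  define l where "l x = (\<Prod>i\<in>UNIV. bump (x $ i + - (a $ i)) * bump (b $ i + (-1) * x $ i))" for x :: "real^'n"
  define \<phi> where "\<phi> m x = complex_of_real (1 + (-1) * ramp (real m * l x))" for m x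
  note lim = open_box_indicator_limit[where a=a and b=b, folded l_def]
  have sub: "box a b \<subseteq> cbox a b" by (rule box_subset_cbox)
  have \<phi>: "\<phi> m \<in> test_funs_in (cbox a b)" for m
    using lim(2)[of _ "real m"] lim(3)[of "real m"] sub unfolding test_funs_in_def \<phi>_def by blast
  have "\<phi> m \<in> test_funs" for m using \<phi> compact_cbox unfolding test_funs_def by blast
  then have 0: "(LINT x|lebesgue. w x * \<phi> m x) = 0" for m using z unfolding fun_dist_def by blast
  have wK: "integrable lebesgue (\<lambda>x. indicator (cbox a b) x *\<^sub>R w x)"
    using w compact_cbox unfolding locally_integrable_def set_integrable_def by blast
  have "(\<lambda>m. LINT x|lebesgue. w x * \<phi> m x) \<longlonglongrightarrow> (LINT x|lebesgue. indicator (box a b) x *\<^sub>R w x)"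
  proof (rule integral_dominated_convergence)
    show "integrable lebesgue (\<lambda>x. norm (indicator (cbox a b) x *\<^sub>R w x))" using wK by (rule integrable_norm)
    show "(\<lambda>x. w x * \<phi> m x) \<in> borel_measurable lebesgue" for m
      using locally_integrable_times_test(1)[OF w compact_cbox \<phi>] by (rule borel_measurable_integrable)
    have "(\<lambda>x. indicator (box a b) x *\<^sub>R (indicator (cbox a b) x *\<^sub>R w x)) \<in> borel_measurable lebesgue"
      by (intro borel_measurable_scaleR borel_measurable_indicator borel_measurable_integrable[OF wK]) auto
    also have "(\<lambda>x. indicator (box a b) x *\<^sub>R (indicator (cbox a b) x *\<^sub>R w x)) = (\<lambda>x. indicator (box a b) x *\<^sub>R w x)"
      using sub by (auto simp: fun_eq_iff indicator_def)
    finally show "(\<lambda>x. indicator (box a b) x *\<^sub>R w x) \<in> borel_measurable lebesgue" .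
    show "AE x in lebesgue. (\<lambda>m. w x * \<phi> m x) \<longlonglongrightarrow> indicator (box a b) x *\<^sub>R w x"
    proof (rule AE_I2)
      fix x
      have "(\<lambda>m. w x * \<phi> m x) \<longlonglongrightarrow> w x * indicator (box a b) x"
        unfolding \<phi>_def by (intro tendsto_intros lim(1))
      then show "(\<lambda>m. w x * \<phi> m x) \<longlonglongrightarrow> indicator (box a b) x *\<^sub>R w x"
        by (auto simp: indicator_def)
    qed
    show "AE x in lebesgue. norm (w x * \<phi> m x) <= norm (indicator (cbox a b) x *\<^sub>R w x)" for m
    proof (rule AE_I2)
      fix x
      have "cmod (\<phi> m x) <= 1"
        unfolding \<phi>_def norm_of_real using ramp_bounds[of "real m * l x"] by simp
      moreover have "\<phi> m x = 0" if "x \<notin> cbox a b" using \<phi>[of m] that by (auto simp: test_funs_in_def)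
      ultimately show "norm (w x * \<phi> m x) <= norm (indicator (cbox a b) x *\<^sub>R w x)"
        by (cases "x \<in> cbox a b") (auto simp: norm_mult mult_left_le)
    qed
  qed
  then show ?thesis using 0 by (simp add: LIMSEQ_const_iff)
qed

lemma sigma_finite_lebesgue: "sigma_finite_measure (lebesgue :: 'a::euclidean_space measure)"
proof
  obtain A where "countable A" "A \<subseteq> sets lborel" "\<Union>A = space (lborel :: 'a measure)" "\<forall>a\<in>A. emeasure lborel a \<noteq> \<infinity>"
    using sigma_finite_measure.sigma_finite_countable[OF sigma_finite_lborel] by blast
  then show "\<exists>A. countable A \<and> A \<subseteq> sets lebesgue \<and> \<Union> A = space (lebesgue :: 'a measure) \<and> (\<forall>a\<in>A. emeasure lebesgue a \<noteq> \<infinity>)"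
    by (intro exI[of _ A]) (auto simp: subset_iff)
qed

text \<open>The fundamental lemma of the calculus of variations: integrals over boxes vanish, and boxes generate the
  Borel sets.\<close>

lemma locally_integrable_AE_zero:
  fixes w :: "real^'n::finite => complex"
  assumes w: "locally_integrable w" and z: "\<And>\<phi>. \<phi> \<in> test_funs ==> fun_dist w \<phi> = 0"
  shows "AE x in lebesgue. w x = 0"
proof -
  note box0 = box_integral_zero[OF w z]
  have main: "AE x in lebesgue. indicator (box c d) x *\<^sub>R w x = 0" for c d
  proof -
    define v where "v x = indicator (box c d) x *\<^sub>R w x" for x
    have vint: "integrable lebesgue v"
    proof -
      have "set_integrable lebesgue (cbox c d) w" using w compact_cbox unfolding locally_integrable_def by blast
      then have "set_integrable lebesgue (box c d) w"
        by (rule set_integrable_subset) (auto simp: box_subset_cbox)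
      then show ?thesis unfolding set_integrable_def v_def .
    qed
    have borel0: "(LINT x:A|lebesgue. v x) = 0" if "A \<in> sets borel" for A
    proof -
      let ?G = "range (\<lambda>(a, b). box a b) :: (real^'n) set set"
      have si: "set_integrable lebesgue B v" if "B \<in> sets lebesgue" for B
        using vint that unfolding set_integrable_def by (rule integrable_mult_indicator[rotated])
      have total: "(LINT x|lebesgue. v x) = 0" unfolding v_def by (rule box0)
      have IS: "Int_stable ?G"
      proof (rule Int_stableI)
        fix X Y assume "X \<in> ?G" "Y \<in> ?G"
        then obtain a b a' b' where XY: "X = box a b" "Y = box a' b'" by auto
        show "X \<inter> Y \<in> ?G" unfolding XY box_Int_box by blast
      qed
      have GP: "?G \<subseteq> Pow UNIV" by simp
      have mem: "A \<in> sigma_sets UNIV ?G" using that unfolding borel_eq_box by simp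
      define P where "P B \<longleftrightarrow> B \<in> sets borel \<and> (LINT x:B|lebesgue. v x) = 0" for B
      have "P A"
      proof (rule sigma_sets_induct_disjoint[OF IS GP mem, where P=P])
        fix B assume "B \<in> ?G"
        then obtain a b where B: "B = box a b" by auto
        have "indicator B x *\<^sub>R v x = indicator (box a b \<inter> box c d) x *\<^sub>R w x" for x
          by (auto simp: v_def B indicator_def)
        then have "(LINT x:B|lebesgue. v x) = 0"
          unfolding set_lebesgue_integral_def box_Int_box by (simp only: box0)
        then show "P B" unfolding B P_def by simp
      next
        show "P {}" by (simp add: P_def set_lebesgue_integral_def)
      next
        fix B assume B: "P B"
        have "indicator (UNIV - B) x *\<^sub>R v x = v x - indicator B x *\<^sub>R v x" for x by (auto simp: indicator_def)
        moreover have "integrable lebesgue (\<lambda>x. indicator B x *\<^sub>R v x)"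
          using si[of B] B unfolding set_integrable_def P_def by simp
        moreover have "UNIV - B \<in> sets borel" using B borel_comp[of B] by (simp add: P_def Compl_eq_Diff_UNIV)
        ultimately show "P (UNIV - B)"
          using B vint total unfolding set_lebesgue_integral_def P_def by simp
      next
        fix B :: "nat => (real^'n) set"
        assume B: "disjoint_family B" "\<And>i. P (B i)"
        have "(LINT x:(\<Union>i. B i)|lebesgue. v x) = (\<Sum>i. LINT x:B i|lebesgue. v x)"
        proof (rule lebesgue_integral_countable_add)
          show "B i \<in> sets lebesgue" for i using B(2)[of i] by (simp add: P_def)
          then show "set_integrable lebesgue (\<Union>i. B i) v" by (intro si) auto
          show "i \<noteq> j ==> B i \<inter> B j = {}" for i j using B(1) by (simp add: disjoint_family_on_def)
        qed
        then show "P (\<Union>i. B i)" using B(2) by (auto simp: P_def)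
      qed
      then have "A \<in> sets borel \<and> (LINT x:A|lebesgue. v x) = 0" by (simp add: P_def)
      then show ?thesis by blast
    qed
    have "(LINT x:A|lebesgue. v x) = 0" if A: "A \<in> sets lebesgue" for A
    proof -
      obtain S N N' where S: "A = S \<union> N" "N \<subseteq> N'" "N' \<in> null_sets lborel" "S \<in> sets lborel"
        using A by (rule sets_completionE)
      have "AE x in lborel. x \<notin> N'" using S(3) by (rule AE_not_in)
      then have "AE x in lebesgue. x \<notin> N'" by (rule AE_completion)
      then have "AE x in lebesgue. indicator A x *\<^sub>R v x = indicator S x *\<^sub>R v x"
        by (rule AE_mp) (use S in \<open>auto simp: indicator_def\<close>)
      then have "(LINT x:A|lebesgue. v x) = (LINT x:S|lebesgue. v x)"
        unfolding set_lebesgue_integral_def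
        by (intro integral_cong_AE)
          (use A S(4) borel_measurable_integrable[OF vint] in \<open>auto intro!: borel_measurable_scaleR borel_measurable_indicator\<close>)
      then show ?thesis using borel0 S(4) by simp
    qed
    then have "AE x in lebesgue. v x = 0" by (intro sigma_finite_measure.density_zero[OF sigma_finite_lebesgue] vint)
    then show ?thesis unfolding v_def .
  qed
  have "AE x in lebesgue. \<forall>m. indicator (box (- (\<chi> i. real m)) (\<chi> i. real m)) x *\<^sub>R w x = 0"
    unfolding AE_all_countable using main by blast
  then show ?thesis
  proof (rule AE_mp, intro AE_I2 impI)
    fix x :: "real^'n"
    assume *: "\<forall>m. indicator (box (- (\<chi> i. real m)) (\<chi> i. real m)) x *\<^sub>R w x = 0"
    obtain m where m: "norm x < real m" using reals_Archimedean2 by blast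
    have "\<bar>x $ i\<bar> < real m" for i using component_le_norm_cart[of x i] m by linarith
    then have "x \<in> box (- (\<chi> i. real m)) (\<chi> i. real m)" by (simp add: mem_box_cart abs_less_iff minus_less_iff)
    then show "w x = 0" using *[rule_format, of m] by simp
  qed
qed


section \<open>Hermite functions\<close>

definition nherm :: "nat => real => real" where
  "nherm k t = hermite k t / sqrt (2 ^ k * fact k)"

lemma hermite_times: "t * hermite k t = hermite (Suc k) t / 2 + real k * hermite (k - 1) t"
  by (cases k) (auto simp: field_simps)

lemma hermite_has_derivative: "(hermite k has_real_derivative 2 * real k * hermite (k - 1) t) (at t)"
proof (induction k t rule: hermite.induct)
  case (1 x)
  have "hermite 0 = (\<lambda>x. 1)" by auto
  then show ?case by simp
next
  case (2 x)
  have "hermite (Suc 0) = (\<lambda>x. 2 * x)" by auto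
  then show ?case by (auto intro!: derivative_eq_intros)
next
  case (3 k x)
  have "hermite (Suc (Suc k)) = (\<lambda>x. 2 * x * hermite (Suc k) x - 2 * real (Suc k) * hermite k x)" by auto
  moreover have "((\<lambda>x. 2 * x * hermite (Suc k) x - 2 * real (Suc k) * hermite k x)
     has_real_derivative 2 * real (Suc (Suc k)) * hermite (Suc k) x) (at x)"
  proof -
    have e: "hermite (Suc k) x = 2 * x * hermite k x - 2 * real k * hermite (k - 1) x"
      using hermite_times[of x k] by simp
    show ?thesis
      by (rule derivative_eq_intros 3 refl)+ (simp add: e algebra_simps)
  qed
  ultimately show ?case by simp
qed

lemma sqrt_two_pow_fact_Suc:
  "sqrt (2 ^ Suc k * fact (Suc k)) = 2 * sqrt ((real k + 1) / 2) * sqrt (2 ^ k * fact k)"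
proof -
  have "2 * sqrt ((real k + 1) / 2) = sqrt (2 ^ 2) * sqrt ((real k + 1) / 2)" by simp
  also have "... = sqrt (2 * (real k + 1))" unfolding real_sqrt_mult[symmetric] by simp
  finally show ?thesis by (simp add: real_sqrt_mult[symmetric] algebra_simps)
qed

lemma nherm_lower:
  "real k * hermite (k - 1) t / sqrt (2 ^ k * fact k) = sqrt (real k / 2) * nherm (k - 1) t"
proof (cases k)
  case (Suc j)
  have cancel: "2 * q^2 * x / (2 * q * D) = q * (x / D)" if "q > 0" for x q D :: real
    using that by (simp add: power2_eq_square)
  have r: "2 * (sqrt ((real j + 1) / 2))^2 = real j + 1" by simp
  have e: "real (Suc j) = real j + 1" by simp
  show ?thesis
    unfolding nherm_def Suc sqrt_two_pow_fact_Suc diff_Suc_1 e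
    by (rule cancel[of "sqrt ((real j + 1) / 2)", unfolded r]) simp
qed simp

lemma nherm_times:
  "t * nherm k t = sqrt ((real k + 1) / 2) * nherm (Suc k) t + sqrt (real k / 2) * nherm (k - 1) t"
proof -
  have a: "hermite (Suc k) t / 2 / sqrt (2 ^ k * fact k) = sqrt ((real k + 1) / 2) * nherm (Suc k) t"
  proof -
    have cancel: "x / 2 / D = q * (x / (2 * q * D))" if "q > 0" for x q D :: real
      using that by simp
    show ?thesis unfolding nherm_def sqrt_two_pow_fact_Suc by (rule cancel) simp
  qed
  have b: "real k * hermite (k - 1) t / sqrt (2 ^ k * fact k) = sqrt (real k / 2) * nherm (k - 1) t"
    by (rule nherm_lower)
  have "t * nherm k t = (hermite (Suc k) t / 2 + real k * hermite (k - 1) t) / sqrt (2 ^ k * fact k)"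
    unfolding nherm_def hermite_times[symmetric] by simp
  then show ?thesis unfolding add_divide_distrib a b .
qed

lemma nherm_has_derivative: "(nherm k has_real_derivative 2 * (sqrt (real k / 2) * nherm (k - 1) t)) (at t)"
proof -
  have "2 * real k * hermite (k - 1) t / sqrt (2 ^ k * fact k) = 2 * (sqrt (real k / 2) * nherm (k - 1) t)"
    unfolding nherm_lower[symmetric] by simp
  then show ?thesis
    using DERIV_cdivide[OF hermite_has_derivative[of k t], of "sqrt (2 ^ k * fact k)"]
    by (simp add: nherm_def[abs_def])
qed

definition herm1 :: "nat => real => real" where
  "herm1 k t = exp (- (t^2) / 2) * nherm k t"

lemma herm1_times:
  "t * herm1 k t = sqrt ((real k + 1) / 2) * herm1 (Suc k) t + sqrt (real k / 2) * herm1 (k - 1) t"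
  using arg_cong[OF nherm_times[of t k], of "\<lambda>u. exp (- (t^2) / 2) * u"]
  by (simp add: herm1_def algebra_simps)

lemma herm1_has_derivative:
  "(herm1 k has_real_derivative
     (sqrt (real k / 2) * herm1 (k - 1) t - sqrt ((real k + 1) / 2) * herm1 (Suc k) t)) (at t)"
proof -
  have e: "((\<lambda>t::real. exp (- (t^2) / 2)) has_real_derivative - t * exp (- (t^2) / 2)) (at t)"
    by (auto intro!: derivative_eq_intros)
  have "(herm1 k has_real_derivative
      - t * exp (- (t^2) / 2) * nherm k t + 2 * (sqrt (real k / 2) * nherm (k - 1) t) * exp (- (t^2) / 2)) (at t)"
    unfolding herm1_def[abs_def] by (rule DERIV_mult[OF e nherm_has_derivative])
  moreover have "- t * exp (- (t^2) / 2) * nherm k t + 2 * (sqrt (real k / 2) * nherm (k - 1) t) * exp (- (t^2) / 2)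
      = 2 * (sqrt (real k / 2) * herm1 (k - 1) t) - t * herm1 k t"
    by (simp add: herm1_def)
  moreover have "... = sqrt (real k / 2) * herm1 (k - 1) t - sqrt ((real k + 1) / 2) * herm1 (Suc k) t"
    unfolding herm1_times by simp
  ultimately show ?thesis by (simp only:)
qed

lemma herm1_deriv_alt:
  "(herm1 k has_real_derivative (t * herm1 k t - 2 * (sqrt ((real k + 1) / 2) * herm1 (Suc k) t))) (at t)"
  by (rule DERIV_cong[OF herm1_has_derivative]) (unfold herm1_times, simp)

definition dherm1 :: "nat => real => real" where
  "dherm1 k t = sqrt (real k / 2) * herm1 (k - 1) t - sqrt ((real k + 1) / 2) * herm1 (Suc k) t"

lemma herm1_deriv: "(herm1 k has_real_derivative dherm1 k t) (at t)"
  unfolding dherm1_def by (rule herm1_has_derivative)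

lemma dherm1_deriv: "(dherm1 k has_real_derivative (t^2 - (2 * real k + 1)) * herm1 k t) (at t)"
proof -
  let ?a = "sqrt ((real k + 1) / 2)"
  have "dherm1 k = (\<lambda>t. t * herm1 k t - 2 * (?a * herm1 (Suc k) t))"
    by (rule ext) (simp add: dherm1_def herm1_times)
  moreover have "((\<lambda>t. t * herm1 k t - 2 * (?a * herm1 (Suc k) t)) has_real_derivative
      (1 * herm1 k t + (t * herm1 k t - 2 * (?a * herm1 (Suc k) t)) * t
       - 2 * (?a * (2 * (?a * herm1 k t) - t * herm1 (Suc k) t)))) (at t)"
  proof (intro DERIV_diff DERIV_mult DERIV_ident DERIV_cmult herm1_deriv_alt)
    have "sqrt (real (Suc k) / 2) * herm1 k t - sqrt ((real (Suc k) + 1) / 2) * herm1 (Suc (Suc k)) t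
        = 2 * (?a * herm1 k t) - t * herm1 (Suc k) t"
      using herm1_times[of t "Suc k"] by (simp add: add.commute)
    then show "(herm1 (Suc k) has_real_derivative 2 * (?a * herm1 k t) - t * herm1 (Suc k) t) (at t)"
      using herm1_has_derivative[of "Suc k" t] by simp
  qed
  moreover have "1 * herm1 k t + (t * herm1 k t - 2 * (?a * herm1 (Suc k) t)) * t
       - 2 * (?a * (2 * (?a * herm1 k t) - t * herm1 (Suc k) t)) = (t^2 - (2 * real k + 1)) * herm1 k t"
  proof -
    have "?a * (?a * z) = (real k + 1) / 2 * z" for z
      by (simp flip: mult.assoc)
    then show ?thesis by (simp add: algebra_simps power2_eq_square)
  qed
  ultimately show ?thesis by simp
qed

lemma herm1_power_tendsto: "((\<lambda>t. t ^ m * herm1 k t) \<longlongrightarrow> 0) at_top"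
proof -
  have base: "((\<lambda>t::real. t ^ m * exp (- (t^2) / 2)) \<longlongrightarrow> 0) at_top" for m
  proof (rule Lim_null_comparison)
    show "((\<lambda>t::real. t ^ m / exp t) \<longlongrightarrow> 0) at_top" by (rule tendsto_power_div_exp_0)
    show "\<forall>\<^sub>F t::real in at_top. norm (t ^ m * exp (- (t^2) / 2)) <= t ^ m / exp t"
      using eventually_ge_at_top[of 2]
    proof eventually_elim
      case (elim t)
      have "2 * t <= t * t" using elim by (intro mult_right_mono) auto
      then have "exp (- (t^2) / 2) <= exp (- t)" by (simp add: power2_eq_square)
      then have "t ^ m * exp (- (t^2) / 2) <= t ^ m * exp (- t)" using elim by (intro mult_left_mono) auto
      also have "t ^ m * exp (- t) = t ^ m / exp t" by (simp add: exp_minus divide_inverse)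
      finally show ?case using elim by (simp add: abs_mult power_abs)
    qed
  qed
  have "\<forall>m. ((\<lambda>t. t ^ m * (exp (- (t^2) / 2) * hermite k t)) \<longlongrightarrow> 0) at_top"
  proof (induction k rule: induct_nat_012)
    case 0
    then show ?case using base by simp
  next
    case 1
    have eq: "t ^ m * (exp (- (t^2) / 2) * hermite (Suc 0) t) = 2 * (t ^ Suc m * exp (- (t^2) / 2))" for t and m
      by simp
    show ?case unfolding One_nat_def eq by (intro allI tendsto_mult_right_zero base)
  next
    case (ge2 k)
    show ?case
    proof
      fix m
      have "((\<lambda>t. 2 * (t ^ Suc m * (exp (- (t^2) / 2) * hermite (Suc k) t))
            - 2 * real (Suc k) * (t ^ m * (exp (- (t^2) / 2) * hermite k t))) \<longlongrightarrow> 0 - 0) at_top"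
        by (intro tendsto_diff tendsto_mult_right_zero ge2(2)[rule_format] ge2(1)[rule_format])
      moreover have "2 * (t ^ Suc m * (exp (- (t^2) / 2) * hermite (Suc k) t))
            - 2 * real (Suc k) * (t ^ m * (exp (- (t^2) / 2) * hermite k t))
          = t ^ m * (exp (- (t^2) / 2) * hermite (Suc (Suc k)) t)" for t
        by (simp add: algebra_simps)
      ultimately show "((\<lambda>t. t ^ m * (exp (- (t^2) / 2) * hermite (Suc (Suc k)) t)) \<longlongrightarrow> 0) at_top"
        by (simp only: diff_zero)
    qed
  qed
  then have "((\<lambda>t. t ^ m * (exp (- (t^2) / 2) * hermite k t) / sqrt (2 ^ k * fact k)) \<longlongrightarrow> 0) at_top"
    by (intro tendsto_divide_zero) auto
  then show ?thesis by (simp add: herm1_def nherm_def)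
qed

lemma herm1_zero_bound: "\<bar>herm1 k 0\<bar> <= 1"
proof (induction k rule: induct_nat_012)
  case (ge2 k)
  have "sqrt ((real (Suc k) + 1) / 2) * herm1 (Suc (Suc k)) 0 = - (sqrt (real (Suc k) / 2) * herm1 k 0)"
    using herm1_times[of 0 "Suc k"] by simp
  from arg_cong[OF this, of abs]
  have "sqrt ((real (Suc k) + 1) / 2) * \<bar>herm1 (Suc (Suc k)) 0\<bar> = sqrt (real (Suc k) / 2) * \<bar>herm1 k 0\<bar>"
    unfolding abs_minus_cancel abs_mult by simp
  also have "... <= sqrt ((real (Suc k) + 1) / 2) * 1"
    using ge2 by (intro mult_mono) auto
  finally show ?case by (simp add: mult_le_cancel_left_pos)
qed (auto simp: herm1_def nherm_def)

lemma herm1_minus: "herm1 k (- t) = (-1) ^ k * herm1 k t"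
proof -
  have "hermite k (- t) = (-1) ^ k * hermite k t"
    by (induction k t rule: hermite.induct) (auto simp: algebra_simps)
  then show ?thesis by (simp add: herm1_def nherm_def)
qed

text \<open>With \<open>M = 2k + 1\<close> the function satisfies \<open>h'' = (t\<^sup>2 - M) h\<close>. The energy \<open>h'\<^sup>2 + (M - t\<^sup>2) h\<^sup>2\<close> decreases for
  \<open>t \<ge> 0\<close> and bounds \<open>h'\<close> up to the turning point \<open>t\<^sup>2 = M\<close>. Beyond it \<open>h h'\<close> increases to its limit \<open>0\<close>, so \<open>h\<^sup>2\<close> decreases.\<close>

lemma herm1_bound: "\<bar>herm1 k t\<bar> <= 4 * real k + 2"
proof -
  define M where "M = 2 * real k + 1"
  define E where "E t = (dherm1 k t)^2 + (M - t^2) * (herm1 k t)^2" for t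
  have dE: "(E has_real_derivative - 2 * t * (herm1 k t)^2) (at t)" for t
    unfolding E_def[abs_def] M_def
    by (rule DERIV_cong, (rule herm1_deriv dherm1_deriv DERIV_add DERIV_diff DERIV_mult DERIV_power DERIV_const DERIV_ident)+)
       (simp add: algebra_simps power2_eq_square)
  have Emono: "E t <= E 0" if "t >= 0" for t
    by (rule DERIV_nonpos_imp_nonincreasing[OF that]) (rule exI, rule conjI, rule dE, simp)
  have E0: "E 0 <= 4 * real k + 1"
  proof -
    have "dherm1 k 0 = 2 * (sqrt (real k / 2) * herm1 (k - 1) 0)"
      using herm1_times[of 0 k] unfolding dherm1_def by linarith
    then have "(dherm1 k 0)^2 = 2 * real k * (herm1 (k - 1) 0)^2"
      by (simp add: power_mult_distrib)
    also have "... <= 2 * real k * 1"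
      using herm1_zero_bound[of "k - 1"] by (intro mult_left_mono) (auto simp: abs_square_le_1)
    finally have 1: "(dherm1 k 0)^2 <= 2 * real k" by simp
    have "M * (herm1 k 0)^2 <= M"
      using herm1_zero_bound[of k] by (intro mult_left_le) (auto simp: abs_square_le_1 M_def)
    then have "(dherm1 k 0)^2 + M * (herm1 k 0)^2 <= 4 * real k + 1" using 1 M_def by linarith
    then show ?thesis by (simp add: E_def)
  qed
  have inner: "\<bar>herm1 k t\<bar> <= 4 * real k + 2" if t: "0 <= t" "t^2 <= M" for t
  proof (cases "t = 0")
    case True
    then show ?thesis using herm1_zero_bound[of k] by simp
  next
    case False
    then have "t > 0" using t by simp
    from MVT2[OF this, of "herm1 k" "dherm1 k"] herm1_deriv
    obtain z where z: "0 < z" "z < t" "herm1 k t - herm1 k 0 = (t - 0) * dherm1 k z" by blast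
    have "z^2 <= M" using z t by (intro order_trans[OF power_mono t(2)]) auto
    then have "(dherm1 k z)^2 <= E z" by (simp add: E_def)
    also have "... <= 4 * real k + 1" using Emono[of z] z E0 by simp
    finally have d: "(dherm1 k z)^2 <= 4 * real k + 1" .
    have "(t * dherm1 k z)^2 <= (4 * real k + 1)^2"
      unfolding power_mult_distrib power2_eq_square[of "4 * real k + 1"]
      using t d by (intro mult_mono) (auto simp: M_def)
    then have "\<bar>t * dherm1 k z\<bar> <= 4 * real k + 1" by (simp add: abs_le_square_iff[symmetric])
    then show ?thesis using z(3) herm1_zero_bound[of k] by simp
  qed
  have outer: "\<bar>herm1 k t\<bar> <= 4 * real k + 2" if t: "t > 0" "t^2 > M" for t
  proof -
    have M0: "M >= 0" by (simp add: M_def)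
    define r where "r = sqrt M"
    have r: "r >= 0" "r^2 = M" using M0 by (auto simp: r_def)
    have "r < t" using t r by (simp add: r_def real_less_lsqrt)
    define F where "F t = herm1 k t * dherm1 k t" for t
    have dF: "(F has_real_derivative (dherm1 k t)^2 + (t^2 - M) * (herm1 k t)^2) (at t)" for t
      unfolding F_def[abs_def] M_def
      by (rule DERIV_cong, (rule herm1_deriv dherm1_deriv DERIV_add DERIV_diff DERIV_mult DERIV_power DERIV_const DERIV_ident)+)
         (simp add: algebra_simps power2_eq_square)
    have Flim: "(F \<longlongrightarrow> 0) at_top"
    proof -
      have h: "(herm1 j \<longlongrightarrow> 0) at_top" for j using herm1_power_tendsto[of 0 j] by simp
      have "((\<lambda>t. herm1 k t * (sqrt (real k / 2) * herm1 (k - 1) t - sqrt ((real k + 1) / 2) * herm1 (Suc k) t))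
          \<longlongrightarrow> 0 * (sqrt (real k / 2) * 0 - sqrt ((real k + 1) / 2) * 0)) at_top"
        by (intro tendsto_intros h)
      then show ?thesis by (simp add: F_def[abs_def] dherm1_def)
    qed
    have Fneg: "F y <= 0" if y: "y >= r" for y
    proof (rule tendsto_lowerbound[OF Flim])
      show "\<forall>\<^sub>F x in at_top. F y <= F x"
        using eventually_ge_at_top[of y]
      proof eventually_elim
        case (elim x)
        show ?case
        proof (rule DERIV_nonneg_imp_nondecreasing[OF elim])
          fix z assume "y <= z" "z <= x"
          then have "r^2 <= z^2" using y r by (intro power_mono) auto
          then show "\<exists>d. (F has_real_derivative d) (at z) \<and> 0 <= d"
            using dF[of z] r by (intro exI[of _ "(dherm1 k z)^2 + (z^2 - M) * (herm1 k z)^2"]) auto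
        qed
      qed
    qed simp
    have "(herm1 k t)^2 <= (herm1 k r)^2"
    proof (rule DERIV_nonpos_imp_nonincreasing[of r t "\<lambda>t. (herm1 k t)^2"])
      show "r <= t" using \<open>r < t\<close> by simp
      fix z assume z: "r <= z" "z <= t"
      have "((\<lambda>t. (herm1 k t)^2) has_real_derivative 2 * F z) (at z)"
        unfolding F_def by (rule DERIV_cong, (rule herm1_deriv dherm1_deriv DERIV_add DERIV_diff DERIV_mult DERIV_power DERIV_const DERIV_ident)+) simp
      then show "\<exists>d. ((\<lambda>t. (herm1 k t)^2) has_real_derivative d) (at z) \<and> d <= 0"
        using Fneg[OF z(1)] by (intro exI[of _ "2 * F z"]) auto
    qed
    then have "\<bar>herm1 k t\<bar> <= \<bar>herm1 k r\<bar>" by (simp add: abs_le_square_iff)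
    also have "... <= 4 * real k + 2" using inner[of r] r by simp
    finally show ?thesis .
  qed
  have pos: "\<bar>herm1 k t\<bar> <= 4 * real k + 2" if "t >= 0" for t
  proof (cases "t = 0 \<or> t^2 <= M")
    case True
    then show ?thesis using inner[of t] that by (auto simp: M_def)
  next
    case False
    then show ?thesis using outer[of t] that by simp
  qed
  show ?thesis
  proof (cases "t >= 0")
    case False
    then show ?thesis using pos[of "- t"] herm1_minus[of k t] by (simp add: abs_mult)
  qed (rule pos)
qed


definition hermite_fun :: "('n::finite => nat) => real^'n => complex" where
  "hermite_fun \<mu> x = of_real (sqrt (gauss x) * Herm \<mu> x)"

abbreviation mi_size :: "('n::finite => nat) => nat" where
  "mi_size \<mu> \<equiv> \<Sum>i\<in>UNIV. \<mu> i"

abbreviation mi_raise :: "('n => nat) => 'n => 'n => nat" where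
  "mi_raise \<mu> i \<equiv> \<mu>(i := Suc (\<mu> i))"

abbreviation mi_lower :: "('n => nat) => 'n => 'n => nat" where
  "mi_lower \<mu> i \<equiv> \<mu>(i := \<mu> i - 1)"

abbreviation rt2 :: "nat => real" where
  "rt2 m \<equiv> sqrt (real m / 2)"

lemma mi_size_raise: "mi_size (mi_raise \<mu> i) = Suc (mi_size \<mu>)"
  by (simp add: sum.remove[of _ i])

lemma mi_size_lower: "\<mu> i > 0 ==> Suc (mi_size (mi_lower \<mu> i)) = mi_size \<mu>"
  by (simp add: sum.remove[of _ i])

lemma mi_component_le: "\<mu> i <= mi_size \<mu>"
  by (rule member_le_sum) auto

lemma sqrt_gauss: "sqrt (gauss (x::real^'n::finite)) = pi powr (- real CARD('n) / 4) * exp (- (norm x)\<^sup>2 / 2)"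
proof (rule real_sqrt_unique)
  have "(pi powr (- real CARD('n) / 4))^2 = pi powr (- real CARD('n) / 2)"
    by (simp add: power2_eq_square flip: powr_add)
  moreover have "(exp (- (norm x)\<^sup>2 / 2))^2 = exp (- (norm x)\<^sup>2)"
    by (simp add: power2_eq_square flip: exp_add)
  ultimately show "(pi powr (- real CARD('n) / 4) * exp (- (norm x)\<^sup>2 / 2))^2 = gauss x"
    by (simp add: gauss_def power_mult_distrib)
qed simp

lemma hermite_fun_prod:
  "hermite_fun \<mu> (x::real^'n::finite) = of_real (pi powr (- real CARD('n) / 4) * (\<Prod>i\<in>UNIV. herm1 (\<mu> i) (x $ i)))"
proof -
  have "exp (- (norm x)\<^sup>2 / 2) = (\<Prod>i\<in>UNIV. exp (- ((x $ i)^2) / 2))"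
  proof -
    have "(norm x)^2 = (\<Sum>i\<in>UNIV. (x $ i)^2)"
      by (simp add: norm_vec_def L2_set_def real_sqrt_pow2 sum_nonneg)
    then have "- (norm x)\<^sup>2 / 2 = (\<Sum>i\<in>UNIV. - ((x $ i)^2) / 2)"
      by (simp add: sum_negf sum_divide_distrib)
    then show ?thesis by (simp only: exp_sum finite_class.finite_UNIV)
  qed
  moreover have "Herm \<mu> x = (\<Prod>i\<in>UNIV. nherm (\<mu> i) (x $ i))"
    by (simp add: Herm_def nherm_def)
  moreover have "(\<Prod>i\<in>UNIV. herm1 (\<mu> i) (x $ i))
      = (\<Prod>i\<in>UNIV. exp (- ((x $ i)^2) / 2)) * (\<Prod>i\<in>UNIV. nherm (\<mu> i) (x $ i))"
    unfolding herm1_def prod.distrib ..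
  ultimately show ?thesis
    unfolding hermite_fun_def sqrt_gauss by (simp only: mult.assoc)
qed

lemma hermite_fun_update:
  "\<exists>R. \<forall>m y. (\<forall>j. j \<noteq> i --> y $ j = x $ j) --> hermite_fun (\<mu>(i := m)) y = of_real (R * herm1 m (y $ i))"
proof (intro exI allI impI)
  fix m and y :: "real^'a" assume y: "\<forall>j. j \<noteq> i --> y $ j = x $ j"
  have "(\<Prod>j\<in>UNIV. herm1 ((\<mu>(i := m)) j) (y $ j)) = herm1 m (y $ i) * (\<Prod>j\<in>UNIV - {i}. herm1 (\<mu> j) (x $ j))"
    using y by (subst prod.remove[of _ i]) (auto intro!: prod.cong)
  then show "hermite_fun (\<mu>(i := m)) y = of_real
      ((pi powr (- real CARD('a) / 4) * (\<Prod>j\<in>UNIV - {i}. herm1 (\<mu> j) (x $ j))) * herm1 m (y $ i))"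
    by (simp add: hermite_fun_prod)
qed

lemma hermite_fun_coord:
  "of_real (x $ i) * hermite_fun \<mu> x
    = of_real (rt2 (Suc (\<mu> i))) * hermite_fun (mi_raise \<mu> i) x
      + of_real (rt2 (\<mu> i)) * hermite_fun (mi_lower \<mu> i) x"
proof -
  obtain R where R: "\<And>m y. (\<forall>j. j \<noteq> i --> y $ j = x $ j) ==> hermite_fun (\<mu>(i := m)) y = of_real (R * herm1 m (y $ i))"
    using hermite_fun_update[of i x \<mu>] by blast
  have 0: "hermite_fun \<mu> x = of_real (R * herm1 (\<mu> i) (x $ i))"
    using R[of x "\<mu> i"] by simp
  have "x $ i * (R * herm1 (\<mu> i) (x $ i)) = R * (x $ i * herm1 (\<mu> i) (x $ i))" by simp
  also have "... = rt2 (Suc (\<mu> i)) * (R * herm1 (Suc (\<mu> i)) (x $ i)) + rt2 (\<mu> i) * (R * herm1 (\<mu> i - 1) (x $ i))"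
    unfolding herm1_times by (simp add: distrib_left add.commute)
  finally show ?thesis
    unfolding 0 R[OF allI[OF impI[OF refl]]] of_real_mult[symmetric] of_real_add[symmetric] by (simp only:)
qed

lemma smooth_fun_nherm: "smooth_fun (\<lambda>x. of_real (nherm k (x $ i)))"
proof -
  have "smooth_fun (\<lambda>x. of_real (hermite k (x $ i)))"
  proof (induction k rule: induct_nat_012)
    case 0
    show ?case by simp
  next
    case 1
    show ?case using smooth_fun_mult[OF smooth_fun_const[of 2] smooth_fun_coord[of i]] by simp
  next
    case (ge2 k)
    have "smooth_fun (\<lambda>x. (2 * of_real (x $ i)) * of_real (hermite (Suc k) (x $ i))
        + (- 2 * of_nat (Suc k)) * of_real (hermite k (x $ i)))"
      by (rule smooth_fun_add[OF smooth_fun_mult[OF smooth_fun_mult[OF smooth_fun_const smooth_fun_coord] ge2(2)]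
            smooth_fun_mult[OF smooth_fun_const ge2(1)]])
    then show ?case by (simp add: algebra_simps)
  qed
  from smooth_fun_mult[OF smooth_fun_const[of "of_real (1 / sqrt (2 ^ k * fact k))"] this]
  show ?thesis by (simp add: nherm_def)
qed

lemma smooth_fun_sqrt_gauss: "smooth_fun (\<lambda>x::real^'n::finite. of_real (sqrt (gauss x)))"
  using smooth_fun_exp_norm_sq[of "pi powr (- real CARD('n) / 4)" "- 1 / 2"] by (simp add: sqrt_gauss)

lemma smooth_fun_hermite_fun: "smooth_fun (hermite_fun \<mu>)"
proof -
  have "smooth_fun (\<lambda>x. of_real (sqrt (gauss x)) * (\<Prod>i\<in>UNIV. of_real (nherm (\<mu> i) (x $ i))))"
    by (rule smooth_fun_mult[OF smooth_fun_sqrt_gauss smooth_fun_prod[OF smooth_fun_nherm]])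
  then show ?thesis by (simp add: hermite_fun_def[abs_def] Herm_def nherm_def)
qed

lemma pderiv_at_line:
  assumes "f differentiable (at x)" "((\<lambda>t. f (x + t *\<^sub>R axis i 1)) has_vector_derivative v) (at 0)"
  shows "pderiv_at i f x = v"
proof -
  have 1: "(f has_derivative frechet_derivative f (at x)) (at (x + 0 *\<^sub>R axis i 1))"
    using assms(1) frechet_derivative_works[of f "at x"] by simp
  have "((\<lambda>t. x + t *\<^sub>R axis i 1) has_derivative (\<lambda>h. h *\<^sub>R axis i 1)) (at 0)"
    by (auto intro!: derivative_eq_intros)
  from has_derivative_compose[OF this 1]
  have "((\<lambda>t. f (x + t *\<^sub>R axis i 1)) has_vector_derivative pderiv_at i f x) (at 0)"
    unfolding has_vector_derivative_def
    using linear_scale[OF has_derivative_linear[OF 1]] by (simp add: pderiv_at_def)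
  then show ?thesis using vector_derivative_unique_at assms(2) by blast
qed

lemma pderiv_at_hermite_fun:
  "pderiv_at i (hermite_fun \<mu>) x
    = of_real (rt2 (\<mu> i)) * hermite_fun (mi_lower \<mu> i) x
      - of_real (rt2 (Suc (\<mu> i))) * hermite_fun (mi_raise \<mu> i) x"
proof (rule pderiv_at_line)
  show "hermite_fun \<mu> differentiable at x" by (rule smooth_fun_differentiable[OF smooth_fun_hermite_fun])
  obtain R where R: "\<And>m y. (\<forall>j. j \<noteq> i --> y $ j = x $ j) ==> hermite_fun (\<mu>(i := m)) y = of_real (R * herm1 m (y $ i))"
    using hermite_fun_update[of i x \<mu>] by blast
  have line: "hermite_fun \<mu> (x + t *\<^sub>R axis i 1) = of_real (R * herm1 (\<mu> i) (x $ i + t))" for t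
    using R[of "x + t *\<^sub>R axis i 1" "\<mu> i"] by (simp add: axis_def)
  have "((\<lambda>t. x $ i + t) has_real_derivative 1) (at 0)" by (auto intro!: derivative_eq_intros)
  from DERIV_chain2[OF herm1_deriv this]
  have "((\<lambda>t. herm1 (\<mu> i) (x $ i + t)) has_real_derivative dherm1 (\<mu> i) (x $ i)) (at 0)" by simp
  then have "((\<lambda>t. R * herm1 (\<mu> i) (x $ i + t)) has_real_derivative R * dherm1 (\<mu> i) (x $ i)) (at 0)"
    by (rule DERIV_cmult)
  then have "((\<lambda>t. hermite_fun \<mu> (x + t *\<^sub>R axis i 1)) has_vector_derivative of_real (R * dherm1 (\<mu> i) (x $ i))) (at 0)"
    unfolding line by (rule has_vector_derivative_of_real)
  moreover have "of_real (R * dherm1 (\<mu> i) (x $ i)) = of_real (rt2 (\<mu> i)) * hermite_fun (mi_lower \<mu> i) x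
      - of_real (rt2 (Suc (\<mu> i))) * hermite_fun (mi_raise \<mu> i) x"
    unfolding R[OF allI[OF impI[OF refl]]] of_real_mult[symmetric] of_real_diff[symmetric]
    by (simp add: dherm1_def algebra_simps)
  ultimately show "((\<lambda>t. hermite_fun \<mu> (x + t *\<^sub>R axis i 1)) has_vector_derivative
      of_real (rt2 (\<mu> i)) * hermite_fun (mi_lower \<mu> i) x
      - of_real (rt2 (Suc (\<mu> i))) * hermite_fun (mi_raise \<mu> i) x) (at 0)"
    by (simp only:)
qed

lemma hermite_fun_bound:
  "cmod (hermite_fun \<mu> (x::real^'n::finite)) <= (4 * real (mi_size \<mu>) + 2) ^ CARD('n)"
proof -
  have "cmod (hermite_fun \<mu> x) = pi powr (- real CARD('n) / 4) * (\<Prod>i\<in>UNIV. \<bar>herm1 (\<mu> i) (x $ i)\<bar>)"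
    unfolding hermite_fun_prod norm_of_real by (simp add: abs_mult abs_prod)
  also have "... <= 1 * (\<Prod>i\<in>(UNIV::'n set). 4 * real (mi_size \<mu>) + 2)"
  proof (intro mult_mono prod_mono prod_nonneg)
    have "pi powr (- real CARD('n) / 4) <= pi powr 0" by (rule powr_mono) (use pi_ge_two in auto)
    then show "pi powr (- real CARD('n) / 4) <= 1" by simp
    show "0 <= \<bar>herm1 (\<mu> i) (x $ i)\<bar> \<and> \<bar>herm1 (\<mu> i) (x $ i)\<bar> <= 4 * real (mi_size \<mu>) + 2" for i
      using herm1_bound[of "\<mu> i" "x $ i"] of_nat_mono[OF mi_component_le[of \<mu> i], where 'a=real]
      by (intro conjI abs_ge_zero) linarith
  qed auto
  finally show ?thesis by simp
qed

text \<open>The span of the Hermite functions is closed under coordinates and derivatives by the ladder relations, so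
  boundedness of the single Hermite functions already makes all its members Schwartz functions.\<close>

inductive_set hspan :: "(real^'n::finite => complex) set" where
  base: "hermite_fun \<mu> \<in> hspan"
| lin: "f \<in> hspan ==> g \<in> hspan ==> (\<lambda>x. a * f x + b * g x) \<in> hspan"

lemma hspan_smooth: "f \<in> hspan ==> smooth_fun f"
proof (induction rule: hspan.induct)
  case (lin f g a b)
  show ?case
    by (rule smooth_fun_add[OF smooth_fun_mult[OF smooth_fun_const lin.IH(1)] smooth_fun_mult[OF smooth_fun_const lin.IH(2)]])
qed (rule smooth_fun_hermite_fun)

lemma hspan_coord: "f \<in> hspan ==> (\<lambda>x. of_real (x $ i) * f x) \<in> hspan"
proof (induction rule: hspan.induct)
  case (base \<mu>)
  show ?case unfolding hermite_fun_coord by (intro hspan.lin hspan.base)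
next
  case (lin f g a b)
  from hspan.lin[OF lin.IH, of a b] show ?case by (simp add: algebra_simps)
qed

lemma hspan_pderiv_at: "f \<in> hspan ==> pderiv_at i f \<in> hspan"
proof (induction rule: hspan.induct)
  case (base \<mu>)
  have "pderiv_at i (hermite_fun \<mu>) = (\<lambda>x. of_real (rt2 (\<mu> i)) * hermite_fun (mi_lower \<mu> i) x
      + (- of_real (rt2 (Suc (\<mu> i)))) * hermite_fun (mi_raise \<mu> i) x)"
    by (simp add: fun_eq_iff pderiv_at_hermite_fun)
  then show ?case by (simp only:) (intro hspan.lin hspan.base)
next
  case (lin f g a b)
  note d = smooth_fun_differentiable[OF hspan_smooth[OF lin.hyps(1)]] smooth_fun_differentiable[OF hspan_smooth[OF lin.hyps(2)]]
  have "pderiv_at i (\<lambda>x. a * f x + b * g x) = (\<lambda>x. a * pderiv_at i f x + b * pderiv_at i g x)"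
    by (rule ext, subst pderiv_at_add) (auto simp: pderiv_at_cmult d intro!: differentiable_mult d)
  then show ?case using hspan.lin[OF lin.IH, of a b] by (simp only:)
qed

lemma weight_step:
  fixes x :: "real^'n::finite"
  assumes "c >= 0"
  shows "(1 + norm x) ^ Suc N * c <= (1 + norm x) ^ N * c + (\<Sum>i\<in>UNIV. (1 + norm x) ^ N * (\<bar>x $ i\<bar> * c))"
proof -
  have "(1 + norm x) ^ Suc N * c <= (1 + norm x) ^ N * ((1 + (\<Sum>i\<in>UNIV. \<bar>x $ i\<bar>)) * c)"
    unfolding power_Suc2 mult.assoc using norm_le_l1_cart[of x] assms by (intro mult_left_mono mult_right_mono) auto
  then show ?thesis by (simp add: distrib_left distrib_right sum_distrib_left sum_distrib_right)
qed

lemma hspan_bounded: "f \<in> hspan ==> \<exists>C. \<forall>x. (1 + norm x) ^ N * cmod (f x) <= C"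
proof (induction N arbitrary: f)
  case 0
  then show ?case
  proof (induction rule: hspan.induct)
    case (base \<mu>)
    show ?case using hermite_fun_bound[of \<mu>] by (auto intro!: exI[of _ "(4 * real (mi_size \<mu>) + 2) ^ CARD('a)"])
  next
    case (lin f g a b)
    then obtain C D where "\<And>x. cmod (f x) <= C" "\<And>x. cmod (g x) <= D" by auto
    then have "cmod (a * f x + b * g x) <= cmod a * C + cmod b * D" for x
      by (intro order_trans[OF norm_triangle_ineq] add_mono) (auto simp: norm_mult mult_left_mono)
    then show ?case by auto
  qed
next
  case (Suc N)
  obtain C where C: "\<And>x. (1 + norm x) ^ N * cmod (f x) <= C" using Suc.IH[OF Suc.prems] by blast
  have "\<forall>i. \<exists>D. \<forall>x. (1 + norm x) ^ N * cmod (of_real (x $ i) * f x) <= D"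
    using Suc.IH[OF hspan_coord[OF Suc.prems]] by blast
  from choice[OF this] obtain D where D: "\<And>i x. (1 + norm x) ^ N * (\<bar>x $ i\<bar> * cmod (f x)) <= D i"
    by (auto simp: norm_mult)
  have "(1 + norm x) ^ Suc N * cmod (f x) <= C + (\<Sum>i\<in>UNIV. D i)" for x
    by (rule order_trans[OF weight_step]) (intro norm_ge_zero, intro add_mono sum_mono C D)
  then show ?case by blast
qed

lemma hspan_pderivs: "f \<in> hspan ==> pderivs is f \<in> hspan"
  by (induction "is") (auto intro: hspan_pderiv_at)

lemma hspan_schwartz: "f \<in> hspan ==> f \<in> schwartz_funs"
  by (intro schwartz_funsI hspan_smooth hspan_bounded hspan_pderivs)

lemma hermite_fun_schwartz: "hermite_fun \<mu> \<in> schwartz_funs"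
  by (rule hspan_schwartz[OF hspan.base])

section \<open>Hermite coefficients\<close>

definition herm_coeff :: "(real^'n::finite => complex) => ('n => nat) => complex" where
  "herm_coeff \<phi> \<mu> = (LINT x|lebesgue. \<phi> x * hermite_fun \<mu> x)"

lemma rapid_hermite_integrable: "rapid \<phi> ==> integrable lebesgue (\<lambda>x. \<phi> x * hermite_fun \<mu> x)"
  by (rule schwartz_mult_integrable[OF _ hermite_fun_schwartz])

lemma herm_coeff_coord:
  assumes "rapid \<phi>"
  shows "herm_coeff (\<lambda>x. of_real (x $ i) * \<phi> x) \<mu>
    = of_real (rt2 (Suc (\<mu> i))) * herm_coeff \<phi> (mi_raise \<mu> i)
      + of_real (rt2 (\<mu> i)) * herm_coeff \<phi> (mi_lower \<mu> i)"
proof -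
  have "of_real (x $ i) * \<phi> x * hermite_fun \<mu> x
      = of_real (rt2 (Suc (\<mu> i))) * (\<phi> x * hermite_fun (mi_raise \<mu> i) x)
        + of_real (rt2 (\<mu> i)) * (\<phi> x * hermite_fun (mi_lower \<mu> i) x)" for x
  proof -
    have "of_real (x $ i) * \<phi> x * hermite_fun \<mu> x = \<phi> x * (of_real (x $ i) * hermite_fun \<mu> x)" by simp
    then show ?thesis unfolding hermite_fun_coord by (simp only: distrib_left mult.left_commute)
  qed
  then show ?thesis
    unfolding herm_coeff_def
    by (simp add: rapid_hermite_integrable[OF assms])
qed

lemma herm_coeff_pderiv_at:
  assumes "\<phi> \<in> schwartz_funs"
  shows "herm_coeff (pderiv_at i \<phi>) \<mu>
    = of_real (rt2 (Suc (\<mu> i))) * herm_coeff \<phi> (mi_raise \<mu> i)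
      - of_real (rt2 (\<mu> i)) * herm_coeff \<phi> (mi_lower \<mu> i)"
proof -
  have "\<phi> x * pderiv_at i (hermite_fun \<mu>) x
      = of_real (rt2 (\<mu> i)) * (\<phi> x * hermite_fun (mi_lower \<mu> i) x)
        - of_real (rt2 (Suc (\<mu> i))) * (\<phi> x * hermite_fun (mi_raise \<mu> i) x)" for x
    unfolding pderiv_at_hermite_fun by (simp only: right_diff_distrib mult.left_commute)
  then show ?thesis
    unfolding herm_coeff_def integration_by_parts[OF assms hermite_fun_schwartz]
    by (simp add: rapid_hermite_integrable[OF schwartz_rapid[OF assms]])
qed

lemma herm_coeff_add:
  "rapid f ==> rapid g ==> herm_coeff (\<lambda>x. f x + g x) \<mu> = herm_coeff f \<mu> + herm_coeff g \<mu>"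
  unfolding herm_coeff_def distrib_right by (simp add: rapid_hermite_integrable)

lemma herm_coeff_cmult: "herm_coeff (\<lambda>x. c * f x) \<mu> = c * herm_coeff f \<mu>"
  unfolding herm_coeff_def by (simp add: mult.assoc)

lemma herm_coeff_diff:
  "rapid f ==> rapid g ==> herm_coeff (\<lambda>x. f x - g x) \<mu> = herm_coeff f \<mu> - herm_coeff g \<mu>"
  unfolding herm_coeff_def left_diff_distrib by (simp add: rapid_hermite_integrable)

lemma rapid_sum:
  assumes "finite A" "\<And>a. a \<in> A ==> rapid (F a)" shows "rapid (\<lambda>x. \<Sum>a\<in>A. F a x)"
  using assms
proof (induction A rule: finite_induct)
  case empty
  show ?case using schwartz_rapid[OF schwartz_zero] by simp
next
  case (insert a A)
  have "rapid (\<lambda>x. f x + g x)" if f: "rapid f" and g: "rapid g" for f g :: "real^'b => complex"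
    unfolding rapid_def
  proof (intro conjI allI)
    show "continuous_on UNIV (\<lambda>x. f x + g x)" by (intro continuous_intros rapid_continuous f g)
    fix N
    obtain C D where "\<And>x. (1 + norm x) ^ N * cmod (f x) <= C" "\<And>x. (1 + norm x) ^ N * cmod (g x) <= D"
      using rapid_bound[OF f] rapid_bound[OF g] by metis
    then have "(1 + norm x) ^ N * cmod (f x + g x) <= C + D" for x
      by (intro order_trans[OF mult_left_mono[OF norm_triangle_ineq]]) (auto simp: distrib_left add_mono)
    then show "\<exists>C. \<forall>x. (1 + norm x) ^ N * cmod (f x + g x) <= C" by blast
  qed
  from this[of "F a" "\<lambda>x. \<Sum>a\<in>A. F a x"] show ?case using insert by simp
qed

lemma herm_coeff_sum:
  assumes "finite A" "\<And>a. a \<in> A ==> rapid (F a)"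
  shows "herm_coeff (\<lambda>x. \<Sum>a\<in>A. F a x) \<mu> = (\<Sum>a\<in>A. herm_coeff (F a) \<mu>)"
  unfolding herm_coeff_def sum_distrib_right
  by (rule Bochner_Integration.integral_sum) (use assms rapid_hermite_integrable in auto)

definition harm_osc :: "(real^'n::finite => complex) => real^'n => complex" where
  "harm_osc \<phi> x = (\<Sum>i\<in>UNIV. of_real (x $ i) * (of_real (x $ i) * \<phi> x)
      - pderiv_at i (pderiv_at i \<phi>) x)"

lemma harm_osc_schwartz: "\<phi> \<in> schwartz_funs ==> harm_osc \<phi> \<in> schwartz_funs"
  unfolding harm_osc_def[abs_def]
  by (rule schwartz_sum, rule schwartz_diff) (auto intro!: schwartz_coord schwartz_pderiv_at)

text \<open>Integration by parts moves the ladder operators to the Hermite functions, so the eigenvalue appears for every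
  Schwartz function.\<close>

lemma herm_coeff_harm_osc:
  fixes \<phi> :: "real^'n::finite => complex"
  assumes "\<phi> \<in> schwartz_funs"
  shows "herm_coeff (harm_osc \<phi>) \<mu> = of_real (2 * real (mi_size \<mu>) + real CARD('n)) * herm_coeff \<phi> \<mu>"
proof -
  have trm: "herm_coeff (\<lambda>x. of_real (x $ i) * (of_real (x $ i) * \<phi> x) - pderiv_at i (pderiv_at i \<phi>) x) \<mu>
      = of_real (2 * real (\<mu> i) + 1) * herm_coeff \<phi> \<mu>" for i
  proof -
    let ?u = "herm_coeff \<phi>"
    let ?r = "\<lambda>m. complex_of_real (rt2 m)"
    have S: "(\<lambda>x. of_real (x $ i) * \<phi> x) \<in> schwartz_funs" "pderiv_at i \<phi> \<in> schwartz_funs"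
      using assms by (auto intro: schwartz_coord schwartz_pderiv_at)
    have sq: "?r m * (?r m * z) = of_nat m / 2 * z" for m z
    proof -
      have "?r m * (?r m * z) = of_real (rt2 m * rt2 m) * z" unfolding of_real_mult by (simp only: mult.assoc)
      then show ?thesis by simp
    qed
    have x: "herm_coeff (\<lambda>x. of_real (x $ i) * (of_real (x $ i) * \<phi> x)) \<mu>
        = ?r (Suc (\<mu> i)) * (?r (Suc (Suc (\<mu> i))) * ?u (\<mu>(i := Suc (Suc (\<mu> i)))) + ?r (Suc (\<mu> i)) * ?u \<mu>)
          + ?r (\<mu> i) * (?r (Suc (\<mu> i - 1)) * ?u (\<mu>(i := Suc (\<mu> i - 1))) + ?r (\<mu> i - 1) * ?u (\<mu>(i := \<mu> i - 1 - 1)))"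
      by (simp add: herm_coeff_coord[OF schwartz_rapid[OF S(1)]] herm_coeff_coord[OF schwartz_rapid[OF assms]])
    have d: "herm_coeff (pderiv_at i (pderiv_at i \<phi>)) \<mu>
        = ?r (Suc (\<mu> i)) * (?r (Suc (Suc (\<mu> i))) * ?u (\<mu>(i := Suc (Suc (\<mu> i)))) - ?r (Suc (\<mu> i)) * ?u \<mu>)
          - ?r (\<mu> i) * (?r (Suc (\<mu> i - 1)) * ?u (\<mu>(i := Suc (\<mu> i - 1))) - ?r (\<mu> i - 1) * ?u (\<mu>(i := \<mu> i - 1 - 1)))"
      by (simp add: herm_coeff_pderiv_at[OF S(2)] herm_coeff_pderiv_at[OF assms])
    have low: "?r (\<mu> i) * (?r (Suc (\<mu> i - 1)) * ?u (\<mu>(i := Suc (\<mu> i - 1)))) = of_nat (\<mu> i) / 2 * ?u \<mu>"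
    proof (cases "\<mu> i = 0")
      case False
      then have "Suc (\<mu> i - 1) = \<mu> i" by simp
      then show ?thesis using sq by (simp only: fun_upd_triv)
    qed simp
    have "herm_coeff (\<lambda>x. of_real (x $ i) * (of_real (x $ i) * \<phi> x)) \<mu>
        - herm_coeff (pderiv_at i (pderiv_at i \<phi>)) \<mu>
        = 2 * (?r (Suc (\<mu> i)) * (?r (Suc (\<mu> i)) * ?u \<mu>))
          + 2 * (?r (\<mu> i) * (?r (Suc (\<mu> i - 1)) * ?u (\<mu>(i := Suc (\<mu> i - 1)))))"
      unfolding x d by (simp only: distrib_left right_diff_distrib) simp
    also have "... = of_real (2 * real (\<mu> i) + 1) * ?u \<mu>"
      unfolding sq low by (simp add: algebra_simps)
    finally show ?thesis
      using herm_coeff_diff[of "\<lambda>x. of_real (x $ i) * (of_real (x $ i) * \<phi> x)" "pderiv_at i (pderiv_at i \<phi>)"]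
      by (simp add: schwartz_rapid[OF schwartz_coord[OF S(1)]] schwartz_rapid[OF schwartz_pderiv_at[OF S(2)]])
  qed
  have "herm_coeff (harm_osc \<phi>) \<mu> = (\<Sum>i\<in>UNIV. of_real (2 * real (\<mu> i) + 1) * herm_coeff \<phi> \<mu>)"
    unfolding harm_osc_def[abs_def] trm[symmetric]
    by (rule herm_coeff_sum) (auto intro!: schwartz_rapid schwartz_diff schwartz_coord schwartz_pderiv_at assms)
  also have "... = of_real (\<Sum>i\<in>UNIV. 2 * real (\<mu> i) + 1) * herm_coeff \<phi> \<mu>"
    by (simp add: sum_distrib_right)
  also have "(\<Sum>i\<in>UNIV. 2 * real (\<mu> i) + 1) = 2 * real (mi_size \<mu>) + real CARD('n)"
    by (simp add: sum.distrib sum_distrib_left)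
  finally show ?thesis .
qed

text \<open>Both sides pair the derivative plus the coordinate with a Hermite function.\<close>

lemma herm_coeff_raise_lower:
  "of_real (rt2 (Suc (\<mu> i))) * herm_coeff (hermite_fun \<beta>) (mi_raise \<mu> i)
    = of_real (rt2 (\<beta> i)) * herm_coeff (hermite_fun (mi_lower \<beta> i)) \<mu>"
proof -
  let ?f = "hermite_fun \<beta>"
  note R = schwartz_rapid[OF hermite_fun_schwartz[of \<beta>]]
  have "2 * (of_real (rt2 (Suc (\<mu> i))) * herm_coeff ?f (mi_raise \<mu> i))
      = herm_coeff (\<lambda>x. of_real (x $ i) * ?f x) \<mu> + herm_coeff (pderiv_at i ?f) \<mu>"
    unfolding herm_coeff_coord[OF R] herm_coeff_pderiv_at[OF hermite_fun_schwartz] by simp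
  also have "... = herm_coeff (\<lambda>x. of_real (x $ i) * ?f x + pderiv_at i ?f x) \<mu>"
    by (rule herm_coeff_add[symmetric])
      (auto intro!: schwartz_rapid schwartz_coord schwartz_pderiv_at hermite_fun_schwartz)
  also have "(\<lambda>x. of_real (x $ i) * ?f x + pderiv_at i ?f x)
      = (\<lambda>x. (2 * of_real (rt2 (\<beta> i))) * hermite_fun (mi_lower \<beta> i) x)"
    by (rule ext) (simp add: hermite_fun_coord pderiv_at_hermite_fun mult.assoc)
  finally have "2 * (of_real (rt2 (Suc (\<mu> i))) * herm_coeff ?f (mi_raise \<mu> i))
      = 2 * (of_real (rt2 (\<beta> i)) * herm_coeff (hermite_fun (mi_lower \<beta> i)) \<mu>)"
    unfolding herm_coeff_cmult mult.assoc .
  then show ?thesis by (rule mult_left_cancel[THEN iffD1, rotated]) simp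
qed

lemma herm_coeff_sym: "herm_coeff (hermite_fun \<beta>) \<mu> = herm_coeff (hermite_fun \<mu>) \<beta>"
  by (simp add: herm_coeff_def mult.commute)

text \<open>Induction on \<open>|\<mu>|\<close>: raising one index lowers the other, down to the Gaussian.\<close>

theorem hermite_fun_orthonormal:
  "herm_coeff (hermite_fun \<beta>) \<mu> = (if \<mu> = \<beta> then 1 else 0)"
proof (induction "mi_size \<mu>" arbitrary: \<mu> \<beta>)
  case 0
  then have \<mu>: "\<mu> = (\<lambda>_. 0)" by (auto simp: fun_eq_iff)
  show ?case
  proof (cases "\<beta> = \<mu>")
    case True
    have "hermite_fun \<mu> x * hermite_fun \<mu> x = of_real (gauss x)" for x :: "real^'a"
    proof -
      have "sqrt (gauss x) * sqrt (gauss x) = gauss x" by (simp add: gauss_def)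
      then show ?thesis by (simp add: \<mu> hermite_fun_def Herm_def flip: of_real_mult)
    qed
    then have "herm_coeff (hermite_fun \<mu>) \<mu> = of_real (LINT x|lebesgue. gauss (x::real^'a))"
      by (simp add: herm_coeff_def)
    then show ?thesis using True by (simp add: integral_gauss)
  next
    case False
    then obtain i where "\<beta> i \<noteq> 0" unfolding \<mu> by (auto simp: fun_eq_iff)
    then have "mi_raise (mi_lower \<beta> i) i = \<beta>" by auto
    with herm_coeff_raise_lower[of "mi_lower \<beta> i" i \<mu>] \<open>\<beta> i \<noteq> 0\<close>
    have "herm_coeff (hermite_fun \<mu>) \<beta> = 0" by (simp add: \<mu>)
    then show ?thesis using False herm_coeff_sym[of \<beta> \<mu>] by auto
  qed
next
  case (Suc k)
  then obtain i where i: "\<mu> i \<noteq> 0" by (metis Zero_not_Suc sum.neutral)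
  define \<gamma> where "\<gamma> = mi_lower \<mu> i"
  have \<gamma>: "mi_raise \<gamma> i = \<mu>" "Suc (\<gamma> i) = \<mu> i" using i by (auto simp: \<gamma>_def)
  have k: "k = mi_size \<gamma>" using mi_size_lower[of \<mu> i] i Suc(2) by (simp add: \<gamma>_def)
  have "of_real (rt2 (\<mu> i)) * herm_coeff (hermite_fun \<beta>) \<mu>
      = of_real (rt2 (\<beta> i)) * (if \<gamma> = mi_lower \<beta> i then 1 else 0)"
    using herm_coeff_raise_lower[of \<gamma> i \<beta>] Suc(1)[OF k, of "mi_lower \<beta> i"] \<gamma> by simp
  also have "... = of_real (rt2 (\<mu> i)) * (if \<mu> = \<beta> then 1 else 0)"
  proof (cases "\<mu> = \<beta>")
    case True
    then show ?thesis by (simp add: \<gamma>_def)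
  next
    case False
    have "\<beta> i = 0" if "\<gamma> = mi_lower \<beta> i"
    proof (rule ccontr)
      assume "\<beta> i \<noteq> 0"
      then have "mi_raise (mi_lower \<beta> i) i = \<beta>" by auto
      then show False using that \<gamma>(1) False by simp
    qed
    then show ?thesis using False by auto
  qed
  finally show ?case using i by simp
qed


section \<open>Completeness of the Hermite functions\<close>

lemma real_polynomial_function_bound:
  assumes "real_polynomial_function (p :: real^'n::finite => real)"
  shows "\<exists>B M. B >= 0 \<and> (\<forall>x. \<bar>p x\<bar> <= B * (1 + norm x) ^ M)"
  using assms
proof (induction rule: real_polynomial_function.induct)
  case (linear f)
  obtain K where K: "\<And>x. norm (f x) <= norm x * K" "K > 0" using bounded_linear.pos_bounded[OF linear] by blast
  have "\<bar>f x\<bar> <= K * (1 + norm x) ^ 1" for x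
    using K(1)[of x] K(2) by (simp add: distrib_left mult.commute)
  then show ?case using K(2) by (intro exI[of _ K] exI[of _ 1]) auto
next
  case (const c)
  show ?case by (intro exI[of _ "\<bar>c\<bar>"] exI[of _ 0]) auto
next
  case (add f g)
  then obtain B M B' M' where 1: "B >= 0" "\<And>x. \<bar>f x\<bar> <= B * (1 + norm x) ^ M" "B' >= 0" "\<And>x. \<bar>g x\<bar> <= B' * (1 + norm x) ^ M'"
    by blast
  have "\<bar>f x + g x\<bar> <= (B + B') * (1 + norm x) ^ (M + M')" for x
  proof -
    have "\<bar>f x\<bar> <= B * (1 + norm x) ^ (M + M')"
      by (rule order_trans[OF 1(2)]) (intro mult_left_mono power_increasing, use 1 in auto)
    moreover have "\<bar>g x\<bar> <= B' * (1 + norm x) ^ (M + M')"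
      by (rule order_trans[OF 1(4)]) (intro mult_left_mono power_increasing, use 1 in auto)
    ultimately show ?thesis using abs_triangle_ineq[of "f x" "g x"] unfolding distrib_right by linarith
  qed
  then show ?case using 1 by (intro exI[of _ "B + B'"] exI[of _ "M + M'"]) auto
next
  case (mult f g)
  then obtain B M B' M' where 1: "B >= 0" "\<And>x. \<bar>f x\<bar> <= B * (1 + norm x) ^ M" "B' >= 0" "\<And>x. \<bar>g x\<bar> <= B' * (1 + norm x) ^ M'"
    by blast
  have "\<bar>f x * g x\<bar> <= (B * B') * (1 + norm x) ^ (M + M')" for x
  proof -
    have "\<bar>f x * g x\<bar> <= (B * (1 + norm x) ^ M) * (B' * (1 + norm x) ^ M')"
      unfolding abs_mult using 1 by (intro mult_mono) auto
    then show ?thesis by (simp add: power_add mult_ac)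
  qed
  then show ?case using 1 by (intro exI[of _ "B * B'"] exI[of _ "M + M'"]) auto
qed

lemma hspan_zero: "(\<lambda>x. 0) \<in> hspan"
  using hspan.lin[OF hspan.base[of "\<lambda>_. 0"] hspan.base[of "\<lambda>_. 0"], of 0 0] by simp

lemma hspan_add: "f \<in> hspan ==> g \<in> hspan ==> (\<lambda>x. f x + g x) \<in> hspan"
  using hspan.lin[of f g 1 1] by simp

lemma hspan_cmult: "f \<in> hspan ==> (\<lambda>x. c * f x) \<in> hspan"
  using hspan.lin[of f f c 0] by simp

lemma hspan_sum: "(\<And>a. a \<in> A ==> F a \<in> hspan) ==> (\<lambda>x. \<Sum>a\<in>A. F a x) \<in> hspan"
  by (induction A rule: infinite_finite_induct) (auto intro!: hspan_add simp: hspan_zero)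

lemma hspan_polynomial:
  fixes p :: "real^'n::finite => real"
  assumes "real_polynomial_function p" "f \<in> hspan"
  shows "(\<lambda>x. of_real (p x) * f x) \<in> hspan"
  using assms
proof (induction arbitrary: f rule: real_polynomial_function.induct)
  case (linear l)
  have l: "l x = (\<Sum>i\<in>UNIV. l (axis i 1) * x $ i)" for x
  proof -
    have "l x = l (\<Sum>i\<in>UNIV. x $ i *\<^sub>R axis i 1)" using basis_expansion[of x] by (simp add: scalar_mult_eq_scaleR)
    also have "... = (\<Sum>i\<in>UNIV. l (x $ i *\<^sub>R axis i 1))"
      by (rule linear_sum[OF bounded_linear.linear[OF linear.hyps]])
    also have "... = (\<Sum>i\<in>UNIV. l (axis i 1) * x $ i)"
      by (rule sum.cong) (auto simp: linear_scale[OF bounded_linear.linear[OF linear.hyps]])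
    finally show ?thesis .
  qed
  have "(\<lambda>x. of_real (l x) * f x)
      = (\<lambda>x. \<Sum>i\<in>UNIV. of_real (l (axis i 1)) * (of_real (x $ i) * f x))"
    by (rule ext, subst l) (simp only: of_real_sum of_real_mult sum_distrib_right mult.assoc)
  also have "... \<in> hspan" by (intro hspan_sum hspan_cmult hspan_coord linear.prems)
  finally show ?case .
next
  case (const c)
  then show ?case by (intro hspan_cmult)
next
  case (add p q)
  show ?case using hspan_add[OF add.IH(1)[OF add.prems] add.IH(2)[OF add.prems]] by (simp add: distrib_right)
next
  case (mult p q)
  show ?case using mult.IH(1)[OF mult.IH(2)[OF mult.prems]] by (simp add: mult.assoc)
qed

text \<open>\<open>\<eta>\<close> is orthogonal to all polynomials times the weight. Vanishing Hermite coefficients give this for a Gaussian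
  weight, and the aim is to reach arbitrarily narrow Gaussians with arbitrary centres.\<close>

definition annihilates :: "(real^'n::finite => complex) => (real^'n => real) => bool" where
  "annihilates \<eta> w \<longleftrightarrow>
     (\<forall>p. real_polynomial_function p --> (LINT x|lebesgue. \<eta> x * of_real (p x * w x)) = 0)"

lemma annihilates_gaussian:
  assumes \<eta>: "rapid \<eta>" and z: "\<And>\<mu>. herm_coeff \<eta> \<mu> = 0"
  shows "annihilates \<eta> (\<lambda>x::real^'n::finite. exp (- (norm x)\<^sup>2 / 2))"
  unfolding annihilates_def
proof (intro allI impI)
  fix p :: "real^'n => real" assume p: "real_polynomial_function p"
  have z': "(LINT x|lebesgue. \<eta> x * f x) = 0" if "f \<in> hspan" for f
    using that
  proof (induction rule: hspan.induct)
    case (base \<mu>)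
    show ?case using z[of \<mu>] by (simp add: herm_coeff_def)
  next
    case (lin f g a b)
    have int: "integrable lebesgue (\<lambda>x. \<eta> x * f x)" if "f \<in> hspan" for f
      by (rule schwartz_mult_integrable[OF \<eta> hspan_schwartz[OF that]])
    have "(\<lambda>x. \<eta> x * (a * f x + b * g x)) = (\<lambda>x. a * (\<eta> x * f x) + b * (\<eta> x * g x))"
      by (simp add: fun_eq_iff algebra_simps)
    then show ?case using int[OF lin.hyps(1)] int[OF lin.hyps(2)] lin.IH by simp
  qed
  define K where "K = pi powr (- real CARD('n) / 4)"
  have "K \<noteq> 0" by (simp add: K_def)
  have "hermite_fun (\<lambda>_. 0) x = of_real (K * exp (- (norm x)\<^sup>2 / 2))" for x :: "real^'n"
    by (simp add: hermite_fun_def sqrt_gauss Herm_def K_def)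
  then have "\<eta> x * of_real (p x * exp (- (norm x)\<^sup>2 / 2))
      = \<eta> x * (of_real (1 / K) * (of_real (p x) * hermite_fun (\<lambda>_. 0) x))" for x
    using \<open>K \<noteq> 0\<close> by simp
  then show "(LINT x|lebesgue. \<eta> x * of_real (p x * exp (- (norm x)\<^sup>2 / 2))) = 0"
    using z'[OF hspan_cmult[OF hspan_polynomial[OF p hspan.base]], of "of_real (1 / K)" "\<lambda>_. 0"]
    by (simp only:)
qed

lemma real_polynomial_function_continuous:
  "real_polynomial_function p ==> continuous_on A p"
  using continuous_real_polymonial_function by (blast intro: continuous_at_imp_continuous_on)

text \<open>Expand the exponential: partial sums are polynomials, and the hypothesis on \<open>B\<close> dominates them. It forces the
  exponent \<open>q\<close> to be at most of the size of that of \<open>w\<close>, hence the doubling below.\<close>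

lemma annihilates_exp_step:
  assumes \<eta>: "rapid \<eta>" and w: "continuous_on UNIV w" "annihilates \<eta> w"
    and q: "real_polynomial_function q" and B: "\<And>x. \<bar>w x\<bar> * exp \<bar>q x\<bar> <= B"
  shows "annihilates \<eta> (\<lambda>x. w x * exp (q x))"
  unfolding annihilates_def
proof (intro allI impI)
  fix p :: "real^'a => real" assume p: "real_polynomial_function p"
  obtain Bp M where Bp: "\<And>x. \<bar>p x\<bar> <= Bp * (1 + norm x) ^ M" using real_polynomial_function_bound[OF p] by blast
  have cont: "continuous_on UNIV \<eta>" "continuous_on UNIV p" "continuous_on UNIV q"
    using rapid_continuous[OF \<eta>] real_polynomial_function_continuous[OF p] real_polynomial_function_continuous[OF q] by auto
  have "rapid (\<lambda>x. \<eta> x * of_real (p x))"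
    by (rule rapid_mult_bounded[OF \<eta>, of _ Bp M]) (use Bp in \<open>auto intro!: continuous_intros cont\<close>)
  then have dom: "integrable lebesgue (\<lambda>x. cmod (\<eta> x * of_real (p x)) * B)"
    by (intro integrable_mult_left integrable_norm rapid_integrable)
  define F where "F N x = \<eta> x * of_real ((p x * (\<Sum>j<N. inverse (fact j) * q x ^ j)) * w x)" for N x
  have poly: "real_polynomial_function (\<lambda>x. p x * (\<Sum>j<N. inverse (fact j) * q x ^ j))" for N
    by (intro real_polynomial_function.intros(4) p real_polynomial_function_sum finite_lessThan
        real_polynomial_function_power q real_polynomial_function.intros(2))
  have F0: "(LINT x|lebesgue. F N x) = 0" for N
    using w(2) poly[of N] unfolding annihilates_def F_def by blast
  have "(\<lambda>N. LINT x|lebesgue. F N x) \<longlonglongrightarrow> (LINT x|lebesgue. \<eta> x * of_real (p x * (w x * exp (q x))))"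
  proof (rule integral_dominated_convergence[OF _ _ dom])
    show "(\<lambda>x. \<eta> x * of_real (p x * (w x * exp (q x)))) \<in> borel_measurable lebesgue"
      by (intro continuous_lebesgue_measurable continuous_intros cont w)
    show "F N \<in> borel_measurable lebesgue" for N
      unfolding F_def by (intro continuous_lebesgue_measurable continuous_intros cont w)
    have es: "(\<lambda>j. inverse (fact j) * q x ^ j) sums exp (q x)" for x
      using exp_converges[of "q x"] by (simp add: scaleR_conv_of_real)
    show "AE x in lebesgue. (\<lambda>N. F N x) \<longlonglongrightarrow> \<eta> x * of_real (p x * (w x * exp (q x)))"
    proof (rule AE_I2)
      fix x
      have "(\<lambda>N. F N x) \<longlonglongrightarrow> \<eta> x * of_real ((p x * exp (q x)) * w x)"
        unfolding F_def by (intro tendsto_intros es[unfolded sums_def])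
      then show "(\<lambda>N. F N x) \<longlonglongrightarrow> \<eta> x * of_real (p x * (w x * exp (q x)))"
        by (simp add: mult_ac)
    qed
    show "AE x in lebesgue. norm (F N x) <= cmod (\<eta> x * of_real (p x)) * B" for N
    proof (rule AE_I2)
      fix x
      have "\<bar>\<Sum>j<N. inverse (fact j) * q x ^ j\<bar> <= (\<Sum>j<N. inverse (fact j) * \<bar>q x\<bar> ^ j)"
        by (rule order_trans[OF sum_abs]) (simp add: abs_mult power_abs)
      also have "... <= exp \<bar>q x\<bar>"
      proof -
        have s: "(\<lambda>j. inverse (fact j) * \<bar>q x\<bar> ^ j) sums exp \<bar>q x\<bar>"
          using exp_converges[of "\<bar>q x\<bar>"] by (simp add: scaleR_conv_of_real)
        show ?thesis
          unfolding sums_unique[OF s] by (rule sum_le_suminf[OF sums_summable[OF s]]) auto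
      qed
      finally have 1: "\<bar>\<Sum>j<N. inverse (fact j) * q x ^ j\<bar> <= exp \<bar>q x\<bar>" .
      have "norm (F N x) = cmod (\<eta> x * of_real (p x)) * (\<bar>\<Sum>j<N. inverse (fact j) * q x ^ j\<bar> * \<bar>w x\<bar>)"
        unfolding F_def norm_mult norm_of_real abs_mult by (simp only: mult.assoc)
      also have "... <= cmod (\<eta> x * of_real (p x)) * (exp \<bar>q x\<bar> * \<bar>w x\<bar>)"
        by (intro mult_left_mono mult_right_mono 1) auto
      also have "... <= cmod (\<eta> x * of_real (p x)) * B"
        using B[of x] by (intro mult_left_mono) (auto simp: mult.commute)
      finally show "norm (F N x) <= cmod (\<eta> x * of_real (p x)) * B" .
    qed
  qed
  then show "(LINT x|lebesgue. \<eta> x * of_real (p x * (w x * exp (q x)))) = 0"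
    unfolding F0 by (simp add: LIMSEQ_const_iff)
qed

lemma real_polynomial_function_norm_sq: "real_polynomial_function (\<lambda>x::real^'n::finite. c * (norm x)^2)"
proof -
  have "(\<lambda>x::real^'n. c * (norm x)^2) = (\<lambda>x. c * (\<Sum>i\<in>UNIV. (x $ i) ^ 2))"
    by (simp add: norm_vec_def L2_set_def real_sqrt_pow2 sum_nonneg)
  moreover have "real_polynomial_function (\<lambda>x::real^'n. c * (\<Sum>i\<in>UNIV. (x $ i) ^ 2))"
    by (intro real_polynomial_function.intros(4) real_polynomial_function.intros(2) real_polynomial_function_sum
        finite_class.finite_UNIV real_polynomial_function_power real_polynomial_function.intros(1) bounded_linear_vec_nth)
  ultimately show ?thesis by simp
qed

lemma annihilates_narrow_gaussian:
  assumes "rapid \<eta>" "\<And>\<mu>. herm_coeff \<eta> \<mu> = 0"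
  shows "annihilates \<eta> (\<lambda>x::real^'n::finite. exp (- (2 ^ j / 2) * (norm x)^2))"
proof (induction j)
  case 0
  show ?case using annihilates_gaussian[OF assms] by simp
next
  case (Suc j)
  have "annihilates \<eta> (\<lambda>x::real^'n. exp (- (2 ^ j / 2) * (norm x)^2) * exp (- (2 ^ j / 2) * (norm x)^2))"
    by (rule annihilates_exp_step[OF assms(1) _ Suc real_polynomial_function_norm_sq, where B=1])
      (auto intro!: continuous_intros simp: abs_mult simp flip: exp_add)
  then show ?case by (simp flip: exp_add)
qed

text \<open>A linear exponent \<open>x \<bullet> y\<close> moves the centre from \<open>0\<close> to \<open>y\<close>.\<close>

lemma gaussian_average_zero:
  fixes \<eta> :: "real^'n::finite => complex"
  assumes "rapid \<eta>" "\<And>\<mu>. herm_coeff \<eta> \<mu> = 0"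
  shows "(LINT x|lebesgue. \<eta> x * of_real (exp (- (2 ^ j / 2) * (norm (x - y))^2))) = 0"
proof -
  define c :: real where "c = 2 ^ j / 2"
  have c: "c > 0" by (simp add: c_def)
  have "annihilates \<eta> (\<lambda>x. exp (- c * (norm x)^2) * exp (2 * c * (x \<bullet> y)))"
  proof (rule annihilates_exp_step[OF assms(1)])
    show "annihilates \<eta> (\<lambda>x. exp (- c * (norm x)^2))"
      unfolding c_def by (rule annihilates_narrow_gaussian[OF assms])
    have "bounded_linear (\<lambda>x::real^'n. 2 * c * (x \<bullet> y))"
      by (intro bounded_linear_const_mult bounded_linear_inner_left)
    then show "real_polynomial_function (\<lambda>x::real^'n. 2 * c * (x \<bullet> y))" by (rule real_polynomial_function.intros(1))
    fix x :: "real^'n"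
    have "0 <= c * (norm x - norm y)^2" using c by simp
    then have "2 * c * (norm x * norm y) <= c * (norm x)^2 + c * (norm y)^2"
      by (simp add: power2_eq_square algebra_simps)
    moreover have "\<bar>2 * c * (x \<bullet> y)\<bar> <= 2 * c * (norm x * norm y)"
      using Cauchy_Schwarz_ineq2[of x y] c by (simp add: abs_mult)
    ultimately have "- c * (norm x)^2 + \<bar>2 * c * (x \<bullet> y)\<bar> <= c * (norm y)^2" by linarith
    then have "exp (- c * (norm x)^2 + \<bar>2 * c * (x \<bullet> y)\<bar>) <= exp (c * (norm y)^2)" by (simp only: exp_le_cancel_iff)
    then show "\<bar>exp (- c * (norm x)^2)\<bar> * exp \<bar>2 * c * (x \<bullet> y)\<bar> <= exp (c * (norm y)^2)"
      by (simp only: exp_add abs_exp_cancel)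
  qed (intro continuous_intros)
  from this[unfolded annihilates_def, rule_format, OF real_polynomial_function.intros(2)[of 1]]
  have 0: "(LINT x|lebesgue. \<eta> x * of_real (exp (- c * (norm x)^2) * exp (2 * c * (x \<bullet> y)))) = 0"
    by (simp only: mult_1)
  have "exp (- c * (norm (x - y))^2) = exp (- c * (norm y)^2) * (exp (- c * (norm x)^2) * exp (2 * c * (x \<bullet> y)))" for x :: "real^'n"
  proof -
    have e: "(norm (x - y))^2 = (norm x)^2 - 2 * (x \<bullet> y) + (norm y)^2"
      by (simp add: power2_norm_eq_inner inner_diff_left inner_diff_right inner_commute)
    have "- c * (norm (x - y))^2 = - c * (norm y)^2 + (- c * (norm x)^2 + 2 * c * (x \<bullet> y))"
      unfolding e by (simp add: algebra_simps)
    then show ?thesis by (simp only: exp_add)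
  qed
  then have "\<eta> x * of_real (exp (- c * (norm (x - y))^2))
      = of_real (exp (- c * (norm y)^2)) * (\<eta> x * of_real (exp (- c * (norm x)^2) * exp (2 * c * (x \<bullet> y))))" for x
    by (simp only: of_real_mult mult.left_commute)
  then show ?thesis using 0 unfolding c_def[symmetric] by (simp only: integral_mult_right_zero mult_zero_right)
qed

lemma lebesgue_integral_affine:
  fixes h :: "real^'n::finite => complex"
  assumes "continuous_on UNIV h" "c > 0"
  shows "(LINT x|lebesgue. h x) = c ^ CARD('n) *\<^sub>R (LINT x|lebesgue. h (y + c *\<^sub>R x))"
proof -
  have m: "h \<in> borel_measurable borel" using assms(1) by (rule borel_measurable_continuous_onI)
  have m2: "(\<lambda>x. h (y + c *\<^sub>R x)) \<in> borel_measurable borel"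
    by (rule borel_measurable_continuous_onI, rule continuous_on_compose2[OF assms(1)]) (auto intro!: continuous_intros)
  have "(LINT x|lebesgue. h x) = (LINT x|density (distr lborel borel (\<lambda>x. y + c *\<^sub>R x)) (\<lambda>_. ennreal (c ^ CARD('n))). h x)"
    using m lborel_affine[of c y] assms(2) by (simp add: integral_completion)
  also have "... = (LINT x|distr lborel borel (\<lambda>x. y + c *\<^sub>R x). c ^ CARD('n) *\<^sub>R h x)"
    using m assms(2) by (intro integral_density) auto
  also have "... = (LINT x|lborel. c ^ CARD('n) *\<^sub>R h (y + c *\<^sub>R x))"
    using m by (intro integral_distr) auto
  also have "... = c ^ CARD('n) *\<^sub>R (LINT x|lebesgue. h (y + c *\<^sub>R x))"
    using m2 by (simp add: integral_completion)
  finally show ?thesis .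
qed

text \<open>The Gaussians around \<open>y\<close> with shrinking width form an approximate identity.\<close>

theorem hermite_complete:
  fixes \<eta> :: "real^'n::finite => complex"
  assumes \<eta>: "rapid \<eta>" and z: "\<And>\<mu>. herm_coeff \<eta> \<mu> = 0"
  shows "\<eta> y = 0"
proof -
  define c where "c j = sqrt (2 / 2 ^ j)" for j :: nat
  have c: "c j > 0" "(c j)^2 = 2 / 2 ^ j" for j by (auto simp: c_def)
  have contc: "continuous_on UNIV (\<lambda>x. \<eta> (y + t *\<^sub>R x))" for t
    by (rule continuous_on_compose2[OF rapid_continuous[OF \<eta>, of UNIV]]) (auto intro!: continuous_intros)
  have gc: "continuous_on UNIV (gauss :: real^'n => real)"
    unfolding gauss_def by (intro continuous_intros)
  have 0: "(LINT x|lebesgue. \<eta> (y + c j *\<^sub>R x) * of_real (gauss (x::real^'n))) = 0" for j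
  proof -
    let ?h = "\<lambda>x. \<eta> x * of_real (exp (- (2 ^ j / 2) * (norm (x - y))^2))"
    have "continuous_on UNIV ?h" by (intro continuous_intros rapid_continuous[OF \<eta>])
    from lebesgue_integral_affine[OF this c(1)[of j], of y] gaussian_average_zero[OF \<eta> z, of j y]
    have "c j ^ CARD('n) *\<^sub>R (LINT x|lebesgue. ?h (y + c j *\<^sub>R x)) = 0" by (simp only:)
    then have "(LINT x|lebesgue. ?h (y + c j *\<^sub>R x)) = 0"
      by (subst (asm) scaleR_eq_0_iff) (use c(1)[of j] in auto)
    moreover have "?h (y + c j *\<^sub>R x) = \<eta> (y + c j *\<^sub>R x) * of_real (exp (- (norm x)\<^sup>2))" for x
    proof -
      have "2 ^ j / 2 * (norm (c j *\<^sub>R x))^2 = 2 ^ j / 2 * (c j)^2 * (norm x)^2"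
        by (simp add: power_mult_distrib)
      also have "... = (norm x)^2" unfolding c(2) by simp
      finally show ?thesis by simp
    qed
    ultimately have "(LINT x|lebesgue. \<eta> (y + c j *\<^sub>R x) * of_real (exp (- (norm x)\<^sup>2))) = 0" by (simp only:)
    moreover have "\<eta> (y + c j *\<^sub>R x) * of_real (gauss x)
        = of_real (pi powr (- real CARD('n) / 2)) * (\<eta> (y + c j *\<^sub>R x) * of_real (exp (- (norm x)\<^sup>2)))" for x
      by (simp add: gauss_def)
    ultimately show ?thesis by (simp only: integral_mult_right_zero mult_zero_right)
  qed
  have clim: "c \<longlonglongrightarrow> 0"
  proof -
    have "(\<lambda>j. sqrt (2 * (1 / 2) ^ j)) \<longlonglongrightarrow> sqrt (2 * 0)"
      by (intro tendsto_real_sqrt tendsto_mult tendsto_const LIMSEQ_power_zero) auto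
    then show ?thesis by (simp add: c_def[abs_def] power_one_over)
  qed
  obtain B where B: "\<And>x. (1 + norm x) ^ 0 * cmod (\<eta> x) <= B" using rapid_bound[OF \<eta>] by blast
  have "(\<lambda>j. LINT x|lebesgue. \<eta> (y + c j *\<^sub>R x) * of_real (gauss x))
      \<longlonglongrightarrow> (LINT x|lebesgue. \<eta> y * of_real (gauss (x::real^'n)))"
  proof (rule integral_dominated_convergence)
    show "integrable lebesgue (\<lambda>x::real^'n. B * gauss x)" using integrable_gauss by (rule integrable_mult_right)
    show "(\<lambda>x::real^'n. \<eta> y * of_real (gauss x)) \<in> borel_measurable lebesgue"
      by (intro continuous_lebesgue_measurable continuous_intros gc)
    show "(\<lambda>x. \<eta> (y + c j *\<^sub>R x) * of_real (gauss x)) \<in> borel_measurable lebesgue" for j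
      by (intro continuous_lebesgue_measurable continuous_intros gc contc)
    show "AE x in lebesgue. (\<lambda>j. \<eta> (y + c j *\<^sub>R x) * of_real (gauss x)) \<longlonglongrightarrow> \<eta> y * of_real (gauss x)"
    proof (rule AE_I2)
      fix x
      have "(\<lambda>j. y + c j *\<^sub>R x) \<longlonglongrightarrow> y + 0 *\<^sub>R x" by (intro tendsto_intros clim)
      then have "(\<lambda>j. \<eta> (y + c j *\<^sub>R x)) \<longlonglongrightarrow> \<eta> y"
        using continuous_on_tendsto_compose[OF rapid_continuous[OF \<eta>, of UNIV]] by auto
      then show "(\<lambda>j. \<eta> (y + c j *\<^sub>R x) * of_real (gauss x)) \<longlonglongrightarrow> \<eta> y * of_real (gauss x)"
        by (intro tendsto_mult tendsto_const)
    qed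
    show "AE x in lebesgue. norm (\<eta> (y + c j *\<^sub>R x) * of_real (gauss x)) <= B * gauss x" for j
    proof (rule AE_I2)
      fix x :: "real^'n"
      have "gauss x >= 0" by (simp add: gauss_def)
      then show "norm (\<eta> (y + c j *\<^sub>R x) * of_real (gauss x)) <= B * gauss x"
        using B[of "y + c j *\<^sub>R x"] by (simp add: norm_mult mult_right_mono)
    qed
  qed
  then have "(LINT x|lebesgue. \<eta> y * of_real (gauss (x::real^'n))) = 0"
    unfolding 0 by (simp add: LIMSEQ_const_iff)
  then show ?thesis by (simp add: integral_gauss)
qed


section \<open>Hermite expansions of Schwartz functions and tempered distributions\<close>

lemma multi_indices_subset: "multi_indices k \<subseteq> (UNIV :: 'n::finite set) \<rightarrow>\<^sub>E {..k}"
proof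
  fix \<mu> :: "'n => nat" assume "\<mu> \<in> multi_indices k"
  then have "\<mu> i <= k" for i using mi_component_le[of \<mu> i] by (simp add: multi_indices_def)
  then show "\<mu> \<in> UNIV \<rightarrow>\<^sub>E {..k}" by auto
qed

lemma finite_multi_indices [simp, intro]: "finite (multi_indices k :: ('n::finite => nat) set)"
  by (rule finite_subset[OF multi_indices_subset]) (rule finite_PiE, auto)

lemma card_multi_indices: "real (card (multi_indices k :: ('n::finite => nat) set)) <= (1 + real k) ^ CARD('n)"
proof -
  have "card (multi_indices k :: ('n => nat) set) <= card ((UNIV :: 'n set) \<rightarrow>\<^sub>E {..k})"
    by (rule card_mono[OF _ multi_indices_subset]) (rule finite_PiE, auto)
  also have "... = Suc k ^ CARD('n)" by (subst card_PiE) auto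
  finally have "real (card (multi_indices k :: ('n => nat) set)) <= real (Suc k ^ CARD('n))" by (rule of_nat_mono)
  then show ?thesis by (simp add: add.commute)
qed

lemma in_multi_indices: "\<mu> \<in> multi_indices k \<longleftrightarrow> mi_size \<mu> = k"
  by (simp add: multi_indices_def)

definition mi_weight :: "('n::finite => nat) => real" where
  "mi_weight \<mu> = 1 + real (mi_size \<mu>)"

lemma mi_weight_ge_1: "mi_weight \<mu> >= 1" and mi_weight_pos: "mi_weight \<mu> > 0" and mi_weight_nonneg: "mi_weight \<mu> >= 0"
  by (simp_all add: mi_weight_def sum_nonneg add_pos_nonneg)

lemma mi_weight_raise: "mi_weight (mi_raise \<mu> i) = 1 + mi_weight \<mu>"
  unfolding mi_weight_def mi_size_raise by simp

lemma mi_weight_lower: "\<mu> i > 0 ==> mi_weight \<mu> = 1 + mi_weight (mi_lower \<mu> i)"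
  unfolding mi_weight_def using mi_size_lower[of \<mu> i] by linarith

lemma rt2_Suc_le_weight: "rt2 (Suc (\<mu> i)) <= mi_weight \<mu>"
proof -
  have "real (\<mu> i) <= real (mi_size \<mu>)" by (rule of_nat_mono[OF mi_component_le])
  then have "real (Suc (\<mu> i)) / 2 <= mi_weight \<mu>" by (simp add: mi_weight_def)
  also have "... <= (mi_weight \<mu>)^2" using mi_weight_ge_1[of \<mu>] by (simp add: self_le_power)
  finally show ?thesis using mi_weight_ge_1[of \<mu>] by (intro real_le_lsqrt) auto
qed

lemma rt2_le_weight: "rt2 (\<mu> i) <= mi_weight \<mu>"
  by (rule order_trans[OF _ rt2_Suc_le_weight[of \<mu> i]]) simp

text \<open>Each coordinate factor costs one ladder step, that is, one power of the weight.\<close>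

lemma hermite_fun_weighted_bound:
  "\<exists>C M. C >= 0 \<and> (\<forall>\<mu> (x::real^'n::finite). (1 + norm x) ^ N * cmod (hermite_fun \<mu> x) <= C * mi_weight \<mu> ^ M)"
proof (induction N)
  case 0
  have "(1 + norm x) ^ 0 * cmod (hermite_fun \<mu> x) <= 4 ^ CARD('n) * mi_weight \<mu> ^ CARD('n)" for \<mu> and x :: "real^'n"
  proof -
    have "cmod (hermite_fun \<mu> x) <= (4 * real (mi_size \<mu>) + 2) ^ CARD('n)" by (rule hermite_fun_bound)
    also have "... <= (4 * mi_weight \<mu>) ^ CARD('n)" by (intro power_mono) (auto simp: mi_weight_def sum_nonneg)
    finally show ?thesis by (simp add: power_mult_distrib)
  qed
  then show ?case by (intro exI[of _ "4 ^ CARD('n)"] exI[of _ "CARD('n)"]) auto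
next
  case (Suc N)
  then obtain C M where C: "C >= 0" "\<And>\<mu> (x::real^'n). (1 + norm x) ^ N * cmod (hermite_fun \<mu> x) <= C * mi_weight \<mu> ^ M" by blast
  let ?D = "2 * (2 ^ M * C)"
  have "(1 + norm x) ^ Suc N * cmod (hermite_fun \<mu> x) <= (C + real CARD('n) * ?D) * mi_weight \<mu> ^ Suc M" for \<mu> and x :: "real^'n"
  proof -
    let ?w = "mi_weight \<mu>"
    note w = mi_weight_ge_1[of \<mu>]
    have W: "?w ^ M <= ?w ^ Suc M" using w by (intro power_increasing) auto
    have up: "(1 + norm x) ^ N * cmod (hermite_fun (mi_raise \<mu> i) x) <= 2 ^ M * C * ?w ^ M" for i
    proof -
      have "mi_weight (mi_raise \<mu> i) ^ M <= (2 * ?w) ^ M"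
        unfolding mi_weight_raise using w by (intro power_mono) auto
      then have "C * mi_weight (mi_raise \<mu> i) ^ M <= C * (2 * ?w) ^ M" by (intro mult_left_mono C)
      then show ?thesis using C(2)[of x "mi_raise \<mu> i"] by (simp add: power_mult_distrib mult_ac)
    qed
    have low: "rt2 (\<mu> i) * ((1 + norm x) ^ N * cmod (hermite_fun (mi_lower \<mu> i) x)) <= ?w * (2 ^ M * C * ?w ^ M)" for i
    proof (cases "\<mu> i = 0")
      case True
      then show ?thesis using C w by simp
    next
      case False
      then have "mi_weight (mi_lower \<mu> i) ^ M <= ?w ^ M"
        using mi_weight_lower[of \<mu> i] mi_weight_nonneg by (intro power_mono) auto
      also have "... <= (2 * ?w) ^ M" using w by (intro power_mono) auto
      finally have "C * mi_weight (mi_lower \<mu> i) ^ M <= C * (2 * ?w) ^ M" by (intro mult_left_mono C)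
      then have "(1 + norm x) ^ N * cmod (hermite_fun (mi_lower \<mu> i) x) <= 2 ^ M * C * ?w ^ M"
        using C(2)[of x "mi_lower \<mu> i"] by (simp add: power_mult_distrib mult_ac)
      then show ?thesis by (rule mult_mono[OF rt2_le_weight]) (use w in auto)
    qed
    have one: "(1 + norm x) ^ N * (\<bar>x $ i\<bar> * cmod (hermite_fun \<mu> x)) <= ?D * ?w ^ Suc M" for i
    proof -
      have "\<bar>x $ i\<bar> * cmod (hermite_fun \<mu> x) = cmod (of_real (x $ i) * hermite_fun \<mu> x)"
        by (simp add: norm_mult)
      also have "... <= rt2 (Suc (\<mu> i)) * cmod (hermite_fun (mi_raise \<mu> i) x) + rt2 (\<mu> i) * cmod (hermite_fun (mi_lower \<mu> i) x)"
        unfolding hermite_fun_coord by (rule order_trans[OF norm_triangle_ineq]) (simp add: norm_mult)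
      finally have "(1 + norm x) ^ N * (\<bar>x $ i\<bar> * cmod (hermite_fun \<mu> x))
          <= rt2 (Suc (\<mu> i)) * ((1 + norm x) ^ N * cmod (hermite_fun (mi_raise \<mu> i) x))
            + rt2 (\<mu> i) * ((1 + norm x) ^ N * cmod (hermite_fun (mi_lower \<mu> i) x))"
        using mult_left_mono[of _ _ "(1 + norm x) ^ N"] by (fastforce simp: algebra_simps)
      also have "... <= ?w * (2 ^ M * C * ?w ^ M) + ?w * (2 ^ M * C * ?w ^ M)"
        using w C by (intro add_mono low mult_mono rt2_Suc_le_weight up) auto
      finally show ?thesis by (simp add: mult_ac)
    qed
    have "(1 + norm x) ^ Suc N * cmod (hermite_fun \<mu> x)
        <= C * ?w ^ Suc M + (\<Sum>i\<in>(UNIV::'n set). ?D * ?w ^ Suc M)"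
      by (rule order_trans[OF weight_step[OF norm_ge_zero]])
        (intro add_mono sum_mono one order_trans[OF C(2)] mult_left_mono W C)
    then show ?thesis by (simp add: distrib_right)
  qed
  moreover have "C + real CARD('n) * ?D >= 0" using C by simp
  ultimately show ?case by blast
qed

text \<open>Series over multi-indices are summed by levels \<open>|\<mu>| = k\<close>, as in the definition of the projections \<open>Q\<^sub>k\<close>.\<close>

definition herm_level :: "(('n::finite => nat) => complex) => nat => real^'n => complex" where
  "herm_level c k x = (\<Sum>\<mu>\<in>multi_indices k. c \<mu> * hermite_fun \<mu> x)"

definition herm_synth :: "(('n::finite => nat) => complex) => real^'n => complex" where
  "herm_synth c x = (\<Sum>k. herm_level c k x)"

definition fast_coeff :: "(('n::finite => nat) => complex) => bool" where
  "fast_coeff c \<longleftrightarrow> (\<forall>M. \<exists>B. \<forall>\<mu>. mi_weight \<mu> ^ M * cmod (c \<mu>) <= B)"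

text \<open>A sum over the \<open>k\<close>-th level costs only a polynomial factor in \<open>k\<close>.\<close>

lemma level_sum_bound:
  fixes c :: "('n::finite => nat) => complex"
  assumes c: "\<And>\<mu>. mi_weight \<mu> ^ (M + CARD('n) + L) * cmod (c \<mu>) <= B"
    and d: "\<And>\<mu>. cmod (d \<mu>) <= D * mi_weight \<mu> ^ M" and D: "D >= 0"
  shows "(\<Sum>\<mu>\<in>multi_indices k. cmod (c \<mu> * d \<mu>)) <= D * B / (1 + real k) ^ L"
proof -
  have B: "B >= 0" using order_trans[OF _ c[of "\<lambda>_. 0"]] mi_weight_nonneg by (metis mult_nonneg_nonneg norm_ge_zero zero_le_power)
  have w: "(1 + real k) ^ m > 0" for m by (intro zero_less_power) simp
  have "cmod (c \<mu> * d \<mu>) <= D * B / (1 + real k) ^ (CARD('n) + L)" if "\<mu> \<in> multi_indices k" for \<mu>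
  proof -
    have wk: "mi_weight \<mu> = 1 + real k" using that by (simp add: mi_weight_def in_multi_indices)
    have "cmod (c \<mu> * d \<mu>) * (1 + real k) ^ (CARD('n) + L) <= cmod (c \<mu>) * (D * (1 + real k) ^ M) * (1 + real k) ^ (CARD('n) + L)"
      unfolding norm_mult using d[of \<mu>] wk by (intro mult_right_mono mult_left_mono) auto
    also have "... = D * ((1 + real k) ^ (M + CARD('n) + L) * cmod (c \<mu>))" by (simp add: power_add)
    also have "... <= D * B" using c[of \<mu>] wk D by (intro mult_left_mono) auto
    finally show ?thesis using w by (simp add: pos_le_divide_eq)
  qed
  then have "(\<Sum>\<mu>\<in>multi_indices k. cmod (c \<mu> * d \<mu>)) <= real (card (multi_indices k :: ('n => nat) set)) * (D * B / (1 + real k) ^ (CARD('n) + L))"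
    by (rule sum_bounded_above)
  also have "... <= (1 + real k) ^ CARD('n) * (D * B / (1 + real k) ^ (CARD('n) + L))"
    using B D by (intro mult_right_mono card_multi_indices) auto
  also have "... = D * B / (1 + real k) ^ L" using w[of "CARD('n)"] by (simp add: power_add)
  finally show ?thesis .
qed

lemma herm_level_weighted_bound:
  "\<exists>C M. C >= 0 \<and> (\<forall>c B. (\<forall>\<mu>. mi_weight \<mu> ^ M * cmod (c \<mu>) <= B) -->
     (\<forall>k (x::real^'n::finite). (1 + norm x) ^ N * cmod (herm_level c k x) <= C * B / (1 + real k) ^ 2))"
proof -
  obtain C M where C: "C >= 0" "\<And>\<mu> (x::real^'n). (1 + norm x) ^ N * cmod (hermite_fun \<mu> x) <= C * mi_weight \<mu> ^ M"
    using hermite_fun_weighted_bound by blast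
  have "(1 + norm x) ^ N * cmod (herm_level c k x) <= C * B / (1 + real k) ^ 2"
    if c: "\<And>\<mu>. mi_weight \<mu> ^ (M + CARD('n) + 2) * cmod (c \<mu>) <= B" for c B k and x :: "real^'n"
  proof -
    have "(1 + norm x) ^ N * cmod (herm_level c k x) <= (1 + norm x) ^ N * (\<Sum>\<mu>\<in>multi_indices k. cmod (c \<mu> * hermite_fun \<mu> x))"
      unfolding herm_level_def by (intro mult_left_mono norm_sum) auto
    also have "... = (\<Sum>\<mu>\<in>multi_indices k. cmod (c \<mu> * (of_real ((1 + norm x) ^ N) * hermite_fun \<mu> x)))"
      unfolding sum_distrib_left norm_mult norm_of_real by (simp add: mult_ac)
    also have "... <= C * B / (1 + real k) ^ 2"
    proof (rule level_sum_bound[OF c])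
      show "cmod (of_real ((1 + norm x) ^ N) * hermite_fun \<mu> x) <= C * mi_weight \<mu> ^ M" for \<mu>
        using C(2)[of x \<mu>] unfolding norm_mult norm_of_real by simp
    qed fact
    finally show ?thesis .
  qed
  then show ?thesis using C(1) by blast
qed

lemma summable_inverse_squares: "summable (\<lambda>k. C / (1 + real k) ^ 2)"
proof -
  have "summable (\<lambda>k. inverse ((real (Suc k)) ^ 2))"
    using inverse_power_summable[of 2, where 'a=real] by (subst summable_Suc_iff) auto
  from summable_mult[OF this, of C] show ?thesis by (simp add: divide_inverse add.commute)
qed

lemma herm_level_continuous: "continuous_on A (herm_level c k)"
  unfolding herm_level_def[abs_def]
  by (intro continuous_intros smooth_fun_continuous smooth_fun_hermite_fun)

lemma herm_level_schwartz: "herm_level c k \<in> schwartz_funs"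
  unfolding herm_level_def[abs_def] by (intro schwartz_sum schwartz_cmult hermite_fun_schwartz)

lemma herm_coeff_level: "herm_coeff (herm_level c k) \<mu> = (if mi_size \<mu> = k then c \<mu> else 0)"
proof -
  have "herm_coeff (herm_level c k) \<mu> = (\<Sum>\<beta>\<in>multi_indices k. c \<beta> * herm_coeff (hermite_fun \<beta>) \<mu>)"
    unfolding herm_level_def[abs_def] herm_coeff_cmult[symmetric]
    by (rule herm_coeff_sum) (auto intro!: schwartz_rapid schwartz_cmult hermite_fun_schwartz)
  also have "... = (\<Sum>\<beta>\<in>multi_indices k. if \<beta> = \<mu> then c \<mu> else 0)"
    by (rule sum.cong) (auto simp: hermite_fun_orthonormal)
  also have "... = (if mi_size \<mu> = k then c \<mu> else 0)"
    by (simp add: in_multi_indices sum.delta)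
  finally show ?thesis .
qed

lemma fast_coeff_level_bound:
  assumes "fast_coeff c"
  obtains C where "\<And>k (x::real^'n::finite). (1 + norm x) ^ N * cmod (herm_level c k x) <= C / (1 + real k) ^ 2"
proof -
  obtain C M where *: "\<And>c B k (x::real^'n). (\<And>\<mu>. mi_weight \<mu> ^ M * cmod (c \<mu>) <= B) ==>
      (1 + norm x) ^ N * cmod (herm_level c k x) <= C * B / (1 + real k) ^ 2"
    using herm_level_weighted_bound[where N=N and 'n='n] by blast
  obtain B where "\<And>\<mu>. mi_weight \<mu> ^ M * cmod (c \<mu>) <= B" using assms unfolding fast_coeff_def by blast
  from *[OF this] show ?thesis using that[of "C * B"] by blast
qed

lemma herm_level_summable:
  assumes "fast_coeff c" shows "summable (\<lambda>k. norm (herm_level c k x))"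
proof -
  obtain C where "\<And>k (x::real^'a). (1 + norm x) ^ 0 * cmod (herm_level c k x) <= C / (1 + real k) ^ 2"
    using fast_coeff_level_bound[OF assms, of 0] by blast
  then show ?thesis
    by (intro summable_comparison_test[OF _ summable_inverse_squares[of C]]) auto
qed

lemma herm_synth_weighted_tail:
  fixes c :: "('n::finite => nat) => complex"
  assumes "fast_coeff c"
  shows "\<exists>\<epsilon>. \<epsilon> \<longlonglongrightarrow> 0 \<and> (\<forall>K x. (1 + norm x) ^ N * cmod (herm_synth c x - (\<Sum>k<K. herm_level c k x)) <= \<epsilon> K)"
proof -
  obtain C where C: "\<And>k (x::real^'n). (1 + norm x) ^ N * cmod (herm_level c k x) <= C / (1 + real k) ^ 2"
    using fast_coeff_level_bound[OF assms, of N] by blast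
  define \<epsilon> where "\<epsilon> K = (\<Sum>k. C / (1 + real (k + K)) ^ 2)" for K
  have "\<epsilon> \<longlonglongrightarrow> 0"
    unfolding \<epsilon>_def[abs_def] by (rule suminf_exist_split2[OF summable_inverse_squares])
  moreover have "(1 + norm x) ^ N * cmod (herm_synth c x - (\<Sum>k<K. herm_level c k x)) <= \<epsilon> K" for K and x :: "real^'n"
  proof -
    have s: "summable (\<lambda>k. herm_level c k x)" by (rule summable_norm_cancel[OF herm_level_summable[OF assms]])
    have "herm_synth c x - (\<Sum>k<K. herm_level c k x) = (\<Sum>k. herm_level c (k + K) x)"
      unfolding herm_synth_def using suminf_minus_initial_segment[OF s, of K] by simp
    also have "(1 + norm x) ^ N * cmod ... <= (1 + norm x) ^ N * (\<Sum>k. cmod (herm_level c (k + K) x))"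
      by (intro mult_left_mono summable_norm summable_ignore_initial_segment herm_level_summable assms) auto
    also have "... = (\<Sum>k. (1 + norm x) ^ N * cmod (herm_level c (k + K) x))"
      by (rule suminf_mult[symmetric]) (intro summable_ignore_initial_segment herm_level_summable assms)
    also have "... <= \<epsilon> K"
      unfolding \<epsilon>_def
    proof (rule suminf_le)
      show "summable (\<lambda>k. (1 + norm x) ^ N * cmod (herm_level c (k + K) x))"
        by (rule summable_mult[OF summable_ignore_initial_segment[OF herm_level_summable[OF assms]]])
      show "summable (\<lambda>k. C / (1 + real (k + K)) ^ 2)"
        by (rule summable_ignore_initial_segment[OF summable_inverse_squares])
      show "(1 + norm x) ^ N * cmod (herm_level c (k + K) x) <= C / (1 + real (k + K)) ^ 2" for k
        by (rule C)
    qed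
    finally show ?thesis .
  qed
  ultimately show ?thesis by blast
qed

lemma herm_synth_rapid:
  fixes c :: "('n::finite => nat) => complex"
  assumes "fast_coeff c" shows "rapid (herm_synth c)"
  unfolding rapid_def
proof (intro conjI allI)
  obtain \<epsilon> where \<epsilon>: "\<epsilon> \<longlonglongrightarrow> 0" "\<And>K (x::real^'n). (1 + norm x) ^ 0 * cmod (herm_synth c x - (\<Sum>k<K. herm_level c k x)) <= \<epsilon> K"
    using herm_synth_weighted_tail[OF assms, of 0] by blast
  have "uniform_limit UNIV (\<lambda>K (x::real^'n). \<Sum>k<K. herm_level c k x) (herm_synth c) sequentially"
    unfolding uniform_limit_iff
  proof (intro allI impI)
    fix e :: real assume "e > 0"
    from order_tendstoD(2)[OF \<epsilon>(1) this] have "\<forall>\<^sub>F K in sequentially. \<epsilon> K < e" .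
    then show "\<forall>\<^sub>F K in sequentially. \<forall>x\<in>UNIV. dist (\<Sum>k<K. herm_level c k x) (herm_synth c x) < e"
    proof eventually_elim
      case (elim K)
      show ?case
      proof
        fix x :: "real^'n"
        have "dist (\<Sum>k<K. herm_level c k x) (herm_synth c x) <= \<epsilon> K"
          using \<epsilon>(2)[of x K] by (simp add: dist_norm norm_minus_commute)
        then show "dist (\<Sum>k<K. herm_level c k x) (herm_synth c x) < e" using elim by simp
      qed
    qed
  qed
  then show "continuous_on UNIV (herm_synth c)"
    by (rule uniform_limit_theorem[rotated]) (auto intro!: always_eventually continuous_on_sum herm_level_continuous)
  fix N
  obtain \<epsilon> where \<epsilon>: "\<And>K (x::real^'n). (1 + norm x) ^ N * cmod (herm_synth c x - (\<Sum>k<K. herm_level c k x)) <= \<epsilon> K"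
    using herm_synth_weighted_tail[OF assms, of N] by blast
  then show "\<exists>C. \<forall>x. (1 + norm x) ^ N * cmod (herm_synth c x) <= C"
    using \<epsilon>[where K=0] by (intro exI[of _ "\<epsilon> 0"]) auto
qed

lemma herm_coeff_synth:
  fixes c :: "('n::finite => nat) => complex"
  assumes "fast_coeff c" shows "herm_coeff (herm_synth c) \<mu> = c \<mu>"
proof -
  obtain \<epsilon> where \<epsilon>: "\<epsilon> \<longlonglongrightarrow> 0" "\<And>K (x::real^'n). (1 + norm x) ^ 0 * cmod (herm_synth c x - (\<Sum>k<K. herm_level c k x)) <= \<epsilon> K"
    using herm_synth_weighted_tail[OF assms, of 0] by blast
  define I where "I = (LINT x|lebesgue. cmod (hermite_fun \<mu> x))"
  note R = herm_synth_rapid[OF assms]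
  have RL: "rapid (\<lambda>x. \<Sum>k<K. herm_level c k x)" for K
    by (rule schwartz_rapid) (intro schwartz_sum herm_level_schwartz)
  have bound: "cmod (herm_coeff (herm_synth c) \<mu> - herm_coeff (\<lambda>x. \<Sum>k<K. herm_level c k x) \<mu>) <= \<epsilon> K * I" for K
  proof -
    have "herm_coeff (herm_synth c) \<mu> - herm_coeff (\<lambda>x. \<Sum>k<K. herm_level c k x) \<mu>
        = (LINT x|lebesgue. (herm_synth c x - (\<Sum>k<K. herm_level c k x)) * hermite_fun \<mu> x)"
      unfolding herm_coeff_diff[OF R RL, symmetric] by (simp add: herm_coeff_def)
    also have "cmod ... <= (LINT x|lebesgue. cmod ((herm_synth c x - (\<Sum>k<K. herm_level c k x)) * hermite_fun \<mu> x))"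
      by (rule integral_norm_bound)
    also have "... <= (LINT x|lebesgue. \<epsilon> K * cmod (hermite_fun \<mu> x))"
    proof (rule integral_mono)
      have "integrable lebesgue (\<lambda>x. herm_synth c x * hermite_fun \<mu> x - (\<Sum>k<K. herm_level c k x) * hermite_fun \<mu> x)"
        by (intro Bochner_Integration.integrable_diff rapid_hermite_integrable R RL)
      then show "integrable lebesgue (\<lambda>x. cmod ((herm_synth c x - (\<Sum>k<K. herm_level c k x)) * hermite_fun \<mu> x))"
        by (intro integrable_norm) (simp add: left_diff_distrib)
      show "integrable lebesgue (\<lambda>x. \<epsilon> K * cmod (hermite_fun \<mu> x))"
        by (intro integrable_mult_right integrable_norm rapid_integrable schwartz_rapid hermite_fun_schwartz)
      show "cmod ((herm_synth c x - (\<Sum>k<K. herm_level c k x)) * hermite_fun \<mu> x) <= \<epsilon> K * cmod (hermite_fun \<mu> x)" for x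
        unfolding norm_mult using \<epsilon>(2)[of x K] by (intro mult_right_mono) auto
    qed
    finally show ?thesis by (simp add: I_def)
  qed
  have "(\<lambda>K. herm_coeff (herm_synth c) \<mu> - herm_coeff (\<lambda>x. \<Sum>k<K. herm_level c k x) \<mu>) \<longlonglongrightarrow> 0"
    by (rule Lim_null_comparison[OF always_eventually[OF allI[OF bound]]]) (rule tendsto_mult_left_zero[OF \<epsilon>(1)])
  moreover have "\<forall>\<^sub>F K in sequentially. herm_coeff (herm_synth c) \<mu> - herm_coeff (\<lambda>x. \<Sum>k<K. herm_level c k x) \<mu>
      = herm_coeff (herm_synth c) \<mu> - c \<mu>"
    using eventually_gt_at_top[of "mi_size \<mu>"]
  proof eventually_elim
    case (elim K)
    have "herm_coeff (\<lambda>x. \<Sum>k<K. herm_level c k x) \<mu> = (\<Sum>k<K. herm_coeff (herm_level c k) \<mu>)"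
      by (rule herm_coeff_sum) (auto intro: schwartz_rapid herm_level_schwartz)
    also have "... = c \<mu>" using elim by (simp add: herm_coeff_level sum.delta)
    finally show ?case by simp
  qed
  ultimately have "(\<lambda>K::nat. herm_coeff (herm_synth c) \<mu> - c \<mu>) \<longlonglongrightarrow> 0"
    by (rule Lim_transform_eventually)
  then show ?thesis by (simp add: LIMSEQ_const_iff)
qed


lemma herm_coeff_crude_bound:
  fixes \<phi> :: "real^'n::finite => complex"
  assumes "rapid \<phi>"
  shows "\<exists>C. \<forall>\<mu>. cmod (herm_coeff \<phi> \<mu>) <= C * mi_weight \<mu> ^ CARD('n)"
proof -
  have "cmod (herm_coeff \<phi> \<mu>) <= ((LINT x|lebesgue. cmod (\<phi> x)) * 4 ^ CARD('n)) * mi_weight \<mu> ^ CARD('n)" for \<mu>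
  proof -
    have "cmod (herm_coeff \<phi> \<mu>) <= (LINT x|lebesgue. cmod (\<phi> x * hermite_fun \<mu> x))"
      unfolding herm_coeff_def by (rule integral_norm_bound)
    also have "... <= (LINT x|lebesgue. cmod (\<phi> x) * (4 * mi_weight \<mu>) ^ CARD('n))"
    proof (rule integral_mono)
      show "integrable lebesgue (\<lambda>x. cmod (\<phi> x * hermite_fun \<mu> x))"
        by (intro integrable_norm rapid_hermite_integrable assms)
      show "integrable lebesgue (\<lambda>x. cmod (\<phi> x) * (4 * mi_weight \<mu>) ^ CARD('n))"
        by (intro integrable_mult_left integrable_norm rapid_integrable assms)
      fix x
      have "cmod (hermite_fun \<mu> x) <= (4 * real (mi_size \<mu>) + 2) ^ CARD('n)" by (rule hermite_fun_bound)
      also have "... <= (4 * mi_weight \<mu>) ^ CARD('n)" by (intro power_mono) (auto simp: mi_weight_def sum_nonneg)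
      finally show "cmod (\<phi> x * hermite_fun \<mu> x) <= cmod (\<phi> x) * (4 * mi_weight \<mu>) ^ CARD('n)"
        unfolding norm_mult by (intro mult_left_mono) auto
    qed
    finally show ?thesis by (simp add: power_mult_distrib mult_ac)
  qed
  then show ?thesis by blast
qed

text \<open>Every application of the oscillator multiplies the coefficient by its eigenvalue and stays in the Schwartz space,
  where coefficients are at least polynomially bounded.\<close>

lemma fast_coeff_schwartz:
  fixes \<phi> :: "real^'n::finite => complex"
  assumes "\<phi> \<in> schwartz_funs" shows "fast_coeff (herm_coeff \<phi>)"
  unfolding fast_coeff_def
proof
  fix M
  define \<psi> where "\<psi> m = (harm_osc ^^ m) \<phi>" for m
  have S: "\<psi> m \<in> schwartz_funs" for m
    unfolding \<psi>_def by (induction m) (use assms harm_osc_schwartz in auto)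
  have eig: "herm_coeff (\<psi> m) \<mu> = of_real ((2 * real (mi_size \<mu>) + real CARD('n)) ^ m) * herm_coeff \<phi> \<mu>" for m \<mu>
  proof (induction m)
    case 0
    show ?case by (simp add: \<psi>_def)
  next
    case (Suc m)
    have "herm_coeff (\<psi> (Suc m)) \<mu> = of_real (2 * real (mi_size \<mu>) + real CARD('n)) * herm_coeff (\<psi> m) \<mu>"
      using herm_coeff_harm_osc[OF S[of m], of \<mu>] by (simp add: \<psi>_def)
    then show ?case unfolding Suc.IH by simp
  qed
  let ?n = "CARD('n)"
  obtain C where C: "\<And>\<mu>. cmod (herm_coeff (\<psi> (M + ?n)) \<mu>) <= C * mi_weight \<mu> ^ ?n"
    using herm_coeff_crude_bound[OF schwartz_rapid[OF S]] by blast
  have "mi_weight \<mu> ^ M * cmod (herm_coeff \<phi> \<mu>) <= C" for \<mu> :: "'n => nat"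
  proof -
    let ?w = "mi_weight \<mu>"
    have n1: "1 <= ?n" by (simp add: Suc_leI)
    have "?w <= 2 * real (mi_size \<mu>) + real ?n"
      unfolding mi_weight_def using of_nat_mono[OF n1, where 'a=real] of_nat_0_le_iff[of "mi_size \<mu>", where 'a=real] by linarith
    then have "?w ^ (M + ?n) <= (2 * real (mi_size \<mu>) + real ?n) ^ (M + ?n)"
      by (intro power_mono mi_weight_nonneg)
    then have "?w ^ (M + ?n) * cmod (herm_coeff \<phi> \<mu>) <= (2 * real (mi_size \<mu>) + real ?n) ^ (M + ?n) * cmod (herm_coeff \<phi> \<mu>)"
      by (intro mult_right_mono) auto
    also have "... = cmod (herm_coeff (\<psi> (M + ?n)) \<mu>)"
      unfolding eig norm_mult norm_of_real by (simp add: sum_nonneg)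
    also have "... <= C * ?w ^ ?n" by (rule C)
    finally have "?w ^ ?n * (?w ^ M * cmod (herm_coeff \<phi> \<mu>)) <= ?w ^ ?n * C"
      by (simp add: power_add mult_ac)
    then show ?thesis using mi_weight_pos[of \<mu>] by (simp only: mult_le_cancel_left_pos zero_less_power)
  qed
  then show "\<exists>B. \<forall>\<mu>. mi_weight \<mu> ^ M * cmod (herm_coeff \<phi> \<mu>) <= B" by blast
qed

theorem hermite_expansion:
  assumes "\<phi> \<in> schwartz_funs" shows "\<phi> x = herm_synth (herm_coeff \<phi>) x"
proof -
  note F = fast_coeff_schwartz[OF assms]
  have "rapid (\<lambda>x. \<phi> x + (-1) * herm_synth (herm_coeff \<phi>) x)"
    using rapid_sum[of "{False, True}" "\<lambda>b. if b then \<phi> else (\<lambda>x. (-1) * herm_synth (herm_coeff \<phi>) x)"]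
      schwartz_rapid[OF assms]
      rapid_mult_bounded[OF herm_synth_rapid[OF F], of "\<lambda>_. -1" 1 0]
    by (simp add: add.commute)
  then have r: "rapid (\<lambda>x. \<phi> x - herm_synth (herm_coeff \<phi>) x)" by simp
  have "herm_coeff (\<lambda>x. \<phi> x - herm_synth (herm_coeff \<phi>) x) \<mu> = 0" for \<mu>
    unfolding herm_coeff_diff[OF schwartz_rapid[OF assms] herm_synth_rapid[OF F]] herm_coeff_synth[OF F] by simp
  from hermite_complete[OF r this, of x] show ?thesis by simp
qed

text \<open>The weighted suprema of the Hermite coefficients of \<open>\<psi>\<close> control all Schwartz seminorms of \<open>\<psi>\<close>:
  multiplication by a coordinate and differentiation act on coefficients by the ladder relations,
  and so cost one power of the weight each.\<close>

definition coeff_bound :: "nat => real => (real^'n::finite => complex) => bool" where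
  "coeff_bound M B \<psi> \<longleftrightarrow> (\<forall>\<mu>. mi_weight \<mu> ^ M * cmod (herm_coeff \<psi> \<mu>) <= B)"

lemma coeff_bound_nonneg: "coeff_bound M B (\<psi> :: real^'n::finite => complex) ==> B >= 0"
proof -
  assume "coeff_bound M B \<psi>"
  then have "mi_weight (\<lambda>_::'n. 0) ^ M * cmod (herm_coeff \<psi> (\<lambda>_. 0)) <= B" unfolding coeff_bound_def by blast
  moreover have "0 <= mi_weight (\<lambda>_::'n. 0) ^ M * cmod (herm_coeff \<psi> (\<lambda>_. 0))"
    by (intro mult_nonneg_nonneg zero_le_power mi_weight_nonneg norm_ge_zero)
  ultimately show ?thesis by linarith
qed

lemma coeff_bound_mono:
  fixes \<psi> :: "real^'n::finite => complex"
  assumes "coeff_bound M' B \<psi>" "M <= M'" shows "coeff_bound M B \<psi>"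
  unfolding coeff_bound_def
proof
  fix \<mu> :: "'n => nat"
  have "mi_weight \<mu> ^ M <= mi_weight \<mu> ^ M'" using assms(2) mi_weight_ge_1 by (intro power_increasing) auto
  then have "mi_weight \<mu> ^ M * cmod (herm_coeff \<psi> \<mu>) <= mi_weight \<mu> ^ M' * cmod (herm_coeff \<psi> \<mu>)"
    by (intro mult_right_mono) auto
  then show "mi_weight \<mu> ^ M * cmod (herm_coeff \<psi> \<mu>) <= B"
    using assms(1) unfolding coeff_bound_def by (meson order_trans)
qed

lemma coeff_bound_ladder:
  fixes \<psi> \<psi>' :: "real^'n::finite => complex"
  assumes B: "coeff_bound (Suc M) B \<psi>"
    and eq: "\<And>\<mu>. cmod (herm_coeff \<psi>' \<mu>) <= rt2 (Suc (\<mu> i)) * cmod (herm_coeff \<psi> (mi_raise \<mu> i))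
        + rt2 (\<mu> i) * cmod (herm_coeff \<psi> (mi_lower \<mu> i))"
  shows "coeff_bound M (2 ^ Suc (Suc M) * B) \<psi>'"
  unfolding coeff_bound_def
proof
  fix \<mu> :: "'n => nat"
  let ?w = "mi_weight \<mu>"
  have b: "mi_weight \<beta> ^ Suc M * cmod (herm_coeff \<psi> \<beta>) <= B" for \<beta> using B unfolding coeff_bound_def by blast
  have B0: "B >= 0" by (rule coeff_bound_nonneg[OF B])
  have 1: "?w ^ M * (rt2 (Suc (\<mu> i)) * cmod (herm_coeff \<psi> (mi_raise \<mu> i))) <= B"
  proof -
    have "?w ^ M * (rt2 (Suc (\<mu> i)) * cmod (herm_coeff \<psi> (mi_raise \<mu> i))) <= ?w ^ M * (?w * cmod (herm_coeff \<psi> (mi_raise \<mu> i)))"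
      by (intro mult_left_mono mult_right_mono rt2_Suc_le_weight zero_le_power mi_weight_nonneg norm_ge_zero)
    also have "... = ?w ^ Suc M * cmod (herm_coeff \<psi> (mi_raise \<mu> i))" by simp
    also have "... <= mi_weight (mi_raise \<mu> i) ^ Suc M * cmod (herm_coeff \<psi> (mi_raise \<mu> i))"
      by (intro mult_right_mono power_mono mi_weight_nonneg) (simp_all add: mi_weight_raise)
    also have "... <= B" by (rule b)
    finally show ?thesis .
  qed
  have 2: "?w ^ M * (rt2 (\<mu> i) * cmod (herm_coeff \<psi> (mi_lower \<mu> i))) <= 2 ^ Suc M * B"
  proof (cases "\<mu> i = 0")
    case True
    then show ?thesis using B0 by simp
  next
    case False
    let ?v = "mi_weight (mi_lower \<mu> i)"
    have w: "?w <= 2 * ?v" using mi_weight_lower[of \<mu> i] mi_weight_ge_1[of "mi_lower \<mu> i"] False by simp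
    have "?w ^ M * (rt2 (\<mu> i) * cmod (herm_coeff \<psi> (mi_lower \<mu> i))) <= ?w ^ M * (?w * cmod (herm_coeff \<psi> (mi_lower \<mu> i)))"
      by (intro mult_left_mono mult_right_mono rt2_le_weight zero_le_power mi_weight_nonneg norm_ge_zero)
    also have "... = ?w ^ Suc M * cmod (herm_coeff \<psi> (mi_lower \<mu> i))" by simp
    also have "... <= (2 * ?v) ^ Suc M * cmod (herm_coeff \<psi> (mi_lower \<mu> i))"
      by (intro mult_right_mono power_mono mi_weight_nonneg w norm_ge_zero)
    also have "... = 2 ^ Suc M * (?v ^ Suc M * cmod (herm_coeff \<psi> (mi_lower \<mu> i)))"
      by (simp only: power_mult_distrib mult.assoc)
    also have "... <= 2 ^ Suc M * B" by (intro mult_left_mono b) simp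
    finally show ?thesis .
  qed
  have "?w ^ M * cmod (herm_coeff \<psi>' \<mu>) <= ?w ^ M * (rt2 (Suc (\<mu> i)) * cmod (herm_coeff \<psi> (mi_raise \<mu> i))
        + rt2 (\<mu> i) * cmod (herm_coeff \<psi> (mi_lower \<mu> i)))"
    by (intro mult_left_mono eq zero_le_power mi_weight_nonneg)
  also have "... <= B + 2 ^ Suc M * B" unfolding distrib_left by (intro add_mono 1 2)
  also have "... <= 2 ^ Suc M * B + 2 ^ Suc M * B"
  proof -
    have "1 * B <= 2 ^ Suc M * B" using B0 by (intro mult_right_mono one_le_power) auto
    then show ?thesis unfolding mult_1 by (rule add_right_mono)
  qed
  finally show "?w ^ M * cmod (herm_coeff \<psi>' \<mu>) <= 2 ^ Suc (Suc M) * B" by (simp add: mult_ac)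
qed

lemma coeff_bound_pderiv_at:
  assumes "\<psi> \<in> schwartz_funs" "coeff_bound (Suc M) B \<psi>"
  shows "coeff_bound M (2 ^ Suc (Suc M) * B) (pderiv_at i \<psi>)"
proof (rule coeff_bound_ladder[OF assms(2)])
  show "cmod (herm_coeff (pderiv_at i \<psi>) \<mu>)
      <= rt2 (Suc (\<mu> i)) * cmod (herm_coeff \<psi> (mi_raise \<mu> i)) + rt2 (\<mu> i) * cmod (herm_coeff \<psi> (mi_lower \<mu> i))" for \<mu>
    unfolding herm_coeff_pderiv_at[OF assms(1)]
    by (rule order_trans[OF norm_triangle_ineq4]) (simp add: norm_mult)
qed

lemma coeff_bound_weighted:
  "\<exists>C M. C >= 0 \<and> (\<forall>\<psi>\<in>schwartz_funs. \<forall>B. coeff_bound M B \<psi> -->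
     (\<forall>x::real^'n::finite. (1 + norm x) ^ N * cmod (pderivs is \<psi> x) <= C * B))"
proof (induction "is" rule: rev_induct)
  case Nil
  obtain C M where *: "C >= 0" "\<And>c B k (x::real^'n). (\<And>\<mu>. mi_weight \<mu> ^ M * cmod (c \<mu>) <= B) ==>
      (1 + norm x) ^ N * cmod (herm_level c k x) <= C * B / (1 + real k) ^ 2"
    using herm_level_weighted_bound[where N=N and 'n='n] by blast
  define S where "S = (\<Sum>k. 1 / (1 + real k) ^ 2)"
  have S: "S >= 0" unfolding S_def by (intro suminf_nonneg summable_inverse_squares) auto
  have "(1 + norm x) ^ N * cmod (\<psi> x) <= (C * S) * B" if \<psi>: "\<psi> \<in> schwartz_funs" "coeff_bound M B \<psi>" for \<psi> B and x :: "real^'n"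
  proof -
    note F = fast_coeff_schwartz[OF \<psi>(1)]
    have lev: "(1 + norm x) ^ N * cmod (herm_level (herm_coeff \<psi>) k x) <= (C * B) * (1 / (1 + real k) ^ 2)" for k
      using *(2)[of "herm_coeff \<psi>" B x k] \<psi>(2) unfolding coeff_bound_def by simp
    have "(1 + norm x) ^ N * cmod (\<psi> x) <= (1 + norm x) ^ N * (\<Sum>k. cmod (herm_level (herm_coeff \<psi>) k x))"
      unfolding hermite_expansion[OF \<psi>(1), of x] herm_synth_def
      by (intro mult_left_mono summable_norm herm_level_summable F) auto
    also have "... = (\<Sum>k. (1 + norm x) ^ N * cmod (herm_level (herm_coeff \<psi>) k x))"
      by (rule suminf_mult[symmetric, OF herm_level_summable[OF F]])
    also have "... <= (\<Sum>k. (C * B) * (1 / (1 + real k) ^ 2))"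
      by (rule suminf_le[OF lev summable_mult[OF herm_level_summable[OF F]] summable_mult[OF summable_inverse_squares]])
    also have "... = (C * B) * S" unfolding S_def by (rule suminf_mult[OF summable_inverse_squares])
    finally show ?thesis by (simp add: mult_ac)
  qed
  then show ?case using *(1) S by (intro exI[of _ "C * S"] exI[of _ M]) auto
next
  case (snoc i "is")
  then obtain C M where C: "C >= 0" "\<And>\<psi> B (x::real^'n). \<psi> \<in> schwartz_funs ==> coeff_bound M B \<psi> ==>
      (1 + norm x) ^ N * cmod (pderivs is \<psi> x) <= C * B" by blast
  have "(1 + norm x) ^ N * cmod (pderivs (is @ [i]) \<psi> x) <= (C * 2 ^ Suc (Suc M)) * B"
    if "\<psi> \<in> schwartz_funs" "coeff_bound (Suc M) B \<psi>" for \<psi> B and x :: "real^'n"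
    using C(2)[OF schwartz_pderiv_at[OF that(1)] coeff_bound_pderiv_at[OF that]] unfolding pderivs_snoc mult.assoc .
  then show ?case using C(1) by (intro exI[of _ "C * 2 ^ Suc (Suc M)"] exI[of _ "Suc M"]) auto
qed

lemma schwartz_seminorm_coeff_bound:
  "\<exists>C M. C >= 0 \<and> (\<forall>\<psi>\<in>schwartz_funs. \<forall>B. coeff_bound M B \<psi> -->
     schwartz_seminorm N (\<psi> :: real^'n::finite => complex) <= C * B)"
proof -
  have "\<forall>is. \<exists>p. fst p >= 0 \<and> (\<forall>\<psi>\<in>schwartz_funs. \<forall>B. coeff_bound (snd p) B \<psi> -->
     (\<forall>x::real^'n. (1 + norm x) ^ N * cmod (pderivs is \<psi> x) <= fst p * B))"
    using coeff_bound_weighted[where N=N and 'n='n] by simp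
  from choice[OF this] obtain p where p: "\<And>is. fst (p is) >= 0"
    "\<And>is \<psi> B x. \<psi> \<in> schwartz_funs ==> coeff_bound (snd (p is)) B \<psi> ==>
       (1 + norm (x::real^'n)) ^ N * cmod (pderivs is \<psi> x) <= fst (p is) * B" by blast
  let ?L = "{is :: 'n list. length is <= N}"
  have "schwartz_seminorm N \<psi> <= (\<Sum>is\<in>?L. fst (p is)) * B"
    if \<psi>: "\<psi> \<in> schwartz_funs" "coeff_bound (\<Sum>is\<in>?L. snd (p is)) B \<psi>" for \<psi> :: "real^'n => complex" and B
  proof (rule schwartz_seminorm_le)
    fix "is" :: "'n list" and x assume len: "length is <= N"
    have "coeff_bound (snd (p is)) B \<psi>"
      by (rule coeff_bound_mono[OF \<psi>(2)], rule member_le_sum) (use len finite_short_lists in auto)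
    from p(2)[OF \<psi>(1) this] have "(1 + norm x) ^ N * cmod (pderivs is \<psi> x) <= fst (p is) * B" .
    also have "... <= (\<Sum>is\<in>?L. fst (p is)) * B"
      by (intro mult_right_mono coeff_bound_nonneg[OF \<psi>(2)] member_le_sum) (use len finite_short_lists p in auto)
    finally show "(1 + norm x) ^ N * cmod (pderivs is \<psi> x) <= (\<Sum>is\<in>?L. fst (p is)) * B" .
  qed
  moreover have "(\<Sum>is\<in>?L. fst (p is)) >= 0" by (intro sum_nonneg p)
  ultimately show ?thesis by blast
qed

definition slow_coeff :: "(('n::finite => nat) => complex) => bool" where
  "slow_coeff d \<longleftrightarrow> (\<exists>D M. D >= 0 \<and> (\<forall>\<mu>. cmod (d \<mu>) <= D * mi_weight \<mu> ^ M))"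

lemma schwartz_continuous_slow_coeff:
  fixes T :: "'n::finite functional"
  assumes T: "schwartz_continuous T" shows "slow_coeff (\<lambda>\<mu>. T (hermite_fun \<mu>))"
proof -
  obtain C N where CN: "\<And>\<psi>. \<psi> \<in> schwartz_funs ==> cmod (T \<psi>) <= C * schwartz_seminorm N \<psi>"
    using T unfolding schwartz_continuous_def by blast
  obtain C' M where C': "C' >= 0" "\<And>\<psi> B. \<psi> \<in> schwartz_funs ==> coeff_bound M B \<psi> ==> schwartz_seminorm N (\<psi> :: real^'n => complex) <= C' * B"
    using schwartz_seminorm_coeff_bound[where N=N and 'n='n] by blast
  have "cmod (T (hermite_fun \<mu>)) <= (\<bar>C\<bar> * C') * mi_weight \<mu> ^ M" for \<mu>
  proof -
    have cb: "coeff_bound M (mi_weight \<mu> ^ M) (hermite_fun \<mu>)"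
      unfolding coeff_bound_def hermite_fun_orthonormal using zero_le_power[OF mi_weight_nonneg] by auto
    have "cmod (T (hermite_fun \<mu>)) <= C * schwartz_seminorm N (hermite_fun \<mu>)"
      by (rule CN[OF hermite_fun_schwartz])
    also have "... <= \<bar>C\<bar> * schwartz_seminorm N (hermite_fun \<mu>)"
      by (intro mult_right_mono schwartz_seminorm_nonneg hermite_fun_schwartz) auto
    also have "... <= \<bar>C\<bar> * (C' * mi_weight \<mu> ^ M)"
      by (intro mult_left_mono C'(2) hermite_fun_schwartz cb) auto
    finally show ?thesis by (simp add: mult.assoc)
  qed
  moreover have "\<bar>C\<bar> * C' >= 0" using C'(1) by simp
  ultimately show ?thesis unfolding slow_coeff_def by blast
qed

lemma linear_functional_sum:
  assumes T: "linear_functional_on schwartz_funs T" and "finite A" "\<And>a. a \<in> A ==> F a \<in> schwartz_funs"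
  shows "T (\<lambda>x. \<Sum>a\<in>A. F a x) = (\<Sum>a\<in>A. T (F a))"
  using assms(2,3)
proof (induction A rule: finite_induct)
  case empty
  have "T (\<lambda>x. 0 * (0::complex)) = 0 * T (\<lambda>x. 0)"
    using T[unfolded linear_functional_on_def, THEN conjunct2, rule_format, OF schwartz_zero] .
  then show ?case by simp
next
  case (insert a A)
  have "T (\<lambda>x. F a x + (\<Sum>a\<in>A. F a x)) = T (F a) + T (\<lambda>x. \<Sum>a\<in>A. F a x)"
    using T[unfolded linear_functional_on_def, THEN conjunct1, rule_format, of "F a" "\<lambda>x. \<Sum>a\<in>A. F a x"]
      insert.prems schwartz_sum[of A F] by simp
  then show ?case using insert by simp
qed

definition herm_pairing :: "(('n::finite => nat) => complex) => (real^'n => complex) => nat => complex" where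
  "herm_pairing d \<phi> k = (\<Sum>\<mu>\<in>multi_indices k. herm_coeff \<phi> \<mu> * d \<mu>)"

text \<open>The partial sums of the Hermite series converge in every Schwartz seminorm, because the remainders have coefficients
  that are uniformly small after weighting.\<close>

theorem tempered_hermite_expansion:
  fixes T :: "'n::finite functional"
  assumes T: "schwartz_continuous T" and \<phi>: "\<phi> \<in> schwartz_funs"
  shows "herm_pairing (\<lambda>\<mu>. T (hermite_fun \<mu>)) \<phi> sums T \<phi>"
proof -
  note F = fast_coeff_schwartz[OF \<phi>]
  have lin: "linear_functional_on schwartz_funs T" using T by (simp add: schwartz_continuous_def)
  obtain C N where CN: "\<And>\<psi>. \<psi> \<in> schwartz_funs ==> cmod (T \<psi>) <= C * schwartz_seminorm N \<psi>"
    using T unfolding schwartz_continuous_def by blast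
  obtain C' M where C': "C' >= 0" "\<And>\<psi> B. \<psi> \<in> schwartz_funs ==> coeff_bound M B \<psi> ==> schwartz_seminorm N (\<psi> :: real^'n => complex) <= C' * B"
    using schwartz_seminorm_coeff_bound[where N=N and 'n='n] by blast
  obtain B where B: "\<And>\<mu>. mi_weight \<mu> ^ Suc M * cmod (herm_coeff \<phi> \<mu>) <= B"
    using F unfolding fast_coeff_def by blast
  define P where "P K x = (\<Sum>k<K. herm_level (herm_coeff \<phi>) k x)" for K x
  have PS: "P K \<in> schwartz_funs" for K unfolding P_def[abs_def] by (intro schwartz_sum herm_level_schwartz)
  have Tlev: "T (herm_level (herm_coeff \<phi>) k) = herm_pairing (\<lambda>\<mu>. T (hermite_fun \<mu>)) \<phi> k" for k
  proof -
    have 1: "T (\<lambda>x. herm_coeff \<phi> \<mu> * hermite_fun \<mu> x) = herm_coeff \<phi> \<mu> * T (hermite_fun \<mu>)" for \<mu>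
      using lin[unfolded linear_functional_on_def, THEN conjunct2, rule_format, OF hermite_fun_schwartz] .
    have "T (herm_level (herm_coeff \<phi>) k) = (\<Sum>\<mu>\<in>multi_indices k. T (\<lambda>x. herm_coeff \<phi> \<mu> * hermite_fun \<mu> x))"
      unfolding herm_level_def[abs_def]
      by (rule linear_functional_sum[OF lin]) (auto intro: schwartz_cmult hermite_fun_schwartz)
    then show ?thesis unfolding herm_pairing_def 1 .
  qed
  have TP: "T (P K) = (\<Sum>k<K. herm_pairing (\<lambda>\<mu>. T (hermite_fun \<mu>)) \<phi> k)" for K
  proof -
    have "T (P K) = (\<Sum>k<K. T (herm_level (herm_coeff \<phi>) k))"
      unfolding P_def[abs_def] by (rule linear_functional_sum[OF lin]) (auto intro: herm_level_schwartz)
    then show ?thesis unfolding Tlev .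
  qed
  have bound: "cmod (T \<phi> - T (P K)) <= \<bar>C\<bar> * (C' * (B / (1 + real K)))" for K
  proof -
    have coeff: "herm_coeff (\<lambda>x. \<phi> x - P K x) \<mu> = (if mi_size \<mu> < K then 0 else herm_coeff \<phi> \<mu>)" for \<mu>
    proof -
      have "herm_coeff (P K) \<mu> = (\<Sum>k<K. herm_coeff (herm_level (herm_coeff \<phi>) k) \<mu>)"
        unfolding P_def[abs_def] by (rule herm_coeff_sum) (auto intro: schwartz_rapid herm_level_schwartz)
      also have "... = (if mi_size \<mu> < K then herm_coeff \<phi> \<mu> else 0)"
        by (simp add: herm_coeff_level sum.delta)
      finally show ?thesis unfolding herm_coeff_diff[OF schwartz_rapid[OF \<phi>] schwartz_rapid[OF PS]] by simp
    qed
    have "coeff_bound M (B / (1 + real K)) (\<lambda>x. \<phi> x - P K x)"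
      unfolding coeff_bound_def coeff
    proof
      fix \<mu> :: "'n => nat"
      have B0: "B >= 0" using B[of \<mu>] mi_weight_nonneg[of \<mu>] by (meson mult_nonneg_nonneg norm_ge_zero order_trans zero_le_power)
      show "mi_weight \<mu> ^ M * cmod (if mi_size \<mu> < K then 0 else herm_coeff \<phi> \<mu>) <= B / (1 + real K)"
      proof (cases "mi_size \<mu> < K")
        case True
        then show ?thesis using B0 by simp
      next
        case False
        then have "real K <= real (mi_size \<mu>)" by (intro of_nat_mono) simp
        then have "1 + real K <= mi_weight \<mu>" unfolding mi_weight_def by linarith
        then have "(1 + real K) * (mi_weight \<mu> ^ M * cmod (herm_coeff \<phi> \<mu>)) <= mi_weight \<mu> * (mi_weight \<mu> ^ M * cmod (herm_coeff \<phi> \<mu>))"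
          by (intro mult_right_mono mult_nonneg_nonneg zero_le_power mi_weight_nonneg norm_ge_zero)
        also have "... <= B" using B[of \<mu>] by (simp add: mult.assoc)
        finally show ?thesis using False by (simp add: pos_le_divide_eq add_pos_nonneg mult.commute)
      qed
    qed
    then have "schwartz_seminorm N (\<lambda>x. \<phi> x - P K x) <= C' * (B / (1 + real K))"
      by (intro C'(2) schwartz_diff \<phi> PS)
    then have "\<bar>C\<bar> * schwartz_seminorm N (\<lambda>x. \<phi> x - P K x) <= \<bar>C\<bar> * (C' * (B / (1 + real K)))"
      by (intro mult_left_mono) auto
    moreover have "C * schwartz_seminorm N (\<lambda>x. \<phi> x - P K x) <= \<bar>C\<bar> * schwartz_seminorm N (\<lambda>x. \<phi> x - P K x)"
      by (rule mult_right_mono[OF abs_ge_self schwartz_seminorm_nonneg[OF schwartz_diff[OF \<phi> PS]]])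
    moreover have "cmod (T \<phi> - T (P K)) <= C * schwartz_seminorm N (\<lambda>x. \<phi> x - P K x)"
      using CN[OF schwartz_diff[OF \<phi> PS]] unfolding bounded_functional_diff[OF schwartz_continuous_bounded_functional[OF T] \<phi> PS] .
    ultimately show ?thesis by linarith
  qed
  have "(\<lambda>K. \<bar>C\<bar> * (C' * (B / (1 + real K)))) \<longlonglongrightarrow> 0"
    by (intro tendsto_mult_right_zero tendsto_divide_0[OF tendsto_const] filterlim_at_top_imp_at_infinity
        filterlim_tendsto_add_at_top[OF tendsto_const] filterlim_real_sequentially)
  then have "(\<lambda>K. T \<phi> - T (P K)) \<longlonglongrightarrow> 0"
    by (rule Lim_null_comparison[OF always_eventually[OF allI[OF bound]]])
  then have "(\<lambda>K. T \<phi> - (T \<phi> - T (P K))) \<longlonglongrightarrow> T \<phi> - 0"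
    by (rule tendsto_diff[OF tendsto_const])
  then show ?thesis unfolding sums_def TP[symmetric] by simp
qed

lemma herm_pairing_summable:
  assumes "slow_coeff d" "\<phi> \<in> schwartz_funs"
  shows "\<exists>C. \<forall>k. (\<Sum>\<mu>\<in>multi_indices k. cmod (herm_coeff \<phi> \<mu> * d \<mu>)) <= C / (1 + real k) ^ L"
proof -
  obtain D M where D: "D >= 0" "\<And>\<mu>. cmod (d \<mu>) <= D * mi_weight \<mu> ^ M" using assms(1) unfolding slow_coeff_def by blast
  obtain B where "\<And>\<mu>. mi_weight \<mu> ^ (M + CARD('a) + L) * cmod (herm_coeff \<phi> \<mu>) <= B"
    using fast_coeff_schwartz[OF assms(2)] unfolding fast_coeff_def by blast
  from level_sum_bound[OF this D(2) D(1)] show ?thesis by blast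
qed


section \<open>Kummer's function\<close>

definition kummer_coeff :: "real => real => nat => real" where
  "kummer_coeff a c p = pochhammer a p / (pochhammer c p * fact p)"

definition kummer :: "real => real => real => real" where
  "kummer a c x = (\<Sum>p. kummer_coeff a c p * x ^ p)"

lemma kummer_coeff_pos: "a > 0 ==> c > 0 ==> kummer_coeff a c p > 0"
  by (simp add: kummer_coeff_def pochhammer_pos)

lemma kummer_coeff_0: "kummer_coeff a c 0 = 1"
  by (simp add: kummer_coeff_def)

lemma kummer_coeff_Suc:
  assumes "c > 0"
  shows "kummer_coeff a c (Suc p) * ((c + real p) * (real p + 1)) = (a + real p) * kummer_coeff a c p"
proof -
  have "pochhammer c p \<noteq> 0" "c + real p \<noteq> 0" using pochhammer_pos[OF assms, of p] assms by auto
  then show ?thesis by (simp add: kummer_coeff_def pochhammer_Suc divide_simps)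
qed

lemma kummer_summable:
  assumes "a > 0" "c > 0"
  shows "summable (\<lambda>p. kummer_coeff a c p * x ^ p)"
proof -
  define m where "m = max 1 (a / c)"
  have m: "m >= 1" "a <= m * c" using assms by (auto simp: m_def field_simps max_def)
  obtain N :: nat where N: "2 * (m * \<bar>x\<bar>) <= real N" using real_arch_simple by blast
  show ?thesis
  proof (rule summable_ratio_test[of "1/2" N])
    fix p assume "p >= N"
    then have p: "2 * (m * \<bar>x\<bar>) <= real p + 1" using N by linarith
    have "a + real p <= m * (c + real p)" using m mult_right_mono[of 1 m "real p"] by (simp add: distrib_left)
    let ?k = "kummer_coeff a c p" and ?k' = "kummer_coeff a c (Suc p)"
    have k: "?k > 0" "?k' > 0" using kummer_coeff_pos assms by auto
    have "?k' * (real p + 1) * (c + real p) = (a + real p) * ?k"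
      using kummer_coeff_Suc[OF assms(2), of a p] by (simp add: mult_ac)
    also have "... <= (m * ?k) * (c + real p)"
      using \<open>a + real p <= m * (c + real p)\<close> k by (simp add: mult.commute mult_left_mono mult.left_commute)
    finally have "?k' * (real p + 1) <= m * ?k" using assms(2) by (simp add: mult_le_cancel_right_pos add_pos_nonneg)
    then have "(?k' * (real p + 1)) * \<bar>x\<bar> <= (m * ?k) * \<bar>x\<bar>" by (rule mult_right_mono) simp
    also have "... = ?k * (m * \<bar>x\<bar>)" by simp
    also have "... <= ?k * ((real p + 1) / 2)" using p k by (intro mult_left_mono) auto
    finally have "(?k' * \<bar>x\<bar>) * (real p + 1) <= (?k / 2) * (real p + 1)" by (simp add: mult_ac)
    then have "?k' * \<bar>x\<bar> <= ?k / 2" by (rule mult_right_le_imp_le) simp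
    then have "(?k' * \<bar>x\<bar>) * \<bar>x\<bar> ^ p <= (?k / 2) * \<bar>x\<bar> ^ p" by (rule mult_right_mono) simp
    then show "norm (?k' * x ^ Suc p) <= 1 / 2 * norm (?k * x ^ p)"
      using k by (simp add: abs_mult power_abs mult_ac)
  qed simp
qed

lemma kummer_sums:
  "a > 0 ==> c > 0 ==> (\<lambda>p. kummer_coeff a c p * x ^ p) sums kummer a c x"
  unfolding kummer_def by (rule summable_sums[OF kummer_summable])

lemma kummer_ge_1:
  assumes "a > 0" "c > 0" "x >= 0" shows "kummer a c x >= 1"
proof -
  have "(\<Sum>p<1. kummer_coeff a c p * x ^ p) <= kummer a c x"
    unfolding kummer_def
    by (rule sum_le_suminf[OF kummer_summable]) (auto intro!: mult_nonneg_nonneg zero_le_power less_imp_le[OF kummer_coeff_pos] simp: assms)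
  then show ?thesis by (simp add: kummer_coeff_0)
qed

definition kummer' :: "real => real => real => real" where
  "kummer' a c x = (\<Sum>p. diffs (kummer_coeff a c) p * x ^ p)"

definition kummer'' :: "real => real => real => real" where
  "kummer'' a c x = (\<Sum>p. diffs (diffs (kummer_coeff a c)) p * x ^ p)"

lemma kummer_has_derivative:
  assumes "a > 0" "c > 0"
  shows "(kummer a c has_real_derivative kummer' a c x) (at x)"
    and "(kummer' a c has_real_derivative kummer'' a c x) (at x)"
proof -
  show "(kummer a c has_real_derivative kummer' a c x) (at x)"
    unfolding kummer_def[abs_def] kummer'_def
    by (rule termdiffs_strong_converges_everywhere[OF kummer_summable[OF assms]])
  show "(kummer' a c has_real_derivative kummer'' a c x) (at x)"
    unfolding kummer'_def[abs_def] kummer''_def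
    by (rule termdiffs_strong_converges_everywhere[OF termdiff_converges_all[OF kummer_summable[OF assms]]])
qed

lemma kummer_ode:
  assumes "a > 0" "c > 0"
  shows "x * kummer'' a c x + (c - x) * kummer' a c x = a * kummer a c x"
proof -
  let ?k = "kummer_coeff a c"
  note s0 = kummer_summable[OF assms]
  note s1 = termdiff_converges_all[OF s0]
  note s2 = termdiff_converges_all[OF s1]
  have times_x: "(\<lambda>p. real p * e p * x ^ p) sums (x * (\<Sum>p. diffs e p * x ^ p))"
    if "summable (\<lambda>p. diffs e p * x ^ p)" for e
  proof -
    have "(\<lambda>p. x * (real p * e p * x ^ (p - Suc 0))) sums (x * (\<Sum>p. diffs e p * x ^ p))"
      by (rule sums_mult[OF diffs_equiv[OF that]])
    moreover have "x * (real p * e p * x ^ (p - Suc 0)) = real p * e p * x ^ p" for p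
      by (cases p) auto
    ultimately show ?thesis by simp
  qed
  have 1: "(\<lambda>p. real p * diffs ?k p * x ^ p) sums (x * kummer'' a c x)"
    unfolding kummer''_def by (rule times_x[OF s2])
  have 2: "(\<lambda>p. c * (diffs ?k p * x ^ p)) sums (c * kummer' a c x)"
    unfolding kummer'_def by (rule sums_mult[OF summable_sums[OF s1]])
  have 3: "(\<lambda>p. real p * ?k p * x ^ p) sums (x * kummer' a c x)"
    unfolding kummer'_def by (rule times_x[OF s1])
  have "(\<lambda>p. (real p * diffs ?k p * x ^ p + c * (diffs ?k p * x ^ p)) - real p * ?k p * x ^ p)
      sums ((x * kummer'' a c x + c * kummer' a c x) - x * kummer' a c x)"
    by (intro sums_diff sums_add 1 2 3)
  moreover have "(real p * diffs ?k p * x ^ p + c * (diffs ?k p * x ^ p)) - real p * ?k p * x ^ p = a * (?k p * x ^ p)" for p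
  proof -
    have "(real p + c) * diffs ?k p = (a + real p) * ?k p"
      using kummer_coeff_Suc[OF assms(2), of a p] by (simp add: diffs_def mult_ac add_ac)
    then have "((real p + c) * diffs ?k p) * x ^ p = ((a + real p) * ?k p) * x ^ p" by simp
    then show ?thesis by (simp add: algebra_simps)
  qed
  ultimately have A: "(\<lambda>p. a * (?k p * x ^ p)) sums ((x * kummer'' a c x + c * kummer' a c x) - x * kummer' a c x)"
    by simp
  have B: "(\<lambda>p. a * (?k p * x ^ p)) sums (a * kummer a c x)"
    by (rule sums_mult[OF kummer_sums[OF assms]])
  from sums_unique2[OF A B] show ?thesis by (simp add: left_diff_distrib)
qed

lemma kummer_tendsto_1:
  assumes "a > 0" "c > 0" shows "(kummer a c \<longlongrightarrow> 1) (at 0)"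
proof -
  have "isCont (kummer a c) 0" using kummer_has_derivative(1)[OF assms] by (rule DERIV_isCont)
  moreover have "kummer a c 0 = 1"
    using powser_zero[of "kummer_coeff a c"] by (simp add: kummer_def kummer_coeff_0)
  ultimately show ?thesis by (simp add: isCont_def)
qed

text \<open>An upper bound of order \<open>exp (const * sqrt a)\<close>: for every \<open>0 < r < 1\<close> each term \<open>(a)\<^sub>p r\<^sup>p / p!\<close> of the
  binomial series is at most its sum \<open>(1 - r) powr (- a)\<close>; the choice \<open>r = 1 / (2 sqrt (a + 1))\<close>
  balances this against \<open>exp (x / r)\<close>.\<close>

lemma kummer_upper_bound:
  assumes a: "a > 0" and c: "c >= 1" and x: "x >= 0"
  shows "kummer a c x <= exp (2 * (x + 1) * sqrt (a + 1))"
proof -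
  define R where "R = sqrt (a + 1)"
  have R: "R > 1" "R * R = a + 1" using a by (auto simp: R_def)
  define r where "r = 1 / (2 * R)"
  have r: "0 < r" "r < 1 / 2" using R by (auto simp: r_def field_simps)
  define E where "E = (1 - r) powr (- a)"
  have bin: "(\<lambda>p. pochhammer a p / fact p * r ^ p) sums E"
  proof -
    have "(\<lambda>p. ((- a) gchoose p) * (- r) ^ p) sums (1 + (- r)) powr (- a)"
      by (rule gen_binomial_real) (use r in auto)
    moreover have "((- a) gchoose p) * (- r) ^ p = pochhammer a p / fact p * r ^ p" for p
      unfolding gbinomial_pochhammer power_minus[of r] by (simp add: power_mult_distrib[symmetric])
    ultimately show ?thesis by (simp add: E_def)
  qed
  have Ebound: "E <= exp R"
  proof -
    have "ln (1 - r) >= - r - 2 * r^2" using r by (intro ln_one_minus_pos_lower_bound) auto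
    then have "- a * ln (1 - r) <= a * (r + 2 * r^2)" using a mult_left_mono[of "- r - 2 * r^2" "ln (1 - r)" a] by (simp add: algebra_simps)
    also have "... <= a * (2 * r)"
      using r a by (intro mult_left_mono) (auto simp: power2_eq_square)
    also have "... <= (a + 1) * (2 * r)" using r by simp
    also have "... = R" using R unfolding r_def by (simp flip: R(2))
    finally show ?thesis using r by (simp add: E_def powr_def)
  qed
  have trm: "kummer_coeff a c p * x ^ p <= E * (inverse (fact p) * (x / r) ^ p)" for p
  proof -
    have "pochhammer a p / fact p * r ^ p <= E"
    proof -
      have "(\<Sum>i<Suc p. pochhammer a i / fact i * r ^ i) <= E"
        unfolding sums_unique[OF bin]
        by (rule sum_le_suminf[OF sums_summable[OF bin]])
          (use r a in \<open>auto intro!: mult_nonneg_nonneg divide_nonneg_nonneg less_imp_le[OF pochhammer_pos]\<close>)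
      moreover have "(\<Sum>i<p. pochhammer a i / fact i * r ^ i) >= 0"
        using r a by (intro sum_nonneg mult_nonneg_nonneg divide_nonneg_nonneg less_imp_le[OF pochhammer_pos]) auto
      ultimately show ?thesis by simp
    qed
    then have 1: "pochhammer a p / fact p <= E / r ^ p" using r by (simp add: pos_le_divide_eq)
    have "(fact p :: real) = pochhammer 1 p" by (simp add: pochhammer_fact)
    also have "... <= pochhammer c p"
      unfolding pochhammer_prod using c by (intro prod_mono) auto
    finally have 2: "fact p <= pochhammer c p" .
    have "kummer_coeff a c p = pochhammer a p / fact p * (1 / pochhammer c p)"
      by (simp add: kummer_coeff_def)
    also have "... <= E / r ^ p * (1 / fact p)"
    proof (rule mult_mono[OF 1])
      show "1 / pochhammer c p <= 1 / fact p" using 2 pochhammer_pos[of c p] c by (intro divide_left_mono mult_pos_pos) auto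
      show "0 <= E / r ^ p" using r by (simp add: E_def)
      show "0 <= 1 / pochhammer c p" using c by (auto intro!: divide_nonneg_nonneg less_imp_le[OF pochhammer_pos])
    qed
    finally have "kummer_coeff a c p * x ^ p <= E / r ^ p * (1 / fact p) * x ^ p"
      using x by (intro mult_right_mono) auto
    also have "... = E * (inverse (fact p) * (x / r) ^ p)" by (simp add: divide_inverse power_mult_distrib power_inverse mult_ac)
    finally show ?thesis .
  qed
  have es: "(\<lambda>p. inverse (fact p) * (x / r) ^ p) sums exp (x / r)"
    using exp_converges[of "x / r"] by (simp add: scaleR_conv_of_real)
  have "kummer a c x <= E * exp (x / r)"
    unfolding kummer_def sums_unique[OF sums_mult[OF es, of E]]
    by (rule suminf_le[OF trm kummer_summable sums_summable[OF sums_mult[OF es]]]) (use a c in auto)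
  also have "... <= exp R * exp (x / r)" by (intro mult_right_mono Ebound) auto
  also have "... = exp (R + 2 * x * R)" using R by (simp add: r_def exp_add)
  also have "... <= exp (2 * (x + 1) * R)" using R x by (simp add: algebra_simps)
  finally show ?thesis by (simp add: R_def)
qed

text \<open>As \<open>(a)\<^sub>p \<ge> a\<^sup>p\<close> and \<open>(c)\<^sub>p p! \<le> 4\<^sup>p (2p)!\<close>, the series dominates that of \<open>cosh (sqrt (a x) / 2)\<close>.\<close>

lemma kummer_lower_bound:
  assumes a: "a > 0" and c: "0 < c" "c <= 2" and x: "x >= 0"
  shows "exp (sqrt (a * x) / 2) / 2 <= kummer a c x"
proof -
  define y where "y = sqrt (a * x)"
  have y: "y >= 0" "y^2 = a * x" using a x by (auto simp: y_def)
  have trm: "(if even n then (y / 2) ^ n /\<^sub>R fact n else 0) <= (if even n then kummer_coeff a c (n div 2) * x ^ (n div 2) else 0)" for n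
  proof (cases "even n")
    case True
    then obtain p where n: "n = 2 * p" by (elim evenE)
    have 1: "a ^ p <= pochhammer a p"
    proof -
      have "a ^ p = (\<Prod>i = 0..<p. a)" by simp
      also have "... <= (\<Prod>i = 0..<p. a + of_nat i)" using a by (intro prod_mono) auto
      finally show ?thesis by (simp add: pochhammer_prod)
    qed
    have 2: "pochhammer c p * fact p <= 4 ^ p * fact (2 * p)"
    proof -
      have A: "pochhammer c p <= pochhammer 2 p"
        unfolding pochhammer_prod using c by (intro prod_mono) auto
      have B: "pochhammer 2 p = (fact (Suc p) :: real)"
        by (induction p) (simp_all add: pochhammer_Suc)
      have D: "(fact (Suc p) :: real) * fact p <= 4 ^ p * fact (2 * p)"
      proof (induction p)
        case (Suc p)
        have "(fact (Suc (Suc p)) :: real) * fact (Suc p) = ((real p + 2) * (real p + 1)) * (fact (Suc p) * fact p)"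
          by (simp add: algebra_simps)
        also have "... <= (4 * ((2 * real p + 2) * (2 * real p + 1))) * (4 ^ p * fact (2 * p))"
          by (rule mult_mono[OF _ Suc.IH]) (auto simp: algebra_simps)
        also have "... = 4 ^ Suc p * fact (2 * Suc p)" by (simp add: algebra_simps)
        finally show ?case .
      qed simp
      have "pochhammer c p * fact p <= fact (Suc p) * fact p"
        using A unfolding B by (intro mult_right_mono) auto
      then show ?thesis using D by (rule order_trans)
    qed
    have "(y / 2) ^ n /\<^sub>R fact n = a ^ p * x ^ p / (4 ^ p * fact (2 * p))"
      unfolding n by (simp add: power_mult power_divide y power_mult_distrib divide_simps)
    also have "... <= pochhammer a p * x ^ p / (pochhammer c p * fact p)"
      using 1 2 a x c by (intro frac_le mult_right_mono mult_nonneg_nonneg) (auto intro!: mult_pos_pos pochhammer_pos less_imp_le[OF pochhammer_pos])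
    also have "... = kummer_coeff a c p * x ^ p" by (simp add: kummer_coeff_def)
    finally show ?thesis by (simp add: n)
  qed simp
  have "(\<lambda>n. if even n then (y / 2) ^ n /\<^sub>R fact n else 0) sums cosh (y / 2)" by (rule cosh_converges)
  moreover have "(\<lambda>n. if even n then kummer_coeff a c (n div 2) * x ^ (n div 2) else 0) sums kummer a c x"
  proof -
    have z: "(if even n then kummer_coeff a c (n div 2) * x ^ (n div 2) else 0) = 0" if "n \<notin> range (\<lambda>p. 2 * p)" for n
      using that by (auto elim!: evenE)
    have "strict_mono (\<lambda>p::nat. 2 * p)" by (simp add: strict_mono_def)
    from sums_mono_reindex[of _ "\<lambda>n. if even n then kummer_coeff a c (n div 2) * x ^ (n div 2) else 0" "kummer a c x", OF this z]
    have "(\<lambda>p. kummer_coeff a c p * x ^ p) sums kummer a c x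
        \<longleftrightarrow> (\<lambda>n. if even n then kummer_coeff a c (n div 2) * x ^ (n div 2) else 0) sums kummer a c x"
      by simp
    then show ?thesis using kummer_sums[OF a c(1)] by simp
  qed
  ultimately have "cosh (y / 2) <= kummer a c x" by (rule sums_le[OF trm])
  moreover have "exp (y / 2) / 2 <= cosh (y / 2)" by (simp add: cosh_def)
  ultimately show ?thesis by (simp add: y_def)
qed

section \<open>Comparison of power series at infinity\<close>

text \<open>By weighted arithmetic and geometric means, \<open>x\<^sup>s u\<^sub>p\<^sup>1\<^sup>-\<^sup>s u\<^sub>p\<^sub>+\<^sub>1\<^sup>s x\<^sup>p\<close> is at most
  \<open>(1 - s) u\<^sub>p x\<^sup>p + s u\<^sub>p\<^sub>+\<^sub>1 x\<^sup>p\<^sup>+\<^sup>1\<close>, and both sums are at most the full series. This handles the shift by a non-integer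
  power without asymptotic expansions. Finitely many terms are of lower order as \<open>s < 1\<close>.\<close>

lemma powser_comparison:
  fixes u v :: "nat => real"
  assumes s: "0 < s" "s < 1" and u: "\<And>p. u p > 0" and v: "\<And>p. v p > 0"
    and su: "\<And>x. summable (\<lambda>p. u p * x ^ p)" and sv: "\<And>x. summable (\<lambda>p. v p * x ^ p)"
    and lim: "(\<lambda>p. v p / (u p powr (1 - s) * u (Suc p) powr s)) \<longlonglongrightarrow> 1" and \<epsilon>: "\<epsilon> > 0"
  shows "\<forall>\<^sub>F x in at_top. x powr s * (\<Sum>p. v p * x ^ p) <= (1 + \<epsilon>) * (\<Sum>p. u p * x ^ p)"
proof -
  have "\<forall>\<^sub>F p in sequentially. v p / (u p powr (1 - s) * u (Suc p) powr s) < 1 + \<epsilon> / 2"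
    by (rule order_tendstoD(2)[OF lim]) (use \<epsilon> in simp)
  then obtain P where P: "\<And>p. p >= P ==> v p / (u p powr (1 - s) * u (Suc p) powr s) < 1 + \<epsilon> / 2"
    unfolding eventually_sequentially by blast
  have vP: "v p <= (1 + \<epsilon> / 2) * (u p powr (1 - s) * u (Suc p) powr s)" if "p >= P" for p
    using P[OF that] u[of p] u[of "Suc p"] by (simp add: divide_less_eq less_imp_le)
  define V where "V = (\<Sum>p<P. v p)"
  have V: "V >= 0" unfolding V_def by (intro sum_nonneg less_imp_le v)
  define x0 where "x0 = max 1 ((2 * V / (\<epsilon> * u P)) powr (1 / (1 - s)))"
  have "x powr s * (\<Sum>p. v p * x ^ p) <= (1 + \<epsilon>) * (\<Sum>p. u p * x ^ p)" if x: "x >= x0" for x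
  proof -
    have x1: "x >= 1" using x by (simp add: x0_def)
    define U where "U = (\<Sum>p. u p * x ^ p)"
    have upos: "0 <= u p * x ^ p" for p using u[of p] x1 by (intro mult_nonneg_nonneg) auto
    have head: "x powr s * (\<Sum>p<P. v p * x ^ p) <= \<epsilon> / 2 * U"
    proof (cases "P = 0")
      case True
      have "0 <= U" unfolding U_def by (rule suminf_nonneg[OF su upos])
      then show ?thesis using \<epsilon> True by simp
    next
      case False
      have "(\<Sum>p<P. v p * x ^ p) <= (\<Sum>p<P. v p * x ^ (P - 1))"
        using x1 v by (intro sum_mono mult_left_mono power_increasing) (auto intro: less_imp_le)
      then have "x powr s * (\<Sum>p<P. v p * x ^ p) <= x powr s * (V * x ^ (P - 1))"
        by (intro mult_left_mono) (auto simp: V_def sum_distrib_right)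
      also have "... = V * (x powr s * x ^ (P - 1))" by simp
      also have "x powr s * x ^ (P - 1) = x ^ P / x powr (1 - s)"
      proof -
        have "x powr s * x powr (1 - s) = x" using x1 by (simp flip: powr_add)
        then have "(x powr s * x ^ (P - 1)) * x powr (1 - s) = x ^ (P - 1) * x" by (simp add: mult_ac)
        also have "... = x ^ P" using False by (simp flip: power_Suc2)
        finally show ?thesis using x1 by (simp add: eq_divide_eq)
      qed
      also have "V * (x ^ P / x powr (1 - s)) <= \<epsilon> / 2 * (u P * x ^ P)"
      proof -
        have "2 * V / (\<epsilon> * u P) <= x powr (1 - s)"
        proof (cases "V = 0")
          case False
          then have q: "2 * V / (\<epsilon> * u P) > 0" using V \<epsilon> u[of P] by simp
          have "((2 * V / (\<epsilon> * u P)) powr (1 / (1 - s))) powr (1 - s) <= x powr (1 - s)"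
            using x s by (intro powr_mono2) (auto simp: x0_def)
          then show ?thesis using q s V \<epsilon> u[of P] by (simp add: powr_powr abs_mult)
        qed simp
        then have "V <= \<epsilon> / 2 * u P * x powr (1 - s)" using \<epsilon> u[of P] by (simp add: field_simps)
        then have "V * x ^ P <= (\<epsilon> / 2 * u P * x powr (1 - s)) * x ^ P" using x1 by (intro mult_right_mono) auto
        then show ?thesis using x1 by (simp add: field_simps)
      qed
      also have "... <= \<epsilon> / 2 * U"
      proof -
        have "(\<Sum>p<Suc P. u p * x ^ p) <= U" unfolding U_def by (rule sum_le_suminf[OF su]) (use upos in auto)
        moreover have "0 <= (\<Sum>p<P. u p * x ^ p)" by (intro sum_nonneg upos)
        ultimately have "u P * x ^ P <= U" by simp
        then show ?thesis using \<epsilon> by (intro mult_left_mono) auto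
      qed
      finally show ?thesis .
    qed
    have tail: "x powr s * (\<Sum>p. v (p + P) * x ^ (p + P)) <= (1 + \<epsilon> / 2) * U"
    proof -
      have su': "summable (\<lambda>p. u (p + P) * x ^ (p + P))" "summable (\<lambda>p. u (Suc p + P) * x ^ (Suc p + P))"
        using summable_ignore_initial_segment[OF su, of P] summable_ignore_initial_segment[OF su, of "Suc P"] by auto
      have le: "x powr s * (v (p + P) * x ^ (p + P))
          <= (1 + \<epsilon> / 2) * ((1 - s) * (u (p + P) * x ^ (p + P)) + s * (u (Suc p + P) * x ^ (Suc p + P)))" for p
      proof -
        let ?q = "p + P"
        have "x powr s * (v ?q * x ^ ?q) <= x powr s * (((1 + \<epsilon> / 2) * (u ?q powr (1 - s) * u (Suc ?q) powr s)) * x ^ ?q)"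
          using x1 by (intro mult_left_mono mult_right_mono vP) auto
        also have "... = (1 + \<epsilon> / 2) * ((u ?q * x ^ ?q) powr (1 - s) * (u (Suc ?q) * x ^ Suc ?q) powr s)"
        proof -
          have "(u ?q * x ^ ?q) powr (1 - s) * (u (Suc ?q) * x ^ Suc ?q) powr s
              = u ?q powr (1 - s) * u (Suc ?q) powr s * ((x ^ ?q) powr (1 - s) * (x ^ ?q * x) powr s)"
            using u x1 by (simp add: powr_mult mult_ac)
          also have "(x ^ ?q) powr (1 - s) * (x ^ ?q * x) powr s = ((x ^ ?q) powr (1 - s) * (x ^ ?q) powr s) * x powr s"
            using x1 by (simp add: powr_mult)
          also have "(x ^ ?q) powr (1 - s) * (x ^ ?q) powr s = x ^ ?q"
            using x1 by (simp flip: powr_add)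
          finally show ?thesis by (simp only: mult_ac)
        qed
        also have "... <= (1 + \<epsilon> / 2) * ((1 - s) * (u ?q * x ^ ?q) + s * (u (Suc ?q) * x ^ Suc ?q))"
          using s u x1 \<epsilon> by (intro mult_left_mono Youngs_inequality_0) auto
        finally show ?thesis by simp
      qed
      have "x powr s * (\<Sum>p. v (p + P) * x ^ (p + P)) = (\<Sum>p. x powr s * (v (p + P) * x ^ (p + P)))"
        by (rule suminf_mult[symmetric, OF summable_ignore_initial_segment[OF sv]])
      also have "... <= (\<Sum>p. (1 + \<epsilon> / 2) * ((1 - s) * (u (p + P) * x ^ (p + P)) + s * (u (Suc p + P) * x ^ (Suc p + P))))"
        by (rule suminf_le[OF le]) (intro summable_mult summable_add su' summable_ignore_initial_segment sv)+
      also have "... = (1 + \<epsilon> / 2) * ((1 - s) * (\<Sum>p. u (p + P) * x ^ (p + P)) + s * (\<Sum>p. u (Suc p + P) * x ^ (Suc p + P)))"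
        using su' by (simp add: suminf_mult suminf_add[symmetric] summable_mult summable_add)
      also have "... <= (1 + \<epsilon> / 2) * ((1 - s) * U + s * U)"
      proof -
        have shift: "(\<Sum>p. u (p + m) * x ^ (p + m)) <= U" for m
          unfolding U_def suminf_split_initial_segment[OF su[of x], of m] using sum_nonneg[of "{..<m}" "\<lambda>p. u p * x ^ p", OF upos] by simp
        show ?thesis using shift[of P] shift[of "Suc P"] s \<epsilon> by (intro mult_left_mono add_mono) auto
      qed
      finally show ?thesis by (simp add: algebra_simps)
    qed
    have "(\<Sum>p. v p * x ^ p) = (\<Sum>p. v (p + P) * x ^ (p + P)) + (\<Sum>p<P. v p * x ^ p)"
      by (rule suminf_split_initial_segment[OF sv])
    then show ?thesis using head tail by (simp add: U_def[symmetric] distrib_left distrib_right)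
  qed
  then show ?thesis unfolding eventually_at_top_linorder by blast
qed

lemma pochhammer_ratio_tendsto:
  assumes "a > 0" "b > 0"
  shows "(\<lambda>p. pochhammer a p / pochhammer b p * real p powr (b - a)) \<longlonglongrightarrow> Gamma b / Gamma (a::real)"
proof -
  have "(\<lambda>p. Gamma_series' b p / Gamma_series' a p) \<longlonglongrightarrow> Gamma b / Gamma a"
    using Gamma_real_pos[OF assms(1)] by (intro tendsto_divide Gamma_series'_LIMSEQ) auto
  moreover have "\<forall>\<^sub>F p in sequentially. Gamma_series' b p / Gamma_series' a p = pochhammer a p / pochhammer b p * real p powr (b - a)"
    using eventually_gt_at_top[of 0]
  proof eventually_elim
    case (elim p)
    have "exp (b * ln (real p)) / exp (a * ln (real p)) = real p powr (b - a)"
      using elim by (simp add: powr_def left_diff_distrib flip: exp_diff)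
    then show ?case using pochhammer_pos[OF assms(1), of p] pochhammer_pos[OF assms(2), of p]
      by (simp add: Gamma_series'_def field_simps)
  qed
  ultimately show ?thesis by (rule Lim_transform_eventually)
qed


section \<open>The radial equation\<close>

definition radial_sol :: "real => real => (real => real) => (real => real) => bool" where
  "radial_sol s l y y' \<longleftrightarrow> (\<forall>\<rho>>0. (y has_real_derivative y' \<rho>) (at \<rho>) \<and>
     (y' has_real_derivative ((l + \<rho>^2 / 4) * y \<rho> - (1 - 2 * s) / \<rho> * y' \<rho>)) (at \<rho>))"

lemma radial_solD:
  assumes "radial_sol s l y y'" "\<rho> > 0"
  shows "(y has_real_derivative y' \<rho>) (at \<rho>)"
    and "(y' has_real_derivative ((l + \<rho>^2 / 4) * y \<rho> - (1 - 2 * s) / \<rho> * y' \<rho>)) (at \<rho>)"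
  using assms by (auto simp: radial_sol_def)

lemma radial_sol_lin:
  assumes "radial_sol s l y y'" "radial_sol s l z z'"
  shows "radial_sol s l (\<lambda>\<rho>. a * y \<rho> + b * z \<rho>) (\<lambda>\<rho>. a * y' \<rho> + b * z' \<rho>)"
  unfolding radial_sol_def
proof (intro allI impI conjI)
  fix \<rho> :: real assume \<rho>: "\<rho> > 0"
  note d = radial_solD[OF assms(1) \<rho>] radial_solD[OF assms(2) \<rho>]
  show "((\<lambda>\<rho>. a * y \<rho> + b * z \<rho>) has_real_derivative a * y' \<rho> + b * z' \<rho>) (at \<rho>)"
    by (intro DERIV_add DERIV_cmult d)
  have "((\<lambda>\<rho>. a * y' \<rho> + b * z' \<rho>) has_real_derivative
      a * ((l + \<rho>^2 / 4) * y \<rho> - (1 - 2 * s) / \<rho> * y' \<rho>) + b * ((l + \<rho>^2 / 4) * z \<rho> - (1 - 2 * s) / \<rho> * z' \<rho>)) (at \<rho>)"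
    by (intro DERIV_add DERIV_cmult d)
  then show "((\<lambda>\<rho>. a * y' \<rho> + b * z' \<rho>) has_real_derivative
      (l + \<rho>^2 / 4) * (a * y \<rho> + b * z \<rho>) - (1 - 2 * s) / \<rho> * (a * y' \<rho> + b * z' \<rho>)) (at \<rho>)"
  proof (rule DERIV_cong)
    define k where "k = (1 - 2 * s) / \<rho>"
    show "a * ((l + \<rho>^2 / 4) * y \<rho> - (1 - 2 * s) / \<rho> * y' \<rho>) + b * ((l + \<rho>^2 / 4) * z \<rho> - (1 - 2 * s) / \<rho> * z' \<rho>)
        = (l + \<rho>^2 / 4) * (a * y \<rho> + b * z \<rho>) - (1 - 2 * s) / \<rho> * (a * y' \<rho> + b * z' \<rho>)"
      unfolding k_def[symmetric] by (simp add: algebra_simps)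
  qed
qed

text \<open>In the variable \<open>x = \<rho>^2 / 2\<close> the radial equation becomes \<open>x G'' + (1 - s) G' = (l / 2 + x / 4) G\<close>,
  and a product \<open>G = P * F\<close> with \<open>P' = h * P\<close> is handled at once for both Kummer solutions.\<close>

lemma radial_sol_of_product:
  assumes P: "\<And>x. x > 0 ==> (P has_real_derivative h x * P x) (at x)"
    and h: "\<And>x. x > 0 ==> (h has_real_derivative h' x) (at x)"
    and F: "\<And>x. (F has_real_derivative F' x) (at x)" "\<And>x. (F' has_real_derivative F'' x) (at x)"
    and ode: "\<And>x. x > 0 ==> x * (F'' x + 2 * h x * F' x + ((h x)^2 + h' x) * F x)
        + (1 - s) * (F' x + h x * F x) = (l / 2 + x / 4) * F x"
  shows "radial_sol s l (\<lambda>\<rho>. P (\<rho>^2 / 2) * F (\<rho>^2 / 2))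
      (\<lambda>\<rho>. \<rho> * (P (\<rho>^2 / 2) * (F' (\<rho>^2 / 2) + h (\<rho>^2 / 2) * F (\<rho>^2 / 2))))"
  unfolding radial_sol_def
proof (intro allI impI conjI)
  fix \<rho> :: real assume \<rho>: "\<rho> > 0"
  define x where "x = \<rho>^2 / 2"
  have x: "x > 0" using \<rho> by (simp add: x_def)
  have dx: "((\<lambda>\<rho>. \<rho>^2 / 2) has_real_derivative \<rho>) (at \<rho>)" by (auto intro!: derivative_eq_intros)
  have chain: "((\<lambda>\<rho>. f (\<rho>^2 / 2)) has_real_derivative f' * \<rho>) (at \<rho>)"
    if "(f has_real_derivative f') (at x)" for f f'
    using DERIV_chain2[OF that[unfolded x_def] dx] .
  have G: "((\<lambda>x. P x * F x) has_real_derivative P x * (F' x + h x * F x)) (at x)"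
    by (rule DERIV_cong[OF DERIV_mult[OF P[OF x] F(1)]]) (simp add: algebra_simps)
  show "((\<lambda>\<rho>. P (\<rho>^2 / 2) * F (\<rho>^2 / 2)) has_real_derivative
      \<rho> * (P (\<rho>^2 / 2) * (F' (\<rho>^2 / 2) + h (\<rho>^2 / 2) * F (\<rho>^2 / 2)))) (at \<rho>)"
    by (rule DERIV_cong[OF chain[OF G]]) (simp add: x_def mult.commute)
  have G1: "((\<lambda>x. P x * (F' x + h x * F x)) has_real_derivative
      P x * (F'' x + 2 * h x * F' x + ((h x)^2 + h' x) * F x)) (at x)"
    by (rule DERIV_cong[OF DERIV_mult[OF P[OF x] DERIV_add[OF F(2) DERIV_mult[OF h[OF x] F(1)]]]])
      (simp add: algebra_simps power2_eq_square)
  have "((\<lambda>\<rho>. \<rho> * (P (\<rho>^2 / 2) * (F' (\<rho>^2 / 2) + h (\<rho>^2 / 2) * F (\<rho>^2 / 2)))) has_real_derivative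
      1 * (P (\<rho>^2 / 2) * (F' (\<rho>^2 / 2) + h (\<rho>^2 / 2) * F (\<rho>^2 / 2)))
      + (P x * (F'' x + 2 * h x * F' x + ((h x)^2 + h' x) * F x) * \<rho>) * \<rho>) (at \<rho>)"
    by (rule DERIV_mult[OF DERIV_ident chain[OF G1]])
  moreover have "1 * (P (\<rho>^2 / 2) * (F' (\<rho>^2 / 2) + h (\<rho>^2 / 2) * F (\<rho>^2 / 2)))
      + (P x * (F'' x + 2 * h x * F' x + ((h x)^2 + h' x) * F x) * \<rho>) * \<rho>
    = (l + \<rho>^2 / 4) * (P (\<rho>^2 / 2) * F (\<rho>^2 / 2))
      - (1 - 2 * s) / \<rho> * (\<rho> * (P (\<rho>^2 / 2) * (F' (\<rho>^2 / 2) + h (\<rho>^2 / 2) * F (\<rho>^2 / 2))))"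
  proof -
    define X Y W K where abbr: "X = F'' x + 2 * h x * F' x + ((h x)^2 + h' x) * F x"
      "Y = F' x + h x * F x" "W = P x" "K = F x"
    have r: "\<rho> * \<rho> = 2 * x" "\<rho>^2 / 4 = x / 2" by (simp_all add: x_def power2_eq_square)
    have "x * X + (1 - s) * Y = (l / 2 + x / 4) * K" unfolding abbr by (rule ode[OF x])
    then have o: "2 * (x * X) = (l + x / 2) * K - 2 * (1 - s) * Y" by (simp add: algebra_simps)
    have "1 * (W * Y) + (W * X * \<rho>) * \<rho> = W * Y + W * X * (\<rho> * \<rho>)" by (simp only: mult_1 mult.assoc)
    also have "... = W * Y + W * (2 * (x * X))" unfolding r by simp
    also have "... = (l + x / 2) * (W * K) - (1 - 2 * s) * (W * Y)" unfolding o by (simp add: algebra_simps)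
    also have "(1 - 2 * s) * (W * Y) = (1 - 2 * s) / \<rho> * (\<rho> * (W * Y))" using \<rho> by simp
    finally show ?thesis unfolding x_def[symmetric] r(2) abbr .
  qed
  ultimately show "((\<lambda>\<rho>. \<rho> * (P (\<rho>^2 / 2) * (F' (\<rho>^2 / 2) + h (\<rho>^2 / 2) * F (\<rho>^2 / 2)))) has_real_derivative
      (l + \<rho>^2 / 4) * (P (\<rho>^2 / 2) * F (\<rho>^2 / 2))
      - (1 - 2 * s) / \<rho> * (\<rho> * (P (\<rho>^2 / 2) * (F' (\<rho>^2 / 2) + h (\<rho>^2 / 2) * F (\<rho>^2 / 2))))) (at \<rho>)"
    by (simp only:)
qed

text \<open>Multiplying \<open>grow\<close> and \<open>reg\<close> by suitable powers gives the two functions \<open>M\<^sub>\<kappa>\<^sub>,\<^sub>\<plusminus>\<^sub>s\<^sub>/\<^sub>2\<close>. Both grow at infinity; \<open>dec\<close> is the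
  combination in which the leading terms cancel. Primed names are derivatives in \<open>\<rho>\<close>.\<close>

locale radial =
  fixes s l :: real
  assumes s: "0 < s" "s < 1" and l: "l >= 1"
begin

definition A :: real where "A = (1 + s + l) / 2"
definition A' :: real where "A' = (1 - s + l) / 2"

lemma A_pos: "A > 0" "A' > 0" "A = A' + s"
  using s l by (auto simp: A_def A'_def field_simps)

definition grow :: "real => real" where
  "grow \<rho> = exp (- (\<rho>^2 / 2) / 2) * (\<rho>^2 / 2) powr s * kummer A (1 + s) (\<rho>^2 / 2)"

definition grow' :: "real => real" where
  "grow' \<rho> = \<rho> * (exp (- (\<rho>^2 / 2) / 2) * (\<rho>^2 / 2) powr s *
     (kummer' A (1 + s) (\<rho>^2 / 2) + (s / (\<rho>^2 / 2) - 1 / 2) * kummer A (1 + s) (\<rho>^2 / 2)))"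

definition reg :: "real => real" where
  "reg \<rho> = exp (- (\<rho>^2 / 2) / 2) * kummer A' (1 - s) (\<rho>^2 / 2)"

definition reg' :: "real => real" where
  "reg' \<rho> = \<rho> * (exp (- (\<rho>^2 / 2) / 2) *
     (kummer' A' (1 - s) (\<rho>^2 / 2) + (- 1 / 2) * kummer A' (1 - s) (\<rho>^2 / 2)))"

lemma grow_sol: "radial_sol s l grow grow'"
proof -
  have "radial_sol s l (\<lambda>\<rho>. (\<lambda>x. exp (- x / 2) * x powr s) (\<rho>^2 / 2) * kummer A (1 + s) (\<rho>^2 / 2))
      (\<lambda>\<rho>. \<rho> * ((\<lambda>x. exp (- x / 2) * x powr s) (\<rho>^2 / 2) * (kummer' A (1 + s) (\<rho>^2 / 2)
         + (\<lambda>x. s / x - 1 / 2) (\<rho>^2 / 2) * kummer A (1 + s) (\<rho>^2 / 2))))"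
  proof (rule radial_sol_of_product[where h' = "\<lambda>x. - s / x^2" and F'' = "kummer'' A (1 + s)"])
    fix x :: real assume x: "x > 0"
    have "((\<lambda>x. exp (- x / 2) * x powr s) has_real_derivative
        (- 1 / 2 * exp (- x / 2)) * x powr s + (s * x powr (s - 1)) * exp (- x / 2)) (at x)"
      by (rule DERIV_mult) (use x in \<open>auto intro!: derivative_eq_intros\<close>)
    moreover have "x powr (s - 1) = x powr s / x" using x by (simp add: powr_diff)
    ultimately show "((\<lambda>x. exp (- x / 2) * x powr s) has_real_derivative (s / x - 1 / 2) * (exp (- x / 2) * x powr s)) (at x)"
      by (simp add: algebra_simps)
    show "((\<lambda>x. s / x - 1 / 2) has_real_derivative - s / x^2) (at x)"
      using x by (auto intro!: derivative_eq_intros simp: power2_eq_square)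
    define K K1 K2 where K: "K = kummer A (1 + s) x" "K1 = kummer' A (1 + s) x" "K2 = kummer'' A (1 + s) x"
    have o: "x * K2 + ((1 + s) - x) * K1 = A * K"
      unfolding K by (rule kummer_ode) (use A_pos s in auto)
    have "x * (K2 + 2 * (s / x - 1 / 2) * K1 + ((s / x - 1 / 2)^2 + - s / x^2) * K) + (1 - s) * (K1 + (s / x - 1 / 2) * K)
        = (x * K2 + ((1 + s) - x) * K1) + (x / 4 - (1 + s) / 2) * K"
      using x by (simp add: field_simps power2_eq_square)
    also have "... = (l / 2 + x / 4) * K" unfolding o by (simp add: A_def algebra_simps add_divide_distrib)
    finally show "x * (kummer'' A (1 + s) x + 2 * (s / x - 1 / 2) * kummer' A (1 + s) x
        + ((s / x - 1 / 2)^2 + - s / x^2) * kummer A (1 + s) x)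
        + (1 - s) * (kummer' A (1 + s) x + (s / x - 1 / 2) * kummer A (1 + s) x) = (l / 2 + x / 4) * kummer A (1 + s) x"
      unfolding K .
  qed (use kummer_has_derivative A_pos s in auto)
  then show ?thesis unfolding grow_def[abs_def] grow'_def[abs_def] .
qed

lemma reg_sol: "radial_sol s l reg reg'"
proof -
  have "radial_sol s l (\<lambda>\<rho>. (\<lambda>x. exp (- x / 2)) (\<rho>^2 / 2) * kummer A' (1 - s) (\<rho>^2 / 2))
      (\<lambda>\<rho>. \<rho> * ((\<lambda>x. exp (- x / 2)) (\<rho>^2 / 2) * (kummer' A' (1 - s) (\<rho>^2 / 2)
         + (\<lambda>x. - 1 / 2) (\<rho>^2 / 2) * kummer A' (1 - s) (\<rho>^2 / 2))))"
  proof (rule radial_sol_of_product[where h' = "\<lambda>x. 0" and F'' = "kummer'' A' (1 - s)"])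
    fix x :: real assume x: "x > 0"
    show "((\<lambda>x. exp (- x / 2)) has_real_derivative - 1 / 2 * exp (- x / 2)) (at x)"
      by (auto intro!: derivative_eq_intros)
    show "((\<lambda>x. - 1 / 2 :: real) has_real_derivative 0) (at x)" by simp
    define K K1 K2 where K: "K = kummer A' (1 - s) x" "K1 = kummer' A' (1 - s) x" "K2 = kummer'' A' (1 - s) x"
    have o: "x * K2 + ((1 - s) - x) * K1 = A' * K"
      unfolding K by (rule kummer_ode) (use A_pos s in auto)
    have "x * (K2 + 2 * (- 1 / 2) * K1 + ((- 1 / 2)^2 + 0) * K) + (1 - s) * (K1 + (- 1 / 2) * K)
        = (x * K2 + ((1 - s) - x) * K1) + (x / 4 - (1 - s) / 2) * K"
      by (simp add: field_simps power2_eq_square)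
    also have "... = (l / 2 + x / 4) * K" unfolding o by (simp add: A'_def algebra_simps add_divide_distrib diff_divide_distrib)
    finally show "x * (kummer'' A' (1 - s) x + 2 * (- 1 / 2) * kummer' A' (1 - s) x
        + ((- 1 / 2)^2 + 0) * kummer A' (1 - s) x)
        + (1 - s) * (kummer' A' (1 - s) x + - 1 / 2 * kummer A' (1 - s) x) = (l / 2 + x / 4) * kummer A' (1 - s) x"
      unfolding K by simp
  qed (use kummer_has_derivative A_pos s in auto)
  then show ?thesis unfolding reg_def[abs_def] reg'_def[abs_def] .
qed

lemma grow_pos: "\<rho> > 0 ==> grow \<rho> > 0"
  using kummer_ge_1[of A "1 + s" "\<rho>^2 / 2"] A_pos s by (simp add: grow_def)

lemma half_square_at_right: "filterlim (\<lambda>\<rho>::real. \<rho>^2 / 2) (at 0) (at_right 0)"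
  unfolding filterlim_at
proof
  show "\<forall>\<^sub>F x in at_right (0::real). x^2 / 2 \<in> UNIV \<and> x^2 / 2 \<noteq> 0"
    by (auto simp: eventually_at_right_field intro!: exI[of _ 1])
  have "((\<lambda>\<rho>::real. \<rho>^2 / 2) \<longlongrightarrow> 0^2 / 2) (at_right 0)" by (intro tendsto_intros) simp_all
  then show "((\<lambda>\<rho>::real. \<rho>^2 / 2) \<longlongrightarrow> 0) (at_right 0)" by simp
qed

lemma exp_half_square_tendsto: "((\<lambda>\<rho>::real. exp (- (\<rho>^2 / 2) / 2)) \<longlongrightarrow> 1) (at_right 0)"
proof -
  have "((\<lambda>\<rho>::real. exp (- (\<rho>^2 / 2) / 2)) \<longlongrightarrow> exp (- (0^2 / 2) / 2)) (at_right 0)" by (intro tendsto_intros) simp_all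
  then show ?thesis by simp
qed

lemma grow_tendsto_0: "(grow \<longlongrightarrow> 0) (at_right 0)"
proof -
  have k: "((\<lambda>\<rho>. kummer A (1 + s) (\<rho>^2 / 2)) \<longlongrightarrow> 1) (at_right 0)"
    by (rule filterlim_compose[OF kummer_tendsto_1 half_square_at_right]) (use A_pos s in auto)
  have "((\<lambda>\<rho>::real. (\<rho>^2 / 2) powr s) \<longlongrightarrow> 0) (at_right 0)"
  proof (rule tendsto_zero_powrI)
    have "((\<lambda>\<rho>::real. \<rho>^2 / 2) \<longlongrightarrow> 0^2 / 2) (at_right 0)" by (intro tendsto_intros) simp_all
    then show "((\<lambda>\<rho>::real. \<rho>^2 / 2) \<longlongrightarrow> 0) (at_right 0)" by simp
  qed (use s in auto)
  then have "((\<lambda>\<rho>. exp (- (\<rho>^2 / 2) / 2) * (\<rho>^2 / 2) powr s * kummer A (1 + s) (\<rho>^2 / 2)) \<longlongrightarrow> 1 * 0 * 1) (at_right 0)"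
    by (intro tendsto_mult exp_half_square_tendsto k)
  then show ?thesis by (simp add: grow_def[abs_def])
qed

lemma reg_tendsto_1: "(reg \<longlongrightarrow> 1) (at_right 0)"
proof -
  have k: "((\<lambda>\<rho>. kummer A' (1 - s) (\<rho>^2 / 2)) \<longlongrightarrow> 1) (at_right 0)"
    by (rule filterlim_compose[OF kummer_tendsto_1 half_square_at_right]) (use A_pos s in auto)
  have "((\<lambda>\<rho>. exp (- (\<rho>^2 / 2) / 2) * kummer A' (1 - s) (\<rho>^2 / 2)) \<longlongrightarrow> 1 * 1) (at_right 0)"
    by (intro tendsto_mult exp_half_square_tendsto k)
  then show ?thesis by (simp add: reg_def[abs_def])
qed

definition conn :: real where
  "conn = (Gamma (1 - s) * Gamma A) / (Gamma (1 + s) * Gamma A')"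

lemma conn_pos: "conn > 0"
  unfolding conn_def using A_pos s by (intro divide_pos_pos mult_pos_pos Gamma_real_pos) auto

definition dec :: "real => real" where "dec \<rho> = reg \<rho> - conn * grow \<rho>"
definition dec' :: "real => real" where "dec' \<rho> = reg' \<rho> - conn * grow' \<rho>"

lemma dec_sol: "radial_sol s l dec dec'"
  using radial_sol_lin[OF reg_sol grow_sol, of 1 "- conn"] by (simp add: dec_def[abs_def] dec'_def[abs_def])

lemma dec_tendsto_1: "(dec \<longlongrightarrow> 1) (at_right 0)"
proof -
  have "((\<lambda>\<rho>. reg \<rho> - conn * grow \<rho>) \<longlongrightarrow> 1 - conn * 0) (at_right 0)"
    by (intro tendsto_intros reg_tendsto_1 grow_tendsto_0)
  then show ?thesis by (simp add: dec_def[abs_def])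
qed

text \<open>The constant \<open>conn\<close> is the limit of \<open>reg / grow\<close>. With \<open>u p\<close> the coefficients of
  \<open>kummer A' (1 - s)\<close> and \<open>v p\<close> those of \<open>conn * kummer A (1 + s)\<close>, asymptotically \<open>v p\<close> is the geometric
  mean of \<open>u p\<close> and \<open>u (p + 1)\<close> with exponents \<open>1 - s\<close> and \<open>s\<close>, and \<open>u (p + 1)\<close> is the geometric mean of
  \<open>v p\<close> and \<open>v (p + 1)\<close> with exponents \<open>s\<close> and \<open>1 - s\<close>; the comparison lemma applies in both directions.\<close>

definition u :: "nat => real" where "u p = kummer_coeff A' (1 - s) p"
definition v :: "nat => real" where "v p = conn * kummer_coeff A (1 + s) p"

lemma u_pos: "u p > 0" and v_pos: "v p > 0"
  using kummer_coeff_pos[of A' "1 - s" p] kummer_coeff_pos[of A "1 + s" p] A_pos s conn_pos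
  by (auto simp: u_def v_def)

lemma uv_summable: "summable (\<lambda>p. u p * x ^ p)" "summable (\<lambda>p. v p * x ^ p)"
proof -
  show "summable (\<lambda>p. u p * x ^ p)" unfolding u_def by (rule kummer_summable) (use A_pos s in auto)
  have "summable (\<lambda>p. conn * (kummer_coeff A (1 + s) p * x ^ p))"
    by (rule summable_mult[OF kummer_summable]) (use A_pos s in auto)
  then show "summable (\<lambda>p. v p * x ^ p)" by (simp add: v_def mult.assoc)
qed

lemma uv_ratio: "(\<lambda>p. v p / u p * real p powr s) \<longlonglongrightarrow> 1"
proof -
  have "(\<lambda>p. conn * ((pochhammer A p / pochhammer A' p * real p powr (A' - A)) *
      (pochhammer (1 - s) p / pochhammer (1 + s) p * real p powr ((1 + s) - (1 - s)))))
     \<longlonglongrightarrow> conn * ((Gamma A' / Gamma A) * (Gamma (1 + s) / Gamma (1 - s)))"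
    by (intro tendsto_mult tendsto_const pochhammer_ratio_tendsto) (use A_pos s in auto)
  moreover have "conn * ((Gamma A' / Gamma A) * (Gamma (1 + s) / Gamma (1 - s))) = 1"
  proof -
    have "Gamma A > 0" "Gamma A' > 0" "Gamma (1 + s) > 0" "Gamma (1 - s) > 0"
      using A_pos(1,2) s by (auto intro: Gamma_real_pos)
    then show ?thesis by (simp add: conn_def)
  qed
  moreover have "\<forall>\<^sub>F p in sequentially. conn * ((pochhammer A p / pochhammer A' p * real p powr (A' - A)) *
      (pochhammer (1 - s) p / pochhammer (1 + s) p * real p powr ((1 + s) - (1 - s)))) = v p / u p * real p powr s"
    using eventually_gt_at_top[of 0]
  proof eventually_elim
    case (elim p)
    have "real p powr (A' - A) * real p powr ((1 + s) - (1 - s)) = real p powr s"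
      using A_pos(3) by (simp flip: powr_add)
    moreover have "pochhammer A' p > 0" "pochhammer (1 + s) p > 0" "pochhammer (1 - s) p > 0"
      using A_pos s by (auto intro!: pochhammer_pos)
    then have "v p / u p = conn * (pochhammer A p / pochhammer A' p * (pochhammer (1 - s) p / pochhammer (1 + s) p))"
      by (simp add: u_def v_def kummer_coeff_def)
    moreover have "conn * ((a1 * r1) * (a2 * r2)) = conn * (a1 * a2) * (r1 * r2)" for a1 a2 r1 r2 by simp
    ultimately show ?case by (simp only: )
  qed
  ultimately show ?thesis using Lim_transform_eventually by (simp only:)
qed

lemma kummer_coeff_step:
  assumes "a > 0" "c > 0"
  shows "(\<lambda>p. kummer_coeff a c (Suc p) / kummer_coeff a c p * real p) \<longlonglongrightarrow> 1"
proof -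
  have eq: "kummer_coeff a c (Suc p) / kummer_coeff a c p * real p = (a + real p) / (c + real p) * (real p / (real p + 1))" for p
  proof -
    have k: "kummer_coeff a c p > 0" by (rule kummer_coeff_pos[OF assms])
    have "(c + real p) * (real p + 1) \<noteq> 0" using assms by (simp add: add_nonneg_eq_0_iff)
    then have "kummer_coeff a c (Suc p) = (a + real p) * kummer_coeff a c p / ((c + real p) * (real p + 1))"
      using kummer_coeff_Suc[OF assms(2), of a p] by (simp add: eq_divide_eq)
    then show ?thesis using k by simp
  qed
  have "(\<lambda>p. (a + real p) / (c + real p) * (real p / (real p + 1))) \<longlonglongrightarrow> 1" by real_asymp
  then show ?thesis unfolding eq .
qed

lemma v_step: "(\<lambda>p. v (Suc p) / v p * real p) \<longlonglongrightarrow> 1"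
  using kummer_coeff_step[of A "1 + s"] A_pos s conn_pos by (simp add: v_def)

lemma u_step: "(\<lambda>p. u (Suc p) / u p * real p) \<longlonglongrightarrow> 1"
  using kummer_coeff_step[of A' "1 - s"] A_pos s by (simp add: u_def)

lemma v_geometric: "(\<lambda>p. v p / (u p powr (1 - s) * u (Suc p) powr s)) \<longlonglongrightarrow> 1"
proof -
  have lim: "(\<lambda>p. v p / u p * real p powr s / (u (Suc p) / u p * real p) powr s) \<longlonglongrightarrow> 1 / 1 powr s"
    by (intro tendsto_divide uv_ratio tendsto_powr u_step tendsto_const) auto
  have ev: "\<forall>\<^sub>F p in sequentially. v p / u p * real p powr s / (u (Suc p) / u p * real p) powr s
      = v p / (u p powr (1 - s) * u (Suc p) powr s)"
    using eventually_gt_at_top[of 0]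
  proof eventually_elim
    case (elim p)
    have 1: "(u (Suc p) / u p * real p) powr s = u (Suc p) powr s / u p powr s * real p powr s"
      using u_pos[of p] u_pos[of "Suc p"] by (simp add: powr_mult powr_divide)
    define ps us ut w where pq: "ps = real p powr s" "us = u p powr s" "ut = u p powr (1 - s)" "w = u (Suc p) powr s"
    have 2: "u p = us * ut" using u_pos[of p] by (simp add: pq flip: powr_add)
    have pos: "ps > 0" "us > 0" "ut > 0" "w > 0" using elim u_pos[of p] u_pos[of "Suc p"] by (auto simp: pq)
    have "v p / u p * ps / (w / us * ps) = v p / (ut * w)"
      using pos by (subst 2) (simp add: field_simps)
    then show ?case unfolding 1 pq .
  qed
  from Lim_transform_eventually[OF lim ev] show ?thesis by simp
qed

lemma u_geometric: "(\<lambda>p. u (Suc p) / (v p powr (1 - (1 - s)) * v (Suc p) powr (1 - s))) \<longlonglongrightarrow> 1"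
proof -
  have lim: "(\<lambda>p. (u (Suc p) / u p * real p) * (1 / (v p / u p * real p powr s)) / (v (Suc p) / v p * real p) powr (1 - s))
      \<longlonglongrightarrow> 1 * (1 / 1) / 1 powr (1 - s)"
    by (intro tendsto_divide tendsto_mult uv_ratio tendsto_powr u_step v_step tendsto_const) auto
  have ev: "\<forall>\<^sub>F p in sequentially. (u (Suc p) / u p * real p) * (1 / (v p / u p * real p powr s)) / (v (Suc p) / v p * real p) powr (1 - s)
      = u (Suc p) / (v p powr (1 - (1 - s)) * v (Suc p) powr (1 - s))"
    using eventually_gt_at_top[of 0]
  proof eventually_elim
    case (elim p)
    have 1: "(v (Suc p) / v p * real p) powr (1 - s) = v (Suc p) powr (1 - s) / v p powr (1 - s) * real p powr (1 - s)"
      using v_pos[of p] v_pos[of "Suc p"] by (simp add: powr_mult powr_divide)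
    have 2: "real p = real p powr s * real p powr (1 - s)" "v p = v p powr s * v p powr (1 - s)"
      using elim v_pos[of p] by (simp_all flip: powr_add)
    define ps pt vs vt where pq: "ps = real p powr s" "pt = real p powr (1 - s)" "vs = v p powr s" "vt = v p powr (1 - s)"
    have pos: "ps > 0" "pt > 0" "vs > 0" "vt > 0" "v (Suc p) powr (1 - s) > 0" using elim v_pos[of p] v_pos[of "Suc p"] by (auto simp: pq)
    have "(u (Suc p) / u p * (ps * pt)) * (1 / ((vs * vt) / u p * ps)) / (v (Suc p) powr (1 - s) / vt * pt)
        = u (Suc p) / (vs * v (Suc p) powr (1 - s))"
      using pos u_pos[of p] by (simp add: field_simps)
    then show ?case unfolding 1 using 2 by (simp add: pq)
  qed
  from Lim_transform_eventually[OF lim ev] show ?thesis by simp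
qed

end


section \<open>The decaying solution\<close>

lemma powr_bounded_below:
  assumes "0 < r" "r <= x" "x <= R" "\<bar>t\<bar> <= 1"
  shows "min r (1 / R) <= x powr (t::real)"
proof (cases "x >= 1")
  case True
  have "1 / R <= 1 / x" using assms True by (intro divide_left_mono mult_pos_pos) auto
  also have "1 / x = x powr (- 1)" using assms by (simp add: powr_minus_divide)
  also have "... <= x powr t" using True assms by (intro powr_mono) auto
  finally show ?thesis by simp
next
  case False
  have "r <= x powr 1" using assms by simp
  also have "... <= x powr t" using False assms by (intro powr_mono') auto
  finally show ?thesis by simp
qed

lemma powr_minus_one: "x > 0 ==> x powr (a - 1) = x powr a / (x::real)"
  by (simp add: powr_diff)

lemma powr_minus_cancel: "x > 0 ==> x powr (- a) * (x powr a * y) = (y::real)"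
  by (simp add: powr_minus)

lemma deriv_nonneg_exI:
  "(f has_real_derivative d) (at z) ==> 0 <= d ==> \<exists>d. (f has_real_derivative d) (at z) \<and> 0 <= d"
  by blast

lemma deriv_nonpos_exI:
  "(f has_real_derivative d) (at z) ==> d <= 0 ==> \<exists>d. (f has_real_derivative d) (at z) \<and> d <= 0"
  by blast

text \<open>The weight \<open>\<rho>\<^sup>1\<^sup>-\<^sup>2\<^sup>s\<close> brings the equation into divergence form, which makes the flux monotone.\<close>

lemma flux_deriv:
  assumes "radial_sol s l y y'" "\<rho> > 0"
  shows "((\<lambda>\<rho>. \<rho> powr (1 - 2 * s) * (y \<rho> * y' \<rho>)) has_real_derivative
    \<rho> powr (1 - 2 * s) * ((y' \<rho>)^2 + (l + \<rho>^2 / 4) * (y \<rho>)^2)) (at \<rho>)"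
proof -
  note d = radial_solD[OF assms]
  have p: "((\<lambda>\<rho>. \<rho> powr (1 - 2 * s)) has_real_derivative (1 - 2 * s) * \<rho> powr (1 - 2 * s - 1)) (at \<rho>)"
    using assms(2) by (auto intro!: derivative_eq_intros)
  have e: "\<rho> powr (1 - 2 * s - 1) = \<rho> powr (1 - 2 * s) / \<rho>" by (rule powr_minus_one[OF assms(2)])
  show ?thesis
  proof (rule DERIV_cong[OF DERIV_mult[OF p DERIV_mult[OF d]]])
    define k w where kw: "k = (1 - 2 * s) / \<rho>" "w = \<rho> powr (1 - 2 * s)"
    have e': "(1 - 2 * s) * \<rho> powr (1 - 2 * s - 1) = k * w" unfolding e kw by simp
    show "(1 - 2 * s) * \<rho> powr (1 - 2 * s - 1) * (y \<rho> * y' \<rho>)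
        + (y' \<rho> * y' \<rho> + ((l + \<rho>^2 / 4) * y \<rho> - (1 - 2 * s) / \<rho> * y' \<rho>) * y \<rho>) * \<rho> powr (1 - 2 * s)
        = \<rho> powr (1 - 2 * s) * ((y' \<rho>)^2 + (l + \<rho>^2 / 4) * (y \<rho>)^2)"
      unfolding e' unfolding kw[symmetric] by (simp add: algebra_simps power2_eq_square)
  qed
qed

lemma momentum_deriv:
  assumes "radial_sol s l y y'" "\<rho> > 0"
  shows "((\<lambda>\<rho>. \<rho> powr (1 - 2 * s) * y' \<rho>) has_real_derivative
    \<rho> powr (1 - 2 * s) * ((l + \<rho>^2 / 4) * y \<rho>)) (at \<rho>)"
proof -
  note d = radial_solD[OF assms]
  have p: "((\<lambda>\<rho>. \<rho> powr (1 - 2 * s)) has_real_derivative (1 - 2 * s) * \<rho> powr (1 - 2 * s - 1)) (at \<rho>)"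
    using assms(2) by (auto intro!: derivative_eq_intros)
  have e: "\<rho> powr (1 - 2 * s - 1) = \<rho> powr (1 - 2 * s) / \<rho>" by (rule powr_minus_one[OF assms(2)])
  show ?thesis
  proof (rule DERIV_cong[OF DERIV_mult[OF p d(2)]])
    define k w where kw: "k = (1 - 2 * s) / \<rho>" "w = \<rho> powr (1 - 2 * s)"
    have e': "(1 - 2 * s) * \<rho> powr (1 - 2 * s - 1) = k * w" unfolding e kw by simp
    show "(1 - 2 * s) * \<rho> powr (1 - 2 * s - 1) * y' \<rho>
        + ((l + \<rho>^2 / 4) * y \<rho> - (1 - 2 * s) / \<rho> * y' \<rho>) * \<rho> powr (1 - 2 * s)
        = \<rho> powr (1 - 2 * s) * ((l + \<rho>^2 / 4) * y \<rho>)"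
      unfolding e' unfolding kw[symmetric] by (simp add: algebra_simps)
  qed
qed

lemma wronskian_const:
  assumes y: "radial_sol s l y y'" and z: "radial_sol s l z z'"
  shows "\<exists>c. \<forall>\<rho>>0. \<rho> powr (1 - 2 * s) * (y \<rho> * z' \<rho> - y' \<rho> * z \<rho>) = c"
proof -
  have "\<exists>c. \<forall>\<rho>\<in>{0<..}. y \<rho> * (\<rho> powr (1 - 2 * s) * z' \<rho>) - (\<rho> powr (1 - 2 * s) * y' \<rho>) * z \<rho> = c"
  proof (rule has_field_derivative_zero_constant)
    fix \<rho> :: real assume "\<rho> \<in> {0<..}"
    then have \<rho>: "\<rho> > 0" by simp
    have "((\<lambda>\<rho>. y \<rho> * (\<rho> powr (1 - 2 * s) * z' \<rho>) - (\<rho> powr (1 - 2 * s) * y' \<rho>) * z \<rho>) has_real_derivative 0) (at \<rho>)"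
      by (rule DERIV_cong[OF DERIV_diff[OF DERIV_mult[OF radial_solD(1)[OF y \<rho>] momentum_deriv[OF z \<rho>]]
              DERIV_mult[OF momentum_deriv[OF y \<rho>] radial_solD(1)[OF z \<rho>]]]])
        (simp add: algebra_simps)
    then show "((\<lambda>\<rho>. y \<rho> * (\<rho> powr (1 - 2 * s) * z' \<rho>) - (\<rho> powr (1 - 2 * s) * y' \<rho>) * z \<rho>) has_real_derivative 0) (at \<rho> within {0<..})"
      by (rule has_field_derivative_at_within)
  qed (rule convex_real_interval)
  then obtain c where c: "\<And>\<rho>. \<rho> > 0 ==> y \<rho> * (\<rho> powr (1 - 2 * s) * z' \<rho>) - (\<rho> powr (1 - 2 * s) * y' \<rho>) * z \<rho> = c"
    by auto
  have "\<rho> powr (1 - 2 * s) * (y \<rho> * z' \<rho> - y' \<rho> * z \<rho>) = c" if "\<rho> > 0" for \<rho>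
    using c[OF that] by (simp add: algebra_simps)
  then show ?thesis by blast
qed

text \<open>A solution that is positive and increasing at one point stays positive: the flux
  \<open>\<rho> powr (1 - 2 s) * y * y'\<close> is nondecreasing, so \<open>y^2\<close> cannot come down again.\<close>

lemma radial_sol_stays_positive:
  assumes sol: "radial_sol s l y y'" and l: "l >= 0" and r: "r > 0" "y r > 0" "y' r > 0" and \<rho>: "r <= \<rho>"
  shows "y \<rho> > 0"
proof -
  define P where "P \<rho> = \<rho> powr (1 - 2 * s) * (y \<rho> * y' \<rho>)" for \<rho>
  have P: "P x > 0" if "r <= x" for x
  proof -
    have "P r <= P x"
    proof (rule DERIV_nonneg_imp_nondecreasing[OF that])
      fix z assume "r <= z" "z <= x"
      then have "z > 0" using r by simp
      from flux_deriv[OF sol this] show "\<exists>d. (P has_real_derivative d) (at z) \<and> 0 <= d"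
        unfolding P_def[abs_def] by (rule deriv_nonneg_exI) (use l in simp)
    qed
    moreover have "P r > 0" using r by (simp add: P_def)
    ultimately show ?thesis by linarith
  qed
  have prod: "y x * y' x > 0" if "r <= x" for x
    using P[OF that] r that by (simp add: P_def zero_less_mult_iff)
  have sq: "(y r)^2 <= (y x)^2" if "r <= x" for x
  proof (rule DERIV_nonneg_imp_nondecreasing[OF that, of "\<lambda>x. (y x)^2"])
    fix z assume z: "r <= z" "z <= x"
    have "((\<lambda>x. (y x)^2) has_real_derivative 2 * (y z * y' z)) (at z)"
      using DERIV_power[OF radial_solD(1)[OF sol, of z], of 2] z r by (simp add: mult_ac)
    then show "\<exists>d. ((\<lambda>x. (y x)^2) has_real_derivative d) (at z) \<and> 0 <= d"
      by (rule deriv_nonneg_exI) (use prod[OF z(1)] in simp)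
  qed
  show ?thesis
  proof (rule ccontr)
    assume "\<not> y \<rho> > 0"
    then have "y \<rho> <= 0" by simp
    have "\<exists>x\<ge>r. x <= \<rho> \<and> y x = 0"
      by (rule IVT2[OF \<open>y \<rho> <= 0\<close> less_imp_le[OF r(2)] \<rho>])
        (use r DERIV_isCont[OF radial_solD(1)[OF sol]] in auto)
    then obtain x where "r <= x" "y x = 0" by blast
    then show False using sq[of x] r(2) by simp
  qed
qed

context radial begin

lemma dec_le_grow:
  assumes "\<delta> > 0" shows "\<forall>\<^sub>F \<rho> in at_top. \<bar>dec \<rho>\<bar> <= \<delta> * grow \<rho>"
proof -
  define \<epsilon> where "\<epsilon> = min 1 (\<delta> / (3 * conn))"
  have \<epsilon>: "\<epsilon> > 0" "\<epsilon> <= 1" "3 * \<epsilon> * conn <= \<delta>"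
    using assms conn_pos by (auto simp: \<epsilon>_def min_def field_simps)
  let ?R = "\<lambda>x. \<Sum>p. u p * x ^ p" and ?V = "\<lambda>x. \<Sum>p. v p * x ^ p"
  have su: "summable (\<lambda>p. u (Suc p) * x ^ p)" for x
  proof (cases "x = 0")
    case False
    have "summable (\<lambda>p. u (Suc p) * x ^ Suc p)"
      using uv_summable(1)[of x] by (subst summable_Suc_iff)
    from summable_mult[OF this, of "1 / x"] False show ?thesis by simp
  qed simp
  have 1: "\<forall>\<^sub>F x in at_top. x powr s * ?V x <= (1 + \<epsilon>) * ?R x"
    by (rule powser_comparison[OF s u_pos v_pos uv_summable v_geometric \<epsilon>(1)])
  have 2: "\<forall>\<^sub>F x in at_top. x powr (1 - s) * (\<Sum>p. u (Suc p) * x ^ p) <= (1 + \<epsilon>) * ?V x"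
    by (rule powser_comparison[OF _ _ v_pos u_pos uv_summable(2) su u_geometric \<epsilon>(1)]) (use s in auto)
  have 3: "\<forall>\<^sub>F x in at_top. 1 / (\<epsilon> * v 0) <= x powr s"
  proof -
    have "filterlim (\<lambda>x::real. x powr s) at_top at_top" using s(1) by real_asymp
    then show ?thesis unfolding filterlim_at_top by blast
  qed
  have "\<forall>\<^sub>F x in at_top. \<bar>?R x - x powr s * ?V x\<bar> <= 3 * \<epsilon> * (x powr s * ?V x)"
    using 1 2 3 eventually_gt_at_top[of 0]
  proof eventually_elim
    case (elim x)
    define G where "G = x powr s * ?V x"
    have R: "?R x = 1 + x * (\<Sum>p. u (Suc p) * x ^ p)"
    proof -
      have "?R x = (\<Sum>p. u (Suc p) * x ^ Suc p) + u 0 * x ^ 0"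
        using suminf_split_head[OF uv_summable(1)[of x]] by simp
      also have "(\<Sum>p. u (Suc p) * x ^ Suc p) = x * (\<Sum>p. u (Suc p) * x ^ p)"
        using suminf_mult[OF su[of x], of x] by (simp add: mult_ac)
      finally show ?thesis by (simp add: u_def kummer_coeff_0)
    qed
    have "x powr s * (x powr (1 - s) * (\<Sum>p. u (Suc p) * x ^ p)) <= x powr s * ((1 + \<epsilon>) * ?V x)"
      using elim by (intro mult_left_mono) auto
    moreover have "x powr s * x powr (1 - s) = x" using elim by (simp flip: powr_add)
    ultimately have up: "?R x <= 1 + (1 + \<epsilon>) * G"
      unfolding R G_def by (simp add: mult.assoc[symmetric] mult.commute mult.left_commute)
    have "v 0 * x ^ 0 <= ?V x"
    proof -
      have "(\<Sum>p<1. v p * x ^ p) <= ?V x"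
        by (rule sum_le_suminf[OF uv_summable(2)]) (use elim v_pos in \<open>auto intro!: mult_nonneg_nonneg less_imp_le[OF v_pos]\<close>)
      then show ?thesis by simp
    qed
    then have "x powr s * v 0 <= G" unfolding G_def by (intro mult_left_mono) auto
    moreover have "1 <= \<epsilon> * (x powr s * v 0)" using elim(3) \<epsilon>(1) v_pos[of 0] by (simp add: field_simps)
    ultimately have one: "1 <= \<epsilon> * G" using \<epsilon>(1) mult_left_mono[of "x powr s * v 0" G \<epsilon>] by linarith
    have G0: "G >= 0" using one \<epsilon>(1) by (meson less_eq_real_def mult_nonneg_nonpos not_le order_trans zero_less_one)
    have e2: "\<epsilon> * (\<epsilon> * G) <= \<epsilon> * G" using \<epsilon> G0 by (intro mult_right_le_one_le mult_nonneg_nonneg mult_left_le_one_le) auto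
    have "?R x - G <= 2 * (\<epsilon> * G)" using up one by (simp add: distrib_right)
    moreover have "G - ?R x <= 3 * (\<epsilon> * G)"
    proof -
      have "G - ?R x <= \<epsilon> * ?R x" using elim(1) unfolding G_def by (simp add: distrib_right)
      also have "... <= \<epsilon> * (1 + (1 + \<epsilon>) * G)" using up \<epsilon>(1) by (intro mult_left_mono) auto
      also have "... = \<epsilon> + \<epsilon> * G + \<epsilon> * (\<epsilon> * G)" by (simp add: algebra_simps)
      also have "... <= 3 * (\<epsilon> * G)" using e2 one \<epsilon>(2) by linarith
      finally show ?thesis .
    qed
    moreover have "\<epsilon> * G >= 0" using one by simp
    ultimately show ?case unfolding G_def[symmetric] mult.assoc by linarith
  qed
  moreover have "filterlim (\<lambda>\<rho>::real. \<rho>^2 / 2) at_top at_top" by real_asymp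
  ultimately have "\<forall>\<^sub>F \<rho> in at_top. \<bar>?R (\<rho>^2 / 2) - (\<rho>^2 / 2) powr s * ?V (\<rho>^2 / 2)\<bar>
      <= 3 * \<epsilon> * ((\<rho>^2 / 2) powr s * ?V (\<rho>^2 / 2))"
    unfolding filterlim_iff by blast
  then show ?thesis
  proof eventually_elim
    case (elim \<rho>)
    define x E where xE: "x = \<rho>^2 / 2" "E = exp (- (\<rho>^2 / 2) / 2)"
    have V: "?V x = conn * kummer A (1 + s) x"
      unfolding kummer_def using suminf_mult[OF kummer_summable[of A "1 + s" x], of conn] A_pos s
      by (simp add: v_def mult.assoc)
    have g: "conn * grow \<rho> = E * (x powr s * ?V x)" unfolding V by (simp add: grow_def xE)
    have r: "reg \<rho> = E * ?R x" by (simp add: reg_def kummer_def u_def xE)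
    have "\<bar>dec \<rho>\<bar> = E * \<bar>?R x - x powr s * ?V x\<bar>"
      unfolding dec_def g r right_diff_distrib[symmetric] abs_mult by (simp add: xE)
    also have "... <= E * (3 * \<epsilon> * (x powr s * ?V x))" using elim unfolding xE by (intro mult_left_mono) auto
    also have "... = 3 * \<epsilon> * (conn * grow \<rho>)" unfolding g by simp
    also have "... = (3 * \<epsilon> * conn) * grow \<rho>" by simp
    also have "... <= \<delta> * grow \<rho>"
    proof (rule mult_right_mono[OF \<epsilon>(3)])
      show "0 <= grow \<rho>" using kummer_ge_1[of A "1 + s" "\<rho>^2 / 2"] A_pos s by (simp add: grow_def)
    qed
    finally show ?case .
  qed
qed

text \<open>If \<open>y\<close> were positive and increasing, so would be \<open>y - \<delta> * grow\<close> for a small \<open>\<delta>\<close>, and it would stay positive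
  for ever, against \<open>y = o(grow)\<close>.\<close>

lemma not_dominated:
  assumes sol: "radial_sol s l y y'" and small: "\<And>\<delta>. \<delta> > 0 ==> \<forall>\<^sub>F \<rho> in at_top. y \<rho> <= \<delta> * grow \<rho>"
    and r: "r > 0"
  shows "\<not> (y r > 0 \<and> y' r > 0)"
proof
  assume yr: "y r > 0 \<and> y' r > 0"
  define \<delta> where "\<delta> = min (y r / (2 * (grow r + 1))) (y' r / (2 * (\<bar>grow' r\<bar> + 1)))"
  have g: "grow r > 0" by (rule grow_pos[OF r])
  have half: "a / (2 * c) * c = a / 2" if "c \<noteq> 0" for a c :: real using that by simp
  have \<delta>: "\<delta> > 0" using yr g by (auto simp: \<delta>_def intro!: divide_pos_pos mult_pos_pos add_pos_nonneg)
  have "\<delta> * grow r < y r"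
  proof -
    have "\<delta> * grow r <= y r / (2 * (grow r + 1)) * (grow r + 1)"
      using g \<delta> yr by (intro mult_mono) (auto simp: \<delta>_def intro!: divide_nonneg_nonneg)
    also have "... = y r / 2" by (rule half) (use g in simp)
    finally show ?thesis using yr by linarith
  qed
  moreover have "\<delta> * grow' r < y' r"
  proof -
    have "\<delta> * grow' r <= \<delta> * (\<bar>grow' r\<bar> + 1)" using \<delta> by (intro mult_left_mono) auto
    also have "... <= y' r / (2 * (\<bar>grow' r\<bar> + 1)) * (\<bar>grow' r\<bar> + 1)"
      by (intro mult_right_mono) (auto simp: \<delta>_def)
    also have "... = y' r / 2" by (rule half) (simp add: add_nonneg_eq_0_iff)
    finally show ?thesis using yr by linarith
  qed
  moreover have "radial_sol s l (\<lambda>\<rho>. y \<rho> + - \<delta> * grow \<rho>) (\<lambda>\<rho>. y' \<rho> + - \<delta> * grow' \<rho>)"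
    using radial_sol_lin[OF sol grow_sol, of 1 "- \<delta>"] by simp
  ultimately have pos: "y \<rho> + - \<delta> * grow \<rho> > 0" if "\<rho> >= r" for \<rho>
    using radial_sol_stays_positive[of s l "\<lambda>\<rho>. y \<rho> + - \<delta> * grow \<rho>" "\<lambda>\<rho>. y' \<rho> + - \<delta> * grow' \<rho>" r \<rho>] that l r by simp
  have "\<forall>\<^sub>F \<rho> in at_top. y \<rho> <= \<delta> * grow \<rho> \<and> r <= \<rho>"
    by (rule eventually_conj[OF small[OF \<delta>] eventually_ge_at_top])
  from eventually_happens[OF this] obtain \<rho> where "y \<rho> <= \<delta> * grow \<rho>" "r <= \<rho>"
    using trivial_limit_at_top_linorder by blast
  then show False using pos[of \<rho>] by simp
qed

text \<open>Both signs of \<open>dec\<close> are excluded by \<open>not_dominated\<close>, so that the square of \<open>dec\<close> never increases.\<close>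

lemma dec_flux_nonpos:
  assumes "r > 0" shows "dec r * dec' r <= 0"
proof -
  have "\<not> (dec r > 0 \<and> dec' r > 0)"
  proof (rule not_dominated[OF dec_sol _ assms])
    show "\<forall>\<^sub>F \<rho> in at_top. dec \<rho> <= \<delta> * grow \<rho>" if "\<delta> > 0" for \<delta>
      using dec_le_grow[OF that] by eventually_elim linarith
  qed
  moreover have "\<not> (- dec r > 0 \<and> - dec' r > 0)"
  proof (rule not_dominated[OF _ _ assms])
    show "radial_sol s l (\<lambda>\<rho>. - dec \<rho>) (\<lambda>\<rho>. - dec' \<rho>)"
      using radial_sol_lin[OF dec_sol dec_sol, of "-1" 0] by simp
    show "\<forall>\<^sub>F \<rho> in at_top. - dec \<rho> <= \<delta> * grow \<rho>" if "\<delta> > 0" for \<delta>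
      using dec_le_grow[OF that] by eventually_elim linarith
  qed
  ultimately show ?thesis by (auto simp: mult_le_0_iff not_less)
qed

lemma dec_sq_antimono:
  assumes "0 < r" "r <= \<rho>" shows "(dec \<rho>)^2 <= (dec r)^2"
proof (rule DERIV_nonpos_imp_nonincreasing[OF assms(2), of "\<lambda>x. (dec x)^2"])
  fix z assume z: "r <= z" "z <= \<rho>"
  then have z0: "z > 0" using assms by simp
  have "((\<lambda>x. (dec x)^2) has_real_derivative 2 * (dec z * dec' z)) (at z)"
    using DERIV_power[OF radial_solD(1)[OF dec_sol z0], of 2] by (simp add: mult_ac)
  then show "\<exists>d. ((\<lambda>x. (dec x)^2) has_real_derivative d) (at z) \<and> d <= 0"
    by (rule deriv_nonpos_exI) (use dec_flux_nonpos[OF z0] in simp)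
qed

lemma dec_sq_le_1:
  assumes "\<rho> > 0" shows "(dec \<rho>)^2 <= 1"
proof -
  have "((\<lambda>r. (dec r)^2) \<longlongrightarrow> 1^2) (at_right 0)" by (intro tendsto_power dec_tendsto_1)
  moreover have "\<forall>\<^sub>F r in at_right 0. (dec \<rho>)^2 <= (dec r)^2"
    unfolding eventually_at_right_field using assms dec_sq_antimono by (intro exI[of _ \<rho>]) auto
  ultimately have "(dec \<rho>)^2 <= 1^2" by (rule tendsto_lowerbound) simp
  then show ?thesis by simp
qed

lemma dec_energy_antimono:
  assumes "0 < r" "r <= \<rho>"
  shows "(\<rho> powr (1 - 2 * s) * dec' \<rho>)^2 <= (r powr (1 - 2 * s) * dec' r)^2"
proof (rule DERIV_nonpos_imp_nonincreasing[OF assms(2), of "\<lambda>\<rho>. (\<rho> powr (1 - 2 * s) * dec' \<rho>)^2"])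
  fix z assume z: "r <= z" "z <= \<rho>"
  then have z0: "z > 0" using assms by simp
  have "((\<lambda>\<rho>. (\<rho> powr (1 - 2 * s) * dec' \<rho>)^2) has_real_derivative
      2 * ((z powr (1 - 2 * s))^2 * (l + z^2 / 4)) * (dec z * dec' z)) (at z)"
    by (rule DERIV_cong[OF DERIV_power[OF momentum_deriv[OF dec_sol z0], of 2]]) (simp add: power2_eq_square mult_ac)
  moreover have "2 * ((z powr (1 - 2 * s))^2 * (l + z^2 / 4)) * (dec z * dec' z) <= 0"
    by (rule mult_nonneg_nonpos[OF _ dec_flux_nonpos[OF z0]]) (use l in simp)
  ultimately show "\<exists>d. ((\<lambda>\<rho>. (\<rho> powr (1 - 2 * s) * dec' \<rho>)^2) has_real_derivative d) (at z) \<and> d <= 0"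
    by blast
qed

text \<open>The flux is nonpositive at \<open>r2\<close> and its derivative is at least \<open>K\<close>, so integrating twice shows how far \<open>dec\<^sup>2\<close> must
  have been above \<open>0\<close> at \<open>r1\<close>. The minimum \<open>m\<close> bounds \<open>x\<^sup>a\<close> for \<open>|a| \<le> 1\<close> from below.\<close>

lemma dec_convexity:
  assumes r: "0 < r1" "r1 < r2" and m: "m = min r1 (1 / r2)"
    and K: "K >= 0" "\<And>x. r1 <= x ==> x <= r2 ==> K <= x powr (1 - 2 * s) * ((dec' x)^2 + (l + x^2 / 4) * (dec x)^2)"
  shows "m * K * (r2 - r1)^2 <= (dec r1)^2"
proof -
  define P where "P x = x powr (1 - 2 * s) * (dec x * dec' x)" for x
  have m0: "m > 0" using r by (simp add: m)
  have P: "P x <= - K * (r2 - x)" if x: "r1 <= x" "x <= r2" for x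
  proof -
    have "P x - K * x <= P r2 - K * r2"
    proof (rule DERIV_nonneg_imp_nondecreasing[OF x(2), of "\<lambda>x. P x - K * x"])
      fix z assume z: "x <= z" "z <= r2"
      then have z0: "z > 0" using x r by simp
      have "((\<lambda>x. P x - K * x) has_real_derivative
          z powr (1 - 2 * s) * ((dec' z)^2 + (l + z^2 / 4) * (dec z)^2) - K * 1) (at z)"
        unfolding P_def by (intro DERIV_diff flux_deriv[OF dec_sol z0] DERIV_cmult DERIV_ident)
      then show "\<exists>d. ((\<lambda>x. P x - K * x) has_real_derivative d) (at z) \<and> 0 <= d"
        by (rule deriv_nonneg_exI) (use K(2)[of z] z x in simp)
    qed
    moreover have "P r2 <= 0" unfolding P_def by (rule mult_nonneg_nonpos[OF _ dec_flux_nonpos]) (use r in auto)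
    ultimately show ?thesis by (simp add: algebra_simps)
  qed
  have "(dec r2)^2 - m * K * (r2 - r2)^2 <= (dec r1)^2 - m * K * (r2 - r1)^2"
  proof (rule DERIV_nonpos_imp_nonincreasing[of r1 r2 "\<lambda>x. (dec x)^2 - m * K * (r2 - x)^2"])
    fix z assume z: "r1 <= z" "z <= r2"
    then have z0: "z > 0" using r by simp
    have "((\<lambda>x. (dec x)^2 - m * K * (r2 - x)^2) has_real_derivative 2 * (dec z * dec' z) + 2 * (m * K * (r2 - z))) (at z)"
      by (rule DERIV_cong, (rule radial_solD(1)[OF dec_sol z0] DERIV_diff DERIV_cmult DERIV_power DERIV_const DERIV_ident)+)
        (simp add: algebra_simps)
    moreover have "dec z * dec' z = z powr (- (1 - 2 * s)) * P z"
      unfolding P_def by (rule powr_minus_cancel[OF z0, symmetric])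
    moreover have "z powr (- (1 - 2 * s)) * P z <= z powr (- (1 - 2 * s)) * (- K * (r2 - z))"
      using P[OF z] by (intro mult_left_mono) auto
    moreover have "m * (K * (r2 - z)) <= z powr (- (1 - 2 * s)) * (K * (r2 - z))"
      using K(1) z r s unfolding m by (intro mult_right_mono powr_bounded_below) auto
    ultimately show "\<exists>d. ((\<lambda>x. (dec x)^2 - m * K * (r2 - x)^2) has_real_derivative d) (at z) \<and> d <= 0"
      by (intro deriv_nonpos_exI[of _ "2 * (dec z * dec' z) + 2 * (m * K * (r2 - z))"]) (simp_all add: mult.assoc)
  qed (use r in simp)
  moreover have "0 <= (dec r2)^2" "m * K * (r2 - r2)^2 = 0" by simp_all
  ultimately show ?thesis by linarith
qed

lemma dec_decay_step:
  assumes "0 < r1" "r1 < r2"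
  shows "(min r1 (1 / r2))^2 * (r2 - r1)^2 * (l * (dec r2)^2) <= (dec r1)^2"
proof -
  let ?m = "min r1 (1 / r2)"
  have m0: "?m > 0" using assms by simp
  have "?m * (?m * (l * (dec r2)^2)) * (r2 - r1)^2 <= (dec r1)^2"
  proof (rule dec_convexity[OF assms refl])
    show "0 <= ?m * (l * (dec r2)^2)" using m0 l by simp
    fix x assume x: "r1 <= x" "x <= r2"
    have "l * (dec r2)^2 <= (dec' x)^2 + (l + x^2 / 4) * (dec x)^2"
    proof -
      have "l * (dec r2)^2 <= (l + x^2 / 4) * (dec x)^2"
        using dec_sq_antimono[of x r2] x assms l by (intro mult_mono) auto
      then show ?thesis by (simp add: add_increasing)
    qed
    then show "?m * (l * (dec r2)^2) <= x powr (1 - 2 * s) * ((dec' x)^2 + (l + x^2 / 4) * (dec x)^2)"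
      using x assms s l m0 by (intro mult_mono powr_bounded_below) auto
  qed
  then show ?thesis by (simp add: power2_eq_square mult_ac)
qed

lemma dec'_decay_step:
  assumes "0 < r1" "r1 < r2"
  shows "(min r1 (1 / r2)) ^ 4 * (r2 - r1)^2 * (dec' r2)^2 <= (dec r1)^2"
proof -
  let ?m = "min r1 (1 / r2)"
  have m0: "?m > 0" using assms by simp
  have "?m * (?m * (?m^2 * (dec' r2)^2)) * (r2 - r1)^2 <= (dec r1)^2"
  proof (rule dec_convexity[OF assms refl])
    show "0 <= ?m * (?m^2 * (dec' r2)^2)" using m0 by simp
    fix x assume x: "r1 <= x" "x <= r2"
    then have x0: "x > 0" using assms by simp
    have "?m <= r2 powr (1 - 2 * s)" using assms s by (intro powr_bounded_below) auto
    then have "?m^2 * (dec' r2)^2 <= (r2 powr (1 - 2 * s))^2 * (dec' r2)^2"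
      using m0 by (intro mult_right_mono power_mono) auto
    also have "... <= (x powr (1 - 2 * s))^2 * (dec' x)^2"
      using dec_energy_antimono[OF x0 x(2)] by (simp add: power_mult_distrib)
    finally have "?m^2 * (dec' r2)^2 <= (x powr (1 - 2 * s))^2 * (dec' x)^2" .
    have "?m <= x powr (- (1 - 2 * s))" using x assms s by (intro powr_bounded_below) auto
    from mult_mono[OF this \<open>?m^2 * (dec' r2)^2 <= (x powr (1 - 2 * s))^2 * (dec' x)^2\<close>]
    have "?m * (?m^2 * (dec' r2)^2) <= x powr (- (1 - 2 * s)) * ((x powr (1 - 2 * s))^2 * (dec' x)^2)"
      by simp
    also have "... = x powr (1 - 2 * s) * (dec' x)^2"
      unfolding power2_eq_square[of "x powr (1 - 2 * s)"] mult.assoc by (rule powr_minus_cancel[OF x0])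
    also have "... <= x powr (1 - 2 * s) * ((dec' x)^2 + (l + x^2 / 4) * (dec x)^2)"
      using l by (intro mult_left_mono) auto
    finally show "?m * (?m^2 * (dec' r2)^2) <= x powr (1 - 2 * s) * ((dec' x)^2 + (l + x^2 / 4) * (dec x)^2)" .
  qed
  then show ?thesis by (simp add: power2_eq_square power4_eq_xxxx mult_ac)
qed

end


section \<open>Bounds uniform in the eigenvalue\<close>

context radial begin

lemma A_bounds: "l / 2 <= A" "A + 1 <= 4 * l"
proof -
  have "2 * A = 1 + s + l" by (simp add: A_def)
  then show "l / 2 <= A" "A + 1 <= 4 * l" using s l by linarith+
qed

lemma grow_lower:
  assumes "\<rho> > 0"
  shows "exp (- (\<rho>^2 / 2) / 2) * (\<rho>^2 / 2) powr s * (exp (\<rho> * sqrt l / 4) / 2) <= grow \<rho>"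
proof -
  define x where "x = \<rho>^2 / 2"
  have x: "x >= 0" by (simp add: x_def)
  have "(\<rho> * sqrt l / 2)^2 <= A * x"
  proof -
    have "(\<rho> * sqrt l / 2)^2 = l / 2 * x" using l by (simp add: x_def power_mult_distrib power_divide)
    also have "... <= A * x" using A_bounds(1) x by (rule mult_right_mono)
    finally show ?thesis .
  qed
  then have "\<rho> * sqrt l / 2 <= sqrt (A * x)" by (rule real_le_rsqrt)
  then have "exp (\<rho> * sqrt l / 4) / 2 <= exp (sqrt (A * x) / 2) / 2" by simp
  also have "... <= kummer A (1 + s) x" by (rule kummer_lower_bound) (use A_pos s x in auto)
  finally show ?thesis unfolding grow_def x_def[symmetric] by (intro mult_left_mono) auto
qed

lemma grow_upper:
  assumes "0 < \<rho>" "\<rho> <= R"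
  shows "grow \<rho> <= (R^2 / 2) powr s * exp (4 * (R^2 / 2 + 1) * sqrt l)"
proof -
  define x where "x = \<rho>^2 / 2"
  have x: "0 < x" "x <= R^2 / 2" using assms by (auto simp: x_def intro!: power_mono)
  have "sqrt (A + 1) <= sqrt (2^2 * l)" using A_bounds(2) by simp
  then have q: "sqrt (A + 1) <= 2 * sqrt l" by (simp add: real_sqrt_mult)
  have "kummer A (1 + s) x <= exp (2 * (x + 1) * sqrt (A + 1))"
    by (rule kummer_upper_bound) (use A_pos s x in auto)
  also have "... <= exp (4 * (R^2 / 2 + 1) * sqrt l)"
  proof -
    have "2 * (x + 1) * sqrt (A + 1) <= 2 * (R^2 / 2 + 1) * (2 * sqrt l)"
      using x q A_pos by (intro mult_mono) auto
    also have "... = 4 * (R^2 / 2 + 1) * sqrt l" by (simp add: algebra_simps)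
    finally show ?thesis by (rule iffD2[OF exp_le_cancel_iff])
  qed
  finally have k: "kummer A (1 + s) x <= exp (4 * (R^2 / 2 + 1) * sqrt l)" .
  have k0: "0 <= kummer A (1 + s) x" using kummer_ge_1[of A "1 + s" x] A_pos s x by simp
  have "exp (- x / 2) * x powr s * kummer A (1 + s) x <= 1 * (R^2 / 2) powr s * exp (4 * (R^2 / 2 + 1) * sqrt l)"
    using x s k k0 by (intro mult_mono powr_mono2) auto
  then show ?thesis by (simp add: grow_def x_def)
qed

lemma grow'_pos: assumes "\<rho> > 0" shows "grow' \<rho> >= 0"
proof -
  define P where "P \<rho> = \<rho> powr (1 - 2 * s) * grow' \<rho>" for \<rho>
  define r where "r = min \<rho> (sqrt s)"
  have r: "0 < r" "r <= \<rho>" "r <= sqrt s" using assms s by (auto simp: r_def)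
  have "r^2 <= (sqrt s)^2" using r by (intro power_mono) auto
  then have r2: "r^2 <= s" using s by simp
  have "P r <= P \<rho>"
  proof (rule DERIV_nonneg_imp_nondecreasing[OF r(2)])
    fix z assume "r <= z" "z <= \<rho>"
    then have z: "z > 0" using r by simp
    show "\<exists>d. (P has_real_derivative d) (at z) \<and> 0 <= d"
      unfolding P_def[abs_def]
      by (rule deriv_nonneg_exI[OF momentum_deriv[OF grow_sol z]]) (use l grow_pos[OF z] in \<open>simp add: less_imp_le\<close>)
  qed
  moreover have "grow' r >= 0"
  proof -
    define x where "x = r^2 / 2"
    have x: "x > 0" "x <= s / 2" using r r2 by (auto simp: x_def)
    have "kummer' A (1 + s) x >= 0"
      unfolding kummer'_def
    proof (rule suminf_nonneg)
      show "summable (\<lambda>p. diffs (kummer_coeff A (1 + s)) p * x ^ p)"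
        by (rule termdiff_converges_all[OF kummer_summable]) (use A_pos s in auto)
      show "0 <= diffs (kummer_coeff A (1 + s)) p * x ^ p" for p
        using kummer_coeff_pos[of A "1 + s" "Suc p"] A_pos s x by (simp add: diffs_def)
    qed
    moreover have "s / x - 1 / 2 >= 0" using x s by (simp add: field_simps)
    moreover have "kummer A (1 + s) x >= 0" using kummer_ge_1[of A "1 + s" x] A_pos s x by simp
    ultimately show ?thesis unfolding grow'_def x_def[symmetric] using r by simp
  qed
  ultimately have "P \<rho> >= 0" using r by (simp add: P_def order_trans[rotated])
  then show ?thesis using assms by (simp add: P_def zero_le_mult_iff)
qed

lemma grow_mono: assumes "0 < r" "r <= \<rho>" shows "grow r <= grow \<rho>"
proof (rule DERIV_nonneg_imp_nondecreasing[OF assms(2)])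
  fix z assume "r <= z" "z <= \<rho>"
  then have z: "z > 0" using assms by simp
  show "\<exists>d. (grow has_real_derivative d) (at z) \<and> 0 <= d"
    by (rule deriv_nonneg_exI[OF radial_solD(1)[OF grow_sol z] grow'_pos[OF z]])
qed

lemma grow'_upper:
  assumes "0 < R1" "R1 <= \<rho>" "\<rho> <= R2"
  shows "(min R1 (1 / (2 * R2)))^2 * (R1 * grow' \<rho>) <= grow (2 * R2)"
proof -
  let ?m = "min R1 (1 / (2 * R2))"
  have m0: "?m > 0" using assms by simp
  have "\<rho> < 2 * \<rho>" using assms by simp
  from MVT2[OF this, of grow grow'] radial_solD(1)[OF grow_sol] assms
  obtain z where z: "\<rho> < z" "z < 2 * \<rho>" "grow (2 * \<rho>) - grow \<rho> = (2 * \<rho> - \<rho>) * grow' z" by auto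
  have z0: "z > 0" using z assms by simp
  have "\<rho> powr (1 - 2 * s) * grow' \<rho> <= z powr (1 - 2 * s) * grow' z"
  proof (rule DERIV_nonneg_imp_nondecreasing[of \<rho> z "\<lambda>\<rho>. \<rho> powr (1 - 2 * s) * grow' \<rho>"])
    fix y assume "\<rho> <= y" "y <= z"
    then have y: "y > 0" using assms by simp
    show "\<exists>d. ((\<lambda>\<rho>. \<rho> powr (1 - 2 * s) * grow' \<rho>) has_real_derivative d) (at y) \<and> 0 <= d"
      by (rule deriv_nonneg_exI[OF momentum_deriv[OF grow_sol y]]) (use l grow_pos[OF y] in \<open>simp add: less_imp_le\<close>)
  qed (use z in simp)
  then have "z powr (- (1 - 2 * s)) * (\<rho> powr (1 - 2 * s) * grow' \<rho>) <= z powr (- (1 - 2 * s)) * (z powr (1 - 2 * s) * grow' z)"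
    by (rule mult_left_mono) simp
  also have "... = grow' z" by (rule powr_minus_cancel[OF z0])
  finally have le: "z powr (- (1 - 2 * s)) * (\<rho> powr (1 - 2 * s) * grow' \<rho>) <= grow' z" .
  have g0: "grow' \<rho> >= 0" by (rule grow'_pos) (use assms in simp)
  have "?m <= z powr (- (1 - 2 * s))" using assms z s by (intro powr_bounded_below) auto
  moreover have "?m <= \<rho> powr (1 - 2 * s)" using assms s by (intro powr_bounded_below) auto
  ultimately have "?m * (?m * grow' \<rho>) <= z powr (- (1 - 2 * s)) * (\<rho> powr (1 - 2 * s) * grow' \<rho>)"
    using m0 g0 mult_right_mono[of ?m "\<rho> powr (1 - 2 * s)" "grow' \<rho>"] by (intro mult_mono) auto
  then have "?m * (?m * grow' \<rho>) <= grow' z" using le by linarith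
  then have "R1 * (?m * (?m * grow' \<rho>)) <= \<rho> * grow' z"
    using assms m0 g0 grow'_pos[OF z0] by (intro mult_mono) auto
  also have "... <= grow (2 * \<rho>)" using z(3) grow_pos[of \<rho>] assms by simp
  also have "... <= grow (2 * R2)" using assms by (intro grow_mono) auto
  finally show ?thesis by (simp add: power2_eq_square mult_ac)
qed

text \<open>Wronskians with \<open>dec\<close> and \<open>grow\<close> are constant after weighting and give \<open>y = a * dec + b * grow\<close>; the limit at \<open>0\<close>
  identifies \<open>a\<close>.\<close>

lemma radial_sol_decompose:
  assumes y: "radial_sol s l y y'" and lim: "(y \<longlongrightarrow> f0) (at_right 0)"
  shows "\<exists>c. \<forall>\<rho>>0. y \<rho> = f0 * dec \<rho> + c * grow \<rho>"
proof -
  obtain w0 where w0: "\<And>\<rho>. \<rho> > 0 ==> \<rho> powr (1 - 2 * s) * (dec \<rho> * grow' \<rho> - dec' \<rho> * grow \<rho>) = w0"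
    using wronskian_const[OF dec_sol grow_sol] by blast
  obtain w1 where w1: "\<And>\<rho>. \<rho> > 0 ==> \<rho> powr (1 - 2 * s) * (y \<rho> * grow' \<rho> - y' \<rho> * grow \<rho>) = w1"
    using wronskian_const[OF y grow_sol] by blast
  obtain w2 where w2: "\<And>\<rho>. \<rho> > 0 ==> \<rho> powr (1 - 2 * s) * (y \<rho> * dec' \<rho> - y' \<rho> * dec \<rho>) = w2"
    using wronskian_const[OF y dec_sol] by blast
  have "w0 \<noteq> 0"
  proof
    assume "w0 = 0"
    then have z: "dec \<rho> * grow' \<rho> = dec' \<rho> * grow \<rho>" if "\<rho> > 0" for \<rho> using w0[OF that] that by simp
    have "\<exists>c. \<forall>\<rho>\<in>{0<..}. dec \<rho> / grow \<rho> = c"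
    proof (rule has_field_derivative_zero_constant)
      fix \<rho> :: real assume "\<rho> \<in> {0<..}"
      then have \<rho>: "\<rho> > 0" by simp
      have "((\<lambda>\<rho>. dec \<rho> / grow \<rho>) has_real_derivative (dec' \<rho> * grow \<rho> - dec \<rho> * grow' \<rho>) / (grow \<rho> * grow \<rho>)) (at \<rho>)"
        by (rule DERIV_divide[OF radial_solD(1)[OF dec_sol \<rho>] radial_solD(1)[OF grow_sol \<rho>]]) (use grow_pos[OF \<rho>] in simp)
      then show "((\<lambda>\<rho>. dec \<rho> / grow \<rho>) has_real_derivative 0) (at \<rho> within {0<..})"
        using z[OF \<rho>] by (simp add: has_field_derivative_at_within)
    qed (rule convex_real_interval)
    then obtain c where c: "\<And>\<rho>. \<rho> > 0 ==> dec \<rho> / grow \<rho> = c" by auto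
    have "((\<lambda>\<rho>. c * grow \<rho>) \<longlongrightarrow> c * 0) (at_right 0)" by (intro tendsto_mult tendsto_const grow_tendsto_0)
    moreover have "\<forall>\<^sub>F \<rho> in at_right 0. c * grow \<rho> = dec \<rho>"
      unfolding eventually_at_right_field
    proof (intro exI[of _ 1] conjI allI impI)
      show "c * grow \<rho> = dec \<rho>" if "0 < \<rho>" "\<rho> < 1" for \<rho> using c[OF that(1)] grow_pos[OF that(1)] by (simp add: field_simps)
    qed simp
    ultimately have "(dec \<longlongrightarrow> c * 0) (at_right 0)" by (rule Lim_transform_eventually)
    from tendsto_unique[OF _ dec_tendsto_1 this] show False by simp
  qed
  have eq: "y \<rho> = (w1 / w0) * dec \<rho> + (- w2 / w0) * grow \<rho>" if \<rho>: "\<rho> > 0" for \<rho>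
  proof -
    define p where "p = \<rho> powr (1 - 2 * s)"
    have "w0 * y \<rho> = w1 * dec \<rho> - w2 * grow \<rho>"
      unfolding w0[OF \<rho>, symmetric] w1[OF \<rho>, symmetric] w2[OF \<rho>, symmetric] p_def[symmetric]
      by (simp add: algebra_simps)
    then show ?thesis using \<open>w0 \<noteq> 0\<close> by (simp add: field_simps)
  qed
  have "((\<lambda>\<rho>. (w1 / w0) * dec \<rho> + (- w2 / w0) * grow \<rho>) \<longlongrightarrow> (w1 / w0) * 1 + (- w2 / w0) * 0) (at_right 0)"
    by (intro tendsto_add tendsto_mult tendsto_const dec_tendsto_1 grow_tendsto_0)
  moreover have "\<forall>\<^sub>F \<rho> in at_right 0. (w1 / w0) * dec \<rho> + (- w2 / w0) * grow \<rho> = y \<rho>"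
    unfolding eventually_at_right_field using eq by (intro exI[of _ 1]) auto
  ultimately have "(y \<longlongrightarrow> (w1 / w0) * 1 + (- w2 / w0) * 0) (at_right 0)" by (rule Lim_transform_eventually)
  from tendsto_unique[OF _ lim this] have "f0 = w1 / w0" by simp
  then show ?thesis using eq by blast
qed

lemma whittaker_M_grow:
  assumes "\<rho> > 0"
  shows "(\<rho>^2 / 2) powr ((s - 1) / 2) * whittaker_M (- (l / 2)) (s / 2) (\<rho>^2 / 2) = grow \<rho>"
proof -
  define x where "x = \<rho>^2 / 2"
  have x: "x > 0" using assms by (simp add: x_def)
  have "whittaker_M (- (l / 2)) (s / 2) x = exp (- x / 2) * x powr (1/2 + s/2) * kummer A (1 + s) x"
  proof -
    have "1/2 + s/2 - (- (l / 2)) = A" "1 + 2 * (s / 2) = 1 + s" by (simp_all add: A_def)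
    then show ?thesis unfolding whittaker_M_def kummer_def kummer_coeff_def by simp
  qed
  moreover have "x powr ((s - 1) / 2) * x powr (1/2 + s/2) = x powr s"
    using x by (simp add: diff_divide_distrib flip: powr_add)
  ultimately show ?thesis unfolding grow_def x_def[symmetric] by (simp add: mult_ac)
qed

lemma whittaker_M_reg:
  assumes "\<rho> > 0"
  shows "(\<rho>^2 / 2) powr ((s - 1) / 2) * whittaker_M (- (l / 2)) (- (s / 2)) (\<rho>^2 / 2) = reg \<rho>"
proof -
  define x where "x = \<rho>^2 / 2"
  have x: "x > 0" using assms by (simp add: x_def)
  have "whittaker_M (- (l / 2)) (- (s / 2)) x = exp (- x / 2) * x powr (1/2 + - (s/2)) * kummer A' (1 - s) x"
  proof -
    have "1/2 + - (s/2) - (- (l / 2)) = A'" "1 + 2 * (- (s / 2)) = 1 - s" by (simp_all add: A'_def diff_divide_distrib)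
    then show ?thesis unfolding whittaker_M_def kummer_def kummer_coeff_def by simp
  qed
  moreover have "x powr ((s - 1) / 2) * x powr (1/2 + - (s/2)) = 1"
    using x by (simp add: diff_divide_distrib flip: powr_add)
  ultimately have "x powr ((s - 1) / 2) * whittaker_M (- (l / 2)) (- (s / 2)) x = exp (- x / 2) * kummer A' (1 - s) x"
    by (simp add: mult_ac)
  then show ?thesis unfolding reg_def x_def[symmetric] .
qed

text \<open>Both connection coefficients of \<open>W\<close> become those of \<open>dec\<close> after division by \<open>\<Gamma>(s) / \<Gamma>(A)\<close>.\<close>

lemma whittaker_W_dec:
  assumes "\<rho> > 0"
  shows "(\<rho>^2 / 2) powr ((s - 1) / 2) / Gamma s *
     (Gamma A * whittaker_W (- (l / 2)) (s / 2) (\<rho>^2 / 2)) = dec \<rho>"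
proof -
  define B where "B = (\<rho>^2 / 2) powr ((s - 1) / 2)"
  define G1 G2 where G12: "G1 = whittaker_M (- (l / 2)) (s / 2) (\<rho>^2 / 2)" "G2 = whittaker_M (- (l / 2)) (- (s / 2)) (\<rho>^2 / 2)"
  have gs: "Gamma s > 0" "Gamma A > 0" "Gamma A' > 0" "Gamma (1 - s) > 0"
    using s A_pos(1,2) by (auto intro: Gamma_real_pos)
  have r1: "Gamma (1 - s) = - s * Gamma (- s)"
  proof -
    have "- s \<notin> \<int>\<^sub>\<le>\<^sub>0"
    proof
      assume "- s \<in> \<int>\<^sub>\<le>\<^sub>0"
      then obtain n :: int where "- s = of_int n" by (elim nonpos_Ints_cases) auto
      then have "of_int (- n) = s" by simp
      then have "0 < real_of_int (- n)" "real_of_int (- n) < 1" using s by simp_all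
      then show False unfolding of_int_0_less_iff of_int_less_1_iff by simp
    qed
    from Gamma_plus1[OF this] show ?thesis by (simp add: add.commute)
  qed
  have r2: "Gamma (1 + s) = s * Gamma s"
  proof -
    have "s \<notin> \<int>\<^sub>\<le>\<^sub>0" using s nonpos_Ints_nonpos by force
    from Gamma_plus1[OF this] show ?thesis by (simp add: add.commute)
  qed
  have "1/2 - s/2 - (- (l / 2)) = A'" "1/2 + s/2 - (- (l / 2)) = A" by (simp_all add: A_def A'_def add_divide_distrib diff_divide_distrib)
  then have W: "whittaker_W (- (l / 2)) (s / 2) (\<rho>^2 / 2) = Gamma (- s) / Gamma A' * G1 + Gamma s / Gamma A * G2"
    unfolding whittaker_W_def G12 by simp
  have "conn = - (Gamma (- s) * Gamma A) / (Gamma s * Gamma A')"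
    unfolding conn_def r1 r2 using s by simp
  from this have "B / Gamma s * (Gamma A * whittaker_W (- (l / 2)) (s / 2) (\<rho>^2 / 2)) = B * G2 - conn * (B * G1)"
  proof -
    assume c: "conn = - (Gamma (- s) * Gamma A) / (Gamma s * Gamma A')"
    have eq: "B / g * (a * (m / a' * G1 + g / a * G2)) = B * G2 - (- (m * a) / (g * a')) * (B * G1)"
      if "g > 0" "a > 0" "a' > 0" for g a a' m :: real
      using that by (simp add: field_simps)
    show ?thesis unfolding W c by (rule eq) (use gs in auto)
  qed
  then show ?thesis
    using whittaker_M_grow[OF assms] whittaker_M_reg[OF assms] unfolding B_def G12 dec_def by simp
qed

end

definition radial_rhs :: "real => real => (real => real) => (real => real) => real => real" where
  "radial_rhs s l y y' \<rho> = (l + \<rho>^2 / 4) * y \<rho> - (1 - 2 * s) / \<rho> * y' \<rho>"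

text \<open>Each step from \<open>R / 2\<close> to \<open>R\<close> gains a factor \<open>l\<close> by \<open>dec_decay_step\<close>.\<close>

lemma dec_sq_decay:
  assumes s: "0 < s" "s < 1"
  shows "R > 0 ==> \<exists>C. \<forall>l\<ge>1. \<forall>\<rho>\<ge>R. l ^ M * (radial.dec s l \<rho>)^2 <= C"
proof (induction M arbitrary: R)
  case 0
  have "l ^ 0 * (radial.dec s l \<rho>)^2 <= 1" if "l >= 1" "\<rho> >= R" for l \<rho>
  proof -
    interpret radial s l by standard (use s that in auto)
    show ?thesis using dec_sq_le_1[of \<rho>] 0 that by simp
  qed
  then show ?case by blast
next
  case (Suc M)
  obtain C where C: "\<And>l \<rho>. l >= 1 ==> \<rho> >= R / 2 ==> l ^ M * (radial.dec s l \<rho>)^2 <= C"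
    using Suc.IH[of "R / 2"] Suc.prems by auto
  define q where "q = (min (R / 2) (1 / R))^2 * (R - R / 2)^2"
  have "min (R / 2) (1 / R) > 0" "R - R / 2 > 0" using Suc.prems by auto
  then have q: "q > 0" unfolding q_def by (intro mult_pos_pos zero_less_power)
  have "l ^ Suc M * (radial.dec s l \<rho>)^2 <= C / q" if l: "l >= 1" and \<rho>: "\<rho> >= R" for l \<rho>
  proof -
    interpret radial s l by standard (use s l in auto)
    have "q * (l * (dec R)^2) <= (dec (R / 2))^2"
      unfolding q_def by (rule dec_decay_step) (use Suc.prems in auto)
    then have "l ^ M * (q * (l * (dec R)^2)) <= l ^ M * (dec (R / 2))^2" using l by (intro mult_left_mono) auto
    also have "... <= C" using C[of l "R / 2"] l by simp
    finally have "l ^ Suc M * (dec R)^2 <= C / q" using q by (simp add: pos_le_divide_eq mult_ac)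
    moreover have "l ^ Suc M * (dec \<rho>)^2 <= l ^ Suc M * (dec R)^2"
      using dec_sq_antimono[of R \<rho>] Suc.prems \<rho> l by (intro mult_left_mono) auto
    ultimately show ?thesis by linarith
  qed
  then show ?case by blast
qed

lemma abs_le_of_sq_le: "x^2 <= C ==> \<bar>x\<bar> <= C + (1::real)"
proof -
  assume a: "x^2 <= C"
  have "0 <= (\<bar>x\<bar> - 1)^2" by simp
  then have "2 * \<bar>x\<bar> <= x^2 + 1" by (simp add: power2_eq_square algebra_simps)
  then show ?thesis using a zero_le_power2[of x] by linarith
qed

lemma dec_decay:
  assumes s: "0 < s" "s < 1" and R: "0 < R1" "R1 <= R2"
  shows "\<exists>C\<ge>0. \<forall>l\<ge>1. \<forall>\<rho>\<in>{R1..R2}. l ^ M * \<bar>radial.dec s l \<rho>\<bar> <= C \<and> l ^ M * \<bar>radial.dec' s l \<rho>\<bar> <= C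
     \<and> l ^ M * \<bar>radial_rhs s l (radial.dec s l) (radial.dec' s l) \<rho>\<bar> <= C"
proof -
  have d: "\<exists>C. \<forall>l\<ge>1. \<forall>\<rho>\<in>{R1..R2}. l ^ M * \<bar>radial.dec s l \<rho>\<bar> <= C" for M
  proof -
    obtain C where C: "\<And>l \<rho>. l >= 1 ==> \<rho> >= R1 ==> l ^ (2 * M) * (radial.dec s l \<rho>)^2 <= C"
      using dec_sq_decay[OF s R(1), of "2 * M"] by blast
    have "l ^ M * \<bar>radial.dec s l \<rho>\<bar> <= C + 1" if "l >= 1" "\<rho> \<in> {R1..R2}" for l \<rho>
    proof -
      have "(l ^ M * radial.dec s l \<rho>)^2 <= C" using C[of l \<rho>] that by (simp add: power_mult_distrib mult.commute[of M 2] flip: power_mult)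
      from abs_le_of_sq_le[OF this] show ?thesis using that by (simp add: abs_mult power_abs)
    qed
    then show ?thesis by blast
  qed
  have d': "\<exists>C. \<forall>l\<ge>1. \<forall>\<rho>\<in>{R1..R2}. l ^ M * \<bar>radial.dec' s l \<rho>\<bar> <= C" for M
  proof -
    obtain C where C: "\<And>l \<rho>. l >= 1 ==> \<rho> >= R1 / 2 ==> l ^ (2 * M) * (radial.dec s l \<rho>)^2 <= C"
      using dec_sq_decay[OF s, of "R1 / 2" "2 * M"] R by auto
    define q where "q = (min (R1 / 2) (1 / R2)) ^ 4 * (R1 / 2)^2"
    have "min (R1 / 2) (1 / R2) > 0" "R1 / 2 > 0" using R by auto
    then have q: "q > 0" unfolding q_def by (intro mult_pos_pos zero_less_power)
    have "l ^ M * \<bar>radial.dec' s l \<rho>\<bar> <= C / q + 1" if l: "l >= 1" and \<rho>: "\<rho> \<in> {R1..R2}" for l \<rho>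
    proof -
      interpret radial s l by standard (use s l in auto)
      have "q * (dec' \<rho>)^2 <= (min (\<rho> / 2) (1 / \<rho>)) ^ 4 * (\<rho> - \<rho> / 2)^2 * (dec' \<rho>)^2"
        unfolding q_def using R \<rho> by (intro mult_right_mono mult_mono power_mono min.mono divide_left_mono) auto
      also have "... <= (dec (\<rho> / 2))^2" by (rule dec'_decay_step) (use \<rho> R in auto)
      finally have "l ^ (2 * M) * (q * (dec' \<rho>)^2) <= l ^ (2 * M) * (dec (\<rho> / 2))^2" using l by (intro mult_left_mono) auto
      also have "... <= C" using C[of l "\<rho> / 2"] l \<rho> by simp
      finally have "l ^ (2 * M) * (dec' \<rho>)^2 <= C / q" using q by (simp add: pos_le_divide_eq mult_ac)
      then have "(l ^ M * dec' \<rho>)^2 <= C / q" by (simp add: power_mult_distrib mult.commute[of M 2] flip: power_mult)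
      from abs_le_of_sq_le[OF this] show ?thesis using l by (simp add: abs_mult power_abs)
    qed
    then show ?thesis by blast
  qed
  obtain C1 where C1: "\<And>l \<rho>. l >= 1 ==> \<rho> \<in> {R1..R2} ==> l ^ M * \<bar>radial.dec s l \<rho>\<bar> <= C1" using d by blast
  obtain C2 where C2: "\<And>l \<rho>. l >= 1 ==> \<rho> \<in> {R1..R2} ==> l ^ M * \<bar>radial.dec' s l \<rho>\<bar> <= C2" using d' by blast
  obtain C3 where C3: "\<And>l \<rho>. l >= 1 ==> \<rho> \<in> {R1..R2} ==> l ^ Suc M * \<bar>radial.dec s l \<rho>\<bar> <= C3" using d by blast
  have "l ^ M * \<bar>radial_rhs s l (radial.dec s l) (radial.dec' s l) \<rho>\<bar> <= (1 + R2^2) * \<bar>C3\<bar> + 1 / R1 * \<bar>C2\<bar>"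
    if l: "l >= 1" and \<rho>: "\<rho> \<in> {R1..R2}" for l \<rho>
  proof -
    let ?d = "\<bar>radial.dec s l \<rho>\<bar>" and ?d' = "\<bar>radial.dec' s l \<rho>\<bar>"
    have "\<bar>radial_rhs s l (radial.dec s l) (radial.dec' s l) \<rho>\<bar> <= (l + \<rho>^2 / 4) * ?d + \<bar>(1 - 2 * s) / \<rho>\<bar> * ?d'"
      unfolding radial_rhs_def using l by (intro order_trans[OF abs_triangle_ineq4]) (simp add: abs_mult)
    also have "... <= ((1 + R2^2) * l) * ?d + 1 / R1 * ?d'"
    proof (intro add_mono mult_right_mono)
      have "\<rho>^2 <= R2^2" using \<rho> R by (intro power_mono) auto
      then have "\<rho>^2 / 4 <= R2^2 * 1" using zero_le_power2[of \<rho>] by linarith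
      also have "... <= R2^2 * l" using l by (intro mult_left_mono) auto
      finally show "l + \<rho>^2 / 4 <= (1 + R2^2) * l" by (simp add: distrib_right)
      have "\<bar>1 - 2 * s\<bar> / \<rho> <= 1 / R1" using s \<rho> R by (intro frac_le) auto
      then show "\<bar>(1 - 2 * s) / \<rho>\<bar> <= 1 / R1" using \<rho> R by (simp add: abs_divide)
    qed auto
    finally have "l ^ M * \<bar>radial_rhs s l (radial.dec s l) (radial.dec' s l) \<rho>\<bar>
        <= l ^ M * (((1 + R2^2) * l) * ?d + 1 / R1 * ?d')" using l by (intro mult_left_mono) auto
    also have "... = (1 + R2^2) * (l ^ Suc M * ?d) + 1 / R1 * (l ^ M * ?d')" by (simp add: algebra_simps)
    also have "... <= (1 + R2^2) * \<bar>C3\<bar> + 1 / R1 * \<bar>C2\<bar>"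
      using C3[OF l \<rho>] C2[OF l \<rho>] R by (intro add_mono mult_left_mono) auto
    finally show ?thesis .
  qed
  then have "\<forall>l\<ge>1. \<forall>\<rho>\<in>{R1..R2}. l ^ M * \<bar>radial.dec s l \<rho>\<bar> <= K \<and> l ^ M * \<bar>radial.dec' s l \<rho>\<bar> <= K
     \<and> l ^ M * \<bar>radial_rhs s l (radial.dec s l) (radial.dec' s l) \<rho>\<bar> <= K"
    if "C1 <= K" "C2 <= K" "(1 + R2^2) * \<bar>C3\<bar> + 1 / R1 * \<bar>C2\<bar> <= K" for K
    using C1 C2 that by (blast intro: order_trans)
  moreover define K where "K = \<bar>C1\<bar> + \<bar>C2\<bar> + ((1 + R2^2) * \<bar>C3\<bar> + 1 / R1 * \<bar>C2\<bar>)"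
  moreover have "0 <= (1 + R2^2) * \<bar>C3\<bar> + 1 / R1 * \<bar>C2\<bar>" using R by simp
  then have "C1 <= K" "C2 <= K" "(1 + R2^2) * \<bar>C3\<bar> + 1 / R1 * \<bar>C2\<bar> <= K" "0 <= K" unfolding K_def by linarith+
  ultimately show ?thesis by blast
qed

lemma grow_growth:
  assumes s: "0 < s" "s < 1" and R: "0 < R1" "R1 <= R2"
  shows "\<exists>C\<ge>0. \<exists>t. \<forall>l\<ge>1. \<forall>\<rho>\<in>{R1..R2}. \<bar>radial.grow s l \<rho>\<bar> <= C * exp (t * sqrt l)
     \<and> \<bar>radial.grow' s l \<rho>\<bar> <= C * exp (t * sqrt l)
     \<and> \<bar>radial_rhs s l (radial.grow s l) (radial.grow' s l) \<rho>\<bar> <= C * exp (t * sqrt l)"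
proof -
  \<comment> \<open>Bounds at \<open>2 * R2\<close>, since \<open>grow'\<close> at \<open>\<rho>\<close> is controlled by the increment of \<open>grow\<close> up to \<open>2 * \<rho>\<close>; the extra \<open>2\<close> in the
    exponent below absorbs the factor \<open>l\<close> of the equation.\<close>
  define C0 t0 where C0: "C0 = ((2 * R2)^2 / 2) powr s" "t0 = 4 * ((2 * R2)^2 / 2 + 1)"
  define q where "q = (min R1 (1 / (2 * R2)))^2 * R1"
  have "min R1 (1 / (2 * R2)) > 0" using R by auto
  then have q: "q > 0" unfolding q_def using R by (intro mult_pos_pos zero_less_power)
  define K where "K = (1 + R2^2) * 4 * C0 + 1 / R1 * (C0 / q) + C0 + C0 / q"
  have C0p: "C0 >= 0" by (simp add: C0)
  have "\<bar>radial.grow s l \<rho>\<bar> <= K * exp ((t0 + 2) * sqrt l) \<and> \<bar>radial.grow' s l \<rho>\<bar> <= K * exp ((t0 + 2) * sqrt l)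
     \<and> \<bar>radial_rhs s l (radial.grow s l) (radial.grow' s l) \<rho>\<bar> <= K * exp ((t0 + 2) * sqrt l)"
    if l: "l >= 1" and \<rho>: "\<rho> \<in> {R1..R2}" for l \<rho>
  proof -
    interpret radial s l by standard (use s l in auto)
    let ?e = "exp (t0 * sqrt l)" and ?E = "exp ((t0 + 2) * sqrt l)"
    have eE: "?e <= ?E" using l by (simp add: distrib_right)
    have leE: "l * ?e <= 4 * ?E"
    proof -
      have "sqrt l <= exp (sqrt l)" using exp_ge_add_one_self[of "sqrt l"] by linarith
      then have "sqrt l * sqrt l <= exp (sqrt l) * exp (sqrt l)" using l by (intro mult_mono) auto
      then have "l <= exp (2 * sqrt l)" using l by (simp flip: exp_add)
      then have "l * ?e <= exp (2 * sqrt l) * ?e" by (intro mult_right_mono) auto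
      also have "... = ?E" by (simp add: distrib_right flip: exp_add)
      finally show ?thesis by (simp add: order_trans[of _ ?E])
    qed
    have g2: "grow (2 * R2) <= C0 * ?e" unfolding C0 by (rule grow_upper) (use R in auto)
    have gp: "grow \<rho> > 0" by (rule grow_pos) (use \<rho> R in auto)
    have g: "grow \<rho> <= C0 * ?e" using grow_mono[of \<rho> "2 * R2"] g2 \<rho> R by auto
    have g': "0 <= grow' \<rho>" by (rule grow'_pos) (use \<rho> R in auto)
    have "q * grow' \<rho> <= C0 * ?e"
      using grow'_upper[of R1 \<rho> R2] \<rho> R g2 by (simp add: q_def mult.assoc)
    then have g'u: "grow' \<rho> <= C0 / q * ?e" using q by (simp add: field_simps)
    have "\<bar>radial_rhs s l grow grow' \<rho>\<bar> <= (l + \<rho>^2 / 4) * grow \<rho> + \<bar>(1 - 2 * s) / \<rho>\<bar> * grow' \<rho>"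
      unfolding radial_rhs_def using l gp g' by (intro order_trans[OF abs_triangle_ineq4]) (simp add: abs_mult)
    also have "... <= ((1 + R2^2) * l) * (C0 * ?e) + 1 / R1 * (C0 / q * ?e)"
    proof (intro add_mono mult_mono g g'u)
      have "\<rho>^2 <= R2^2" using \<rho> R by (intro power_mono) auto
      then have "\<rho>^2 / 4 <= R2^2 * 1" using zero_le_power2[of \<rho>] by linarith
      also have "... <= R2^2 * l" using l by (intro mult_left_mono) auto
      finally show "l + \<rho>^2 / 4 <= (1 + R2^2) * l" by (simp add: distrib_right)
      have "\<bar>1 - 2 * s\<bar> / \<rho> <= 1 / R1" using s \<rho> R by (intro frac_le) auto
      then show "\<bar>(1 - 2 * s) / \<rho>\<bar> <= 1 / R1" using \<rho> R by (simp add: abs_divide)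
    qed (use l gp g' R in auto)
    also have "... = (1 + R2^2) * C0 * (l * ?e) + 1 / R1 * (C0 / q) * ?e" by (simp add: mult_ac)
    also have "... <= (1 + R2^2) * C0 * (4 * ?E) + 1 / R1 * (C0 / q) * ?E"
      using C0p q R by (intro add_mono mult_left_mono leE eE) auto
    finally have rhs: "\<bar>radial_rhs s l grow grow' \<rho>\<bar> <= ((1 + R2^2) * 4 * C0 + 1 / R1 * (C0 / q)) * ?E" by (simp add: algebra_simps)
    have K1: "C0 <= K" "C0 / q <= K" "(1 + R2^2) * 4 * C0 + 1 / R1 * (C0 / q) <= K"
      using C0p q R by (auto simp: K_def add_nonneg_nonneg)
    have "grow \<rho> <= K * ?E"
      by (rule order_trans[OF g mult_mono[OF K1(1) eE]]) (use K1 C0p in auto)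
    moreover have "grow' \<rho> <= K * ?E"
      by (rule order_trans[OF g'u mult_mono[OF K1(2) eE]]) (use K1 C0p in auto)
    moreover have "\<bar>radial_rhs s l grow grow' \<rho>\<bar> <= K * ?E"
      by (rule order_trans[OF rhs mult_right_mono[OF K1(3)]]) simp
    ultimately show ?thesis using gp g' by simp
  qed
  moreover have "K >= 0" unfolding K_def using C0p q R by (intro add_nonneg_nonneg mult_nonneg_nonneg divide_nonneg_nonneg) auto
  ultimately show ?thesis by blast
qed


section \<open>Operations on tempered distributions\<close>

lemma linear_functional_test_sum:
  assumes T: "linear_functional_on test_funs T" and "finite A" "\<And>a. a \<in> A ==> F a \<in> test_funs"
  shows "T (\<lambda>x. \<Sum>a\<in>A. F a x) = (\<Sum>a\<in>A. T (F a))"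
  using assms(2,3)
proof (induction A rule: finite_induct)
  case empty
  have "T (\<lambda>x. 0 * (0::complex)) = 0 * T (\<lambda>x. 0)"
    using T[unfolded linear_functional_on_def, THEN conjunct2, rule_format, OF test_funs_zero] .
  then show ?case by simp
next
  case (insert a A)
  have "T (\<lambda>x. F a x + (\<Sum>a\<in>A. F a x)) = T (F a) + T (\<lambda>x. \<Sum>a\<in>A. F a x)"
    using T[unfolded linear_functional_on_def, THEN conjunct1, rule_format, of "F a" "\<lambda>x. \<Sum>a\<in>A. F a x"]
      insert.prems test_funs_sum[of A F] by simp
  then show ?case using insert by simp
qed

lemma test_funs_cmult: "f \<in> test_funs ==> (\<lambda>x. c * f x) \<in> test_funs"
  using test_funs_mult[of f "\<lambda>x. c"] by simp

abbreviation root_gauss :: "real^'n::finite => complex" where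
  "root_gauss x \<equiv> of_real (sqrt (gauss x))"

lemma gauss_pos: "gauss (x :: real^'n::finite) > 0" by (simp add: gauss_def)

lemma gauss_nz [simp]: "gauss (x :: real^'n::finite) \<noteq> 0" using gauss_pos[of x] by simp

lemma root_gauss_nz: "root_gauss (x :: real^'n::finite) \<noteq> 0" using gauss_pos[of x] by simp

lemma root_gauss_sq: "root_gauss x * root_gauss x = of_real (gauss (x::real^'n::finite))"
  using gauss_pos[of x] by (simp flip: of_real_mult)

lemma smooth_fun_inverse_root_gauss: "smooth_fun (\<lambda>x::real^'n::finite. inverse (root_gauss x))"
proof -
  have "inverse (root_gauss x) = of_real (pi powr (real CARD('n) / 4) * exp (1 / 2 * (norm x)^2))" for x :: "real^'n"
  proof -
    have "sqrt (gauss x) * (pi powr (real CARD('n) / 4) * exp (1 / 2 * (norm x)^2))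
        = (pi powr (- real CARD('n) / 4) * pi powr (real CARD('n) / 4)) * (exp (- (norm x)\<^sup>2 / 2) * exp (1 / 2 * (norm x)^2))"
      by (simp add: sqrt_gauss)
    also have "... = 1" by (simp flip: powr_add exp_add)
    finally have "root_gauss x * of_real (pi powr (real CARD('n) / 4) * exp (1 / 2 * (norm x)^2)) = 1"
      by (simp flip: of_real_mult)
    then show ?thesis by (rule inverse_unique)
  qed
  then show ?thesis using smooth_fun_exp_norm_sq[of "pi powr (real CARD('n) / 4)" "1 / 2"] by simp
qed

lemma test_funs_root_gauss: "\<phi> \<in> test_funs ==> (\<lambda>x. root_gauss x * \<phi> x) \<in> test_funs"
  by (rule test_funs_mult[OF _ smooth_fun_sqrt_gauss])

lemma test_funs_factor_root_gauss:
  assumes "\<phi> \<in> test_funs"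
  obtains \<psi> where "\<psi> \<in> test_funs" "\<phi> = (\<lambda>x. root_gauss x * \<psi> x)"
proof
  show "(\<lambda>x. inverse (root_gauss x) * \<phi> x) \<in> test_funs"
    by (rule test_funs_mult[OF assms smooth_fun_inverse_root_gauss])
  show "\<phi> = (\<lambda>x. root_gauss x * (inverse (root_gauss x) * \<phi> x))"
    by (simp add: fun_eq_iff flip: mult.assoc)
qed

lemma pderiv_at_root_gauss: "pderiv_at i root_gauss x = - (of_real (x $ i) * root_gauss (x :: real^'n::finite))"
proof -
  have e: "hermite_fun (\<lambda>_. 0) = (root_gauss :: real^'n => complex)" by (simp add: hermite_fun_def fun_eq_iff Herm_def)
  show ?thesis using pderiv_at_hermite_fun[of i "\<lambda>_. 0" x] hermite_fun_coord[of x i "\<lambda>_. 0"] unfolding e by simp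
qed

lemma pderiv_at_root_gauss_mult:
  assumes "smooth_fun (\<psi> :: real^'n::finite => complex)"
  shows "pderiv_at i (\<lambda>x. root_gauss x * \<psi> x)
    = (\<lambda>x. root_gauss x * (pderiv_at i \<psi> x + (-1) * (of_real (x $ i) * \<psi> x)))"
proof
  fix x :: "real^'n"
  show "pderiv_at i (\<lambda>x. root_gauss x * \<psi> x) x
    = root_gauss x * (pderiv_at i \<psi> x + (-1) * (of_real (x $ i) * \<psi> x))"
    using pderiv_at_mult[OF smooth_fun_differentiable[OF smooth_fun_sqrt_gauss] smooth_fun_differentiable[OF assms], of i x]
    by (simp add: pderiv_at_root_gauss algebra_simps)
qed

lemma pderiv_at_coord_mult:
  assumes "smooth_fun (\<psi> :: real^'n::finite => complex)"
  shows "pderiv_at i (\<lambda>x. of_real (x $ i) * \<psi> x) x = \<psi> x + of_real (x $ i) * pderiv_at i \<psi> x"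
  using pderiv_at_mult[OF smooth_fun_differentiable[OF smooth_fun_coord] smooth_fun_differentiable[OF assms], of i i x]
  by (simp add: pderiv_at_coord)

text \<open>Transposing, \<open>L\<close> becomes \<open>- \<Delta> - 2 div(x \<cdot>) + n\<close>, and \<open>\<partial>\<^sub>i sqrt \<gamma> = - x\<^sub>i sqrt \<gamma>\<close> cancels the first-order terms.\<close>

lemma OU_op_M_gauss:
  fixes F :: "'n::finite functional"
  assumes F: "linear_functional_on test_funs F" and \<psi>: "\<psi> \<in> test_funs"
  shows "OU_op F (\<lambda>x. root_gauss x * \<psi> x) = M_gauss F (harm_osc \<psi>)"
proof -
  define \<phi> where "\<phi> = (\<lambda>x. root_gauss x * \<psi> x)"
  have \<phi>: "\<phi> \<in> test_funs" unfolding \<phi>_def by (rule test_funs_root_gauss[OF \<psi>])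
  have sm: "smooth_fun \<psi>" by (rule test_funs_smooth[OF \<psi>])
  have F_add: "F (\<lambda>x. a x + b x) = F a + F b" if "a \<in> test_funs" "b \<in> test_funs" for a b
    using F that unfolding linear_functional_on_def by blast
  have F_cmult: "F (\<lambda>x. c * a x) = c * F a" if "a \<in> test_funs" for a c
    using F that unfolding linear_functional_on_def by blast
  define P where "P i = pderiv_at i (pderiv_at i \<phi>)" for i
  define X where "X i = pderiv_at i (\<lambda>x. of_real (x $ i) * \<phi> x)" for i
  have tP: "P i \<in> test_funs" for i unfolding P_def by (intro test_funs_pderiv_at \<phi>)
  have tX: "X i \<in> test_funs" for i unfolding X_def by (intro test_funs_pderiv_at test_funs_mult[OF \<phi>] smooth_fun_coord)
  have "OU_op F \<phi> = (\<Sum>i\<in>UNIV. (-1) * F (P i) + ((-2) * F (X i) + F \<phi>))"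
    by (simp add: OU_op_def dist_pderiv_def dist_mult_def P_def X_def sum.distrib sum_negf sum_distrib_left sum_subtractf)
  also have "... = (\<Sum>i\<in>UNIV. F (\<lambda>x. (-1) * P i x + ((-2) * X i x + \<phi> x)))"
    by (simp only: F_add F_cmult test_funs_cmult test_funs_add tP tX \<phi>)
  also have "... = F (\<lambda>x. \<Sum>i\<in>UNIV. (-1) * P i x + ((-2) * X i x + \<phi> x))"
    by (rule linear_functional_test_sum[OF F, symmetric]) (intro finite test_funs_add test_funs_cmult tP tX \<phi>)+
  also have "(\<lambda>x. \<Sum>i\<in>UNIV. (-1) * P i x + ((-2) * X i x + \<phi> x)) = (\<lambda>x. root_gauss x * harm_osc \<psi> x)"
  proof
    fix x :: "real^'n"
    have "(-1) * P i x + ((-2) * X i x + \<phi> x)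
      = root_gauss x * (of_real (x $ i) * (of_real (x $ i) * \<psi> x) - pderiv_at i (pderiv_at i \<psi>) x)" for i
    proof -
      let ?x = "of_real (x $ i)"
      have s1: "smooth_fun (\<lambda>x. of_real (x $ i) * \<psi> x)" by (intro smooth_fun_mult smooth_fun_coord sm)
      have s1': "smooth_fun (\<lambda>x. (-1) * (of_real (x $ i) * \<psi> x))" by (intro smooth_fun_mult s1 smooth_fun_const)
      have s2: "smooth_fun (\<lambda>x. pderiv_at i \<psi> x + (-1) * (of_real (x $ i) * \<psi> x))"
        by (intro smooth_fun_add smooth_fun_pderiv_at sm s1')
      have d: "pderiv_at i (\<lambda>x. pderiv_at i \<psi> x + (-1) * (of_real (x $ i) * \<psi> x)) x
          = pderiv_at i (pderiv_at i \<psi>) x + (-1) * (\<psi> x + ?x * pderiv_at i \<psi> x)"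
        unfolding pderiv_at_add[OF smooth_fun_differentiable[OF smooth_fun_pderiv_at[OF sm]] smooth_fun_differentiable[OF s1']]
          pderiv_at_cmult[OF smooth_fun_differentiable[OF s1]] pderiv_at_coord_mult[OF sm] ..
      have "P i x = root_gauss x * (pderiv_at i (pderiv_at i \<psi>) x + (-1) * (\<psi> x + ?x * pderiv_at i \<psi> x)
            + (-1) * (?x * (pderiv_at i \<psi> x + (-1) * (?x * \<psi> x))))"
        unfolding P_def \<phi>_def pderiv_at_root_gauss_mult[OF sm] pderiv_at_root_gauss_mult[OF s2] d ..
      moreover have "X i x = \<phi> x + ?x * (root_gauss x * (pderiv_at i \<psi> x + (-1) * (?x * \<psi> x)))"
        unfolding X_def pderiv_at_coord_mult[OF test_funs_smooth[OF \<phi>]] unfolding \<phi>_def pderiv_at_root_gauss_mult[OF sm] ..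
      moreover have "\<phi> x = root_gauss x * \<psi> x" by (simp add: \<phi>_def)
      ultimately show ?thesis by (simp only:) (simp add: algebra_simps)
    qed
    then show "(\<Sum>i\<in>UNIV. (-1) * P i x + ((-2) * X i x + \<phi> x)) = root_gauss x * harm_osc \<psi> x"
      by (simp add: harm_osc_def sum_distrib_left)
  qed
  finally show ?thesis by (simp add: \<phi>_def M_gauss_def dist_mult_def)
qed

lemma bounded_functional_lincomb:
  assumes T: "bounded_functional T" and S: "bounded_functional S"
  shows "bounded_functional (\<lambda>\<phi>. a * T \<phi> + b * S \<phi>)"
  unfolding bounded_functional_def
proof (intro conjI allI impI)
  show "linear_functional_on schwartz_funs (\<lambda>\<phi>. a * T \<phi> + b * S \<phi>)"
    unfolding linear_functional_on_def
    by (simp add: bounded_functional_linear[OF T] bounded_functional_linear[OF S] algebra_simps)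
  fix \<Phi> :: "real => real^'a => complex" assume f: "schwartz_family {1::real..} \<Phi>"
  obtain C where C: "\<And>R. R >= 1 ==> cmod (T (\<Phi> R)) <= C" using bounded_functional_bound[OF T f] by blast
  obtain D where D: "\<And>R. R >= 1 ==> cmod (S (\<Phi> R)) <= D" using bounded_functional_bound[OF S f] by blast
  have "cmod (a * T (\<Phi> R) + b * S (\<Phi> R)) <= cmod a * C + cmod b * D" if "R >= 1" for R
    by (rule order_trans[OF norm_triangle_ineq]) (unfold norm_mult, intro add_mono mult_left_mono C D that norm_ge_zero)
  then show "\<exists>C. \<forall>R\<ge>1. cmod (a * T (\<Phi> R) + b * S (\<Phi> R)) <= C" by blast
qed

lemma harm_osc_linear:
  assumes \<phi>: "\<phi> \<in> schwartz_funs"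
  shows "\<psi> \<in> schwartz_funs ==> harm_osc (\<lambda>x. \<phi> x + \<psi> x) = (\<lambda>x. harm_osc \<phi> x + harm_osc \<psi> x)"
    and "harm_osc (\<lambda>x. c * \<phi> x) = (\<lambda>x. c * harm_osc \<phi> x)"
proof -
  assume \<psi>: "\<psi> \<in> schwartz_funs"
  have "pderiv_at i (pderiv_at i (\<lambda>x. \<phi> x + \<psi> x)) = (\<lambda>x. pderiv_at i (pderiv_at i \<phi>) x + pderiv_at i (pderiv_at i \<psi>) x)" for i
    using pderivs_add[OF schwartz_smooth[OF \<phi>] schwartz_smooth[OF \<psi>], of "[i, i]"] by simp
  then show "harm_osc (\<lambda>x. \<phi> x + \<psi> x) = (\<lambda>x. harm_osc \<phi> x + harm_osc \<psi> x)"
    unfolding harm_osc_def sum.distrib[symmetric] by (intro ext sum.cong refl) (simp add: distrib_left)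
next
  have "pderiv_at i (pderiv_at i (\<lambda>x. c * \<phi> x)) = (\<lambda>x. c * pderiv_at i (pderiv_at i \<phi>) x)" for i
    using pderivs_cmult[OF schwartz_smooth[OF \<phi>], of "[i, i]" c] by simp
  then show "harm_osc (\<lambda>x. c * \<phi> x) = (\<lambda>x. c * harm_osc \<phi> x)"
    unfolding harm_osc_def sum_distrib_left by (intro ext sum.cong refl) (simp add: right_diff_distrib mult.left_commute)
qed

lemma schwartz_family_harm_osc:
  assumes \<Phi>: "schwartz_family J \<Phi>" shows "schwartz_family J (\<lambda>j. harm_osc (\<Phi> j))"
proof -
  have sum: "schwartz_family J (\<lambda>j x. \<Sum>i\<in>A. F i j x)" if "\<And>i. schwartz_family J (F i)" "finite A"
    for A :: "'b set" and F :: "'b => 'a => real^'b => complex"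
    using that(2)
  proof (induction A rule: finite_induct)
    case empty
    show ?case by (auto simp: schwartz_family_def)
  qed (simp add: schwartz_family_add that(1))
  have "schwartz_family J (\<lambda>j x. \<Sum>i\<in>UNIV. \<Phi> j x * of_real (x $ i) * of_real (x $ i) + pderiv_at i (pderiv_at i (\<Phi> j)) x * (-1))"
    by (intro sum schwartz_family_add schwartz_family_mult slow_family_coord slow_family_const schwartz_family_pderiv_at \<Phi> finite)
  moreover have "harm_osc (\<Phi> j) = (\<lambda>x. \<Sum>i\<in>UNIV. \<Phi> j x * of_real (x $ i) * of_real (x $ i) + pderiv_at i (pderiv_at i (\<Phi> j)) x * (-1))" for j
    by (simp add: harm_osc_def fun_eq_iff mult_ac)
  ultimately show ?thesis by simp
qed

lemma bounded_functional_harm_osc: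
  assumes T: "bounded_functional T" shows "bounded_functional (\<lambda>\<phi>. T (harm_osc \<phi>))"
  unfolding bounded_functional_def
proof (intro conjI allI impI)
  show "linear_functional_on schwartz_funs (\<lambda>\<phi>. T (harm_osc \<phi>))"
    unfolding linear_functional_on_def by (simp add: harm_osc_linear bounded_functional_linear[OF T] harm_osc_schwartz)
  show "\<exists>C. \<forall>R\<ge>1. cmod (T (harm_osc (\<Phi> R))) <= C" if "schwartz_family {1::real..} \<Phi>" for \<Phi>
    by (rule bounded_functional_bound[OF T schwartz_family_harm_osc[OF that]])
qed

text \<open>The eigenvalue equation is needed only under a functional, where the Hermite expansion reduces it to coefficients.\<close>

lemma harm_osc_eigen:
  fixes T :: "'n::finite functional"
  assumes T: "schwartz_continuous T"
  shows "T (harm_osc (hermite_fun \<mu>)) = of_real (2 * real (mi_size \<mu>) + real CARD('n)) * T (hermite_fun \<mu>)"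
proof -
  let ?l = "of_real (2 * real (mi_size \<mu>) + real CARD('n))"
  have "herm_coeff (harm_osc (hermite_fun \<mu>)) \<beta> = ?l * herm_coeff (hermite_fun \<mu>) \<beta>" for \<beta>
    using herm_coeff_harm_osc[OF hermite_fun_schwartz, of \<mu> \<beta>] by (simp add: hermite_fun_orthonormal)
  then have "herm_pairing (\<lambda>\<mu>. T (hermite_fun \<mu>)) (harm_osc (hermite_fun \<mu>)) = (\<lambda>k. ?l * herm_pairing (\<lambda>\<mu>. T (hermite_fun \<mu>)) (hermite_fun \<mu>) k)"
    by (simp add: herm_pairing_def fun_eq_iff sum_distrib_left mult.assoc)
  moreover have "(\<lambda>k. ?l * herm_pairing (\<lambda>\<mu>. T (hermite_fun \<mu>)) (hermite_fun \<mu>) k) sums (?l * T (hermite_fun \<mu>))"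
    by (intro sums_mult tempered_hermite_expansion[OF T hermite_fun_schwartz])
  moreover have "herm_pairing (\<lambda>\<mu>. T (hermite_fun \<mu>)) (harm_osc (hermite_fun \<mu>)) sums T (harm_osc (hermite_fun \<mu>))"
    by (intro tempered_hermite_expansion[OF T] harm_osc_schwartz hermite_fun_schwartz)
  ultimately show ?thesis by (metis sums_unique2)
qed

lemma fun_dist_cong_AE:
  assumes "locally_integrable u" "locally_integrable w" "AE x in lebesgue. u x = w x" "\<phi> \<in> test_funs"
  shows "fun_dist u \<phi> = fun_dist w \<phi>"
  unfolding fun_dist_def
proof (rule integral_cong_AE)
  show "(\<lambda>x. u x * \<phi> x) \<in> borel_measurable lebesgue" "(\<lambda>x. w x * \<phi> x) \<in> borel_measurable lebesgue"
    using locally_integrable_test_integrable[of _ \<phi>] assms by auto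
qed (use assms(3) in auto)

lemma M_gauss_fun_dist_div: "M_gauss (fun_dist (\<lambda>x. h x / root_gauss x)) = fun_dist h"
proof
  fix \<phi> :: "real^'a => complex"
  have "h x / root_gauss x * (root_gauss x * \<phi> x) = h x * \<phi> x" for x using root_gauss_nz[of x] by (simp del: of_real_eq_0_iff)
  then show "M_gauss (fun_dist (\<lambda>x. h x / root_gauss x)) \<phi> = fun_dist h \<phi>" by (simp add: M_gauss_def dist_mult_def fun_dist_def)
qed

lemma continuous_div_root_gauss:
  "continuous_on UNIV h ==> continuous_on UNIV (\<lambda>x. h x / root_gauss (x::real^'n::finite))"
  using smooth_fun_continuous[OF smooth_fun_sqrt_gauss, of UNIV] root_gauss_nz by (intro continuous_on_divide) auto

section \<open>The Gaussian Lebesgue space\<close>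

lemma gauss_measurable [measurable]: "gauss \<in> borel_measurable (lebesgue :: (real^'n::finite) measure)"
  using integrable_gauss by (rule borel_measurable_integrable)

lemma measurable_gauss_measure: "borel_measurable (gauss_measure :: (real^'n::finite) measure) = borel_measurable lebesgue"
  unfolding gauss_measure_def by (rule measurable_cong_sets) simp_all

lemma integrable_gauss_measure:
  fixes F :: "real^'n::finite => 'b::{banach, second_countable_topology}"
  assumes "F \<in> borel_measurable lebesgue"
  shows "integrable gauss_measure F \<longleftrightarrow> integrable lebesgue (\<lambda>x. gauss x *\<^sub>R F x)"
  unfolding gauss_measure_def
  by (rule integrable_density[OF assms gauss_measurable]) (use gauss_pos in \<open>auto intro!: less_imp_le\<close>)

lemma integral_gauss_measure:
  fixes F :: "real^'n::finite => 'b::{banach, second_countable_topology}"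
  assumes "F \<in> borel_measurable lebesgue"
  shows "(LINT x|gauss_measure. F x) = (LINT x|lebesgue. gauss x *\<^sub>R F x)"
  unfolding gauss_measure_def
  by (rule integral_density[OF assms gauss_measurable]) (use gauss_pos in \<open>auto intro!: less_imp_le\<close>)

lemma gauss_cmod_sq: "gauss x *\<^sub>R (cmod h)^2 = (cmod (root_gauss x * h))^2"
  using gauss_pos[of x] by (simp add: norm_mult power_mult_distrib)

lemma Herm_measurable: "(\<lambda>x::real^'n::finite. complex_of_real (Herm \<mu> x)) \<in> borel_measurable lebesgue"
proof -
  have "(\<lambda>x::real^'n. complex_of_real (Herm \<mu> x)) = (\<lambda>x. hermite_fun \<mu> x / root_gauss x)"
    by (simp add: hermite_fun_def)
  then show ?thesis
    using continuous_lebesgue_measurable[OF continuous_div_root_gauss[OF smooth_fun_continuous[OF smooth_fun_hermite_fun]]] by simp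
qed

lemma rapid_div_root_gauss_L2:
  assumes "rapid h" shows "(\<lambda>x. h x / root_gauss x) \<in> L2_gauss"
proof -
  have m: "(\<lambda>x. h x / root_gauss x) \<in> borel_measurable lebesgue"
    by (intro continuous_lebesgue_measurable continuous_div_root_gauss rapid_continuous assms)
  have "integrable lebesgue (\<lambda>x. norm (h x * h x))"
    by (intro integrable_norm rapid_integrable rapid_mult assms)
  moreover have "norm (h x * h x) = gauss x *\<^sub>R (cmod (h x / root_gauss x))^2" for x
    unfolding gauss_cmod_sq using root_gauss_nz[of x] by (simp add: norm_mult power2_eq_square)
  ultimately have "integrable lebesgue (\<lambda>x. gauss x *\<^sub>R (cmod (h x / root_gauss x))^2)" by simp
  then show ?thesis using m unfolding L2_gauss_def measurable_gauss_measure by (simp add: integrable_gauss_measure)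
qed

lemma L2_gauss_Herm: "(\<lambda>x. of_real (Herm \<mu> x)) \<in> L2_gauss"
  using rapid_div_root_gauss_L2[OF schwartz_rapid[OF hermite_fun_schwartz], of \<mu>]
  by (simp add: hermite_fun_def)

lemma L2_gauss_add:
  assumes "g \<in> L2_gauss" "h \<in> L2_gauss" shows "(\<lambda>x. g x + h x) \<in> L2_gauss"
proof -
  have [measurable]: "g \<in> borel_measurable gauss_measure" "h \<in> borel_measurable gauss_measure"
    using assms by (auto simp: L2_gauss_def)
  have "integrable gauss_measure (\<lambda>x. 2 * (cmod (g x))^2 + 2 * (cmod (h x))^2)"
    using assms by (auto simp: L2_gauss_def)
  then have "integrable gauss_measure (\<lambda>x. (cmod (g x + h x))^2)"
  proof (rule Bochner_Integration.integrable_bound)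
    have "(cmod (g x + h x))^2 <= 2 * (cmod (g x))^2 + 2 * (cmod (h x))^2" for x
    proof -
      have "(cmod (g x + h x))^2 <= (cmod (g x) + cmod (h x))^2" by (intro power_mono norm_triangle_ineq) simp
      also have "... <= 2 * (cmod (g x))^2 + 2 * (cmod (h x))^2"
        using zero_le_power2[of "cmod (g x) - cmod (h x)"] by (simp add: power2_eq_square algebra_simps)
      finally show ?thesis .
    qed
    then show "AE x in gauss_measure. norm ((cmod (g x + h x))^2) <= norm (2 * (cmod (g x))^2 + 2 * (cmod (h x))^2)"
      by (intro AE_I2) simp
  qed measurable
  then show ?thesis by (simp add: L2_gauss_def)
qed

lemma L2_gauss_cmult: "g \<in> L2_gauss ==> (\<lambda>x. c * g x) \<in> L2_gauss"
  by (auto simp: L2_gauss_def norm_mult power_mult_distrib)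

text \<open>A Cauchy--Schwarz inequality in additive form; a free \<open>\<delta>\<close> serves the same purpose without square roots.\<close>

lemma L2_gauss_mult_bound:
  assumes g: "g \<in> L2_gauss" and h: "h \<in> L2_gauss" and \<delta>: "\<delta> > 0"
  shows "integrable gauss_measure (\<lambda>x. g x * h x)"
    and "cmod (LINT x|gauss_measure. g x * h x)
      <= \<delta> * (LINT x|gauss_measure. (cmod (g x))^2) + (LINT x|gauss_measure. (cmod (h x))^2) / \<delta>"
proof -
  have [measurable]: "g \<in> borel_measurable gauss_measure" "h \<in> borel_measurable gauss_measure"
    using assms by (auto simp: L2_gauss_def)
  have i: "integrable gauss_measure (\<lambda>x. \<delta> * (cmod (g x))^2)" "integrable gauss_measure (\<lambda>x. (cmod (h x))^2 / \<delta>)"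
    using assms by (auto simp: L2_gauss_def)
  have b: "norm (g x * h x) <= \<delta> * (cmod (g x))^2 + (cmod (h x))^2 / \<delta>" for x
  proof -
    have "0 <= (\<delta> * cmod (g x) - cmod (h x))^2 + \<delta>^2 * (cmod (g x))^2 + (cmod (h x))^2" by simp
    then have "cmod (g x) * cmod (h x) * \<delta> <= (\<delta> * (cmod (g x))^2 + (cmod (h x))^2 / \<delta>) * \<delta>"
      using \<delta> by (simp add: power2_eq_square algebra_simps)
    then show ?thesis using \<delta> by (simp add: norm_mult)
  qed
  show int: "integrable gauss_measure (\<lambda>x. g x * h x)"
    by (rule Bochner_Integration.integrable_bound[OF Bochner_Integration.integrable_add[OF i]])
      (auto intro!: AE_I2 order_trans[OF b] abs_ge_self)
  have "cmod (LINT x|gauss_measure. g x * h x) <= (LINT x|gauss_measure. norm (g x * h x))"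
    by (rule integral_norm_bound)
  also have "... <= (LINT x|gauss_measure. \<delta> * (cmod (g x))^2 + (cmod (h x))^2 / \<delta>)"
    by (intro integral_mono integrable_norm int Bochner_Integration.integrable_add i b)
  also have "... = \<delta> * (LINT x|gauss_measure. (cmod (g x))^2) + (LINT x|gauss_measure. (cmod (h x))^2) / \<delta>"
    using i by (subst Bochner_Integration.integral_add) auto
  finally show "cmod (LINT x|gauss_measure. g x * h x)
      <= \<delta> * (LINT x|gauss_measure. (cmod (g x))^2) + (LINT x|gauss_measure. (cmod (h x))^2) / \<delta>" .
qed


section \<open>Hermite series with radial coefficients\<close>

definition eigval :: "('n::finite => nat) => real" where
  "eigval \<mu> = 2 * real (mi_size \<mu>) + real CARD('n)"

lemma eigval_ge_weight: "mi_weight \<mu> <= eigval (\<mu> :: 'n::finite => nat)"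
proof -
  have "CARD('n) >= 1" by (simp add: Suc_leI)
  then have "real CARD('n) >= 1" by linarith
  then show ?thesis unfolding mi_weight_def eigval_def by linarith
qed

lemma eigval_ge_1: "eigval \<mu> >= 1"
  using mi_weight_ge_1[of \<mu>] eigval_ge_weight[of \<mu>] by linarith

text \<open>The coefficient side of membership in \<open>H2_gauss t\<close> for all \<open>t > 0\<close>.\<close>

definition super_fast_coeff :: "(('n::finite => nat) => complex) => bool" where
  "super_fast_coeff c \<longleftrightarrow> (\<forall>t>0. \<exists>C\<ge>0. \<forall>\<mu>. cmod (c \<mu>) <= C * exp (- t * sqrt (eigval \<mu>)))"

text \<open>Rapid decay of a coefficient curve, locally uniformly in \<open>\<rho> > 0\<close>: what termwise differentiation needs.\<close>

definition loc_fast :: "(real => ('n::finite => nat) => complex) => bool" where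
  "loc_fast e \<longleftrightarrow> (\<forall>R1 R2 M. 0 < R1 --> R1 <= R2 -->
     (\<exists>B. \<forall>\<mu>. \<forall>\<rho>\<in>{R1..R2}. mi_weight \<mu> ^ M * cmod (e \<rho> \<mu>) <= B))"

lemma loc_fast_fast_coeff:
  assumes "loc_fast e" "\<rho> > 0" shows "fast_coeff (e \<rho>)"
  unfolding fast_coeff_def
proof
  fix M show "\<exists>B. \<forall>\<mu>. mi_weight \<mu> ^ M * cmod (e \<rho> \<mu>) <= B"
    using assms(1)[unfolded loc_fast_def, rule_format, OF assms(2) order_refl, of M] by simp
qed

lemma power_le_exp: "x >= 0 ==> x ^ n <= real n ^ n * exp (x::real)"
proof (cases n)
  case (Suc m)
  assume x: "x >= 0"
  have "x ^ n = real n ^ n * (x / real n) ^ n" using Suc by (simp add: power_divide)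
  also have "... <= real n ^ n * (1 + x / real n) ^ n"
    using x by (intro mult_left_mono power_mono) auto
  also have "... <= real n ^ n * exp x"
    using x Suc by (intro mult_left_mono exp_ge_one_plus_x_over_n_power_n) auto
  finally show ?thesis .
qed simp

lemma weight_exp_bound: "mi_weight \<mu> ^ M * exp (- sqrt (eigval \<mu>)) <= real (2 * M) ^ (2 * M)"
proof -
  have "mi_weight \<mu> ^ M <= eigval \<mu> ^ M"
    by (intro power_mono eigval_ge_weight mi_weight_nonneg)
  also have "... = sqrt (eigval \<mu>) ^ (2 * M)"
    using eigval_ge_1[of \<mu>] by (simp add: power_mult)
  also have "... <= real (2 * M) ^ (2 * M) * exp (sqrt (eigval \<mu>))"
    using eigval_ge_1[of \<mu>] by (intro power_le_exp) simp
  finally have "mi_weight \<mu> ^ M * exp (- sqrt (eigval \<mu>))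
      <= real (2 * M) ^ (2 * M) * exp (sqrt (eigval \<mu>)) * exp (- sqrt (eigval \<mu>))"
    by (intro mult_right_mono) auto
  then show ?thesis by (simp add: mult.assoc flip: exp_add)
qed

lemma loc_fast_combine:
  fixes c d :: "('n::finite => nat) => complex" and p q :: "real => real => real"
  assumes d: "slow_coeff d" and c: "super_fast_coeff c"
    and p: "\<And>R1 R2 M. 0 < R1 ==> R1 <= R2 ==> \<exists>C\<ge>0. \<forall>l\<ge>1. \<forall>\<rho>\<in>{R1..R2}. l ^ M * \<bar>p l \<rho>\<bar> <= C"
    and q: "\<And>R1 R2. 0 < R1 ==> R1 <= R2 ==> \<exists>C\<ge>0. \<exists>t. \<forall>l\<ge>1. \<forall>\<rho>\<in>{R1..R2}. \<bar>q l \<rho>\<bar> <= C * exp (t * sqrt l)"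
  shows "loc_fast (\<lambda>\<rho> \<mu>. d \<mu> * of_real (p (eigval \<mu>) \<rho>) + c \<mu> * of_real (q (eigval \<mu>) \<rho>))"
  unfolding loc_fast_def
proof (intro allI impI)
  fix R1 R2 :: real and M :: nat assume R: "0 < R1" "R1 <= R2"
  obtain D M' where D: "D >= 0" "\<And>\<mu>. cmod (d \<mu>) <= D * mi_weight \<mu> ^ M'" using d unfolding slow_coeff_def by blast
  obtain P where P: "P >= 0" "\<And>l \<rho>. l >= 1 ==> \<rho> \<in> {R1..R2} ==> l ^ (M + M') * \<bar>p l \<rho>\<bar> <= P" using p[OF R] by blast
  obtain Q t where Q: "Q >= 0" "\<And>l \<rho>. l >= 1 ==> \<rho> \<in> {R1..R2} ==> \<bar>q l \<rho>\<bar> <= Q * exp (t * sqrt l)" using q[OF R] by blast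
  obtain K where K: "K >= 0" "\<And>\<mu>. cmod (c \<mu>) <= K * exp (- (\<bar>t\<bar> + 1) * sqrt (eigval \<mu>))"
  proof -
    have "\<bar>t\<bar> + 1 > 0" by simp
    with c show ?thesis unfolding super_fast_coeff_def using that by blast
  qed
  have "mi_weight \<mu> ^ M * cmod (d \<mu> * of_real (p (eigval \<mu>) \<rho>) + c \<mu> * of_real (q (eigval \<mu>) \<rho>))
      <= D * P + K * Q * real (2 * M) ^ (2 * M)" if \<rho>: "\<rho> \<in> {R1..R2}" for \<mu> \<rho>
  proof -
    let ?w = "mi_weight \<mu>" and ?l = "eigval \<mu>"
    have w: "?w > 0" by (rule mi_weight_pos)
    have "?w ^ M * (cmod (d \<mu>) * \<bar>p ?l \<rho>\<bar>) <= ?w ^ M * ((D * ?w ^ M') * \<bar>p ?l \<rho>\<bar>)"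
      using w by (intro mult_left_mono mult_right_mono D) auto
    also have "... = D * (?w ^ (M + M') * \<bar>p ?l \<rho>\<bar>)" by (simp add: power_add)
    also have "... <= D * (?l ^ (M + M') * \<bar>p ?l \<rho>\<bar>)"
      using w by (intro mult_left_mono mult_right_mono power_mono eigval_ge_weight D(1)) auto
    also have "... <= D * P" by (intro mult_left_mono P(2) eigval_ge_1 \<rho> D(1))
    finally have 1: "?w ^ M * (cmod (d \<mu>) * \<bar>p ?l \<rho>\<bar>) <= D * P" .
    have "cmod (c \<mu>) * \<bar>q ?l \<rho>\<bar> <= (K * exp (- (\<bar>t\<bar> + 1) * sqrt ?l)) * (Q * exp (t * sqrt ?l))"
      by (rule mult_mono[OF K(2) Q(2)[OF eigval_ge_1 \<rho>]]) (use K in auto)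
    also have "... = K * Q * exp (- (\<bar>t\<bar> + 1) * sqrt ?l + t * sqrt ?l)"
      unfolding exp_add by (simp only: mult_ac)
    also have "... <= K * Q * exp (- sqrt ?l)"
    proof -
      have "t * sqrt ?l <= \<bar>t\<bar> * sqrt ?l" using eigval_ge_1[of \<mu>] by (intro mult_right_mono) auto
      then have "- (\<bar>t\<bar> + 1) * sqrt ?l + t * sqrt ?l <= - sqrt ?l" by (simp add: algebra_simps)
      then show ?thesis using K(1) Q(1) by (intro mult_left_mono) auto
    qed
    finally have "?w ^ M * (cmod (c \<mu>) * \<bar>q ?l \<rho>\<bar>) <= ?w ^ M * (K * Q * exp (- sqrt ?l))"
      using w by (intro mult_left_mono) auto
    also have "... = K * Q * (?w ^ M * exp (- sqrt ?l))" by simp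
    also have "... <= K * Q * real (2 * M) ^ (2 * M)" using K(1) Q(1) by (intro mult_left_mono weight_exp_bound) auto
    finally have 2: "?w ^ M * (cmod (c \<mu>) * \<bar>q ?l \<rho>\<bar>) <= K * Q * real (2 * M) ^ (2 * M)" .
    have "?w ^ M * cmod (d \<mu> * of_real (p ?l \<rho>) + c \<mu> * of_real (q ?l \<rho>))
        <= ?w ^ M * (cmod (d \<mu>) * \<bar>p ?l \<rho>\<bar> + cmod (c \<mu>) * \<bar>q ?l \<rho>\<bar>)"
      using w by (intro mult_left_mono order_trans[OF norm_triangle_ineq]) (auto simp: norm_mult)
    then show ?thesis using 1 2 by (simp add: distrib_left)
  qed
  then show "\<exists>B. \<forall>\<mu>. \<forall>\<rho>\<in>{R1..R2}. mi_weight \<mu> ^ M *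
      cmod (d \<mu> * of_real (p (eigval \<mu>) \<rho>) + c \<mu> * of_real (q (eigval \<mu>) \<rho>)) <= B" by blast
qed

text \<open>Coefficient curve of the solution with initial coefficients \<open>d\<close> and free constants \<open>c\<close>, and its two derivatives.\<close>

definition mode :: "real => (('n::finite => nat) => complex) => (('n => nat) => complex) => real => ('n => nat) => complex" where
  "mode s d c \<rho> \<mu> = d \<mu> * of_real (radial.dec s (eigval \<mu>) \<rho>) + c \<mu> * of_real (radial.grow s (eigval \<mu>) \<rho>)"

definition mode' :: "real => (('n::finite => nat) => complex) => (('n => nat) => complex) => real => ('n => nat) => complex" where
  "mode' s d c \<rho> \<mu> = d \<mu> * of_real (radial.dec' s (eigval \<mu>) \<rho>) + c \<mu> * of_real (radial.grow' s (eigval \<mu>) \<rho>)"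

definition mode'' :: "real => (('n::finite => nat) => complex) => (('n => nat) => complex) => real => ('n => nat) => complex" where
  "mode'' s d c \<rho> \<mu> =
     d \<mu> * of_real (radial_rhs s (eigval \<mu>) (radial.dec s (eigval \<mu>)) (radial.dec' s (eigval \<mu>)) \<rho>)
     + c \<mu> * of_real (radial_rhs s (eigval \<mu>) (radial.grow s (eigval \<mu>)) (radial.grow' s (eigval \<mu>)) \<rho>)"

context
  fixes s :: real and d c :: "('n::finite => nat) => complex"
  assumes s: "0 < s" "s < 1" and d: "slow_coeff d" and c: "super_fast_coeff c"
begin

lemma loc_fast_mode: "loc_fast (mode s d c)"
  and loc_fast_mode': "loc_fast (mode' s d c)"
  and loc_fast_mode'': "loc_fast (mode'' s d c)"
proof -
  have p: "\<exists>C\<ge>0. \<forall>l\<ge>1. \<forall>\<rho>\<in>{R1..R2}. l ^ M * \<bar>y l \<rho>\<bar> <= C"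
    if R: "0 < R1" "R1 <= R2" and y: "y = radial.dec s \<or> y = radial.dec' s \<or>
      y = (\<lambda>l. radial_rhs s l (radial.dec s l) (radial.dec' s l))" for R1 R2 M and y :: "real => real => real"
  proof -
    obtain C where C: "C >= 0" "\<And>l \<rho>. l >= 1 ==> \<rho> \<in> {R1..R2} ==> l ^ M * \<bar>radial.dec s l \<rho>\<bar> <= C \<and> l ^ M * \<bar>radial.dec' s l \<rho>\<bar> <= C
        \<and> l ^ M * \<bar>radial_rhs s l (radial.dec s l) (radial.dec' s l) \<rho>\<bar> <= C"
      using dec_decay[OF s R, of M] by blast
    show ?thesis by (intro exI[of _ C] conjI allI ballI impI C(1)) (use C(2) y in auto)
  qed
  have q: "\<exists>C\<ge>0. \<exists>t. \<forall>l\<ge>1. \<forall>\<rho>\<in>{R1..R2}. \<bar>y l \<rho>\<bar> <= C * exp (t * sqrt l)"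
    if R: "0 < R1" "R1 <= R2" and y: "y = radial.grow s \<or> y = radial.grow' s \<or>
      y = (\<lambda>l. radial_rhs s l (radial.grow s l) (radial.grow' s l))" for R1 R2 and y :: "real => real => real"
  proof -
    obtain C t where C: "C >= 0" "\<And>l \<rho>. l >= 1 ==> \<rho> \<in> {R1..R2} ==> \<bar>radial.grow s l \<rho>\<bar> <= C * exp (t * sqrt l)
        \<and> \<bar>radial.grow' s l \<rho>\<bar> <= C * exp (t * sqrt l)
        \<and> \<bar>radial_rhs s l (radial.grow s l) (radial.grow' s l) \<rho>\<bar> <= C * exp (t * sqrt l)"
      using grow_growth[OF s R] by blast
    show ?thesis by (intro exI[of _ C] exI[of _ t] conjI allI ballI impI C(1)) (use C(2) y in auto)
  qed
  show "loc_fast (mode s d c)"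
    unfolding mode_def[abs_def]
    by (rule loc_fast_combine[OF d c, of "radial.dec s" "radial.grow s"]; rule p q; simp)
  show "loc_fast (mode' s d c)"
    unfolding mode'_def[abs_def]
    by (rule loc_fast_combine[OF d c, of "radial.dec' s" "radial.grow' s"]; rule p q; simp)
  show "loc_fast (mode'' s d c)"
    unfolding mode''_def[abs_def]
    by (rule loc_fast_combine[OF d c, of "\<lambda>l. radial_rhs s l (radial.dec s l) (radial.dec' s l)"
          "\<lambda>l. radial_rhs s l (radial.grow s l) (radial.grow' s l)"]; rule p q; simp)
qed

lemma radial_eigval: "radial s (eigval (\<mu> :: 'n => nat))"
  by standard (use s eigval_ge_1 in auto)

lemma mode_has_derivative:
  assumes "\<rho> > 0"
  shows "((\<lambda>r. mode s d c r \<mu>) has_vector_derivative mode' s d c \<rho> \<mu>) (at \<rho>)"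
    and "((\<lambda>r. mode' s d c r \<mu>) has_vector_derivative mode'' s d c \<rho> \<mu>) (at \<rho>)"
proof -
  interpret radial s "eigval \<mu>" by (rule radial_eigval)
  have v: "((\<lambda>r. z * complex_of_real (y r) + w * of_real (x r)) has_vector_derivative z * of_real y' + w * of_real x') (at \<rho>)"
    if "(y has_real_derivative y') (at \<rho>)" "(x has_real_derivative x') (at \<rho>)" for z w y y' x x'
    using that
    by (intro has_vector_derivative_add has_vector_derivative_mult_right has_vector_derivative_of_real)
       (simp_all add: has_real_derivative_iff_has_vector_derivative)
  show "((\<lambda>r. mode s d c r \<mu>) has_vector_derivative mode' s d c \<rho> \<mu>) (at \<rho>)"
    unfolding mode_def mode'_def by (intro v radial_solD(1)[OF dec_sol assms] radial_solD(1)[OF grow_sol assms])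
  show "((\<lambda>r. mode' s d c r \<mu>) has_vector_derivative mode'' s d c \<rho> \<mu>) (at \<rho>)"
    unfolding mode'_def mode''_def radial_rhs_def
    by (intro v radial_solD(2)[OF dec_sol assms] radial_solD(2)[OF grow_sol assms])
qed

lemma mode''_eq:
  "mode'' s d c \<rho> \<mu> = of_real (eigval \<mu> + \<rho>^2 / 4) * mode s d c \<rho> \<mu>
     - of_real ((1 - 2 * s) / \<rho>) * mode' s d c \<rho> \<mu>"
  by (simp add: mode_def mode'_def mode''_def radial_rhs_def algebra_simps)

end

lemma fun_dist_synth_sums:
  assumes "fast_coeff c" "\<phi> \<in> schwartz_funs"
  shows "herm_pairing c \<phi> sums fun_dist (herm_synth c) \<phi>"
proof -
  have "fun_dist (herm_synth c) (hermite_fun \<mu>) = c \<mu>" for \<mu>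
    using herm_coeff_synth[OF assms(1)] by (simp add: fun_dist_def herm_coeff_def)
  then show ?thesis
    using tempered_hermite_expansion[OF schwartz_continuous_fun_dist[OF herm_synth_rapid[OF assms(1)]] assms(2)] by simp
qed

lemma has_vector_derivative_suminf:
  fixes f f' :: "nat => real => complex"
  assumes ab: "a < x" "x < b"
    and der: "\<And>k y. y \<in> {a..b} ==> (f k has_vector_derivative f' k y) (at y)"
    and bound: "\<And>k y. y \<in> {a..b} ==> norm (f' k y) <= M k" and M: "summable M"
    and sum: "\<And>y. y \<in> {a..b} ==> summable (\<lambda>k. f k y)"
  shows "((\<lambda>y. \<Sum>k. f k y) has_vector_derivative (\<Sum>k. f' k x)) (at x)"
proof -
  have u: "uniform_limit {a..b} (\<lambda>n y. \<Sum>k<n. f' k y) (\<lambda>y. \<Sum>k. f' k y) sequentially"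
    by (rule Weierstrass_m_test[OF bound M])
  have "\<exists>g. \<forall>y\<in>{a..b}. (\<lambda>n. f n y) sums g y \<and> (g has_derivative (\<lambda>h. h *\<^sub>R (\<Sum>k. f' k y))) (at y within {a..b})"
  proof (rule has_derivative_series[where f' = "\<lambda>k y h. h *\<^sub>R f' k y" and x = x])
    show "(f n has_derivative (\<lambda>h. h *\<^sub>R f' n y)) (at y within {a..b})" if "y \<in> {a..b}" for n y
      using der[OF that, of n] by (auto simp: has_vector_derivative_def intro: has_derivative_at_withinI)
    show "(\<lambda>n. f n x) sums (\<Sum>k. f k x)" using sum[of x] ab by (simp add: summable_sums)
    fix e :: real assume e: "e > 0"
    have "\<forall>\<^sub>F n in sequentially. \<forall>y\<in>{a..b}. dist (\<Sum>k<n. f' k y) (\<Sum>k. f' k y) < e"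
      using u e by (rule uniform_limitD)
    then show "\<forall>\<^sub>F n in sequentially. \<forall>y\<in>{a..b}. \<forall>h. norm ((\<Sum>i<n. h *\<^sub>R f' i y) - h *\<^sub>R (\<Sum>k. f' k y)) <= e * norm h"
    proof (rule eventually_mono, intro ballI allI)
      fix n y h assume a: "\<forall>y\<in>{a..b}. dist (\<Sum>k<n. f' k y) (\<Sum>k. f' k y) < e" "y \<in> {a..b}"
      have "norm ((\<Sum>i<n. h *\<^sub>R f' i y) - h *\<^sub>R (\<Sum>k. f' k y)) = norm h * dist (\<Sum>k<n. f' k y) (\<Sum>k. f' k y)"
        by (simp add: dist_norm flip: scaleR_sum_right scaleR_diff_right)
      also have "... <= norm h * e" using a(1)[rule_format, OF a(2)] by (rule mult_left_mono[OF less_imp_le]) simp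
      finally show "norm ((\<Sum>i<n. h *\<^sub>R f' i y) - h *\<^sub>R (\<Sum>k. f' k y)) <= e * norm h" by (simp add: mult.commute)
    qed
  qed (use ab in auto)
  then obtain g where g: "\<And>y. y \<in> {a..b} ==> (\<lambda>n. f n y) sums g y"
    "\<And>y. y \<in> {a..b} ==> (g has_derivative (\<lambda>h. h *\<^sub>R (\<Sum>k. f' k y))) (at y within {a..b})" by blast
  have "(g has_vector_derivative (\<Sum>k. f' k x)) (at x)"
    using g(2)[of x] ab at_within_Icc_at[of a x b] by (simp add: has_vector_derivative_def)
  then show ?thesis
  proof (rule has_vector_derivative_transform_within_open)
    show "open {a<..<b}" "x \<in> {a<..<b}" using ab by auto
    show "g y = (\<Sum>k. f k y)" if "y \<in> {a<..<b}" for y using g(1)[of y] that by (simp add: sums_iff)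
  qed
qed

lemma slow_coeff_const: "slow_coeff (\<lambda>_. z)"
  unfolding slow_coeff_def by (intro exI[of _ "cmod z"] exI[of _ "0::nat"]) simp

lemma herm_pairing_dominated:
  assumes "\<And>\<mu>. cmod (e \<mu>) <= cmod (d \<mu>)"
  shows "norm (herm_pairing e \<phi> k) <= (\<Sum>\<mu>\<in>multi_indices k. cmod (herm_coeff \<phi> \<mu> * d \<mu>))"
  unfolding herm_pairing_def
  by (rule order_trans[OF norm_sum]) (intro sum_mono, simp add: norm_mult mult_left_mono assms)

lemma synth_has_derivative:
  fixes e e' :: "real => ('n::finite => nat) => complex"
  assumes e: "loc_fast e" and e': "loc_fast e'" and \<phi>: "\<phi> \<in> schwartz_funs" and \<rho>: "\<rho> > 0"
    and der: "\<And>\<mu> r. r > 0 ==> ((\<lambda>r. e r \<mu>) has_vector_derivative e' r \<mu>) (at r)"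
  shows "((\<lambda>r. fun_dist (herm_synth (e r)) \<phi>) has_vector_derivative fun_dist (herm_synth (e' \<rho>)) \<phi>) (at \<rho>)"
proof -
  have eq: "fun_dist (herm_synth (e r)) \<phi> = (\<Sum>k. herm_pairing (e r) \<phi> k)" "summable (herm_pairing (e r) \<phi>)"
    "fun_dist (herm_synth (e' r)) \<phi> = (\<Sum>k. herm_pairing (e' r) \<phi> k)" if "r > 0" for r
    using fun_dist_synth_sums[OF loc_fast_fast_coeff[OF e that] \<phi>] fun_dist_synth_sums[OF loc_fast_fast_coeff[OF e' that] \<phi>]
    by (simp_all add: sums_iff)
  have "0 < \<rho> / 2" "\<rho> / 2 <= 2 * \<rho>" using \<rho> by auto
  with e' obtain B where B: "\<And>\<mu> r. r \<in> {\<rho> / 2..2 * \<rho>} ==> mi_weight \<mu> ^ 0 * cmod (e' r \<mu>) <= B"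
    unfolding loc_fast_def by blast
  obtain C where C: "\<And>k. (\<Sum>\<mu>\<in>multi_indices k. cmod (herm_coeff \<phi> \<mu> * of_real B)) <= C / (1 + real k) ^ 2"
    using herm_pairing_summable[OF slow_coeff_const \<phi>, of "of_real B" 2] by blast
  have "((\<lambda>r. \<Sum>k. herm_pairing (e r) \<phi> k) has_vector_derivative (\<Sum>k. herm_pairing (e' \<rho>) \<phi> k)) (at \<rho>)"
  proof (rule has_vector_derivative_suminf[where a = "\<rho> / 2" and b = "2 * \<rho>" and M = "\<lambda>k. C / (1 + real k) ^ 2"])
    fix k r assume r: "r \<in> {\<rho> / 2..2 * \<rho>}"
    then have r0: "r > 0" using \<rho> by auto
    show "((\<lambda>r. herm_pairing (e r) \<phi> k) has_vector_derivative herm_pairing (e' r) \<phi> k) (at r)"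
      unfolding herm_pairing_def by (intro has_vector_derivative_sum has_vector_derivative_mult_right der r0)
    show "norm (herm_pairing (e' r) \<phi> k) <= C / (1 + real k) ^ 2"
      by (rule order_trans[OF herm_pairing_dominated C]) (use order_trans[OF B[OF r] abs_ge_self] in simp)
  next
    fix r assume "r \<in> {\<rho> / 2..2 * \<rho>}"
    then show "summable (\<lambda>k. herm_pairing (e r) \<phi> k)" using eq(2)[of r] \<rho> by auto
  qed (use \<rho> summable_inverse_squares in auto)
  then have "((\<lambda>r. \<Sum>k. herm_pairing (e r) \<phi> k) has_vector_derivative fun_dist (herm_synth (e' \<rho>)) \<phi>) (at \<rho>)"
    using eq(3)[OF \<rho>] by simp
  then show ?thesis
    by (rule has_vector_derivative_transform_within_open[of _ _ _ "{0<..}"]) (use \<rho> eq(1) in auto)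
qed

text \<open>Near \<open>0\<close> the curve does not decay, but \<open>|dec| \<le> 1\<close> and the monotonicity of \<open>grow\<close> bound it by a polynomially
  bounded sequence, and the decay of the coefficients of \<open>\<phi>\<close> dominates the series.\<close>

lemma synth_mode_tendsto:
  fixes d c :: "('n::finite => nat) => complex"
  assumes s: "0 < s" "s < 1" and d: "slow_coeff d" and c: "super_fast_coeff c" and \<phi>: "\<phi> \<in> schwartz_funs"
  shows "((\<lambda>\<rho>. fun_dist (herm_synth (mode s d c \<rho>)) \<phi>) \<longlongrightarrow> (\<Sum>k. herm_pairing d \<phi> k)) (at_right 0)"
proof -
  obtain D M where D: "D >= 0" "\<And>\<mu>. cmod (d \<mu>) <= D * mi_weight \<mu> ^ M" using d unfolding slow_coeff_def by blast
  have "loc_fast (mode s (\<lambda>_. 0) c)" by (rule loc_fast_mode[OF s slow_coeff_const c])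
  then have "fast_coeff (mode s (\<lambda>_. 0) c 1)" by (rule loc_fast_fast_coeff) simp
  then obtain B where "\<And>\<mu>. mi_weight \<mu> ^ 0 * cmod (mode s (\<lambda>_. 0) c 1 \<mu>) <= B" unfolding fast_coeff_def by blast
  then have B: "\<And>\<mu>. cmod (c \<mu>) * \<bar>radial.grow s (eigval \<mu>) 1\<bar> <= B" by (simp add: mode_def norm_mult)
  \<comment> \<open>Dominates the modes for \<open>0 < \<rho> \<le> 1\<close>.\<close>
  define b where "b \<mu> = complex_of_real (D * mi_weight \<mu> ^ M + B)" for \<mu> :: "'n => nat"
  have "0 <= cmod (c (\<lambda>_. 0)) * \<bar>radial.grow s (eigval (\<lambda>_::'n. 0)) 1\<bar>" by simp
  then have B0: "B >= 0" using B[of "\<lambda>_. 0"] by linarith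
  have b: "slow_coeff b"
  proof -
    have "cmod (b \<mu>) <= (D + B) * mi_weight \<mu> ^ M" for \<mu>
    proof -
      have "B * 1 <= B * mi_weight \<mu> ^ M" using B0 by (intro mult_left_mono one_le_power mi_weight_ge_1)
      moreover have "0 <= D * mi_weight \<mu> ^ M + B" by (intro add_nonneg_nonneg mult_nonneg_nonneg zero_le_power mi_weight_nonneg D(1) B0)
      then have "cmod (b \<mu>) = D * mi_weight \<mu> ^ M + B" unfolding b_def norm_of_real by (rule abs_of_nonneg)
      ultimately show ?thesis by (simp add: distrib_right)
    qed
    then show ?thesis using D B0 unfolding slow_coeff_def by (intro exI[of _ "D + B"] exI[of _ M]) auto
  qed
  have mb: "cmod (mode s d c \<rho> \<mu>) <= cmod (b \<mu>)" if "\<rho> \<in> {0<..1}" for \<rho> \<mu>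
  proof -
    interpret radial s "eigval \<mu>" by (rule radial_eigval[OF s d c])
    have "\<bar>dec \<rho>\<bar> <= 1" using dec_sq_le_1[of \<rho>] that by (simp add: abs_square_le_1)
    then have "cmod (d \<mu>) * \<bar>dec \<rho>\<bar> <= D * mi_weight \<mu> ^ M"
      using mult_mono[OF D(2)[of \<mu>], of "\<bar>dec \<rho>\<bar>" 1] D(1) mi_weight_nonneg[of \<mu>] by simp
    moreover have "cmod (c \<mu>) * \<bar>grow \<rho>\<bar> <= cmod (c \<mu>) * \<bar>grow 1\<bar>"
      using grow_mono[of \<rho> 1] grow_pos[of \<rho>] that by (intro mult_left_mono) auto
    ultimately have "cmod (d \<mu>) * \<bar>dec \<rho>\<bar> + cmod (c \<mu>) * \<bar>grow \<rho>\<bar> <= D * mi_weight \<mu> ^ M + B" using B[of \<mu>] by linarith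
    moreover have "cmod (mode s d c \<rho> \<mu>) <= cmod (d \<mu>) * \<bar>dec \<rho>\<bar> + cmod (c \<mu>) * \<bar>grow \<rho>\<bar>"
      unfolding mode_def by (rule order_trans[OF norm_triangle_ineq]) (simp add: norm_mult)
    moreover have "D * mi_weight \<mu> ^ M + B <= cmod (b \<mu>)" unfolding b_def norm_of_real by (rule abs_ge_self)
    ultimately show ?thesis by linarith
  qed
  obtain C where C: "\<And>k. (\<Sum>\<mu>\<in>multi_indices k. cmod (herm_coeff \<phi> \<mu> * b \<mu>)) <= C / (1 + real k) ^ 2"
    using herm_pairing_summable[OF b \<phi>, of 2] by blast
  have ev: "\<forall>\<^sub>F \<rho> in at_right 0. \<rho> \<in> {0<..1::real}"
    using eventually_at_right_real[of 0 1] by (rule eventually_mono) auto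
  have "\<forall>\<^sub>F x in at_top \<times>\<^sub>F at_right 0. snd x \<in> {0<..1::real}"
    using ev by (rule eventually_compose_filterlim[OF _ filterlim_snd])
  then have ev2: "\<forall>\<^sub>F (k, \<rho>) in at_top \<times>\<^sub>F at_right 0. norm (herm_pairing (mode s d c \<rho>) \<phi> k) <= C / (1 + real k) ^ 2"
  proof (rule eventually_mono)
    fix x :: "nat \<times> real" assume "snd x \<in> {0<..1}"
    then show "case x of (k, \<rho>) => norm (herm_pairing (mode s d c \<rho>) \<phi> k) <= C / (1 + real k) ^ 2"
      using order_trans[OF herm_pairing_dominated C, OF mb] by (cases x) auto
  qed
  have lim: "((\<lambda>\<rho>. herm_pairing (mode s d c \<rho>) \<phi> k) \<longlongrightarrow> herm_pairing d \<phi> k) (at_right 0)" for k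
    unfolding herm_pairing_def
  proof (intro tendsto_sum tendsto_mult tendsto_const)
    fix \<mu> :: "'n => nat"
    interpret radial s "eigval \<mu>" by (rule radial_eigval[OF s d c])
    have "((\<lambda>\<rho>. d \<mu> * of_real (dec \<rho>) + c \<mu> * of_real (grow \<rho>)) \<longlongrightarrow> d \<mu> * of_real 1 + c \<mu> * of_real 0) (at_right 0)"
      by (intro tendsto_intros dec_tendsto_1 grow_tendsto_0)
    then show "((\<lambda>\<rho>. mode s d c \<rho> \<mu>) \<longlongrightarrow> d \<mu>) (at_right 0)" by (simp add: mode_def)
  qed
  have "((\<lambda>\<rho>. \<Sum>k. herm_pairing (mode s d c \<rho>) \<phi> k) \<longlongrightarrow> (\<Sum>k. herm_pairing d \<phi> k)) (at_right 0)"
    using tannerys_theorem[OF lim ev2 summable_inverse_squares] by simp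
  moreover have "\<forall>\<^sub>F \<rho> in at_right 0. (\<Sum>k. herm_pairing (mode s d c \<rho>) \<phi> k) = fun_dist (herm_synth (mode s d c \<rho>)) \<phi>"
    using ev
  proof (rule eventually_mono)
    fix \<rho> :: real assume "\<rho> \<in> {0<..1}"
    then show "(\<Sum>k. herm_pairing (mode s d c \<rho>) \<phi> k) = fun_dist (herm_synth (mode s d c \<rho>)) \<phi>"
      using fun_dist_synth_sums[OF loc_fast_fast_coeff[OF loc_fast_mode[OF s d c]] \<phi>, of \<rho>] by (simp add: sums_iff)
  qed
  ultimately show ?thesis by (rule Lim_transform_eventually)
qed

lemma synth_mode_equation:
  fixes d c :: "('n::finite => nat) => complex"
  assumes s: "0 < s" "s < 1" and d: "slow_coeff d" and c: "super_fast_coeff c" and \<phi>: "\<phi> \<in> schwartz_funs" and \<rho>: "\<rho> > 0"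
  shows "fun_dist (herm_synth (mode s d c \<rho>)) (harm_osc \<phi>)
    = fun_dist (herm_synth (mode'' s d c \<rho>)) \<phi> + of_real ((1 - 2 * s) / \<rho>) * fun_dist (herm_synth (mode' s d c \<rho>)) \<phi>
      - of_real (\<rho>^2 / 4) * fun_dist (herm_synth (mode s d c \<rho>)) \<phi>"
proof -
  note f = loc_fast_fast_coeff[OF loc_fast_mode[OF s d c] \<rho>] loc_fast_fast_coeff[OF loc_fast_mode'[OF s d c] \<rho>]
    loc_fast_fast_coeff[OF loc_fast_mode''[OF s d c] \<rho>]
  have "herm_pairing (mode s d c \<rho>) (harm_osc \<phi>) k = herm_pairing (mode'' s d c \<rho>) \<phi> k
      + of_real ((1 - 2 * s) / \<rho>) * herm_pairing (mode' s d c \<rho>) \<phi> k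
      - of_real (\<rho>^2 / 4) * herm_pairing (mode s d c \<rho>) \<phi> k" for k
    unfolding herm_pairing_def sum_distrib_left sum.distrib[symmetric] sum_subtractf[symmetric]
  proof (rule sum.cong[OF refl])
    fix \<mu> :: "'n => nat"
    have "herm_coeff (harm_osc \<phi>) \<mu> = of_real (eigval \<mu>) * herm_coeff \<phi> \<mu>"
      unfolding eigval_def by (rule herm_coeff_harm_osc[OF \<phi>])
    then show "herm_coeff (harm_osc \<phi>) \<mu> * mode s d c \<rho> \<mu> = herm_coeff \<phi> \<mu> * mode'' s d c \<rho> \<mu>
      + of_real ((1 - 2 * s) / \<rho>) * (herm_coeff \<phi> \<mu> * mode' s d c \<rho> \<mu>)
      - of_real (\<rho>^2 / 4) * (herm_coeff \<phi> \<mu> * mode s d c \<rho> \<mu>)"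
      unfolding mode''_eq[OF s d c] by (simp add: algebra_simps)
  qed
  moreover have "(\<lambda>k. herm_pairing (mode'' s d c \<rho>) \<phi> k
      + of_real ((1 - 2 * s) / \<rho>) * herm_pairing (mode' s d c \<rho>) \<phi> k
      - of_real (\<rho>^2 / 4) * herm_pairing (mode s d c \<rho>) \<phi> k) sums
    (fun_dist (herm_synth (mode'' s d c \<rho>)) \<phi> + of_real ((1 - 2 * s) / \<rho>) * fun_dist (herm_synth (mode' s d c \<rho>)) \<phi>
      - of_real (\<rho>^2 / 4) * fun_dist (herm_synth (mode s d c \<rho>)) \<phi>)"
    by (intro sums_diff sums_add sums_mult fun_dist_synth_sums f \<phi>)
  ultimately have "herm_pairing (mode s d c \<rho>) (harm_osc \<phi>) sums
    (fun_dist (herm_synth (mode'' s d c \<rho>)) \<phi> + of_real ((1 - 2 * s) / \<rho>) * fun_dist (herm_synth (mode' s d c \<rho>)) \<phi>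
      - of_real (\<rho>^2 / 4) * fun_dist (herm_synth (mode s d c \<rho>)) \<phi>)" by (simp only: sums_def)
  from sums_unique2[OF fun_dist_synth_sums[OF f(1) harm_osc_schwartz[OF \<phi>]] this] show ?thesis .
qed


section \<open>Hermite coefficients in the Gaussian Lebesgue space\<close>

definition dist_coeff :: "'n::finite functional => ('n => nat) => complex" where
  "dist_coeff F \<mu> = tempered_ext (M_gauss F) (hermite_fun \<mu>)"

definition gauss_coeff :: "(real^'n::finite => complex) => ('n => nat) => complex" where
  "gauss_coeff g \<mu> = (LINT y|gauss_measure. g y * of_real (Herm \<mu> y))"

lemma Herm_eq: "of_real (Herm \<mu> x) = hermite_fun \<mu> x / root_gauss (x::real^'n::finite)"
  by (simp add: hermite_fun_def)

lemma Q_dist_eq: "Q_dist k F x = herm_level (dist_coeff F) k x / root_gauss (x::real^'n::finite)"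
proof -
  have e: "(\<lambda>y. of_real (sqrt (gauss y) * Herm \<mu> y)) = hermite_fun \<mu>" for \<mu> :: "'n => nat"
    by (simp add: hermite_fun_def fun_eq_iff)
  show ?thesis unfolding Q_dist_def herm_level_def dist_coeff_def e Herm_eq by (simp add: sum_divide_distrib)
qed

lemma Q_fun_eq: "Q_fun k g x = herm_level (gauss_coeff g) k x / root_gauss (x::real^'n::finite)"
  unfolding Q_fun_def herm_level_def gauss_coeff_def[symmetric] unfolding Herm_eq by (simp add: sum_divide_distrib)

lemma herm_level_scale:
  fixes d :: "('n::finite => nat) => complex"
  shows "herm_level (\<lambda>\<mu>. d \<mu> * of_real (p (eigval \<mu>))) k x
    = of_real (p (2 * real k + real CARD('n))) * herm_level d k x"
  unfolding herm_level_def sum_distrib_left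
  by (rule sum.cong) (auto simp: in_multi_indices eigval_def)

lemma gauss_coeff_div_root_gauss:
  fixes h :: "real^'n::finite => complex"
  assumes "rapid h" shows "gauss_coeff (\<lambda>x. h x / root_gauss x) \<mu> = herm_coeff h \<mu>"
proof -
  have m: "(\<lambda>x. h x / root_gauss x) \<in> borel_measurable lebesgue"
    by (intro continuous_lebesgue_measurable continuous_div_root_gauss rapid_continuous assms)
  have "gauss_coeff (\<lambda>x. h x / root_gauss x) \<mu>
      = (LINT x|lebesgue. gauss x *\<^sub>R (h x / root_gauss x * of_real (Herm \<mu> x)))"
    unfolding gauss_coeff_def by (intro integral_gauss_measure borel_measurable_times m Herm_measurable)
  also have "... = (LINT x|lebesgue. h x * hermite_fun \<mu> x)"
  proof (rule Bochner_Integration.integral_cong[OF refl])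
    fix x :: "real^'n"
    have "gauss x *\<^sub>R (h x / root_gauss x * of_real (Herm \<mu> x))
        = (root_gauss x * root_gauss x) * (h x / root_gauss x * of_real (Herm \<mu> x))"
      by (simp only: root_gauss_sq scaleR_conv_of_real)
    also have "... = h x * hermite_fun \<mu> x" by (simp add: Herm_eq)
    finally show "gauss x *\<^sub>R (h x / root_gauss x * of_real (Herm \<mu> x)) = h x * hermite_fun \<mu> x" .
  qed
  finally show ?thesis by (simp add: herm_coeff_def)
qed

lemma Herm_norm: "(LINT x|gauss_measure. (cmod (complex_of_real (Herm \<mu> (x::real^'n::finite))))^2) = 1"
proof -
  have "complex_of_real (LINT x|gauss_measure. (cmod (complex_of_real (Herm \<mu> (x::real^'n))))^2)
      = gauss_coeff (\<lambda>x. complex_of_real (Herm \<mu> x)) \<mu>"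
    unfolding gauss_coeff_def by (simp add: power2_eq_square flip: integral_complex_of_real)
  also have "... = 1"
    unfolding Herm_eq gauss_coeff_div_root_gauss[OF schwartz_rapid[OF hermite_fun_schwartz]]
    by (simp add: hermite_fun_orthonormal)
  finally show ?thesis by (metis of_real_eq_1_iff)
qed

lemma gauss_coeff_bound:
  assumes "g \<in> L2_gauss" "\<delta> > 0"
  shows "cmod (gauss_coeff g \<mu>) <= \<delta> * (LINT x|gauss_measure. (cmod (g x))^2) + 1 / \<delta>"
  using L2_gauss_mult_bound(2)[OF assms(1) L2_gauss_Herm assms(2), of \<mu>] by (simp only: gauss_coeff_def Herm_norm)

text \<open>Coefficients are continuous in \<open>L\<^sup>2(\<gamma>)\<close>, and those of the partial sums are constant from \<open>|\<mu>| < N\<close> on.\<close>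

lemma is_OU_function_coeff:
  fixes g h :: "real^'n::finite => complex"
  assumes g: "g \<in> L2_gauss" and m: "is_OU_function m h g"
  shows "gauss_coeff g \<mu> = of_real (m (eigval \<mu>)) * gauss_coeff h \<mu>"
proof -
  define S where "S N x = (\<Sum>k<N. of_real (m (2 * real k + real CARD('n))) * herm_level (gauss_coeff h) k x)" for N x
  define E where "E N = (LINT x|gauss_measure. (cmod (g x - S N x / root_gauss x))^2)" for N
  have E: "E \<longlonglongrightarrow> 0"
    using m unfolding is_OU_function_def E_def S_def Q_fun_eq by (simp add: sum_divide_distrib)
  have r: "rapid (\<lambda>x. of_real (m (2 * real k + real CARD('n))) * herm_level (gauss_coeff h) k x)" for k
    by (intro schwartz_rapid schwartz_cmult herm_level_schwartz)
  have S: "rapid (S N)" for N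
    unfolding S_def[abs_def] by (rule rapid_sum[OF finite_lessThan r])
  have cS: "gauss_coeff (\<lambda>x. S N x / root_gauss x) \<mu> = of_real (m (eigval \<mu>)) * gauss_coeff h \<mu>"
    if N: "mi_size \<mu> < N" for N
  proof -
    have "herm_coeff (S N) \<mu> = (\<Sum>k<N. of_real (m (2 * real k + real CARD('n))) * (if mi_size \<mu> = k then gauss_coeff h \<mu> else 0))"
      unfolding S_def[abs_def] herm_coeff_sum[OF finite_lessThan r] herm_coeff_cmult herm_coeff_level ..
    also have "... = (\<Sum>k<N. if mi_size \<mu> = k then of_real (m (2 * real k + real CARD('n))) * gauss_coeff h \<mu> else 0)"
      by (intro sum.cong) auto
    also have "... = of_real (m (eigval \<mu>)) * gauss_coeff h \<mu>" using N by (simp add: eigval_def)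
    finally show ?thesis by (simp add: gauss_coeff_div_root_gauss[OF S])
  qed
  have L: "(\<lambda>x. S N x / root_gauss x) \<in> L2_gauss" for N by (rule rapid_div_root_gauss_L2[OF S])
  have L': "(\<lambda>x. g x - S N x / root_gauss x) \<in> L2_gauss" for N
    using L2_gauss_add[OF g L2_gauss_cmult[OF L, of "-1" N]] by simp
  define z where "z = cmod (gauss_coeff g \<mu> - of_real (m (eigval \<mu>)) * gauss_coeff h \<mu>)"
  have zb: "z <= \<delta> * E N + 1 / \<delta>" if "\<delta> > 0" "mi_size \<mu> < N" for \<delta> N
  proof -
    have "gauss_coeff (\<lambda>x. g x - S N x / root_gauss x) \<mu> = gauss_coeff g \<mu> - gauss_coeff (\<lambda>x. S N x / root_gauss x) \<mu>"
      unfolding gauss_coeff_def left_diff_distrib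
      by (intro Bochner_Integration.integral_diff L2_gauss_mult_bound(1)[OF _ L2_gauss_Herm zero_less_one] g L)
    then show ?thesis
      using gauss_coeff_bound[OF L'[of N] that(1), of \<mu>] cS[OF that(2)] unfolding z_def E_def by simp
  qed
  \<comment> \<open>First the number of terms, then \<open>\<delta>\<close> goes to infinity.\<close>
  have zd: "z <= 1 / \<delta>" if "\<delta> > 0" for \<delta>
  proof (rule LIMSEQ_le_const)
    show "(\<lambda>N. \<delta> * E N + 1 / \<delta>) \<longlonglongrightarrow> 1 / \<delta>"
      using tendsto_add[OF tendsto_mult_left[OF E, of \<delta>] tendsto_const[of "1 / \<delta>"]] by simp
    show "\<exists>N. \<forall>n\<ge>N. z <= \<delta> * E n + 1 / \<delta>" using zb[OF that] by (intro exI[of _ "Suc (mi_size \<mu>)"]) auto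
  qed
  have "z <= 0"
  proof (rule ccontr)
    assume "\<not> z <= 0"
    then show False using zd[of "2 / z"] by (simp add: field_simps)
  qed
  then show ?thesis by (simp add: z_def)
qed

text \<open>The coefficients of the preimage \<open>h\<close> are bounded, uniformly in \<open>\<mu>\<close>.\<close>

lemma super_fast_gauss_coeff:
  assumes "g \<in> (\<Inter>t\<in>{0<..}. H2_gauss t)"
  shows "super_fast_coeff (gauss_coeff g)"
  unfolding super_fast_coeff_def
proof (intro allI impI)
  fix t :: real assume "t > 0"
  then have "g \<in> H2_gauss t" using assms by auto
  then obtain h where g: "g \<in> L2_gauss" and h: "h \<in> L2_gauss" and m: "is_OU_function (\<lambda>l. exp (- t * sqrt l)) h g"
    unfolding H2_gauss_def by blast
  let ?C = "(LINT x|gauss_measure. (cmod (h x))^2) + 1"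
  have "cmod (gauss_coeff g \<mu>) <= ?C * exp (- t * sqrt (eigval \<mu>))" for \<mu>
  proof -
    have "exp (- t * sqrt (eigval \<mu>)) * cmod (gauss_coeff h \<mu>) <= exp (- t * sqrt (eigval \<mu>)) * ?C"
      using gauss_coeff_bound[OF h zero_less_one, of \<mu>] by (intro mult_left_mono) auto
    then show ?thesis unfolding is_OU_function_coeff[OF g m] by (simp add: norm_mult mult.commute)
  qed
  moreover have "?C >= 0" by simp
  ultimately show "\<exists>C\<ge>0. \<forall>\<mu>. cmod (gauss_coeff g \<mu>) <= C * exp (- t * sqrt (eigval \<mu>))" by blast
qed

lemma super_fast_scaled:
  fixes c :: "('n::finite => nat) => complex"
  assumes "super_fast_coeff c" "t >= 0"
  shows "fast_coeff (\<lambda>\<mu>. c \<mu> * of_real (exp (t * sqrt (eigval \<mu>))))"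
  unfolding fast_coeff_def
proof
  fix M :: nat
  have "t + 1 > 0" using assms(2) by simp
  then obtain C where C: "C >= 0" "\<And>\<mu>. cmod (c \<mu>) <= C * exp (- (t + 1) * sqrt (eigval \<mu>))"
    using assms(1) unfolding super_fast_coeff_def by blast
  have "mi_weight \<mu> ^ M * cmod (c \<mu> * of_real (exp (t * sqrt (eigval \<mu>)))) <= C * real (2 * M) ^ (2 * M)" for \<mu>
  proof -
    have "cmod (c \<mu>) * exp (t * sqrt (eigval \<mu>)) <= C * exp (- (t + 1) * sqrt (eigval \<mu>)) * exp (t * sqrt (eigval \<mu>))"
      by (intro mult_right_mono C) simp
    also have "... = C * exp (- sqrt (eigval \<mu>))" by (simp add: mult.assoc algebra_simps flip: exp_add)
    finally have "mi_weight \<mu> ^ M * (cmod (c \<mu>) * exp (t * sqrt (eigval \<mu>))) <= mi_weight \<mu> ^ M * (C * exp (- sqrt (eigval \<mu>)))"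
      by (intro mult_left_mono zero_le_power mi_weight_nonneg)
    also have "... = C * (mi_weight \<mu> ^ M * exp (- sqrt (eigval \<mu>)))" by simp
    also have "... <= C * real (2 * M) ^ (2 * M)" by (intro mult_left_mono weight_exp_bound C(1))
    finally show ?thesis by (simp add: norm_mult)
  qed
  then show "\<exists>B. \<forall>\<mu>. mi_weight \<mu> ^ M * cmod (c \<mu> * of_real (exp (t * sqrt (eigval \<mu>)))) <= B" by blast
qed

text \<open>The preimage has the coefficients multiplied by \<open>exp (t * sqrt l)\<close>, which still decrease rapidly. Convergence in
  \<open>L\<^sup>2(\<gamma>)\<close> follows from weighted uniform convergence.\<close>

lemma super_fast_synth_H2:
  fixes c :: "('n::finite => nat) => complex"
  assumes c: "super_fast_coeff c" and t: "t >= 0"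
  shows "(\<lambda>x. herm_synth c x / root_gauss x) \<in> H2_gauss t"
proof -
  define c' where "c' = (\<lambda>\<mu>. c \<mu> * of_real (exp (t * sqrt (eigval \<mu>))))"
  have fc: "fast_coeff c" using super_fast_scaled[OF c order_refl] by simp
  have fc': "fast_coeff c'" unfolding c'_def by (rule super_fast_scaled[OF c t])
  define h where "h = (\<lambda>x. herm_synth c' x / root_gauss x)"
  have ch: "gauss_coeff h = c'"
    unfolding h_def by (intro ext) (simp add: gauss_coeff_div_root_gauss herm_synth_rapid fc' herm_coeff_synth)
  have lev: "of_real (exp (- t * sqrt (2 * real k + real CARD('n)))) * herm_level c' k x = herm_level c k x" for k x
  proof -
    have "c \<mu> = c' \<mu> * of_real (exp (- t * sqrt (eigval \<mu>)))" for \<mu>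
      by (simp add: c'_def mult.assoc flip: of_real_mult exp_add)
    then have "c = (\<lambda>\<mu>. c' \<mu> * of_real (exp (- t * sqrt (eigval \<mu>))))" by (rule ext)
    then have "herm_level c k x = herm_level (\<lambda>\<mu>. c' \<mu> * of_real (exp (- t * sqrt (eigval \<mu>)))) k x" by simp
    also have "... = of_real (exp (- t * sqrt (2 * real k + real CARD('n)))) * herm_level c' k x"
      by (rule herm_level_scale[of c' "\<lambda>l. exp (- t * sqrt l)"])
    finally show ?thesis by simp
  qed
  define tail where "tail N x = herm_synth c x - (\<Sum>k<N. herm_level c k x)" for N x
  have rt: "rapid (tail N)" for N
  proof -
    have "rapid (\<lambda>x. (\<Sum>k<N. herm_level c k x))"
      by (intro rapid_sum finite_lessThan schwartz_rapid herm_level_schwartz)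
    then have "rapid (\<lambda>x. \<Sum>b\<in>{True, False}. if b then herm_synth c x else (\<Sum>k<N. herm_level c k x) * (-1))"
    proof (intro rapid_sum)
      fix b assume r: "rapid (\<lambda>x. (\<Sum>k<N. herm_level c k x))"
      have "rapid (\<lambda>x. (\<Sum>k<N. herm_level c k x) * (-1))"
        by (rule rapid_mult_bounded[where B = 1 and M = 0, OF r]) auto
      then show "rapid (\<lambda>x. if b then herm_synth c x else (\<Sum>k<N. herm_level c k x) * (-1))"
        using herm_synth_rapid[OF fc] by (cases b) simp_all
    qed simp
    then show ?thesis by (simp add: tail_def[abs_def])
  qed
  obtain \<epsilon> where \<epsilon>: "\<epsilon> \<longlonglongrightarrow> 0" "\<And>N x. (1 + norm x) ^ CARD('n) * cmod (tail N x) <= \<epsilon> N"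
    using herm_synth_weighted_tail[OF fc, of "CARD('n)"] unfolding tail_def by blast
  define I where "I = (LINT x|lebesgue. inverse ((1 + norm (x::real^'n)) ^ (2 * CARD('n))))"
  have int: "(LINT x|gauss_measure. (cmod (herm_synth c x / root_gauss x
      - (\<Sum>k<N. of_real (exp (- t * sqrt (2 * real k + real CARD('n)))) * Q_fun k h x)))^2)
      = (LINT x|lebesgue. (cmod (tail N x))^2)" for N
  proof -
    have eq: "herm_synth c x / root_gauss x
      - (\<Sum>k<N. of_real (exp (- t * sqrt (2 * real k + real CARD('n)))) * Q_fun k h x) = tail N x / root_gauss x" for x
      unfolding Q_fun_eq ch times_divide_eq_right lev tail_def by (simp add: sum_divide_distrib diff_divide_distrib)
    have [measurable]: "(\<lambda>x. tail N x / root_gauss x) \<in> borel_measurable lebesgue"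
      by (intro continuous_lebesgue_measurable continuous_div_root_gauss rapid_continuous[OF rt])
    have m: "(\<lambda>x. (cmod (tail N x / root_gauss x))^2) \<in> borel_measurable lebesgue"
      by measurable
    have e2: "gauss x *\<^sub>R (cmod (tail N x / root_gauss x))^2 = (cmod (tail N x))^2" for x
      unfolding gauss_cmod_sq by simp
    show ?thesis unfolding eq integral_gauss_measure[OF m] e2 ..
  qed
  have bnd: "(LINT x|lebesgue. (cmod (tail N x))^2) <= (\<epsilon> N)^2 * I" for N
  proof -
    have "integrable lebesgue (\<lambda>x. norm (tail N x * tail N x))"
      by (intro integrable_norm rapid_integrable rapid_mult rt)
    then have i1: "integrable lebesgue (\<lambda>x. (cmod (tail N x))^2)" by (simp add: norm_mult power2_eq_square)
    have i2: "integrable lebesgue (\<lambda>x::real^'n. (\<epsilon> N)^2 * inverse ((1 + norm x) ^ (2 * CARD('n))))"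
      by (intro integrable_mult_right integrable_decay)
    have "(cmod (tail N x))^2 <= (\<epsilon> N)^2 * inverse ((1 + norm x) ^ (2 * CARD('n)))" for x
    proof -
      have p: "(1 + norm x) ^ (2 * CARD('n)) > 0" by (intro zero_less_power add_pos_nonneg) auto
      have "((1 + norm x) ^ CARD('n) * cmod (tail N x))^2 <= (\<epsilon> N)^2" by (intro power_mono \<epsilon>) auto
      then have "(1 + norm x) ^ (2 * CARD('n)) * (cmod (tail N x))^2 <= (\<epsilon> N)^2"
        by (simp add: power_mult_distrib mult.commute[of 2] flip: power_mult)
      then show ?thesis using p by (simp add: field_simps)
    qed
    then have "(LINT x|lebesgue. (cmod (tail N x))^2) <= (LINT x|lebesgue. (\<epsilon> N)^2 * inverse ((1 + norm (x::real^'n)) ^ (2 * CARD('n))))"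
      by (intro integral_mono i1 i2)
    then show ?thesis by (simp add: I_def)
  qed
  have "(\<lambda>N. LINT x|lebesgue. (cmod (tail N x))^2) \<longlonglongrightarrow> 0"
  proof (rule tendsto_sandwich[OF _ _ tendsto_const])
    show "(\<lambda>N. (\<epsilon> N)^2 * I) \<longlonglongrightarrow> 0" using tendsto_mult_right[OF tendsto_power[OF \<epsilon>(1), of 2], of I] by simp
  qed (use bnd in auto)
  then have "is_OU_function (\<lambda>l. exp (- t * sqrt l)) h (\<lambda>x. herm_synth c x / root_gauss x)"
    unfolding is_OU_function_def int .
  moreover have "h \<in> L2_gauss" unfolding h_def by (intro rapid_div_root_gauss_L2 herm_synth_rapid fc')
  moreover have "(\<lambda>x. herm_synth c x / root_gauss x) \<in> L2_gauss" by (intro rapid_div_root_gauss_L2 herm_synth_rapid fc)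
  ultimately show ?thesis unfolding H2_gauss_def by blast
qed

section \<open>The solution operators as Hermite series\<close>

lemma synth_scaled:
  assumes K: "K \<noteq> 0" and e: "fast_coeff (\<lambda>\<mu>. d \<mu> * of_real (p (eigval \<mu>)))"
    and w: "\<And>k. K * w k = p (2 * real k + real CARD('n))"
  shows "of_real K * (\<Sum>k. of_real (w k) * (herm_level d k x / root_gauss (x::real^'n::finite)))
    = herm_synth (\<lambda>\<mu>. d \<mu> * of_real (p (eigval \<mu>))) x / root_gauss x"
proof -
  let ?l = "\<lambda>k. herm_level (\<lambda>\<mu>. d \<mu> * of_real (p (eigval \<mu>))) k x"
  have "of_real (w k) * (herm_level d k x / root_gauss x) = ?l k * (1 / (of_real K * root_gauss x))" for k
    unfolding herm_level_scale w[symmetric] using K by simp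
  then have "(\<Sum>k. of_real (w k) * (herm_level d k x / root_gauss x)) = (\<Sum>k. ?l k) * (1 / (of_real K * root_gauss x))"
    using suminf_mult2[OF summable_norm_cancel[OF herm_level_summable[OF e, of x]], of "1 / (of_real K * root_gauss x)"] by simp
  then show ?thesis using K by (simp add: herm_synth_def)
qed

lemma S1_S2_synth:
  fixes f :: "'n::finite functional"
  assumes s: "0 < s" "s < 1" and d: "slow_coeff (dist_coeff f)" and c: "super_fast_coeff (gauss_coeff g)" and \<rho>: "\<rho> > 0"
  shows "S1 s \<rho> f x + S2 s \<rho> g x = herm_synth (mode s (dist_coeff f) (gauss_coeff g) \<rho>) x / root_gauss (x::real^'n)"
proof -
  let ?d = "dist_coeff f" and ?c = "gauss_coeff g"
  have "super_fast_coeff (\<lambda>_::'n => nat. 0)" unfolding super_fast_coeff_def by auto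
  then have "fast_coeff (mode s ?d (\<lambda>_. 0) \<rho>)" by (intro loc_fast_fast_coeff[OF loc_fast_mode \<rho>] s d)
  then have fd: "fast_coeff (\<lambda>\<mu>. ?d \<mu> * of_real (radial.dec s (eigval \<mu>) \<rho>))" by (simp add: mode_def[abs_def])
  have "fast_coeff (mode s (\<lambda>_. 0) ?c \<rho>)" by (intro loc_fast_fast_coeff[OF loc_fast_mode \<rho>] s c slow_coeff_const)
  then have fc: "fast_coeff (\<lambda>\<mu>. ?c \<mu> * of_real (radial.grow s (eigval \<mu>) \<rho>))" by (simp add: mode_def[abs_def])
  have rad: "radial s (2 * real k + real CARD('n))" for k
  proof
    have "CARD('n) >= 1" by (simp add: Suc_leI)
    then have "real CARD('n) >= 1" by linarith
    then show "2 * real k + real CARD('n) >= 1" using of_nat_0_le_iff[of k] by linarith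
  qed (use s in auto)
  have P: "(\<rho>^2 / 2) powr ((s - 1) / 2) > 0" using \<rho> by simp
  have G: "Gamma s > 0" using s by (intro Gamma_real_pos)
  have half: "- (real k + real CARD('n) / 2) = - ((2 * real k + real CARD('n)) / 2)" for k by (simp add: add_divide_distrib)
  have "S1 s \<rho> f x = herm_synth (\<lambda>\<mu>. ?d \<mu> * of_real (radial.dec s (eigval \<mu>) \<rho>)) x / root_gauss x"
    unfolding S1_def Q_dist_eq
  proof (rule synth_scaled[OF _ fd])
    show "(\<rho>^2 / 2) powr ((s - 1) / 2) / Gamma s \<noteq> 0" using P G by simp
    fix k
    have A: "radial.A s (2 * real k + real CARD('n)) = (2 * real k + real CARD('n) + s + 1) / 2"
      unfolding radial.A_def[OF rad] by (simp add: add_ac)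
    show "(\<rho>^2 / 2) powr ((s - 1) / 2) / Gamma s *
         (Gamma ((2 * real k + real CARD('n) + s + 1) / 2) * whittaker_W (- (real k + real CARD('n) / 2)) (s / 2) (\<rho>^2 / 2)) =
         radial.dec s (2 * real k + real CARD('n)) \<rho>"
      using radial.whittaker_W_dec[OF rad \<rho>, of k] unfolding half A .
  qed
  moreover have "S2 s \<rho> g x = herm_synth (\<lambda>\<mu>. ?c \<mu> * of_real (radial.grow s (eigval \<mu>) \<rho>)) x / root_gauss x"
    unfolding S2_def Q_fun_eq
  proof (rule synth_scaled[OF _ fc])
    show "(\<rho>^2 / 2) powr ((s - 1) / 2) \<noteq> 0" using P by simp
    show "(\<rho>^2 / 2) powr ((s - 1) / 2) * whittaker_M (- (real k + real CARD('n) / 2)) (s / 2) (\<rho>^2 / 2) =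
         radial.grow s (2 * real k + real CARD('n)) \<rho>" for k
      using radial.whittaker_M_grow[OF rad \<rho>, of k] unfolding half .
  qed
  moreover have "herm_synth (mode s ?d ?c \<rho>) x = herm_synth (\<lambda>\<mu>. ?d \<mu> * of_real (radial.dec s (eigval \<mu>) \<rho>)) x
      + herm_synth (\<lambda>\<mu>. ?c \<mu> * of_real (radial.grow s (eigval \<mu>) \<rho>)) x"
    unfolding herm_synth_def
    by (subst suminf_add[OF summable_norm_cancel[OF herm_level_summable[OF fd]] summable_norm_cancel[OF herm_level_summable[OF fc]]])
       (simp add: herm_level_def mode_def distrib_right sum.distrib)
  ultimately show ?thesis by (simp only: add_divide_distrib)
qed


section \<open>Proof of the theorem\<close>

lemma test_funs_harm_osc: "\<phi> \<in> test_funs ==> harm_osc \<phi> \<in> test_funs"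
proof -
  assume t: "\<phi> \<in> test_funs"
  have "(\<lambda>x. \<Sum>i\<in>UNIV. of_real (x $ i) * (of_real (x $ i) * \<phi> x) + (-1) * pderiv_at i (pderiv_at i \<phi>) x) \<in> test_funs"
    by (intro test_funs_sum test_funs_add test_funs_cmult test_funs_pderiv_at test_funs_mult[OF test_funs_mult[OF t]] smooth_fun_coord t)
  then show ?thesis by (simp add: harm_osc_def[abs_def])
qed

text \<open>The equation tested with \<open>sqrt \<gamma> \<psi>\<close>. As \<open>sqrt \<gamma>\<close> is smooth and positive, every test function has this form.\<close>

lemma extension_equation_iff:
  fixes U U1 U2 :: "'n::finite functional"
  assumes U: "is_distribution U" and \<psi>: "\<psi> \<in> test_funs"
  defines "\<phi> \<equiv> \<lambda>x. root_gauss x * \<psi> x"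
  shows "- OU_op U \<phi> + U2 \<phi> + a * U1 \<phi> - b * U \<phi>
    = - M_gauss U (harm_osc \<psi>) + M_gauss U2 \<psi> + a * M_gauss U1 \<psi> - b * M_gauss U \<psi>"
  using OU_op_M_gauss[OF _ \<psi>, of U] U unfolding is_distribution_def \<phi>_def
  by (simp add: M_gauss_def dist_mult_def)

lemma tempered_ext_synth:
  assumes "fast_coeff c" "\<And>\<phi>. \<phi> \<in> test_funs ==> M_gauss F \<phi> = fun_dist (herm_synth c) \<phi>" "\<phi> \<in> schwartz_funs"
  shows "tempered_ext (M_gauss F) \<phi> = fun_dist (herm_synth c) \<phi>"
  by (rule tempered_ext_eqI[OF _ assms(3)])
     (simp add: tempered_extension_def assms(2) schwartz_continuous_fun_dist herm_synth_rapid assms(1))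

lemma synth_div_root_gauss:
  fixes c :: "('n::finite => nat) => complex"
  assumes c: "fast_coeff c"
  defines "F \<equiv> fun_dist (\<lambda>x. herm_synth c x / root_gauss x)"
  shows "locally_integrable (\<lambda>x. herm_synth c x / root_gauss x)" "is_distribution F"
    "M_gauss F = fun_dist (herm_synth c)" "tempered (M_gauss F)"
proof -
  note r = herm_synth_rapid[OF c]
  show l: "locally_integrable (\<lambda>x. herm_synth c x / root_gauss x)"
    by (intro continuous_locally_integrable continuous_div_root_gauss rapid_continuous r)
  then show "is_distribution F" unfolding F_def by (rule is_distribution_fun_dist)
  show M: "M_gauss F = fun_dist (herm_synth c)" unfolding F_def by (rule M_gauss_fun_dist_div)
  have "tempered_extension (fun_dist (herm_synth c)) (fun_dist (herm_synth c))"
    by (simp add: tempered_extension_def schwartz_continuous_fun_dist r)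
  then show "tempered (M_gauss F)"
    unfolding M tempered_def by (blast intro: is_distribution_fun_dist continuous_locally_integrable rapid_continuous r)
qed

theorem synth_solves_extension:
  fixes f :: "'n::finite functional" and u :: "real^'n => real => complex"
  assumes s: "0 < s" "s < 1" and f: "tempered (M_gauss f)" and c: "super_fast_coeff c"
    and loc: "\<And>\<rho>. \<rho> > 0 ==> locally_integrable (\<lambda>x. u x \<rho>)"
    and tem: "\<And>\<rho>. \<rho> > 0 ==> tempered (M_gauss (fun_dist (\<lambda>x. u x \<rho>)))"
    and u: "\<And>\<rho>. \<rho> > 0 ==> AE x in lebesgue. u x \<rho> = herm_synth (mode s (dist_coeff f) c \<rho>) x / root_gauss x"
  shows "solves_extension s f (\<lambda>\<rho>. fun_dist (\<lambda>x. u x \<rho>))"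
proof -
  define U where "U \<rho> = fun_dist (\<lambda>x. u x \<rho>)" for \<rho>
  let ?d = "dist_coeff f"
  have d: "slow_coeff ?d"
    unfolding dist_coeff_def[abs_def] by (intro schwartz_continuous_slow_coeff tempered_ext_continuous f)
  define e e1 e2 where "e = mode s ?d c" "e1 = mode' s ?d c" "e2 = mode'' s ?d c"
  note lf = loc_fast_mode[OF s d c, folded e_e1_e2_def] loc_fast_mode'[OF s d c, folded e_e1_e2_def] loc_fast_mode''[OF s d c, folded e_e1_e2_def]
  define U1 U2 where "U1 \<rho> = fun_dist (\<lambda>x. herm_synth (e1 \<rho>) x / root_gauss x)" "U2 \<rho> = fun_dist (\<lambda>x. herm_synth (e2 \<rho>) x / root_gauss x)" for \<rho>
  have F: "fast_coeff (e \<rho>)" "fast_coeff (e1 \<rho>)" "fast_coeff (e2 \<rho>)" if "\<rho> > 0" for \<rho>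
    using lf[THEN loc_fast_fast_coeff] that by auto
  have U: "is_distribution (U \<rho>)" if "\<rho> > 0" for \<rho> unfolding U_def by (rule is_distribution_fun_dist[OF loc[OF that]])
  have MU: "M_gauss (U \<rho>) \<phi> = fun_dist (herm_synth (e \<rho>)) \<phi>" if \<rho>: "\<rho> > 0" and \<phi>: "\<phi> \<in> test_funs" for \<rho> \<phi>
  proof -
    have "U \<rho> (\<lambda>x. root_gauss x * \<phi> x) = fun_dist (\<lambda>x. herm_synth (e \<rho>) x / root_gauss x) (\<lambda>x. root_gauss x * \<phi> x)"
      unfolding U_def e_e1_e2_def
      by (rule fun_dist_cong_AE[OF loc[OF \<rho>] _ u[OF \<rho>] test_funs_root_gauss[OF \<phi>]])
         (rule synth_div_root_gauss(1)[OF F(1)[OF \<rho>], unfolded e_e1_e2_def])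
    then show ?thesis
      using M_gauss_fun_dist_div[of "herm_synth (e \<rho>)", THEN fun_cong, of \<phi>] by (simp add: M_gauss_def dist_mult_def)
  qed
  have MU1: "M_gauss (U1 \<rho>) = fun_dist (herm_synth (e1 \<rho>))" "is_distribution (U1 \<rho>)" "tempered (M_gauss (U1 \<rho>))" if "\<rho> > 0" for \<rho>
    unfolding U1_U2_def by (rule synth_div_root_gauss[OF F(2)[OF that]])+
  have MU2: "M_gauss (U2 \<rho>) = fun_dist (herm_synth (e2 \<rho>))" "is_distribution (U2 \<rho>)" "tempered (M_gauss (U2 \<rho>))" if "\<rho> > 0" for \<rho>
    unfolding U1_U2_def by (rule synth_div_root_gauss[OF F(3)[OF that]])+
  have ext: "tempered_ext (M_gauss (U \<rho>)) \<phi> = fun_dist (herm_synth (e \<rho>)) \<phi>" if "\<rho> > 0" "\<phi> \<in> schwartz_funs" for \<rho> \<phi>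
    by (rule tempered_ext_synth[OF F(1)[OF that(1)] MU[OF that(1)] that(2)])
  have ext1: "tempered_ext (M_gauss (U1 \<rho>)) \<phi> = fun_dist (herm_synth (e1 \<rho>)) \<phi>" if "\<rho> > 0" "\<phi> \<in> schwartz_funs" for \<rho> \<phi>
    by (rule tempered_ext_synth[OF F(2)[OF that(1)] _ that(2)]) (simp add: MU1(1)[OF that(1)])
  have ext2: "tempered_ext (M_gauss (U2 \<rho>)) \<phi> = fun_dist (herm_synth (e2 \<rho>)) \<phi>" if "\<rho> > 0" "\<phi> \<in> schwartz_funs" for \<rho> \<phi>
    by (rule tempered_ext_synth[OF F(3)[OF that(1)] _ that(2)]) (simp add: MU2(1)[OF that(1)])
  have der: "has_rho_derivative U U1"
    unfolding has_rho_derivative_def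
  proof (intro allI impI conjI ballI)
    fix \<rho> :: real and \<phi> :: "real^'n => complex" assume \<rho>: "\<rho> > 0" and \<phi>: "\<phi> \<in> schwartz_funs"
    have "((\<lambda>r. fun_dist (herm_synth (e r)) \<phi>) has_vector_derivative tempered_ext (M_gauss (U1 \<rho>)) \<phi>) (at \<rho>)"
      unfolding ext1[OF \<rho> \<phi>]
      by (rule synth_has_derivative[OF lf(1,2) \<phi> \<rho>]) (unfold e_e1_e2_def, rule mode_has_derivative[OF s d c])
    then show "((\<lambda>r. tempered_ext (M_gauss (U r)) \<phi>) has_vector_derivative tempered_ext (M_gauss (U1 \<rho>)) \<phi>) (at \<rho>)"
      by (rule has_vector_derivative_transform_within_open[of _ _ _ "{0<..}"]) (use \<rho> ext[OF _ \<phi>] in auto)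
  qed (use U tem MU1 in \<open>auto simp: U_def\<close>)
  have der1: "has_rho_derivative U1 U2"
    unfolding has_rho_derivative_def
  proof (intro allI impI conjI ballI)
    fix \<rho> :: real and \<phi> :: "real^'n => complex" assume \<rho>: "\<rho> > 0" and \<phi>: "\<phi> \<in> schwartz_funs"
    have "((\<lambda>r. fun_dist (herm_synth (e1 r)) \<phi>) has_vector_derivative tempered_ext (M_gauss (U2 \<rho>)) \<phi>) (at \<rho>)"
      unfolding ext2[OF \<rho> \<phi>]
      by (rule synth_has_derivative[OF lf(2,3) \<phi> \<rho>]) (unfold e_e1_e2_def, rule mode_has_derivative[OF s d c])
    then show "((\<lambda>r. tempered_ext (M_gauss (U1 r)) \<phi>) has_vector_derivative tempered_ext (M_gauss (U2 \<rho>)) \<phi>) (at \<rho>)"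
      by (rule has_vector_derivative_transform_within_open[of _ _ _ "{0<..}"]) (use \<rho> ext1[OF _ \<phi>] in auto)
  qed (use MU1 MU2 in auto)
  have eqn: "- OU_op (U \<rho>) \<phi> + U2 \<rho> \<phi> + of_real ((1 - 2 * s) / \<rho>) * U1 \<rho> \<phi> - of_real (\<rho>^2 / 4) * U \<rho> \<phi> = 0"
    if \<rho>: "\<rho> > 0" and \<phi>: "\<phi> \<in> test_funs" for \<rho> \<phi>
  proof -
    obtain \<psi> where \<psi>: "\<psi> \<in> test_funs" "\<phi> = (\<lambda>x. root_gauss x * \<psi> x)" by (rule test_funs_factor_root_gauss[OF \<phi>])
    show ?thesis
      unfolding \<psi>(2) extension_equation_iff[OF U[OF \<rho>] \<psi>(1)] MU1(1)[OF \<rho>] MU2(1)[OF \<rho>] MU[OF \<rho> \<psi>(1)] MU[OF \<rho> test_funs_harm_osc[OF \<psi>(1)]]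
      using synth_mode_equation[OF s d c test_funs_schwartz[OF \<psi>(1)] \<rho>] unfolding e_e1_e2_def by simp
  qed
  have lim: "((\<lambda>\<rho>. tempered_ext (M_gauss (U \<rho>)) \<phi>) \<longlongrightarrow> tempered_ext (M_gauss f) \<phi>) (at_right 0)" if \<phi>: "\<phi> \<in> schwartz_funs" for \<phi>
  proof -
    have "(\<Sum>k. herm_pairing ?d \<phi> k) = tempered_ext (M_gauss f) \<phi>"
      using tempered_hermite_expansion[OF tempered_ext_continuous[OF f] \<phi>] by (simp add: sums_iff dist_coeff_def[abs_def])
    then have "((\<lambda>\<rho>. fun_dist (herm_synth (e \<rho>)) \<phi>) \<longlongrightarrow> tempered_ext (M_gauss f) \<phi>) (at_right 0)"
      using synth_mode_tendsto[OF s d c \<phi>] unfolding e_e1_e2_def by simp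
    moreover have "\<forall>\<^sub>F \<rho> in at_right 0. fun_dist (herm_synth (e \<rho>)) \<phi> = tempered_ext (M_gauss (U \<rho>)) \<phi>"
      using eventually_at_right_less[of "0::real"] by (rule eventually_mono) (simp add: ext \<phi>)
    ultimately show ?thesis by (rule Lim_transform_eventually)
  qed
  show ?thesis
    unfolding solves_extension_def U_def[symmetric] using der der1 eqn lim by blast
qed

lemma complex_radial_sol_decompose:
  assumes s: "0 < s" "s < 1" and l: "l >= 1"
    and y: "\<And>\<rho>. \<rho> > 0 ==> (y has_vector_derivative y1 \<rho>) (at \<rho>)" "\<And>\<rho>. \<rho> > 0 ==> (y1 has_vector_derivative y2 \<rho>) (at \<rho>)"
    and eq: "\<And>\<rho>. \<rho> > 0 ==> y2 \<rho> = complex_of_real (l + \<rho>^2 / 4) * y \<rho> - complex_of_real ((1 - 2 * s) / \<rho>) * y1 \<rho>"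
    and lim: "(y \<longlongrightarrow> y0) (at_right 0)"
  shows "\<exists>c. \<forall>\<rho>>0. y \<rho> = y0 * complex_of_real (radial.dec s l \<rho>) + c * complex_of_real (radial.grow s l \<rho>)"
proof -
  interpret radial s l by standard (use s l in auto)
  have sol: "radial_sol s l (\<lambda>\<rho>. L (y \<rho>)) (\<lambda>\<rho>. L (y1 \<rho>))"
    if L: "bounded_linear L" and Lm: "\<And>r z. L (complex_of_real r * z) = r * L z" for L
    unfolding radial_sol_def
  proof (intro allI impI conjI)
    fix \<rho> :: real assume \<rho>: "\<rho> > 0"
    show "((\<lambda>\<rho>. L (y \<rho>)) has_real_derivative L (y1 \<rho>)) (at \<rho>)"
      using bounded_linear.has_vector_derivative[OF L y(1)[OF \<rho>]] by (simp add: has_real_derivative_iff_has_vector_derivative)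
    have "L (y2 \<rho>) = (l + \<rho>^2 / 4) * L (y \<rho>) - (1 - 2 * s) / \<rho> * L (y1 \<rho>)"
      unfolding eq[OF \<rho>] linear_diff[OF bounded_linear.linear[OF L]] Lm ..
    then show "((\<lambda>\<rho>. L (y1 \<rho>)) has_real_derivative (l + \<rho>^2 / 4) * L (y \<rho>) - (1 - 2 * s) / \<rho> * L (y1 \<rho>)) (at \<rho>)"
      using bounded_linear.has_vector_derivative[OF L y(2)[OF \<rho>]] by (simp add: has_real_derivative_iff_has_vector_derivative)
  qed
  obtain a where a: "\<And>\<rho>. \<rho> > 0 ==> Re (y \<rho>) = Re y0 * dec \<rho> + a * grow \<rho>"
    using radial_sol_decompose[OF sol[OF bounded_linear_Re] tendsto_Re[OF lim]] by auto
  obtain b where b: "\<And>\<rho>. \<rho> > 0 ==> Im (y \<rho>) = Im y0 * dec \<rho> + b * grow \<rho>"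
    using radial_sol_decompose[OF sol[OF bounded_linear_Im] tendsto_Im[OF lim]] by auto
  show ?thesis by (intro exI[of _ "Complex a b"]) (auto simp: complex_eq_iff a b)
qed

text \<open>A mode that is polynomially bounded in \<open>|\<mu>|\<close> at \<open>\<rho>\<close>, with \<open>dec\<close> bounded, leaves room only for
  \<open>c = O(l\<^sup>M exp (- \<rho> * sqrt l / 4))\<close>.\<close>

lemma super_fast_of_slow_modes:
  fixes c d :: "('n::finite => nat) => complex"
  assumes s: "0 < s" "s < 1" and d: "slow_coeff d" and m: "\<And>\<rho>. \<rho> > 0 ==> slow_coeff (mode s d c \<rho>)"
  shows "super_fast_coeff c"
  unfolding super_fast_coeff_def
proof (intro allI impI)
  fix t :: real assume t: "t > 0"
  \<comment> \<open>At this radius \<open>grow\<close> exceeds \<open>exp (t * sqrt l) * exp (sqrt l)\<close>; the last factor absorbs polynomial weights.\<close>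
  define \<rho> where "\<rho> = 4 * (t + 1)"
  have \<rho>: "\<rho> > 0" using t by (simp add: \<rho>_def)
  obtain D M where D: "D >= 0" "\<And>\<mu>. cmod (d \<mu>) <= D * mi_weight \<mu> ^ M" using d unfolding slow_coeff_def by blast
  obtain E N where E: "E >= 0" "\<And>\<mu>. cmod (mode s d c \<rho> \<mu>) <= E * mi_weight \<mu> ^ N" using m[OF \<rho>] unfolding slow_coeff_def by blast
  define q where "q = exp (- (\<rho>^2 / 2) / 2) * (\<rho>^2 / 2) powr s / 2"
  have q: "q > 0" using \<rho> by (simp add: q_def)
  define C where "C = (E * real (2 * N) ^ (2 * N) + D * real (2 * M) ^ (2 * M)) / q"
  have C: "C >= 0" unfolding C_def using D(1) E(1) q by (intro divide_nonneg_nonneg add_nonneg_nonneg mult_nonneg_nonneg) auto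
  have "cmod (c \<mu>) <= C * exp (- t * sqrt (eigval \<mu>))" for \<mu>
  proof -
    let ?r = "sqrt (eigval \<mu>)" and ?w = "mi_weight \<mu>"
    interpret radial s "eigval \<mu>" by standard (use s eigval_ge_1 in auto)
    have "\<bar>dec \<rho>\<bar> <= 1" using dec_sq_le_1[OF \<rho>] by (simp add: abs_square_le_1)
    then have dd: "cmod (d \<mu>) * \<bar>dec \<rho>\<bar> <= D * ?w ^ M"
      using mult_mono[OF D(2)[of \<mu>], of "\<bar>dec \<rho>\<bar>" 1] D(1) mi_weight_nonneg[of \<mu>] by simp
    have ex: "exp (\<rho> * ?r / 4) = exp (t * ?r) * exp ?r" by (simp add: \<rho>_def algebra_simps flip: exp_add)
    have "q * exp (\<rho> * ?r / 4) <= grow \<rho>" using grow_lower[OF \<rho>] by (simp add: q_def)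
    then have "cmod (c \<mu>) * (q * exp (\<rho> * ?r / 4)) <= cmod (c \<mu>) * grow \<rho>" by (intro mult_left_mono) auto
    also have "... = cmod (mode s d c \<rho> \<mu> - d \<mu> * of_real (dec \<rho>))"
      using grow_pos[OF \<rho>] by (simp add: mode_def norm_mult)
    also have "... <= cmod (mode s d c \<rho> \<mu>) + cmod (d \<mu>) * \<bar>dec \<rho>\<bar>"
      by (rule order_trans[OF norm_triangle_ineq4]) (simp add: norm_mult)
    also have "... <= E * ?w ^ N + D * ?w ^ M" by (intro add_mono E dd)
    finally have "(cmod (c \<mu>) * (q * exp (\<rho> * ?r / 4))) * exp (- ?r) <= (E * ?w ^ N + D * ?w ^ M) * exp (- ?r)"
      by (intro mult_right_mono) auto
    also have "... = E * (?w ^ N * exp (- ?r)) + D * (?w ^ M * exp (- ?r))" by (simp add: algebra_simps)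
    also have "... <= E * real (2 * N) ^ (2 * N) + D * real (2 * M) ^ (2 * M)"
      by (intro add_mono mult_left_mono weight_exp_bound D(1) E(1))
    also have "... = C * q" using q by (simp add: C_def)
    finally have 1: "(cmod (c \<mu>) * (q * exp (\<rho> * ?r / 4))) * exp (- ?r) <= C * q" .
    have "(cmod (c \<mu>) * (q * exp (\<rho> * ?r / 4))) * exp (- ?r) = (cmod (c \<mu>) * exp (t * ?r)) * q * (exp ?r * exp (- ?r))"
      unfolding ex by (simp only: mult_ac)
    also have "... = (cmod (c \<mu>) * exp (t * ?r)) * q" by (simp flip: exp_add)
    finally have e: "(cmod (c \<mu>) * (q * exp (\<rho> * ?r / 4))) * exp (- ?r) = (cmod (c \<mu>) * exp (t * ?r)) * q" .
    have "cmod (c \<mu>) * exp (t * ?r) <= C" using 1 unfolding e by (rule mult_right_le_imp_le[OF _ q])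
    then have "(cmod (c \<mu>) * exp (t * ?r)) * exp (- t * ?r) <= C * exp (- t * ?r)" by (intro mult_right_mono) auto
    then show ?thesis by (simp add: mult.assoc flip: exp_add)
  qed
  then show "\<exists>C\<ge>0. \<forall>\<mu>. cmod (c \<mu>) <= C * exp (- t * sqrt (eigval \<mu>))" using C by blast
qed

text \<open>The equation holds for Schwartz functions by density, so it may be tested with Hermite functions, which gives the modes.
  The resulting series and \<open>u\<close> agree as distributions, hence almost everywhere.\<close>

theorem solution_is_synth:
  fixes f :: "'n::finite functional" and u :: "real^'n => real => complex"
  assumes s: "0 < s" "s < 1" and f: "tempered (M_gauss f)"
    and loc: "\<And>\<rho>. \<rho> > 0 ==> locally_integrable (\<lambda>x. u x \<rho>)"
    and tem: "\<And>\<rho>. \<rho> > 0 ==> tempered (M_gauss (fun_dist (\<lambda>x. u x \<rho>)))"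
    and sol: "solves_extension s f (\<lambda>\<rho>. fun_dist (\<lambda>x. u x \<rho>))"
  shows "\<exists>c. super_fast_coeff c \<and>
    (\<forall>\<rho>>0. AE x in lebesgue. u x \<rho> = herm_synth (mode s (dist_coeff f) c \<rho>) x / root_gauss x)"
proof -
  define U where "U \<rho> = fun_dist (\<lambda>x. u x \<rho>)" for \<rho>
  let ?d = "dist_coeff f"
  have d: "slow_coeff ?d"
    unfolding dist_coeff_def[abs_def] by (intro schwartz_continuous_slow_coeff tempered_ext_continuous f)
  obtain U1 U2 where der: "has_rho_derivative U U1" "has_rho_derivative U1 U2"
    and eqn: "\<And>\<rho> \<phi>. \<rho> > 0 ==> \<phi> \<in> test_funs ==> - OU_op (U \<rho>) \<phi> + U2 \<rho> \<phi>
        + of_real ((1 - 2 * s) / \<rho>) * U1 \<rho> \<phi> - of_real (\<rho>^2 / 4) * U \<rho> \<phi> = 0"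
    using sol unfolding solves_extension_def U_def[symmetric] by blast
  have lim: "((\<lambda>\<rho>. tempered_ext (M_gauss (U \<rho>)) \<phi>) \<longlongrightarrow> tempered_ext (M_gauss f) \<phi>) (at_right 0)" if "\<phi> \<in> schwartz_funs" for \<phi>
    using sol that unfolding solves_extension_def U_def[symmetric] by blast
  define T T1 T2 where "T \<rho> = tempered_ext (M_gauss (U \<rho>))" "T1 \<rho> = tempered_ext (M_gauss (U1 \<rho>))" "T2 \<rho> = tempered_ext (M_gauss (U2 \<rho>))" for \<rho>
  have temp: "tempered (M_gauss (U \<rho>))" "tempered (M_gauss (U1 \<rho>))" "tempered (M_gauss (U2 \<rho>))" if "\<rho> > 0" for \<rho>
    using der that unfolding has_rho_derivative_def by blast+
  have cont: "schwartz_continuous (T \<rho>)" "schwartz_continuous (T1 \<rho>)" "schwartz_continuous (T2 \<rho>)" if "\<rho> > 0" for \<rho>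
    unfolding T_T1_T2_def by (intro tempered_ext_continuous temp that)+
  have Tder: "((\<lambda>r. T r \<phi>) has_vector_derivative T1 \<rho> \<phi>) (at \<rho>)" "((\<lambda>r. T1 r \<phi>) has_vector_derivative T2 \<rho> \<phi>) (at \<rho>)"
    if "\<rho> > 0" "\<phi> \<in> schwartz_funs" for \<rho> \<phi>
    using der that unfolding has_rho_derivative_def T_T1_T2_def by blast+
  have Teq: "T \<rho> (harm_osc \<phi>) = 1 * (1 * T2 \<rho> \<phi> + of_real ((1 - 2 * s) / \<rho>) * T1 \<rho> \<phi>) + (- of_real (\<rho>^2 / 4)) * T \<rho> \<phi>"
    if \<rho>: "\<rho> > 0" and \<phi>: "\<phi> \<in> schwartz_funs" for \<rho> \<phi>
  proof (rule bounded_functional_eqI[of "\<lambda>\<phi>. T \<rho> (harm_osc \<phi>)"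
      "\<lambda>\<phi>. 1 * (1 * T2 \<rho> \<phi> + of_real ((1 - 2 * s) / \<rho>) * T1 \<rho> \<phi>) + (- of_real (\<rho>^2 / 4)) * T \<rho> \<phi>" \<phi>])
    note b = cont[OF \<rho>, THEN schwartz_continuous_bounded_functional]
    show "bounded_functional (\<lambda>\<phi>. T \<rho> (harm_osc \<phi>))" by (rule bounded_functional_harm_osc[OF b(1)])
    show "bounded_functional (\<lambda>\<phi>. 1 * (1 * T2 \<rho> \<phi> + of_real ((1 - 2 * s) / \<rho>) * T1 \<rho> \<phi>) + (- of_real (\<rho>^2 / 4)) * T \<rho> \<phi>)"
      by (rule bounded_functional_lincomb[OF bounded_functional_lincomb[OF b(3) b(2)] b(1)])
    fix \<psi> :: "real^'n => complex" assume \<psi>: "\<psi> \<in> test_funs"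
    have dist: "is_distribution (U \<rho>)" unfolding U_def by (rule is_distribution_fun_dist[OF loc[OF \<rho>]])
    have "- M_gauss (U \<rho>) (harm_osc \<psi>) + M_gauss (U2 \<rho>) \<psi> + of_real ((1 - 2 * s) / \<rho>) * M_gauss (U1 \<rho>) \<psi>
        - of_real (\<rho>^2 / 4) * M_gauss (U \<rho>) \<psi> = 0"
      using eqn[OF \<rho> test_funs_root_gauss[OF \<psi>]] unfolding extension_equation_iff[OF dist \<psi>] .
    then show "T \<rho> (harm_osc \<psi>) = 1 * (1 * T2 \<rho> \<psi> + of_real ((1 - 2 * s) / \<rho>) * T1 \<rho> \<psi>) + (- of_real (\<rho>^2 / 4)) * T \<rho> \<psi>"
      unfolding T_T1_T2_def tempered_ext_test[OF temp(1)[OF \<rho>] \<psi>] tempered_ext_test[OF temp(1)[OF \<rho>] test_funs_harm_osc[OF \<psi>]]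
        tempered_ext_test[OF temp(2)[OF \<rho>] \<psi>] tempered_ext_test[OF temp(3)[OF \<rho>] \<psi>]
      by (simp add: algebra_simps)
  qed (rule \<phi>)
  have alg: "b = (e + q) * t - p * a" if "e * t = 1 * (1 * b + p * a) + (- q) * t" for a b e p q t :: complex
    using that by (simp add: algebra_simps)
  have "\<exists>c. \<forall>\<rho>>0. T \<rho> (hermite_fun \<mu>) = ?d \<mu> * of_real (radial.dec s (eigval \<mu>) \<rho>) + c * of_real (radial.grow s (eigval \<mu>) \<rho>)" for \<mu>
  proof (rule complex_radial_sol_decompose[OF s eigval_ge_1, where ?y1.0 = "\<lambda>\<rho>. T1 \<rho> (hermite_fun \<mu>)" and ?y2.0 = "\<lambda>\<rho>. T2 \<rho> (hermite_fun \<mu>)"])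
    show "((\<lambda>\<rho>. T \<rho> (hermite_fun \<mu>)) \<longlongrightarrow> ?d \<mu>) (at_right 0)"
      using lim[OF hermite_fun_schwartz, of \<mu>] by (simp add: T_T1_T2_def dist_coeff_def)
    fix \<rho> :: real assume \<rho>: "\<rho> > 0"
    show "((\<lambda>\<rho>. T \<rho> (hermite_fun \<mu>)) has_vector_derivative T1 \<rho> (hermite_fun \<mu>)) (at \<rho>)"
      "((\<lambda>\<rho>. T1 \<rho> (hermite_fun \<mu>)) has_vector_derivative T2 \<rho> (hermite_fun \<mu>)) (at \<rho>)"
      by (rule Tder[OF \<rho> hermite_fun_schwartz])+
    have "T \<rho> (harm_osc (hermite_fun \<mu>)) = of_real (eigval \<mu>) * T \<rho> (hermite_fun \<mu>)"
      unfolding eigval_def by (rule harm_osc_eigen[OF cont(1)[OF \<rho>]])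
    from Teq[OF \<rho> hermite_fun_schwartz, of \<mu>, unfolded this]
    show "T2 \<rho> (hermite_fun \<mu>) = of_real (eigval \<mu> + \<rho>^2 / 4) * T \<rho> (hermite_fun \<mu>)
        - of_real ((1 - 2 * s) / \<rho>) * T1 \<rho> (hermite_fun \<mu>)"
      unfolding of_real_add by (rule alg)
  qed
  then obtain c where c: "\<And>\<mu> \<rho>. \<rho> > 0 ==> T \<rho> (hermite_fun \<mu>) = mode s ?d c \<rho> \<mu>"
    unfolding mode_def by metis
  have "slow_coeff (mode s ?d c \<rho>)" if "\<rho> > 0" for \<rho>
    using schwartz_continuous_slow_coeff[OF cont(1)[OF that]] by (simp add: c that)
  then have sc: "super_fast_coeff c" by (rule super_fast_of_slow_modes[OF s d])
  have "AE x in lebesgue. u x \<rho> = herm_synth (mode s ?d c \<rho>) x / root_gauss x" if \<rho>: "\<rho> > 0" for \<rho>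
  proof -
    define v where "v x = herm_synth (mode s ?d c \<rho>) x / root_gauss x" for x :: "real^'n"
    have F: "fast_coeff (mode s ?d c \<rho>)" by (rule loc_fast_fast_coeff[OF loc_fast_mode[OF s d sc] \<rho>])
    have v: "locally_integrable v" unfolding v_def[abs_def] by (rule synth_div_root_gauss(1)[OF F])
    have "locally_integrable (\<lambda>x. u x \<rho> - v x)"
      using loc[OF \<rho>] v unfolding locally_integrable_def by (intro allI impI set_integral_diff(1)) simp_all
    moreover have "fun_dist (\<lambda>x. u x \<rho> - v x) \<phi> = 0" if \<phi>: "\<phi> \<in> test_funs" for \<phi>
    proof -
      obtain \<psi> where \<psi>: "\<psi> \<in> test_funs" "\<phi> = (\<lambda>x. root_gauss x * \<psi> x)" by (rule test_funs_factor_root_gauss[OF \<phi>])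
      have "fun_dist (\<lambda>x. u x \<rho> - v x) \<phi> = U \<rho> \<phi> - fun_dist v \<phi>"
        unfolding fun_dist_def U_def left_diff_distrib
        by (rule Bochner_Integration.integral_diff[OF locally_integrable_test_integrable[OF loc[OF \<rho>] \<phi>] locally_integrable_test_integrable[OF v \<phi>]])
      also have "U \<rho> \<phi> = M_gauss (U \<rho>) \<psi>" by (simp add: \<psi>(2) M_gauss_def dist_mult_def)
      also have "... = T \<rho> \<psi>" unfolding T_T1_T2_def by (rule tempered_ext_test[OF temp(1)[OF \<rho>] \<psi>(1), symmetric])
      also have "... = fun_dist (herm_synth (mode s ?d c \<rho>)) \<psi>"
        by (rule sums_unique2[OF tempered_hermite_expansion[OF cont(1)[OF \<rho>] test_funs_schwartz[OF \<psi>(1)], unfolded c[OF \<rho>]]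
            fun_dist_synth_sums[OF F test_funs_schwartz[OF \<psi>(1)]]])
      also have "... = fun_dist v \<phi>"
        using M_gauss_fun_dist_div[of "herm_synth (mode s ?d c \<rho>)", THEN fun_cong, of \<psi>]
        by (simp add: M_gauss_def dist_mult_def v_def[abs_def] \<psi>(2))
      finally show ?thesis by simp
    qed
    ultimately have "AE x in lebesgue. u x \<rho> - v x = 0" by (rule locally_integrable_AE_zero)
    then show ?thesis by (simp add: v_def)
  qed
  then show ?thesis using sc by blast
qed

theorem theorem1p6:
  fixes s :: real
    and f :: "'n::finite functional"
    and u :: "real^'n \<Rightarrow> real \<Rightarrow> complex"
  assumes "0 < s" and "s < 1"
    and "is_distribution f" and "tempered (M_gauss f)"
    and "\<And>\<rho>. \<rho> > 0 \<Longrightarrow> locally_integrable (\<lambda>x. u x \<rho>)"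
    and "\<And>\<rho>. \<rho> > 0 \<Longrightarrow> tempered (M_gauss (fun_dist (\<lambda>x. u x \<rho>)))"
  shows "solves_extension s f (\<lambda>\<rho>. fun_dist (\<lambda>x. u x \<rho>)) \<longleftrightarrow>
    (\<exists>g \<in> (\<Inter>t\<in>{0<..}. H2_gauss t).
       \<forall>\<rho>>0. AE x in lebesgue. u x \<rho> = S1 s \<rho> f x + S2 s \<rho> g x)"
proof
  have d: "slow_coeff (dist_coeff f)"
    unfolding dist_coeff_def[abs_def] by (intro schwartz_continuous_slow_coeff tempered_ext_continuous assms(4))
  {
    assume "solves_extension s f (\<lambda>\<rho>. fun_dist (\<lambda>x. u x \<rho>))"
    from solution_is_synth[OF assms(1,2,4,5,6) this]
    obtain c where c: "super_fast_coeff c"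
      and u: "\<And>\<rho>. \<rho> > 0 \<Longrightarrow> AE x in lebesgue. u x \<rho> = herm_synth (mode s (dist_coeff f) c \<rho>) x / root_gauss x" by blast
    define g where "g = (\<lambda>x. herm_synth c x / root_gauss x)"
    have fc: "fast_coeff c" using super_fast_scaled[OF c order_refl] by simp
    have gc: "gauss_coeff g = c"
      unfolding g_def by (intro ext) (simp add: gauss_coeff_div_root_gauss herm_synth_rapid fc herm_coeff_synth)
    have "g \<in> H2_gauss t" if "t > 0" for t unfolding g_def by (rule super_fast_synth_H2[OF c]) (use that in simp)
    moreover have "AE x in lebesgue. u x \<rho> = S1 s \<rho> f x + S2 s \<rho> g x" if "\<rho> > 0" for \<rho>
      using u[OF that] S1_S2_synth[OF assms(1,2) d _ that, of g] c by (simp add: gc)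
    ultimately show "\<exists>g \<in> (\<Inter>t\<in>{0<..}. H2_gauss t). \<forall>\<rho>>0. AE x in lebesgue. u x \<rho> = S1 s \<rho> f x + S2 s \<rho> g x"
      by (intro bexI[of _ g]) auto
  }
  assume "\<exists>g \<in> (\<Inter>t\<in>{0<..}. H2_gauss t). \<forall>\<rho>>0. AE x in lebesgue. u x \<rho> = S1 s \<rho> f x + S2 s \<rho> g x"
  then obtain g where g: "g \<in> (\<Inter>t\<in>{0<..}. H2_gauss t)"
    and u: "\<And>\<rho>. \<rho> > 0 \<Longrightarrow> AE x in lebesgue. u x \<rho> = S1 s \<rho> f x + S2 s \<rho> g x" by blast
  note c = super_fast_gauss_coeff[OF g]
  show "solves_extension s f (\<lambda>\<rho>. fun_dist (\<lambda>x. u x \<rho>))"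
    by (rule synth_solves_extension[OF assms(1,2,4) c assms(5,6)]) (use u S1_S2_synth[OF assms(1,2) d c] in simp_all)
qed


end
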